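(* Let $X$ be a complex Banach space, $\alpha>-1$, $0<p\le 1$ and $\gamma=(n+1+\alpha)\left(\frac1p-1\right)$. The topological dual space $(A^p_\alpha(\mathbb{B}_n,X))^{\star}$ can be identified with $\Gamma_\gamma(\mathbb{B}_n,X^{\star})$ under the pairing $$\langle f,g\rangle_{\alpha,X}=c_k\int_{\mathbb{B}_n}\langle f(z),D_kg(z)\rangle_{X,X^{\star}}(1-|z|^2)^k\,\mathrm{d}\nu_\alpha(z),$$ where $k>\gamma$ is an integer, $g\in\Gamma_\gamma(\mathbb{B}_n,X^{\star})$ and $f\in A^p_\alpha(\mathbb{B}_n,X)$; that is, every $g\in \Gamma_\gamma(\mathbb{B}_n,X^{\star})$ defines a bounded linear functional $f\mapsto\langle f,g\rangle_{\alpha,X}$ on $A^p_\alpha(\mathbb{B}_n,X)$, and every bounded linear functional on $A^p_\alpha(\mathbb{B}_n,X)$ is of this form for a unique $g$. Moreover, $$\|g\|_{\Gamma_\gamma(\mathbb{B}_n,X^{\star})}\simeq\sup_{\|f\|_{A^p_\alpha(\mathbb{B}_n,X)}=1}|\langle f,g\rangle_{\alpha,X}|.$$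
   Context: $n\ge1$; $\mathbb{B}_n$ is the open unit ball of $\mathbb{C}^n$, $\langle z,w\rangle=\sum_j z_j\overline{w_j}$, $|z|^2=\langle z,z\rangle$. $\mathrm{d}\nu_\alpha(z)=c_\alpha(1-|z|^2)^\alpha\mathrm{d}\nu(z)$, $c_\alpha=\frac{\Gamma(n+\alpha+1)}{n!\Gamma(\alpha+1)}$, where $\nu$ is Lebesgue measure normalized so that $\nu_\alpha$ is a probability measure on $\mathbb{B}_n$. For a complex Banach space $X$, $\mathcal{H}(\mathbb{B}_n,X)$ is the space of $X$-valued holomorphic functions on $\mathbb{B}_n$. For $0<p<\infty$, $A^p_\alpha(\mathbb{B}_n,X)$ is the space of $f\in\mathcal{H}(\mathbb{B}_n,X)$ with $\|f\|_{A^p_\alpha(\mathbb{B}_n,X)}^p=\|f\|^p_{p,\alpha,X}=\int_{\mathbb{B}_n}\|f(z)\|_X^p\,\mathrm{d}\nu_\alpha(z)<\infty$. $X^{\star}$ is the space of bounded linear functionals on $X$, with scalar multiplication defined by $(\lambda x^{\star})(x):=\overline{\lambda}\,x^{\star}(x)$; $\langle x,x^{\star}\rangle_{X,X^{\star}}=x^{\star}(x)$, which is linear in $x$ and conjugate-linear in $x^{\star}$. Holomorphy of $X^{\star}$-valued functions is with respect to this complex structure. Radial derivative: $Nf(z)=\sum_{j=1}^n z_j\frac{\partial f}{\partial z_j}(z)$; $N^k$ is its $k$-fold iterate. $D_k=(2I+N)\circ(3I+N)\circ\cdots\circ((k+1)I+N)$, with $I$ the identity. For $\gamma\ge0$, $\Gamma_\gamma(\mathbb{B}_n,X)$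 is the space of $f\in\mathcal{H}(\mathbb{B}_n,X)$ for which there is an integer $k>\gamma$ with $\|f\|_{\Gamma_\gamma(\mathbb{B}_n,X)}=\|f(0)\|_X+\sup_{z\in\mathbb{B}_n}(1-|z|^2)^{k-\gamma}\|N^kf(z)\|_X<\infty$ (the space does not depend on the integer $k>\gamma$ and different $k$ give equivalent norms). $c_k$ is a positive constant depending only on the integer $k$ ($n$ and $\alpha$ being fixed). $A\simeq B$ means $A\le cB$ and $B\le c'A$ with positive constants $c,c'$ independent of $g$. *)

theory Defs
  imports "HOL-Analysis.Analysis"
begin

section \<open>Complex normed spaces and Banach spaces\<close>

class complex_normed_space = real_normed_vector +
  fixes scaleC :: "complex \<Rightarrow> 'a \<Rightarrow> 'a" (infixr "*\<^sub>C" 75)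
  assumes scaleC_add_right: "a *\<^sub>C (x + y) = a *\<^sub>C x + a *\<^sub>C y"
    and scaleC_add_left: "(a + b) *\<^sub>C x = a *\<^sub>C x + b *\<^sub>C x"
    and scaleC_scaleC: "a *\<^sub>C b *\<^sub>C x = (a * b) *\<^sub>C x"
    and scaleC_of_real: "complex_of_real r *\<^sub>C x = r *\<^sub>R x"
    and norm_scaleC: "norm (a *\<^sub>C x) = cmod a * norm x"

class complex_banach = complex_normed_space + banach

instantiation complex :: complex_banach
begin

definition scaleC_complex :: "complex \<Rightarrow> complex \<Rightarrow> complex"
  where "scaleC_complex = (*)"

instance
  by standard (simp_all add: scaleC_complex_def algebra_simps norm_mult scaleR_conv_of_real)

end


section \<open>The dual space, with conjugated scalar multiplication\<close>

text \<open>The elements are the bounded complex-linear functionals with the operator norm, and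
  \<open>(\<lambda> x\<^sup>\<star>)(x) = cnj \<lambda> * x\<^sup>\<star>(x)\<close>.\<close>

typedef (overloaded) ('a :: complex_normed_space) cdual =
  "{u :: 'a \<Rightarrow>\<^sub>L complex. \<forall>c x. blinfun_apply u (c *\<^sub>C x) = c * blinfun_apply u x}"
  morphisms cdual_blinfun Abs_cdual
  by (rule exI[of _ 0]) simp

setup_lifting type_definition_cdual

lift_definition cdual_apply :: "'a::complex_normed_space cdual \<Rightarrow> 'a \<Rightarrow> complex"
  is "\<lambda>u x. blinfun_apply u x" .

lift_definition cnj_scale_blinfun ::
  "complex \<Rightarrow> ('a::real_normed_vector \<Rightarrow>\<^sub>L complex) \<Rightarrow> ('a \<Rightarrow>\<^sub>L complex)"
  is "\<lambda>c u x. cnj c * u x"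
  by (rule bounded_linear_const_mult)

lemma norm_cnj_scale_blinfun_le:
  "norm (cnj_scale_blinfun c u) \<le> cmod c * norm u"
proof (rule norm_blinfun_bound)
  fix x
  have "norm (blinfun_apply (cnj_scale_blinfun c u) x) = cmod c * norm (blinfun_apply u x)"
    by (simp add: cnj_scale_blinfun.rep_eq norm_mult)
  also have "\<dots> \<le> cmod c * (norm u * norm x)"
    by (intro mult_left_mono norm_blinfun) simp
  finally show "norm (blinfun_apply (cnj_scale_blinfun c u) x) \<le> cmod c * norm u * norm x"
    by (simp add: mult.assoc)
qed simp

lemma norm_cnj_scale_blinfun:
  "norm (cnj_scale_blinfun c u) = cmod c * norm u"
proof (cases "c = 0")
  case True
  then show ?thesis using norm_cnj_scale_blinfun_le[of c u] by simp
next
  case False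
  have "cnj_scale_blinfun (inverse c) (cnj_scale_blinfun c u) = u"
    using False by (intro blinfun_eqI) (simp add: cnj_scale_blinfun.rep_eq)
  then have "norm u \<le> cmod (inverse c) * norm (cnj_scale_blinfun c u)"
    using norm_cnj_scale_blinfun_le[of "inverse c" "cnj_scale_blinfun c u"] by simp
  then have "cmod c * norm u \<le> norm (cnj_scale_blinfun c u)"
    using False by (simp add: norm_divide field_simps)
  then show ?thesis using norm_cnj_scale_blinfun_le[of c u] by simp
qed

instantiation cdual :: (complex_normed_space) complex_normed_space
begin

lift_definition norm_cdual :: "'a cdual \<Rightarrow> real" is norm .

lift_definition zero_cdual :: "'a cdual" is 0 by simp

lift_definition plus_cdual :: "'a cdual \<Rightarrow> 'a cdual \<Rightarrow> 'a cdual" is "(+)"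
  by (simp add: blinfun.add_left algebra_simps)

lift_definition minus_cdual :: "'a cdual \<Rightarrow> 'a cdual \<Rightarrow> 'a cdual" is "(-)"
  by (simp add: blinfun.diff_left algebra_simps)

lift_definition uminus_cdual :: "'a cdual \<Rightarrow> 'a cdual" is uminus
  by (simp add: blinfun.minus_left)

lift_definition scaleR_cdual :: "real \<Rightarrow> 'a cdual \<Rightarrow> 'a cdual" is scaleR
  by (simp add: blinfun.scaleR_left)

lift_definition scaleC_cdual :: "complex \<Rightarrow> 'a cdual \<Rightarrow> 'a cdual" is cnj_scale_blinfun
  by (simp add: cnj_scale_blinfun.rep_eq)

definition dist_cdual :: "'a cdual \<Rightarrow> 'a cdual \<Rightarrow> real"
  where "dist_cdual a b = norm (a - b)"

definition uniformity_cdual :: "('a cdual \<times> 'a cdual) filter"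
  where "uniformity_cdual = (INF e\<in>{0 <..}. principal {(x, y). dist x y < e})"

definition open_cdual :: "'a cdual set \<Rightarrow> bool"
  where "open_cdual S = (\<forall>x\<in>S. \<forall>\<^sub>F (x', y) in uniformity. x' = x \<longrightarrow> y \<in> S)"

definition sgn_cdual :: "'a cdual \<Rightarrow> 'a cdual"
  where "sgn_cdual x = scaleR (inverse (norm x)) x"

instance
proof
  fix x y z :: "'a cdual" and r s :: real and a b :: complex
  show "x + y + z = x + (y + z)" by transfer (simp add: algebra_simps)
  show "x + y = y + x" by transfer (simp add: algebra_simps)
  show "0 + x = x" by transfer simp
  show "- x + x = 0" by transfer simp
  show "x - y = x + - y" by transfer simp
  show "r *\<^sub>R (x + y) = r *\<^sub>R x + r *\<^sub>R y" by transfer (simp add: algebra_simps)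
  show "(r + s) *\<^sub>R x = r *\<^sub>R x + s *\<^sub>R x" by transfer (simp add: algebra_simps)
  show "r *\<^sub>R s *\<^sub>R x = (r * s) *\<^sub>R x" by transfer simp
  show "1 *\<^sub>R x = x" by transfer simp
  show "dist x y = norm (x - y)" by (rule dist_cdual_def)
  show "sgn x = inverse (norm x) *\<^sub>R x" by (rule sgn_cdual_def)
  show "(uniformity :: ('a cdual \<times> 'a cdual) filter)
      = (INF e\<in>{0 <..}. principal {(x, y). dist x y < e})"
    by (rule uniformity_cdual_def)
  show "open U = (\<forall>x\<in>U. \<forall>\<^sub>F (x', y) in uniformity. x' = x \<longrightarrow> y \<in> U)" for U :: "'a cdual set"
    by (rule open_cdual_def)
  show "norm x = 0 \<longleftrightarrow> x = 0" by transfer simp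
  show "norm (x + y) \<le> norm x + norm y" by transfer (rule norm_triangle_ineq)
  show "norm (r *\<^sub>R x) = \<bar>r\<bar> * norm x" by transfer simp
  show "a *\<^sub>C (x + y) = a *\<^sub>C x + a *\<^sub>C y"
    by transfer (rule blinfun_eqI, simp add: cnj_scale_blinfun.rep_eq blinfun.add_left algebra_simps)
  show "(a + b) *\<^sub>C x = a *\<^sub>C x + b *\<^sub>C x"
    by transfer (rule blinfun_eqI, simp add: cnj_scale_blinfun.rep_eq blinfun.add_left algebra_simps)
  show "a *\<^sub>C b *\<^sub>C x = (a * b) *\<^sub>C x"
    by transfer (rule blinfun_eqI, simp add: cnj_scale_blinfun.rep_eq)
  show "complex_of_real r *\<^sub>C x = r *\<^sub>R x"
    by transfer (rule blinfun_eqI,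
        simp add: cnj_scale_blinfun.rep_eq blinfun.scaleR_left scaleR_conv_of_real)
  show "norm (a *\<^sub>C x) = cmod a * norm x"
    by transfer (rule norm_cnj_scale_blinfun)
qed

end

lemma cdual_apply_scaleC: "cdual_apply (c *\<^sub>C u) x = cnj c * cdual_apply u x"
  by transfer (simp add: cnj_scale_blinfun.rep_eq)

instance cdual :: (complex_normed_space) complex_banach
proof
  fix X :: "nat \<Rightarrow> 'a cdual"
  assume X: "Cauchy X"
  have d: "dist (cdual_blinfun u) (cdual_blinfun v) = dist u v" for u v :: "'a cdual"
    by (simp add: dist_norm norm_cdual.rep_eq minus_cdual.rep_eq)
  have "Cauchy (\<lambda>n. cdual_blinfun (X n))"
    using X by (simp add: Cauchy_def d)
  then obtain L where L: "(\<lambda>n. cdual_blinfun (X n)) \<longlonglongrightarrow> L"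
    using Cauchy_convergent convergent_def by blast
  have "blinfun_apply L (c *\<^sub>C x) = c * blinfun_apply L x" for c x
  proof -
    have *: "(\<lambda>n. blinfun_apply (cdual_blinfun (X n)) y) \<longlonglongrightarrow> blinfun_apply L y" for y
      using L by (intro tendsto_intros)
    have "(\<lambda>n. blinfun_apply (cdual_blinfun (X n)) (c *\<^sub>C x)) \<longlonglongrightarrow> c * blinfun_apply L x"
      using tendsto_mult_left[OF *[of x], of c] cdual_blinfun[of "X _"] by simp
    then show ?thesis
      using * LIMSEQ_unique by blast
  qed
  then have "cdual_blinfun (Abs_cdual L) = L"
    by (intro Abs_cdual_inverse) simp
  then have "X \<longlonglongrightarrow> Abs_cdual L"
    using L by (simp add: lim_sequentially flip: d)
  then show "convergent X"
    by (rule convergentI)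
qed


section \<open>Vector-valued holomorphic functions on the unit ball\<close>

text \<open>A function on the ball is represented by a total function on \<open>complex ^ 'n\<close> whose values
  off \<open>ball 0 1\<close> are irrelevant; two representatives are the same function iff they agree on
  \<open>ball 0 1\<close>. All operators and norms below depend only on the values on the ball.\<close>

definition hol_ball :: "(complex ^ 'n \<Rightarrow> 'x::complex_normed_space) set"
  where "hol_ball = {f. \<forall>z\<in>ball 0 1. \<exists>D. (f has_derivative D) (at z) \<and>
                        (\<forall>c v. D (c *s v) = c *\<^sub>C D v)}"

definition partial_deriv ::
  "'n \<Rightarrow> (complex ^ 'n \<Rightarrow> 'x::complex_normed_space) \<Rightarrow> complex ^ 'n \<Rightarrow> 'x"
  where "partial_deriv j f z =
           Lim (at (0::complex)) (\<lambda>h. inverse h *\<^sub>C (f (z + axis j h) - f z))"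

definition radial_deriv ::
  "(complex ^ 'n \<Rightarrow> 'x::complex_normed_space) \<Rightarrow> complex ^ 'n \<Rightarrow> 'x"
  where "radial_deriv f z = (\<Sum>j\<in>UNIV. (z $ j) *\<^sub>C partial_deriv j f z)"

text \<open>\<open>D_op k = (2 I + N) \<circ> (3 I + N) \<circ> \<dots> \<circ> ((k + 1) I + N)\<close>\<close>

fun D_op ::
  "nat \<Rightarrow> (complex ^ 'n \<Rightarrow> 'x::complex_normed_space) \<Rightarrow> complex ^ 'n \<Rightarrow> 'x"
  where
    "D_op 0 f = f"
  | "D_op (Suc k) f = D_op k (\<lambda>z. real (k + 2) *\<^sub>R f z + radial_deriv f z)"


section \<open>Weighted measures and Bergman spaces\<close>

definition nu :: "(complex ^ 'n) measure"
  where "nu = uniform_measure lborel (ball 0 1)"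

definition c_alpha :: "nat \<Rightarrow> real \<Rightarrow> real"
  where "c_alpha n \<alpha> = Gamma (real n + \<alpha> + 1) / (fact n * Gamma (\<alpha> + 1))"

definition nu_alpha :: "real \<Rightarrow> (complex ^ 'n) measure"
  where "nu_alpha \<alpha> =
           density nu (\<lambda>z. ennreal (c_alpha CARD('n) \<alpha> * (1 - (norm z)\<^sup>2) powr \<alpha>))"

definition bergman :: "real \<Rightarrow> real \<Rightarrow> (complex ^ 'n \<Rightarrow> 'x::complex_normed_space) set"
  where "bergman p \<alpha> =
           {f \<in> hol_ball. set_integrable (nu_alpha \<alpha>) (ball 0 1) (\<lambda>z. norm (f z) powr p)}"

definition bergman_norm ::
  "real \<Rightarrow> real \<Rightarrow> (complex ^ 'n \<Rightarrow> 'x::complex_normed_space) \<Rightarrow> real"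
  where "bergman_norm p \<alpha> f =
           (LINT z:ball 0 1|nu_alpha \<alpha>. norm (f z) powr p) powr (1 / p)"

text \<open>Such a functional depends only on the restriction of its argument to the ball: if \<open>f\<close> and
  \<open>g\<close> agree there, then \<open>f - g\<close> has norm \<open>0\<close>.\<close>

definition bergman_dual ::
  "real \<Rightarrow> real \<Rightarrow> ((complex ^ 'n \<Rightarrow> 'x::complex_normed_space) \<Rightarrow> complex) set"
  where "bergman_dual p \<alpha> = {\<Lambda>.
           (\<forall>f\<in>bergman p \<alpha>. \<forall>g\<in>bergman p \<alpha>. \<Lambda> (\<lambda>z. f z + g z) = \<Lambda> f + \<Lambda> g) \<and>
           (\<forall>c. \<forall>f\<in>bergman p \<alpha>. \<Lambda> (\<lambda>z. c *\<^sub>C f z) = c * \<Lambda> f) \<and>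
           (\<exists>C. \<forall>f\<in>bergman p \<alpha>. cmod (\<Lambda> f) \<le> C * bergman_norm p \<alpha> f)}"


section \<open>The spaces \<open>\<Gamma>\<^sub>\<gamma>\<close> and the pairing\<close>

text \<open>The norm is extended-valued so that an infinite supremum is meaningful.\<close>

definition Gamma_norm ::
  "real \<Rightarrow> nat \<Rightarrow> (complex ^ 'n \<Rightarrow> 'x::complex_normed_space) \<Rightarrow> ennreal"
  where "Gamma_norm \<gamma> k f = ennreal (norm (f 0)) +
           (SUP z\<in>ball 0 1.
              ennreal ((1 - (norm z)\<^sup>2) powr (real k - \<gamma>) * norm ((radial_deriv ^^ k) f z)))"

definition Gamma_space :: "real \<Rightarrow> (complex ^ 'n \<Rightarrow> 'x::complex_normed_space) set"
  where "Gamma_space \<gamma> = {f \<in> hol_ball. \<exists>k. real k > \<gamma> \<and> Gamma_norm \<gamma> k f < \<infinity>}"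

definition pairing_integrand ::
  "nat \<Rightarrow> (complex ^ 'n \<Rightarrow> 'x::complex_normed_space) \<Rightarrow>
   (complex ^ 'n \<Rightarrow> 'x cdual) \<Rightarrow> complex ^ 'n \<Rightarrow> complex"
  where "pairing_integrand k f g z =
           cdual_apply (D_op k g z) (f z) * complex_of_real ((1 - (norm z)\<^sup>2) ^ k)"

text \<open>\<open>ck\<close> is the normalizing constant in front of the integral.\<close>

definition pairing ::
  "real \<Rightarrow> nat \<Rightarrow> real \<Rightarrow> (complex ^ 'n \<Rightarrow> 'x::complex_normed_space) \<Rightarrow>
   (complex ^ 'n \<Rightarrow> 'x cdual) \<Rightarrow> complex"
  where "pairing ck k \<alpha> f g =
           complex_of_real ck * (LINT z:ball 0 1|nu_alpha \<alpha>. pairing_integrand k f g z)"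

end

theory Submission
  imports Defs "HOL-Complex_Analysis.Cauchy_Integral_Formula"
begin

text \<open>Everything rests on the reproducing formula with kernel \<open>(1 - \<langle>z, w\<rangle>)\<^sup>-\<^sup>c\<close>, \<open>c = n + 1 + \<alpha> + k\<close>. Pairing a
  kernel function with \<open>g\<close> evaluates \<open>D\<^sub>k g\<close> at a point. Since the Forelli--Rudin estimates give
  the norm of the kernel functions, a bounded functional determines a \<open>g\<close> with
  \<open>\<parallel>D\<^sub>k g(w)\<parallel> \<le> C (1 - |w|\<^sup>2)\<^sup>-\<^sup>(\<^sup>k\<^sup>-\<^sup>\<gamma>\<^sup>)\<close>, which by Cauchy estimates and integration along rays is
  equivalent to membership in \<open>\<Gamma>\<^sub>\<gamma>\<close>. Conversely, by the sub-mean value property \<open>A\<^sup>p\<^sub>\<alpha>\<close> embeds into the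
  space \<open>A\<^sup>1\<close> with weight exponent \<open>\<alpha> + \<gamma>\<close>, so that such a \<open>g\<close> defines a bounded functional.

  For surjectivity, \<open>D\<^sub>k g(w)\<close> is prescribed to be \<open>x \<mapsto> r \<Lambda>(x (1 - \<langle>\<sqdot>, w\<rangle>)\<^sup>-\<^sup>c)\<close>; on functions of
  \<open>\<langle>z, w\<rangle>\<close> the operator \<open>D\<^sub>k\<close> is an ordinary differential operator that is inverted by power series.
  Applying \<open>\<Lambda>\<close> under the integral in the reproducing formula shows that \<open>\<Lambda>\<close> agrees with the pairing
  on dilates, and a majorant of \<open>\<parallel>f(r z)\<parallel>\<^sup>p\<close> uniform in \<open>r\<close> allows \<open>r \<rightarrow> 1\<close>.\<close>

section \<open>Norming functionals\<close>

text \<open>For p < 1 the Bergman space is not locally convex, and \<open>X\<close> is arbitrary,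
  possibly inseparable. Norming functionals are therefore taken on \<open>X\<close> only, to carry
  scalar estimates over to vector values. The exponents are forced. The weight (1 -
  |z|^2)^(\<alpha>+k) of the pairing has a reproducing kernel of exponent c = n + 1 + (\<alpha> +
  k). Since p c = (n + 1 + \<alpha>) + p (k - \<gamma>), the Forelli-Rudin estimate with t = p (k -
  \<gamma>) bounds the norm of a kernel function by a multiple of (1 - |w|^2)^(-(k-\<gamma>)), and k
  > \<gamma> is the condition t > 0. The same \<gamma> comes out of |f| = |f|^p |f|^(1-p), because f
  grows at most like (1 - |z|^2)^(-(n+1+\<alpha>)/p). Integrals over the ball rest on integration by
  parts against the weights \<open>eta s\<close>, for functions holomorphic across the sphere. So
  formulas are first shown for functions holomorphic on a larger ball and reach general ones by
  dilation. The limit r -> 1 is the recurring difficulty: it needs a majorant uniform in r.\<close>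

definition norm_graph :: "('a::real_normed_vector \<times> real) set \<Rightarrow> bool"
  where "norm_graph G \<longleftrightarrow> subspace G \<and> (\<forall>x a. (x, a) \<in> G \<longrightarrow> a \<le> norm x)"

text \<open>One step of Hahn-Banach. A partial functional is handled as its graph; dominance by the
  norm at (0, a) and (0, -a) forces a = 0, so single-valuedness comes for free. A value c at y is
  admissible iff it lies between all \<open>a - norm (x - y)\<close> and all
  \<open>norm (x' + y) - a'\<close>, and the triangle inequality separates these two sets.\<close>

lemma norm_graph_extend:
  fixes G :: "('a::real_normed_vector \<times> real) set"
  assumes G: "norm_graph G"
  shows "\<exists>c H. norm_graph H \<and> G \<subseteq> H \<and> (y, c) \<in> H"
proof -
  have sub: "subspace G" and le: "\<And>x a. (x, a) \<in> G \<Longrightarrow> a \<le> norm x"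
    using G by (auto simp: norm_graph_def)
  have z: "(0, 0) \<in> G"
    using subspace_0[OF sub] by (simp add: zero_prod_def)
  have key: "a - norm (x - y) \<le> norm (x' + y) - a'" if "(x, a) \<in> G" "(x', a') \<in> G" for x a x' a'
  proof -
    have "(x + x', a + a') \<in> G"
      using subspace_add[OF sub that] by simp
    then have "a + a' \<le> norm (x + x')" by (rule le)
    also have "\<dots> \<le> norm (x - y) + norm (x' + y)"
      using norm_triangle_ineq[of "x - y" "x' + y"] by simp
    finally show ?thesis by simp
  qed
  define S where "S = {a - norm (x - y) |x a. (x, a) \<in> G}"
  define c where "c = Sup S"
  have ne: "S \<noteq> {}" using z by (auto simp: S_def)
  have c1: "c \<le> norm (x' + y) - a'" if "(x', a') \<in> G" for x' a'
    unfolding c_def using key[OF _ that] by (intro cSup_least ne) (auto simp: S_def)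
  have bdd: "bdd_above S"
    using key[OF _ z] by (intro bdd_aboveI[of _ "norm (0 + y) - 0"]) (auto simp: S_def)
  have c2: "a - norm (x - y) \<le> c" if "(x, a) \<in> G" for x a
    unfolding c_def using that by (intro cSup_upper bdd) (auto simp: S_def)
  define H where "H = {(x + t *\<^sub>R y, a + t * c) |x a t. (x, a) \<in> G}"
  have "subspace H"
    unfolding subspace_def
  proof (intro conjI ballI allI)
    show "0 \<in> H"
      unfolding H_def zero_prod_def mem_Collect_eq
      using z by (intro exI[of _ 0]) simp
  next
    fix u v assume "u \<in> H" "v \<in> H"
    then obtain x a t x' a' t' where uv: "(x, a) \<in> G" "u = (x + t *\<^sub>R y, a + t * c)"
      "(x', a') \<in> G" "v = (x' + t' *\<^sub>R y, a' + t' * c)"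
      unfolding H_def by blast
    then show "u + v \<in> H"
      unfolding H_def mem_Collect_eq
      using subspace_add[OF sub uv(1) uv(3)]
      by (intro exI[of _ "x + x'"] exI[of _ "a + a'"] exI[of _ "t + t'"]) (simp add: algebra_simps)
  next
    fix r :: real and u assume "u \<in> H"
    then obtain x a t where u: "(x, a) \<in> G" "u = (x + t *\<^sub>R y, a + t * c)"
      by (auto simp: H_def)
    then show "r *\<^sub>R u \<in> H"
      unfolding H_def mem_Collect_eq
      using subspace_scale[OF sub u(1), of r]
      by (intro exI[of _ "r *\<^sub>R x"] exI[of _ "r * a"] exI[of _ "r * t"]) (simp add: algebra_simps)
  qed
  moreover have "a + t * c \<le> norm (x + t *\<^sub>R y)" if xa: "(x, a) \<in> G" for x a t
  proof -
    consider "t = 0" | "t > 0" | "t < 0" by linarith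
    then show ?thesis
    proof cases
      case 1
      then show ?thesis using le[OF xa] by simp
    next
      case 2
      have "(inverse t *\<^sub>R x, inverse t * a) \<in> G"
        using subspace_scale[OF sub xa, of "inverse t"] by simp
      from mult_left_mono[OF c1[OF this], of t] 2
      have "t * c \<le> t * norm (inverse t *\<^sub>R x + y) - a" by (simp add: algebra_simps)
      also have "t * norm (inverse t *\<^sub>R x + y) = norm (t *\<^sub>R (inverse t *\<^sub>R x + y))"
        using 2 by simp
      also have "t *\<^sub>R (inverse t *\<^sub>R x + y) = x + t *\<^sub>R y" using 2 by (simp add: algebra_simps)
      finally show ?thesis by simp
    next
      case 3
      define s where "s = - t"
      have s: "s > 0" "t = - s" using 3 by (auto simp: s_def)
      have "(inverse s *\<^sub>R x, inverse s * a) \<in> G"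
        using subspace_scale[OF sub xa, of "inverse s"] by simp
      from mult_left_mono[OF c2[OF this], of s] s
      have "a - s * norm (inverse s *\<^sub>R x - y) \<le> s * c" by (simp add: algebra_simps)
      moreover have "s * norm (inverse s *\<^sub>R x - y) = norm (s *\<^sub>R (inverse s *\<^sub>R x - y))"
        using s by simp
      moreover have "s *\<^sub>R (inverse s *\<^sub>R x - y) = x + t *\<^sub>R y" using s by (simp add: algebra_simps)
      ultimately show ?thesis using s by simp
    qed
  qed
  ultimately have "norm_graph H" by (auto simp: norm_graph_def H_def)
  moreover have "G \<subseteq> H"
  proof
    fix u assume "u \<in> G"
    then show "u \<in> H"
      unfolding H_def mem_Collect_eq
      by (intro exI[of _ "fst u"] exI[of _ "snd u"] exI[of _ "0::real"]) simp
  qed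
  moreover have "(y, c) \<in> H"
    unfolding H_def mem_Collect_eq using z by (intro exI[of _ 0] exI[of _ 0] exI[of _ 1]) simp
  ultimately show ?thesis by blast
qed

text \<open>Zorn's lemma on the dominated graphs that contain \<open>(x0, norm x0)\<close>: by the
  one-step extension a maximal one has full domain.\<close>

lemma real_norming_functional:
  fixes x0 :: "'a::real_normed_vector"
  shows "\<exists>\<phi>::'a \<Rightarrow> real. linear \<phi> \<and> (\<forall>x. \<bar>\<phi> x\<bar> \<le> norm x) \<and> \<phi> x0 = norm x0"
proof -
  define A where "A = {G. norm_graph G \<and> (x0, norm x0) \<in> G}"
  have line: "range (\<lambda>t. t *\<^sub>R (x0, norm x0)) \<in> A"
  proof -
    have "subspace (range (\<lambda>t. t *\<^sub>R (x0, norm x0)))"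
      by (intro linear_subspace_image linearI subspace_UNIV) (auto simp: algebra_simps)
    moreover have "t * norm x0 \<le> norm (t *\<^sub>R x0)" for t :: real
      by (simp add: mult_right_mono)
    moreover have "(x0, norm x0) \<in> range (\<lambda>t. t *\<^sub>R (x0, norm x0))"
      by (rule range_eqI[of _ _ 1]) simp
    ultimately show ?thesis by (auto simp: A_def norm_graph_def)
  qed
  have "\<exists>M\<in>A. \<forall>X\<in>A. M \<subseteq> X \<longrightarrow> X = M"
  proof (rule subset_Zorn_nonempty)
    show "A \<noteq> {}" using line by blast
  next
    fix C assume C: "C \<noteq> {}" "subset.chain A C"
    then have CA: "C \<subseteq> A" and ch: "\<And>X Y. X \<in> C \<Longrightarrow> Y \<in> C \<Longrightarrow> X \<subseteq> Y \<or> Y \<subseteq> X"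
      by (auto simp: subset_chain_def)
    have "subspace (\<Union>C)"
      unfolding subspace_def
    proof (intro conjI ballI allI)
      show "0 \<in> \<Union>C" using C(1) CA by (auto simp: A_def norm_graph_def subspace_def)
    next
      fix u v assume "u \<in> \<Union>C" "v \<in> \<Union>C"
      then obtain X Y where "X \<in> C" "Y \<in> C" "u \<in> X" "v \<in> Y" by blast
      with ch[of X Y] obtain Z where "Z \<in> C" "u \<in> Z" "v \<in> Z" by blast
      moreover from this CA have "subspace Z" by (auto simp: A_def norm_graph_def)
      ultimately show "u + v \<in> \<Union>C" using subspace_add by blast
    next
      fix r :: real and u assume "u \<in> \<Union>C"
      then show "r *\<^sub>R u \<in> \<Union>C" using CA by (fastforce simp: A_def norm_graph_def subspace_def)
    qed
    then show "\<Union>C \<in> A" using C(1) CA by (fastforce simp: A_def norm_graph_def)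
  qed
  then obtain M where M: "M \<in> A" and max: "\<And>X. X \<in> A \<Longrightarrow> M \<subseteq> X \<Longrightarrow> X = M" by blast
  have sub: "subspace M" and le: "\<And>x a. (x, a) \<in> M \<Longrightarrow> a \<le> norm x" and x0: "(x0, norm x0) \<in> M"
    using M by (auto simp: A_def norm_graph_def)
  have ex: "\<exists>c. (y, c) \<in> M" for y
  proof -
    from M norm_graph_extend[of M y] obtain c H where "norm_graph H" "M \<subseteq> H" "(y, c) \<in> H"
      by (auto simp: A_def)
    then have "H = M" using x0 by (intro max) (auto simp: A_def)
    then show ?thesis using \<open>(y, c) \<in> H\<close> by blast
  qed
  have uniq: "a = b" if "(y, a) \<in> M" "(y, b) \<in> M" for y a b
    using le[of 0 "a - b"] le[of 0 "b - a"] subspace_diff[OF sub that] subspace_diff[OF sub that(2,1)]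
    by simp
  define \<phi> where "\<phi> y = (THE c. (y, c) \<in> M)" for y
  have \<phi>: "(y, \<phi> y) \<in> M" for y
  proof -
    obtain c where "(y, c) \<in> M" using ex by blast
    then show ?thesis unfolding \<phi>_def by (rule theI) (rule uniq[OF _ \<open>(y, c) \<in> M\<close>])
  qed
  have "linear \<phi>"
  proof (rule linearI)
    show "\<phi> (x + y) = \<phi> x + \<phi> y" for x y
      using uniq[OF \<phi>[of "x + y"]] subspace_add[OF sub \<phi>[of x] \<phi>[of y]] by simp
    show "\<phi> (r *\<^sub>R x) = r *\<^sub>R \<phi> x" for r x
      using uniq[OF \<phi>[of "r *\<^sub>R x"]] subspace_scale[OF sub \<phi>[of x], of r] by simp
  qed
  moreover have "\<bar>\<phi> x\<bar> \<le> norm x" for x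
    using le[OF \<phi>[of x]] le[OF \<phi>[of "- x"]] linear_neg[OF calculation] by (simp add: abs_le_iff)
  moreover have "\<phi> x0 = norm x0" using uniq[OF \<phi> x0] .
  ultimately show ?thesis by blast
qed

section \<open>Algebra of the dual pairing and of complex scaling\<close>

lemma cdual_apply_add_right: "cdual_apply u (x + y) = cdual_apply u x + cdual_apply u y"
  by transfer (simp add: blinfun.add_right)

lemma cdual_apply_scaleC_right: "cdual_apply u (c *\<^sub>C x) = c * cdual_apply u x"
  by transfer simp

lemma cdual_apply_add_left: "cdual_apply (u + v) x = cdual_apply u x + cdual_apply v x"
  by transfer (simp add: blinfun.add_left)

lemma cdual_apply_scaleR_left: "cdual_apply (r *\<^sub>R u) x = r *\<^sub>R cdual_apply u x"
  by transfer (simp add: blinfun.scaleR_left)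

lemma cdual_apply_scaleR_right: "cdual_apply u (r *\<^sub>R x) = r *\<^sub>R cdual_apply u x"
  by transfer (simp add: blinfun.scaleR_right)

lemma norm_cdual_apply: "cmod (cdual_apply u x) \<le> norm u * norm x"
  by transfer (rule norm_blinfun)

lemma bounded_bilinear_cdual_apply:
  "bounded_bilinear (cdual_apply :: 'a::complex_normed_space cdual \<Rightarrow> 'a \<Rightarrow> complex)"
proof
  show "\<exists>K. \<forall>(a :: 'a cdual) b. norm (cdual_apply a b) \<le> norm a * norm b * K"
    by (intro exI[of _ 1]) (simp add: norm_cdual_apply)
qed (simp_all add: cdual_apply_add_left cdual_apply_add_right cdual_apply_scaleR_left cdual_apply_scaleR_right)

interpretation cdual: bounded_bilinear cdual_apply
  by (rule bounded_bilinear_cdual_apply)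

lemma bounded_bilinear_scaleC:
  "bounded_bilinear (scaleC :: complex \<Rightarrow> 'a \<Rightarrow> 'a::complex_normed_space)"
proof
  fix r :: real and a :: complex and b :: 'a
  show "(r *\<^sub>R a) *\<^sub>C b = r *\<^sub>R a *\<^sub>C b"
    by (simp add: scaleR_conv_of_real scaleC_of_real flip: scaleC_scaleC)
  show "a *\<^sub>C r *\<^sub>R b = r *\<^sub>R a *\<^sub>C b"
    by (simp add: scaleC_scaleC mult.commute flip: scaleC_of_real)
  show "\<exists>K. \<forall>a (b::'a). norm (a *\<^sub>C b) \<le> norm a * norm b * K"
    by (intro exI[of _ 1]) (simp add: norm_scaleC)
qed (simp_all add: scaleC_add_left scaleC_add_right)

interpretation scaleC: bounded_bilinear "scaleC :: complex \<Rightarrow> 'a \<Rightarrow> 'a::complex_normed_space"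
  by (rule bounded_bilinear_scaleC)

lemma scaleC_one [simp]: "1 *\<^sub>C (x :: 'a::complex_normed_space) = x"
  using scaleC_of_real[of 1 x] by simp

lemma cdual_make:
  fixes f :: "'a::complex_normed_space \<Rightarrow> complex"
  assumes add: "\<And>x y. f (x + y) = f x + f y" and sc: "\<And>c x. f (c *\<^sub>C x) = c * f x"
    and B: "\<And>x. cmod (f x) \<le> B * norm x" and "0 \<le> B"
  obtains u where "\<And>x. cdual_apply u x = f x" "norm u \<le> B"
proof -
  have "bounded_linear f"
    by (rule bounded_linear_intro[of _ B])
      (use add sc B in \<open>auto simp: scaleR_conv_of_real mult.commute simp flip: scaleC_of_real\<close>)
  then have 1: "blinfun_apply (Blinfun f) = f" by (rule bounded_linear_Blinfun_apply)
  then have 2: "cdual_blinfun (Abs_cdual (Blinfun f)) = Blinfun f"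
    by (intro Abs_cdual_inverse) (simp add: sc)
  show thesis
  proof
    show "cdual_apply (Abs_cdual (Blinfun f)) x = f x" for x
      by (simp add: cdual_apply.rep_eq 1 2)
    show "norm (Abs_cdual (Blinfun f)) \<le> B"
      unfolding norm_cdual.rep_eq 2 using B \<open>0 \<le> B\<close> by (intro norm_blinfun_bound) (simp_all add: 1)
  qed
qed

lemma norm_cdual_bound:
  assumes "0 \<le> b" "\<And>x. cmod (cdual_apply u x) \<le> b * norm x"
  shows "norm u \<le> b"
  using assms by transfer (rule norm_blinfun_bound)

lemma cdual_eqI: "(\<And>x. cdual_apply u x = cdual_apply v x) \<Longrightarrow> u = v"
  by transfer (rule blinfun_eqI)

text \<open>Complexification of the real functional: f(x) = \<phi>(x) - i \<phi>(i x) is complex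
  linear with real part \<phi>.\<close>

lemma norming_functional:
  fixes x0 :: "'a::complex_normed_space"
  obtains u :: "'a cdual" where "norm u \<le> 1" "cdual_apply u x0 = of_real (norm x0)"
proof -
  obtain \<phi> :: "'a \<Rightarrow> real" where lin: "linear \<phi>" and le: "\<And>x. \<bar>\<phi> x\<bar> \<le> norm x" and x0: "\<phi> x0 = norm x0"
    using real_norming_functional[of x0] by blast
  define f where "f x = Complex (\<phi> x) (- \<phi> (\<i> *\<^sub>C x))" for x
  have add: "f (x + y) = f x + f y" for x y
    by (simp add: f_def complex_eq_iff linear_add[OF lin] scaleC_add_right)
  have f_cx: "f (c *\<^sub>C x) = c * f x" for c x
  proof -
    have 1: "c *\<^sub>C x = Re c *\<^sub>R x + Im c *\<^sub>R (\<i> *\<^sub>C x)"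
      by (subst complex_eq[of c]) (simp add: scaleC_add_left scaleC_of_real mult.commute[of \<i>] flip: scaleC_scaleC)
    have 2: "\<i> *\<^sub>C (c *\<^sub>C x) = Re c *\<^sub>R (\<i> *\<^sub>C x) - Im c *\<^sub>R x"
      unfolding 1 by (simp add: scaleC_add_right scaleC.scaleR_right scaleC_scaleC scaleC.minus_left)
    show ?thesis
      unfolding f_def 2 unfolding 1
      by (simp add: complex_eq_iff linear_add[OF lin] linear_diff[OF lin] linear_cmul[OF lin] algebra_simps)
  qed
  have B: "cmod (f x) \<le> 1 * norm x" for x
  proof -
    \<comment> \<open>Rotating x until f becomes real and nonnegative reduces the bound on |f| to
      the one on \<phi>.\<close>
    define \<theta> where "\<theta> = (if f x = 0 then 1 else cnj (f x) / of_real (cmod (f x)))"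
    have \<theta>: "cmod \<theta> = 1" "\<theta> * f x = of_real (cmod (f x))"
      by (auto simp: \<theta>_def norm_divide power2_eq_square mult.commute divide_simps
          simp flip: complex_norm_square)
    have "cmod (f x) = Re (f (\<theta> *\<^sub>C x))" by (simp add: f_cx \<theta>)
    also have "\<dots> = \<phi> (\<theta> *\<^sub>C x)" by (simp add: f_def)
    also have "\<dots> \<le> norm (\<theta> *\<^sub>C x)" using le[of "\<theta> *\<^sub>C x"] by simp
    finally show ?thesis by (simp add: norm_scaleC \<theta>)
  qed
  from cdual_make[OF add f_cx B] obtain u where u: "\<And>x. cdual_apply u x = f x" "norm u \<le> 1" by auto
  \<comment> \<open>The real part already attains \<open>norm x0\<close>, which bounds the modulus,
    so nothing is left for the imaginary part.\<close>
  have "f x0 = of_real (norm x0)"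
  proof -
    have "(cmod (f x0))\<^sup>2 \<le> (norm x0)\<^sup>2" using B[of x0] by (intro power_mono) auto
    then have "Im (f x0) = 0" by (simp add: cmod_power2) (simp add: f_def x0)
    then show ?thesis by (simp add: complex_eq_iff) (simp add: f_def x0)
  qed
  with u that show thesis by auto
qed

text \<open>Reserves \<open>$\<close> for vector components instead of power series
  coefficients.\<close>

unbundle no fps_syntax

section \<open>Vector-valued holomorphic functions of several variables\<close>

lemma norm_vector_scalar_mult: "norm (c *s (v :: complex ^ 'n)) = cmod c * norm v"
  by (simp add: norm_vec_def norm_mult L2_set_right_distrib)

lemma bounded_bilinear_vector_scalar_mult:
  "bounded_bilinear ((*s) :: complex \<Rightarrow> complex ^ 'n \<Rightarrow> complex ^ 'n)"
proof
  show "\<exists>K. \<forall>(a :: complex) (b :: complex ^ 'n). norm (a *s b) \<le> norm a * norm b * K"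
    by (intro exI[of _ 1]) (simp add: norm_vector_scalar_mult)
qed (simp_all add: vec_eq_iff algebra_simps)

interpretation vsm: bounded_bilinear "(*s) :: complex \<Rightarrow> complex ^ 'n \<Rightarrow> complex ^ 'n"
  by (rule bounded_bilinear_vector_scalar_mult)

lemma of_real_vsm: "of_real r *s (v :: complex ^ 'n) = r *\<^sub>R v"
  by (simp add: vec_eq_iff scaleR_conv_of_real[where 'a = complex])

text \<open>Holomorphy on an arbitrary set, not only on the unit ball: dilates are holomorphic on
  balls of radius greater than 1, and this room makes integrands continuous up to the
  sphere.\<close>

definition hol_on :: "(complex ^ 'n) set \<Rightarrow> (complex ^ 'n \<Rightarrow> 'x::complex_normed_space) \<Rightarrow> bool"
  where "hol_on S F \<longleftrightarrow>
    (\<forall>z\<in>S. \<exists>D. (F has_derivative D) (at z) \<and> (\<forall>c v. D (c *s v) = c *\<^sub>C D v))"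

text \<open>The direction precedes the point so that \<open>dd F v\<close> is again a function on
  the space and can be differentiated in turn.\<close>

definition dd :: "(complex ^ 'n \<Rightarrow> 'x::complex_normed_space) \<Rightarrow> complex ^ 'n \<Rightarrow> complex ^ 'n \<Rightarrow> 'x"
  where "dd F v z = frechet_derivative F (at z) v"

lemma hol_ball_iff: "F \<in> hol_ball \<longleftrightarrow> hol_on (ball 0 1) F"
  by (simp add: hol_ball_def hol_on_def)

lemma hol_onI:
  assumes "\<And>z. z \<in> S \<Longrightarrow> (F has_derivative D z) (at z)"
    and "\<And>z c v. z \<in> S \<Longrightarrow> D z (c *s v) = c *\<^sub>C D z v"
  shows "hol_on S F"
  using assms unfolding hol_on_def by blast

lemma dd_eq: "(F has_derivative D) (at z) \<Longrightarrow> dd F v z = D v"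
  unfolding dd_def by (metis frechet_derivative_at)

lemma hol_on_has_derivative:
  assumes "hol_on S F" "z \<in> S"
  shows "(F has_derivative (\<lambda>v. dd F v z)) (at z)"
  using assms unfolding hol_on_def by (metis (no_types, lifting) ext dd_eq)

lemma dd_cmul:
  assumes "hol_on S F" "z \<in> S"
  shows "dd F (c *s v) z = c *\<^sub>C dd F v z"
  using assms unfolding hol_on_def by (metis dd_eq)

lemma dd_linear: "hol_on S F \<Longrightarrow> z \<in> S \<Longrightarrow> linear (\<lambda>v. dd F v z)"
  using hol_on_has_derivative has_derivative_linear by blast

lemma hol_on_subset: "hol_on S F \<Longrightarrow> T \<subseteq> S \<Longrightarrow> hol_on T F"
  by (auto simp: hol_on_def)

lemma hol_on_continuous_on: "hol_on S F \<Longrightarrow> continuous_on S F"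
  by (meson continuous_at_imp_continuous_on has_derivative_continuous hol_on_has_derivative)

lemma hol_on_cong:
  assumes "open S" "hol_on S F" "\<And>z. z \<in> S \<Longrightarrow> F z = G z"
  shows "hol_on S G"
proof (rule hol_onI[where D = "\<lambda>z v. dd F v z"])
  fix z assume "z \<in> S"
  then show "(G has_derivative (\<lambda>v. dd F v z)) (at z)"
    using assms hol_on_has_derivative has_derivative_transform_within_open by blast
qed (use assms dd_cmul in blast)

lemma hol_on_const: "hol_on S (\<lambda>_. x)"
  by (rule hol_onI[where D = "\<lambda>_ _. 0"]) (auto simp: scaleC.zero_right)

lemma hol_on_add:
  assumes "hol_on S F" "hol_on S G"
  shows "hol_on S (\<lambda>z. F z + G z)" "z \<in> S \<Longrightarrow> dd (\<lambda>z. F z + G z) v z = dd F v z + dd G v z"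
proof -
  have *: "((\<lambda>z. F z + G z) has_derivative (\<lambda>v. dd F v z + dd G v z)) (at z)" if "z \<in> S" for z
    using that assms by (intro has_derivative_add hol_on_has_derivative)
  show "hol_on S (\<lambda>z. F z + G z)"
    by (rule hol_onI[OF *]) (use assms in \<open>auto simp: dd_cmul scaleC_add_right\<close>)
  show "z \<in> S \<Longrightarrow> dd (\<lambda>z. F z + G z) v z = dd F v z + dd G v z" by (rule dd_eq[OF *])
qed

lemma hol_on_cmul:
  assumes "hol_on S F"
  shows "hol_on S (\<lambda>z. c *\<^sub>C F z)" "z \<in> S \<Longrightarrow> dd (\<lambda>z. c *\<^sub>C F z) v z = c *\<^sub>C dd F v z"
proof -
  have *: "((\<lambda>z. c *\<^sub>C F z) has_derivative (\<lambda>v. c *\<^sub>C dd F v z)) (at z)" if "z \<in> S" for z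
    using that assms
    by (intro bounded_linear.has_derivative[OF scaleC.bounded_linear_right] hol_on_has_derivative)
  show "hol_on S (\<lambda>z. c *\<^sub>C F z)"
    by (rule hol_onI[OF *]) (use assms in \<open>auto simp: dd_cmul scaleC_scaleC mult.commute\<close>)
  show "z \<in> S \<Longrightarrow> dd (\<lambda>z. c *\<^sub>C F z) v z = c *\<^sub>C dd F v z" by (rule dd_eq[OF *])
qed

lemma hol_on_scaleR:
  assumes "hol_on S F"
  shows "hol_on S (\<lambda>z. r *\<^sub>R F z)" "z \<in> S \<Longrightarrow> dd (\<lambda>z. r *\<^sub>R F z) v z = r *\<^sub>R dd F v z"
  using hol_on_cmul[OF assms, where c = "of_real r"] by (simp_all add: scaleC_of_real)

lemma hol_on_diff:
  assumes "hol_on S F" "hol_on S G"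
  shows "hol_on S (\<lambda>z. F z - G z)" "z \<in> S \<Longrightarrow> dd (\<lambda>z. F z - G z) v z = dd F v z - dd G v z"
  using hol_on_add(1)[OF assms(1) hol_on_scaleR(1)[OF assms(2), where r = "-1"]]
    hol_on_add(2)[OF assms(1) hol_on_scaleR(1)[OF assms(2), where r = "-1"], where z = z and v = v]
    hol_on_scaleR(2)[OF assms(2), where r = "-1" and z = z and v = v] by auto

lemma hol_on_sum:
  assumes "finite I" "\<And>i. i \<in> I \<Longrightarrow> hol_on S (F i)"
  shows "hol_on S (\<lambda>z. \<Sum>i\<in>I. F i z)"
  using assms by (induction I) (auto intro!: hol_on_const hol_on_add)

lemma hol_on_affine:
  assumes "hol_on T F" "\<And>z. z \<in> S \<Longrightarrow> r *\<^sub>R z + a \<in> T"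
  shows "hol_on S (\<lambda>z. F (r *\<^sub>R z + a))"
    "z \<in> S \<Longrightarrow> dd (\<lambda>z. F (r *\<^sub>R z + a)) v z = r *\<^sub>R dd F v (r *\<^sub>R z + a)"
proof -
  have *: "((\<lambda>z. F (r *\<^sub>R z + a)) has_derivative (\<lambda>v. r *\<^sub>R dd F v (r *\<^sub>R z + a))) (at z)" if "z \<in> S" for z
  proof -
    have "((\<lambda>z. F (r *\<^sub>R z + a)) has_derivative (\<lambda>v. dd F (r *\<^sub>R v) (r *\<^sub>R z + a))) (at z)"
      by (rule has_derivative_compose[where g = F, OF _ hol_on_has_derivative[OF assms(1)]])
        (use assms(2)[OF that] in \<open>auto intro!: derivative_eq_intros\<close>)
    then show ?thesis by (simp add: linear_cmul[OF dd_linear[OF assms(1) assms(2)[OF that]]])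
  qed
  show "hol_on S (\<lambda>z. F (r *\<^sub>R z + a))"
    by (rule hol_onI[OF *]) (use assms in \<open>auto simp: dd_cmul scaleC.scaleR_right\<close>)
  show "z \<in> S \<Longrightarrow> dd (\<lambda>z. F (r *\<^sub>R z + a)) v z = r *\<^sub>R dd F v (r *\<^sub>R z + a)" by (rule dd_eq[OF *])
qed

lemma hol_on_cdual:
  assumes "hol_on S F"
  shows "hol_on S (\<lambda>z. cdual_apply u (F z))"
    "z \<in> S \<Longrightarrow> dd (\<lambda>z. cdual_apply u (F z)) v z = cdual_apply u (dd F v z)"
proof -
  have *: "((\<lambda>z. cdual_apply u (F z)) has_derivative (\<lambda>v. cdual_apply u (dd F v z))) (at z)"
    if "z \<in> S" for z
    using that assms
    by (intro bounded_linear.has_derivative[OF cdual.bounded_linear_right] hol_on_has_derivative)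
  show "hol_on S (\<lambda>z. cdual_apply u (F z))"
    by (rule hol_onI[OF *])
      (use assms in \<open>auto simp: dd_cmul cdual_apply_scaleC_right scaleC_complex_def\<close>)
  show "z \<in> S \<Longrightarrow> dd (\<lambda>z. cdual_apply u (F z)) v z = cdual_apply u (dd F v z)" by (rule dd_eq[OF *])
qed

lemma hol_on_scaleC:
  assumes "hol_on S F" "hol_on S G"
  shows "hol_on S (\<lambda>z. F z *\<^sub>C G z)"
    "z \<in> S \<Longrightarrow> dd (\<lambda>z. F z *\<^sub>C G z) v z = F z *\<^sub>C dd G v z + dd F v z *\<^sub>C G z"
proof -
  have *: "((\<lambda>z. F z *\<^sub>C G z) has_derivative (\<lambda>v. F z *\<^sub>C dd G v z + dd F v z *\<^sub>C G z)) (at z)"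
    if "z \<in> S" for z
    using that assms by (intro scaleC.FDERIV hol_on_has_derivative)
  show "hol_on S (\<lambda>z. F z *\<^sub>C G z)"
    by (rule hol_onI[OF *])
      (use assms in \<open>auto simp: dd_cmul scaleC_scaleC scaleC_add_right mult.commute scaleC_complex_def\<close>)
  show "z \<in> S \<Longrightarrow> dd (\<lambda>z. F z *\<^sub>C G z) v z = F z *\<^sub>C dd G v z + dd F v z *\<^sub>C G z"
    by (rule dd_eq[OF *])
qed

lemma hol_on_nth:
  fixes S :: "(complex ^ 'n) set"
  shows "hol_on S (\<lambda>z. z $ j)" "dd (\<lambda>z :: complex ^ 'n. z $ j) v z = v $ j"
proof -
  have *: "((\<lambda>z. z $ j) has_derivative (\<lambda>v. v $ j)) (at z)" for z :: "complex ^ 'n"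
    by (intro bounded_linear_imp_has_derivative bounded_linear_vec_nth)
  show "hol_on S (\<lambda>z. z $ j)"
    by (rule hol_onI[OF *]) (auto simp: scaleC_complex_def)
  show "dd (\<lambda>z. z $ j) v z = v $ j" by (rule dd_eq[OF *])
qed

lemma line_has_derivative: "((\<lambda>l. z + l *s v) has_derivative (\<lambda>h. h *s v)) (at l)"
  for z v :: "complex ^ 'n"
  using has_derivative_add[OF has_derivative_const
      bounded_linear_imp_has_derivative[OF vsm.bounded_linear_left]] by simp

lemma slice_field_derivative:
  fixes F :: "complex ^ 'n \<Rightarrow> complex"
  assumes "hol_on S F" "z + l *s v \<in> S"
  shows "((\<lambda>l. F (z + l *s v)) has_field_derivative dd F v (z + l *s v)) (at l)"
proof -
  have "((\<lambda>l. F (z + l *s v)) has_derivative (\<lambda>h. dd F (h *s v) (z + l *s v))) (at l)"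
    by (rule has_derivative_compose[where g = F and f = "\<lambda>l. z + l *s v", 
          OF line_has_derivative hol_on_has_derivative[OF assms]])
  then show ?thesis
    by (simp add: has_field_derivative_def dd_cmul[OF assms] scaleC_complex_def mult_commute_abs)
qed

text \<open>Reduction to one complex variable: the slice l \<mapsto> F(z + l v), composed with a
  functional of norm at most 1, has Taylor coefficients at 0 bounded by \<open>M / R ^ n\<close>.
  The first bound is n = 1; the second sums n \<ge> 2 at l = 1. A norming functional of the vector
  in question gives back its norm.\<close>

lemma cauchy_estimates:
  fixes F :: "complex ^ 'n \<Rightarrow> 'x::complex_normed_space"
  assumes hol: "hol_on S F" and R: "0 < R"
    and S: "\<And>l. cmod l \<le> R \<Longrightarrow> z + l *s v \<in> S"
    and M: "\<And>l. cmod l \<le> R \<Longrightarrow> norm (F (z + l *s v)) \<le> M"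
  shows "norm (dd F v z) \<le> M / R"
    and "2 \<le> R \<Longrightarrow> norm (F (z + v) - F z - dd F v z) \<le> 2 * M / R\<^sup>2"
proof -
  have zS: "z \<in> S" using S[of 0] R by (simp add: vsm.zero_left)
  have main: "cmod (cdual_apply u (dd F v z)) \<le> M / R \<and>
      (2 \<le> R \<longrightarrow> cmod (cdual_apply u (F (z + v) - F z - dd F v z)) \<le> 2 * M / R\<^sup>2)"
    if u: "norm u \<le> 1" for u :: "'x cdual"
  proof -
    define \<phi> where "\<phi> l = cdual_apply u (F (z + l *s v))" for l
    have d: "(\<phi> has_field_derivative cdual_apply u (dd F v (z + l *s v))) (at l)" if "cmod l \<le> R" for l
      using slice_field_derivative[OF hol_on_cdual(1)[OF hol] S[OF that]]
        hol_on_cdual(2)[OF hol S[OF that]] unfolding \<phi>_def by simp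
    have h: "\<phi> holomorphic_on ball 0 R"
      unfolding holomorphic_on_def
      by (auto simp: field_differentiable_def intro!: exI has_field_derivative_at_within[OF d])
    have c: "continuous_on (cball 0 R) \<phi>"
      by (intro continuous_at_imp_continuous_on) (auto intro!: DERIV_isCont[OF d])
    have B: "cmod (\<phi> l) \<le> M" if "cmod l \<le> R" for l
    proof -
      have "cmod (\<phi> l) \<le> norm u * norm (F (z + l *s v))" unfolding \<phi>_def by (rule norm_cdual_apply)
      also have "\<dots> \<le> 1 * M" using u M[OF that] by (intro mult_mono) auto
      finally show ?thesis by simp
    qed
    have M0: "0 \<le> M" using B[of 0] R norm_ge_zero order_trans by (metis less_imp_le norm_zero)
    have ineq: "norm ((deriv ^^ n) \<phi> 0) \<le> fact n * M / R ^ n" for n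
      by (rule Cauchy_inequality[OF h c R]) (auto intro: B)
    have d0: "deriv \<phi> 0 = cdual_apply u (dd F v z)"
      using DERIV_imp_deriv[OF d[of 0]] R by (simp add: vsm.zero_left)
    have "cmod (cdual_apply u (dd F v z)) \<le> M / R" using ineq[of 1] by (simp add: d0)
    moreover have "cmod (cdual_apply u (F (z + v) - F z - dd F v z)) \<le> 2 * M / R\<^sup>2" if R2: "2 \<le> R"
    proof -
      define a where "a n = (deriv ^^ n) \<phi> 0 / fact n" for n
      have an: "norm (a n) \<le> M / R ^ n" for n
      proof -
        have "fact n * norm (a n) \<le> fact n * (M / R ^ n)"
          using ineq[of n] by (simp add: a_def norm_divide)
        then show ?thesis by (rule mult_left_le_imp_le) simp
      qed
      have "(\<lambda>n. (deriv ^^ n) \<phi> 0 / fact n * (1 - 0) ^ n) sums \<phi> 1"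
        by (rule holomorphic_power_series[OF h]) (use R2 in auto)
      then have s: "a sums \<phi> 1" unfolding a_def by simp
      have "(\<lambda>n. a (n + 2)) sums (\<phi> 1 - (\<Sum>n<2. a n))"
        using s by (rule sums_split_initial_segment)
      then have s2: "(\<lambda>n. a (n + 2)) sums (\<phi> 1 - \<phi> 0 - deriv \<phi> 0)"
        by (simp add: numeral_2_eq_2 a_def diff_diff_eq)
      have g: "(\<lambda>n. M / R\<^sup>2 * (1 / R) ^ n) sums (M / R\<^sup>2 * (1 / (1 - 1 / R)))"
        by (intro sums_mult geometric_sums) (use R2 in auto)
      have "norm (\<phi> 1 - \<phi> 0 - deriv \<phi> 0) \<le> M / R\<^sup>2 * (1 / (1 - 1 / R))"
      proof -
        have "norm (\<Sum>n. a (n + 2)) \<le> (\<Sum>n. M / R\<^sup>2 * (1 / R) ^ n)"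
        proof (rule norm_suminf_le)
          show "norm (a (n + 2)) \<le> M / R\<^sup>2 * (1 / R) ^ n" for n
            using an[of "n + 2"] by (simp add: power_divide power2_eq_square mult_ac)
          show "summable (\<lambda>n. M / R\<^sup>2 * (1 / R) ^ n)" using g by (rule sums_summable)
        qed
        then show ?thesis using s2 g by (simp add: sums_iff)
      qed
      \<comment> \<open>Geometric series of ratio 1/R \<le> 1/2.\<close>
      also have "\<dots> \<le> M / R\<^sup>2 * 2"
        using R2 M0 by (intro mult_left_mono) (auto simp: divide_simps)
      finally show ?thesis
        by (simp add: d0) (simp add: \<phi>_def vsm.zero_left cdual.diff_right mult.commute)
    qed
    ultimately show ?thesis by blast
  qed
  obtain u where "norm u \<le> 1" "cdual_apply u (dd F v z) = of_real (norm (dd F v z))"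
    by (rule norming_functional)
  then show "norm (dd F v z) \<le> M / R" using main[of u] by simp
  assume "2 \<le> R"
  obtain u where "norm u \<le> 1"
    "cdual_apply u (F (z + v) - F z - dd F v z) = of_real (norm (F (z + v) - F z - dd F v z))"
    by (rule norming_functional)
  then show "norm (F (z + v) - F z - dd F v z) \<le> 2 * M / R\<^sup>2" using main[of u] \<open>2 \<le> R\<close> by simp
qed


text \<open>The derivative in direction v is the limit of the holomorphic difference quotients
  \<open>f m\<close>. The second-order Cauchy estimate gives the rate \<open>K * t m\<close> locally
  uniformly, the first-order one turns this into uniform convergence of the derivatives, and
  completeness of the range supplies their limit.\<close>

lemma hol_on_dd:
  fixes F :: "complex ^ 'n \<Rightarrow> 'x::complex_banach"
  assumes S: "open S" and hol: "hol_on S F"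
  shows "hol_on S (dd F v)"
proof -
  have *: "\<exists>D. (dd F v has_derivative D) (at z) \<and> (\<forall>c h. D (c *s h) = c *\<^sub>C D h)" if z: "z \<in> S" for z
  proof -
    obtain \<rho>' where \<rho>': "\<rho>' > 0" "cball z \<rho>' \<subseteq> S"
      using S z open_contains_cball by blast
    \<comment> \<open>Four nested radii: \<open>F\<close> is bounded on 4\<rho>, the quotients live
      on 3\<rho>, the rate holds on 2\<rho>, derivatives are compared on \<rho>.\<close>
    define \<rho> where "\<rho> = \<rho>' / 4"
    have \<rho>: "\<rho> > 0" and sub: "cball z (4 * \<rho>) \<subseteq> S" using \<rho>' by (auto simp: \<rho>_def)
    have "compact (F ` cball z (4 * \<rho>))"
      by (intro compact_continuous_image continuous_on_subset[OF hol_on_continuous_on[OF hol] sub] compact_cball)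
    then obtain M where M: "\<And>y. y \<in> cball z (4 * \<rho>) \<Longrightarrow> norm (F y) \<le> M" and M0: "M > 0"
      using compact_imp_bounded bounded_pos by (metis imageI)
    define c where "c = \<rho> / (norm v + 1)"
    have c: "c > 0" "c * norm v \<le> \<rho>"
      using \<rho> by (auto simp: c_def field_simps add_pos_nonneg)
    define t where "t m = c / real (Suc m)" for m
    have t: "t m > 0" "t m * norm v \<le> \<rho>" for m
    proof -
      show "t m > 0" using c by (simp add: t_def)
      have "t m \<le> c" using c by (simp add: t_def divide_simps mult_left_mono)
      then have "t m * norm v \<le> c * norm v" by (intro mult_right_mono) auto
      with c show "t m * norm v \<le> \<rho>" by simp
    qed
    have t_lim: "t \<longlonglongrightarrow> 0"
      unfolding t_def by (rule LIMSEQ_Suc[where f = "\<lambda>m. c / real m"]) (simp add: lim_const_over_n)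
    \<comment> \<open>Written with \<open>1 *\<^sub>R y + t m *\<^sub>R v\<close> to match the
      affine substitution \<open>hol_on_affine\<close>.\<close>
    define f where "f m y = inverse (t m) *\<^sub>R (F (1 *\<^sub>R y + t m *\<^sub>R v) - F y)" for m y
    have shift: "1 *\<^sub>R y + t m *\<^sub>R v \<in> S" if "y \<in> ball z (3 * \<rho>)" for y m
    proof -
      have "dist z (y + t m *\<^sub>R v) \<le> dist z y + norm (t m *\<^sub>R v)"
        using norm_triangle_ineq4[of "z - y" "t m *\<^sub>R v"] by (simp add: dist_norm algebra_simps)
      also have "\<dots> \<le> 3 * \<rho> + \<rho>" using that t[of m] by (intro add_mono) auto
      finally have "y + t m *\<^sub>R v \<in> cball z (4 * \<rho>)" by simp
      then show ?thesis using sub by auto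
    qed
    have "ball z (3 * \<rho>) \<subseteq> cball z (4 * \<rho>)" using \<rho> by auto
    with sub have sub3: "ball z (3 * \<rho>) \<subseteq> S" by (rule order_trans[rotated])
    have hol3: "hol_on (ball z (3 * \<rho>)) F" using hol_on_subset[OF hol sub3] .
    note f1 = hol_on_affine[OF hol shift]
    note f2 = hol_on_diff[OF f1(1) hol3]
    have hf: "hol_on (ball z (3 * \<rho>)) (f m)" for m
      unfolding f_def by (rule hol_on_scaleR(1)[OF f2(1)])
    \<comment> \<open>With R = 2\<rho> / (t |v|) the bound 2M / R^2 equals t times K t; dividing by
      t leaves the rate.\<close>
    define K where "K = M * (norm v)\<^sup>2 / (2 * \<rho>\<^sup>2)"
    have K0: "K \<ge> 0" using M0 by (simp add: K_def)
    have close: "norm (f m y - dd F v y) \<le> K * t m" if y: "y \<in> ball z (2 * \<rho>)" for m y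
    proof (cases "v = 0")
      case True
      then show ?thesis using y linear_0[OF dd_linear[OF hol3, of y]] K0 t(1)[of m] \<rho> by (auto simp: f_def)
    next
      case False
      define R where "R = 2 * \<rho> / (t m * norm v)"
      have R: "R \<ge> 2" using t[of m] False by (simp add: R_def divide_simps)
      have in4: "y + l *s (t m *\<^sub>R v) \<in> cball z (4 * \<rho>)" if "cmod l \<le> R" for l
      proof -
        have "dist z (y + l *s (t m *\<^sub>R v)) \<le> dist z y + norm (l *s (t m *\<^sub>R v))"
          using norm_triangle_ineq4[of "z - y" "l *s (t m *\<^sub>R v)"] by (simp add: dist_norm algebra_simps)
        also have "norm (l *s (t m *\<^sub>R v)) = cmod l * (t m * norm v)"
          using t(1)[of m] by (simp add: norm_vector_scalar_mult)
        also have "\<dots> \<le> R * (t m * norm v)" using that t[of m] by (intro mult_right_mono) auto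
        also have "\<dots> = 2 * \<rho>" using False t(1)[of m] by (simp add: R_def)
        finally show ?thesis using y by simp
      qed
      have "norm (F (y + t m *\<^sub>R v) - F y - dd F (t m *\<^sub>R v) y) \<le> 2 * M / R\<^sup>2"
        by (rule cauchy_estimates(2)[OF hol, of R]) (use R in4 sub M in auto)
      also have "dd F (t m *\<^sub>R v) y = t m *\<^sub>R dd F v y"
        using y \<rho> by (intro linear_cmul[OF dd_linear[OF hol3]]) auto
      also have "2 * M / R\<^sup>2 = t m * (K * t m)"
        using False \<rho> t(1)[of m] by (simp add: R_def K_def field_simps power2_eq_square)
      also have "F (y + t m *\<^sub>R v) - F y - t m *\<^sub>R dd F v y = t m *\<^sub>R (f m y - dd F v y)"
        using t(1)[of m] by (simp add: f_def scaleR_diff_right)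
      finally show ?thesis using t(1)[of m] by simp
    qed
    have hdiff: "hol_on (ball z (3 * \<rho>)) (\<lambda>y. f m y - f m' y)" for m m'
      by (rule hol_on_diff(1)[OF hf hf])
    have ddiff: "norm (dd (f m) h y - dd (f m') h y) \<le> K / \<rho> * (t m + t m') * norm h"
      if y: "y \<in> ball z \<rho>" for m m' y h
    proof (cases "h = 0")
      case True
      have "y \<in> ball z (3 * \<rho>)" using y \<rho> by auto
      then show ?thesis using True linear_0[OF dd_linear[OF hf]] by auto
    next
      case False
      have in2: "y + l *s h \<in> ball z (2 * \<rho>)" if "cmod l \<le> \<rho> / norm h" for l
      proof -
        have "dist z (y + l *s h) \<le> dist z y + norm (l *s h)"
          using norm_triangle_ineq4[of "z - y" "l *s h"] by (simp add: dist_norm algebra_simps)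
        also have "norm (l *s h) \<le> \<rho>" using that False by (simp add: norm_vector_scalar_mult field_simps)
        finally show ?thesis using y by simp
      qed
      have "norm (dd (\<lambda>y. f m y - f m' y) h y) \<le> (K * (t m + t m')) / (\<rho> / norm h)"
      proof (rule cauchy_estimates(1)[OF hol_on_subset[OF hdiff, of "ball z (2 * \<rho>)"]])
        fix l assume l: "cmod l \<le> \<rho> / norm h"
        show "norm (f m (y + l *s h) - f m' (y + l *s h)) \<le> K * (t m + t m')"
          using norm_triangle_le_diff[OF add_mono[OF close[OF in2[OF l], of m] close[OF in2[OF l], of m']]]
          by (simp add: algebra_simps)
      qed (use in2 \<rho> False in auto)
      also have "dd (\<lambda>y. f m y - f m' y) h y = dd (f m) h y - dd (f m') h y"
        by (rule hol_on_diff(2)[OF hf hf]) (use y \<rho> in auto)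
      finally show ?thesis using False \<rho> by (simp add: field_simps)
    qed
    have conv: "\<exists>l. (\<lambda>m. dd (f m) h y) \<longlonglongrightarrow> l" if y: "y \<in> ball z \<rho>" for y h
      unfolding convergent_eq_Cauchy
    proof (rule metric_CauchyI)
      fix e :: real assume "e > 0"
      have "(\<lambda>m. K / \<rho> * (t m + t m) * norm h) \<longlonglongrightarrow> K / \<rho> * (0 + 0) * norm h"
        by (intro tendsto_intros t_lim)
      then have "\<forall>\<^sub>F m in sequentially. K / \<rho> * (t m + t m) * norm h < e"
        using \<open>e > 0\<close> by (intro order_tendstoD) auto
      then obtain N where N: "K / \<rho> * (t N + t N) * norm h < e" by (auto simp: eventually_sequentially)
      have mono: "t m \<le> t N" if "m \<ge> N" for m
        unfolding t_def using that c by (intro divide_left_mono) auto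
      show "\<exists>N. \<forall>m\<ge>N. \<forall>n\<ge>N. dist (dd (f m) h y) (dd (f n) h y) < e"
      proof (intro exI[of _ N] allI impI)
        fix m n assume "m \<ge> N" "n \<ge> N"
        then have "K / \<rho> * (t m + t n) * norm h \<le> K / \<rho> * (t N + t N) * norm h"
          using mono K0 \<rho> by (intro mult_right_mono mult_left_mono add_mono) auto
        with ddiff[OF y, of m h n] N show "dist (dd (f m) h y) (dd (f n) h y) < e"
          by (simp add: dist_norm)
      qed
    qed
    define g' where "g' y h = (SOME l. (\<lambda>m. dd (f m) h y) \<longlonglongrightarrow> l)" for y h
    have g': "(\<lambda>m. dd (f m) h y) \<longlonglongrightarrow> g' y h" if "y \<in> ball z \<rho>" for y h
      unfolding g'_def using someI_ex[OF conv[OF that]] .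
    have g'_close: "norm (dd (f m) h y - g' y h) \<le> K / \<rho> * t m * norm h" if y: "y \<in> ball z \<rho>" for m y h
    proof (rule LIMSEQ_le)
      show "(\<lambda>m'. norm (dd (f m) h y - dd (f m') h y)) \<longlonglongrightarrow> norm (dd (f m) h y - g' y h)"
        by (intro tendsto_intros g' y)
      have "(\<lambda>m'. K / \<rho> * (t m + t m') * norm h) \<longlonglongrightarrow> K / \<rho> * (t m + 0) * norm h"
        by (intro tendsto_intros t_lim)
      then show "(\<lambda>m'. K / \<rho> * (t m + t m') * norm h) \<longlonglongrightarrow> K / \<rho> * t m * norm h" by simp
      show "\<exists>N. \<forall>n\<ge>N. norm (dd (f m) h y - dd (f n) h y) \<le> K / \<rho> * (t m + t n) * norm h"
        using ddiff[OF y] by blast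
    qed
    have f_lim: "(\<lambda>m. f m y) \<longlonglongrightarrow> dd F v y" if "y \<in> ball z \<rho>" for y
    proof (rule Lim_null_comparison[of "\<lambda>m. f m y - dd F v y", THEN LIM_zero_cancel])
      have "y \<in> ball z (2 * \<rho>)" using that \<rho> by auto
      then show "\<forall>\<^sub>F m in sequentially. norm (f m y - dd F v y) \<le> K * t m" using close by simp
      show "(\<lambda>m. K * t m) \<longlonglongrightarrow> 0" using tendsto_mult_left[OF t_lim, of K] by simp
    qed
    have "\<exists>g. \<forall>x\<in>ball z \<rho>. (\<lambda>m. f m x) \<longlonglongrightarrow> g x \<and> (g has_derivative g' x) (at x within ball z \<rho>)"
    proof (rule has_derivative_sequence[where f' = "\<lambda>m x h. dd (f m) h x"])
      show "convex (ball z \<rho>)" by simp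
      show "(f m has_derivative (\<lambda>h. dd (f m) h x)) (at x within ball z \<rho>)" if "x \<in> ball z \<rho>" for m x
        by (rule has_derivative_at_withinI, rule hol_on_has_derivative[OF hf]) (use that \<rho> in auto)
      show "\<forall>\<^sub>F n in sequentially. \<forall>x\<in>ball z \<rho>. \<forall>h. norm (dd (f n) h x - g' x h) \<le> e * norm h"
        if "e > 0" for e
      proof -
        have "(\<lambda>m. K / \<rho> * t m) \<longlonglongrightarrow> 0" using tendsto_mult_left[OF t_lim, of "K / \<rho>"] by simp
        then have "\<forall>\<^sub>F m in sequentially. K / \<rho> * t m < e" using that by (rule order_tendstoD)
        then show ?thesis
        proof eventually_elim
          case (elim m)
          show ?case
          proof (intro ballI allI)
            fix x h :: "complex ^ 'n" assume "x \<in> ball z \<rho>"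
            have "K / \<rho> * t m * norm h \<le> e * norm h" using elim by (intro mult_right_mono) auto
            with g'_close[OF \<open>x \<in> ball z \<rho>\<close>, of m h]
            show "norm (dd (f m) h x - g' x h) \<le> e * norm h" by linarith
          qed
        qed
      qed
      show "z \<in> ball z \<rho>" using \<rho> by simp
      then show "(\<lambda>m. f m z) \<longlonglongrightarrow> dd F v z" by (rule f_lim)
    qed
    then obtain g where g: "\<And>x. x \<in> ball z \<rho> \<Longrightarrow> (\<lambda>m. f m x) \<longlonglongrightarrow> g x"
      "\<And>x. x \<in> ball z \<rho> \<Longrightarrow> (g has_derivative g' x) (at x within ball z \<rho>)" by blast
    have zin: "z \<in> ball z \<rho>" using \<rho> by simp
    have "(g has_derivative g' z) (at z)"
      using g(2)[OF zin] at_within_open[OF zin] by simp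
    then have "(dd F v has_derivative g' z) (at z)"
      by (rule has_derivative_transform_within_open[OF _ open_ball zin])
        (use LIMSEQ_unique[OF g(1) f_lim] in blast)
    moreover have "g' z (a *s h) = a *\<^sub>C g' z h" for a h
    proof (rule LIMSEQ_unique[OF g'[OF zin]])
      have "(\<lambda>m. a *\<^sub>C dd (f m) h z) \<longlonglongrightarrow> a *\<^sub>C g' z h"
        by (intro scaleC.tendsto tendsto_intros g'[OF zin])
      then show "(\<lambda>m. dd (f m) (a *s h) z) \<longlonglongrightarrow> a *\<^sub>C g' z h"
        using dd_cmul[OF hf, of z] \<rho> by simp
    qed
    ultimately show ?thesis by blast
  qed
  then show ?thesis unfolding hol_on_def by blast
qed

text \<open>The complex difference quotient and the real one with \<open>norm h\<close> differ by a
  unimodular factor only, so convergence in norm transfers.\<close>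

lemma partial_deriv_eq:
  assumes "hol_on S F" "z \<in> S"
  shows "partial_deriv j F z = dd F (axis j 1) z"
proof -
  define e where "e = axis j (1::complex)"
  have ax: "axis j h = h *s e" for h
    by (simp add: vec_eq_iff axis_def e_def)
  let ?q = "\<lambda>h. inverse h *\<^sub>C (F (z + axis j h) - F z)"
  have "((\<lambda>h. F (z + h *s e)) has_derivative (\<lambda>h. dd F (h *s e) z)) (at 0)"
    by (rule has_derivative_compose[where g = F and f = "\<lambda>h. z + h *s e" and x = 0])
      (use hol_on_has_derivative[OF assms] line_has_derivative in \<open>auto simp: vsm.zero_left\<close>)
  then have "((\<lambda>h. (F (z + axis j h) - F z - h *\<^sub>C dd F (e) z) /\<^sub>R norm h) \<longlongrightarrow> 0) (at 0)"
    by (simp add: has_derivative_at ax dd_cmul[OF assms] vsm.zero_left has_derivative_def)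
  then have "((\<lambda>h. norm (?q h - dd F (e) z)) \<longlongrightarrow> 0) (at 0)"
  proof (rule Lim_transform_eventually[OF tendsto_norm_zero])
    have "norm ((F (z + axis j h) - F z - h *\<^sub>C dd F (e) z) /\<^sub>R norm h)
        = norm (?q h - dd F (e) z)" if "h \<noteq> 0" for h
    proof -
      have "?q h - dd F (e) z = inverse h *\<^sub>C (F (z + axis j h) - F z - h *\<^sub>C dd F (e) z)"
        using that by (simp add: scaleC.diff_right scaleC_scaleC)
      then show ?thesis by (simp add: norm_scaleC norm_inverse)
    qed
    then show "\<forall>\<^sub>F h in at 0. norm ((F (z + axis j h) - F z - h *\<^sub>C dd F (e) z) /\<^sub>R norm h)
        = norm (?q h - dd F (e) z)"
      by (auto simp: eventually_at_filter)
  qed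
  then have "(?q \<longlongrightarrow> dd F (e) z) (at 0)"
    using LIM_zero_cancel tendsto_norm_zero_iff by blast
  then show ?thesis unfolding partial_deriv_def e_def[symmetric] by (intro tendsto_Lim) auto
qed

lemma vec_sum_axis: "(\<Sum>j\<in>UNIV. (z $ j) *s axis j 1) = (z :: complex ^ 'n)"
  by (simp add: vec_eq_iff axis_def if_distrib cong: if_cong)

lemma dd_sum_axis:
  assumes "hol_on S F" "z \<in> S"
  shows "(\<Sum>j\<in>UNIV. (v $ j) *\<^sub>C dd F (axis j 1) z) = dd F v z"
proof -
  have "dd F (\<Sum>j\<in>UNIV. (v $ j) *s axis j 1) z = (\<Sum>j\<in>UNIV. dd F ((v $ j) *s axis j 1) z)"
    by (rule linear_sum[OF dd_linear[OF assms]])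
  then show ?thesis by (simp add: vec_sum_axis dd_cmul[OF assms])
qed

text \<open>Complex linearity of the derivative collapses the coordinate sum: N differentiates along
  the ray through z.\<close>

lemma radial_deriv_eq:
  assumes "hol_on S F" "z \<in> S"
  shows "radial_deriv F z = dd F z z"
  unfolding radial_deriv_def using assms
  by (simp add: partial_deriv_eq[OF assms] dd_sum_axis)

text \<open>The direction in \<open>dd F z z\<close> moves with the point, so holomorphy is read off
  the coordinate sum, whose directions are fixed.\<close>

lemma hol_on_radial_deriv:
  fixes F :: "complex ^ 'n \<Rightarrow> 'x::complex_banach"
  assumes "open S" "hol_on S F"
  shows "hol_on S (radial_deriv F)"
proof (rule hol_on_cong[OF assms(1)])
  show "hol_on S (\<lambda>z. \<Sum>j\<in>UNIV. (z $ j) *\<^sub>C dd F (axis j 1) z)"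
    by (rule hol_on_sum[OF finite], rule hol_on_scaleC(1)[OF hol_on_nth(1) hol_on_dd[OF assms]])
  show "(\<Sum>j\<in>UNIV. (z $ j) *\<^sub>C dd F (axis j 1) z) = radial_deriv F z" if "z \<in> S" for z
    using that assms by (simp add: radial_deriv_eq dd_sum_axis)
qed

section \<open>The Hermitian product and radial weights\<close>

definition cin :: "complex ^ 'n \<Rightarrow> complex ^ 'n \<Rightarrow> complex"
  where "cin z w = (\<Sum>j\<in>UNIV. z $ j * cnj (w $ j))"

lemma cin_add_left: "cin (x + y) w = cin x w + cin y w"
  by (simp add: cin_def algebra_simps sum.distrib)

lemma cin_add_right: "cin w (x + y) = cin w x + cin w y"
  by (simp add: cin_def algebra_simps sum.distrib)

lemma cin_scale_left: "cin (c *s z) w = c * cin z w"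
  by (simp add: cin_def sum_distrib_left algebra_simps)

lemma cin_scale_right: "cin z (c *s w) = cnj c * cin z w"
  by (simp add: cin_def sum_distrib_left algebra_simps)

lemma cin_scaleR_left: "cin (r *\<^sub>R z) w = r *\<^sub>R cin z w"
  using cin_scale_left[of "of_real r" z w] by (simp add: of_real_vsm scaleR_conv_of_real)

lemma cin_scaleR_right: "cin z (r *\<^sub>R w) = r *\<^sub>R cin z w"
  using cin_scale_right[of z "of_real r" w] by (simp add: of_real_vsm scaleR_conv_of_real)

lemma cnj_cin: "cnj (cin z w) = cin w z"
  by (simp add: cin_def mult.commute)

lemma Re_cin: "Re (cin z w) = z \<bullet> w"
  by (simp add: cin_def inner_vec_def inner_complex_def)

lemma cin_self: "cin z z = of_real ((norm z)\<^sup>2)"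
  using arg_cong[OF cnj_cin[of z z], of Im] by (simp add: complex_eq_iff Re_cin power2_norm_eq_inner)

lemma norm_cin_le: "cmod (cin z w) \<le> norm z * norm w"
proof -
  define \<theta> where "\<theta> = (if cin z w = 0 then 1 else cnj (cin z w) / of_real (cmod (cin z w)))"
  have \<theta>: "cmod \<theta> = 1" "\<theta> * cin z w = of_real (cmod (cin z w))"
    by (auto simp: \<theta>_def norm_divide power2_eq_square mult.commute divide_simps
        simp flip: complex_norm_square)
  have "cmod (cin z w) = Re (cin (\<theta> *s z) w)" by (simp add: cin_scale_left \<theta>)
  also have "\<dots> \<le> norm (\<theta> *s z) * norm w" unfolding Re_cin by (rule norm_cauchy_schwarz)
  finally show ?thesis by (simp add: norm_vector_scalar_mult \<theta>)
qed

lemma bounded_bilinear_cin: "bounded_bilinear (cin :: complex ^ 'n \<Rightarrow> complex ^ 'n \<Rightarrow> complex)"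
proof
  show "\<exists>K. \<forall>(a :: complex ^ 'n) b. norm (cin a b) \<le> norm a * norm b * K"
    by (intro exI[of _ 1]) (simp add: norm_cin_le)
qed (simp_all add: cin_add_left cin_add_right cin_scaleR_left cin_scaleR_right)

interpretation cin: bounded_bilinear "cin :: complex ^ 'n \<Rightarrow> complex ^ 'n \<Rightarrow> complex"
  by (rule bounded_bilinear_cin)

lemma hol_on_cin: "hol_on S (\<lambda>x. cin x w)" "dd (\<lambda>x. cin x w) v z = cin v w"
proof -
  have *: "((\<lambda>x. cin x w) has_derivative (\<lambda>v. cin v w)) (at z)" for z
    by (intro bounded_linear_imp_has_derivative cin.bounded_linear_left)
  show "hol_on S (\<lambda>x. cin x w)"
    by (rule hol_onI[OF *]) (auto simp: scaleC_complex_def cin_scale_left)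
  show "dd (\<lambda>x. cin x w) v z = cin v w" by (rule dd_eq[OF *])
qed

lemma hol_on_compose:
  fixes F :: "complex ^ 'n \<Rightarrow> complex"
  assumes "hol_on S F" "\<And>z. z \<in> S \<Longrightarrow> (g has_field_derivative g' z) (at (F z))"
  shows "hol_on S (\<lambda>z. g (F z))" "z \<in> S \<Longrightarrow> dd (\<lambda>z. g (F z)) v z = g' z * dd F v z"
proof -
  have *: "((\<lambda>z. g (F z)) has_derivative (\<lambda>v. g' z * dd F v z)) (at z)" if "z \<in> S" for z
    by (rule has_derivative_compose[where g = g and f = F, OF hol_on_has_derivative[OF assms(1) that]])
      (use assms(2)[OF that] in \<open>simp add: has_field_derivative_def\<close>)
  show "hol_on S (\<lambda>z. g (F z))"
    by (rule hol_onI[OF *]) (use assms(1) in \<open>auto simp: scaleC_complex_def dd_cmul\<close>)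
  show "z \<in> S \<Longrightarrow> dd (\<lambda>z. g (F z)) v z = g' z * dd F v z" by (rule dd_eq[OF *])
qed

text \<open>Zero off the ball for every exponent \<open>s\<close>, because \<open>0 powr s = 0\<close>.\<close>

definition eta :: "real \<Rightarrow> 'a::real_normed_vector \<Rightarrow> real"
  where "eta s x = max 0 (1 - (norm x)\<^sup>2) powr s"

lemma eta_nonneg [simp]: "0 \<le> eta s x"
  by (simp add: eta_def)

lemma eta_outside: "1 \<le> norm x \<Longrightarrow> eta s x = 0"
  using one_le_power[of "norm x" 2] by (simp add: eta_def max_absorb1)

lemma eta_nonzero: "eta s x \<noteq> 0 \<Longrightarrow> norm x < 1"
  by (rule ccontr) (simp add: eta_outside)

lemma one_minus_norm_sq_pos: "norm x < 1 \<Longrightarrow> 0 < 1 - (norm x)\<^sup>2"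
  by (simp add: abs_square_less_1)

lemma eta_inside: "norm x < 1 \<Longrightarrow> eta s x = (1 - (norm x)\<^sup>2) powr s"
  using one_minus_norm_sq_pos[of x] by (simp add: eta_def)

lemma eta_le_1: "0 \<le> s \<Longrightarrow> eta s x \<le> 1"
  unfolding eta_def by (rule powr_le1) auto

lemma eta_measurable [measurable]: "eta s \<in> borel_measurable borel"
  unfolding eta_def by measurable

lemma max_powr_has_derivative:
  assumes s: "s > 1"
  shows "((\<lambda>t::real. max 0 t powr s) has_real_derivative s * max 0 t powr (s - 1)) (at t)"
proof -
  consider "t > 0" | "t < 0" | "t = 0" by linarith
  then show ?thesis
  proof cases
    case 1
    have "((\<lambda>t. t powr s) has_real_derivative s * t powr (s - 1)) (at t)"
      using 1 by (rule has_real_derivative_powr)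
    then have "((\<lambda>t. max 0 t powr s) has_real_derivative s * t powr (s - 1)) (at t)"
      by (rule has_field_derivative_transform_within_open[where S = "{0<..}"]) (use 1 in auto)
    then show ?thesis using 1 by simp
  next
    case 2
    have "((\<lambda>t. 0) has_real_derivative 0) (at t)" by simp
    then have "((\<lambda>t. max 0 t powr s) has_real_derivative 0) (at t)"
      by (rule has_field_derivative_transform_within_open[where S = "{..<0}"]) (use 2 in \<open>auto simp: max_def\<close>)
    then show ?thesis using 2 by (simp add: max_def)
  next
    case 3
    have "((\<lambda>h::real. max 0 h powr s / h) \<longlongrightarrow> 0) (at 0)"
    proof (rule Lim_null_comparison)
      show "\<forall>\<^sub>F h::real in at 0. norm (max 0 h powr s / h) \<le> \<bar>h\<bar> powr (s - 1)"
      proof (intro always_eventually allI)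
        fix h :: real
        show "norm (max 0 h powr s / h) \<le> \<bar>h\<bar> powr (s - 1)"
          by (cases "h > 0") (auto simp: powr_diff not_less max_absorb1 max_absorb2 divide_nonneg_nonpos)
      qed
      have "((\<lambda>h::real. \<bar>h\<bar> powr (s - 1)) \<longlongrightarrow> \<bar>0\<bar> powr (s - 1)) (at 0)"
        by (intro tendsto_powr' tendsto_intros) (use s in auto)
      then show "((\<lambda>h::real. \<bar>h\<bar> powr (s - 1)) \<longlongrightarrow> 0) (at 0)" by simp
    qed
    then show ?thesis using 3 s by (simp add: has_field_derivative_iff)
  qed
qed

lemma eta_has_derivative:
  fixes x :: "'a::real_inner"
  assumes "s > 1"
  shows "(eta s has_derivative (\<lambda>v. - 2 * s * (x \<bullet> v) * eta (s - 1) x)) (at x)"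
proof -
  have 1: "((\<lambda>x::'a. 1 - (norm x)\<^sup>2) has_derivative (\<lambda>v. - 2 * (x \<bullet> v))) (at x)"
    unfolding power2_norm_eq_inner
    by (auto intro!: derivative_eq_intros simp: inner_commute)
  have "((\<lambda>x::'a. max 0 (1 - (norm x)\<^sup>2) powr s) has_derivative
      (\<lambda>v. s * max 0 (1 - (norm x)\<^sup>2) powr (s - 1) * (- 2 * (x \<bullet> v)))) (at x)"
    by (rule has_derivative_compose[where g = "\<lambda>t. max 0 t powr s", OF 1])
      (use max_powr_has_derivative[OF assms] in \<open>simp add: has_field_derivative_def\<close>)
  then show ?thesis by (simp add: eta_def[abs_def] mult_ac)
qed

lemma continuous_eta: "0 < s \<Longrightarrow> continuous_on S (eta s)"
  unfolding eta_def by (intro continuous_on_powr' continuous_intros) auto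

lemma integrable_eta_scaleR:
  fixes G :: "'a::euclidean_space \<Rightarrow> 'b::{banach, second_countable_topology}"
  assumes i: "integrable lborel (eta s :: 'a \<Rightarrow> real)" and c: "continuous_on (ball 0 1) G"
    and M: "\<And>x. norm x < 1 \<Longrightarrow> norm (G x) \<le> M"
  shows "integrable lborel (\<lambda>x. eta s x *\<^sub>R G x)"
proof (rule Bochner_Integration.integrable_bound[of _ "\<lambda>x. M * eta s x"])
  show "integrable lborel (\<lambda>x. M * eta s (x :: 'a))" using i by simp
  have "(\<lambda>x. eta s x *\<^sub>R (indicator (ball 0 1) x *\<^sub>R G x)) \<in> borel_measurable borel"
    using c by (intro borel_measurable_scaleR borel_measurable_continuous_on_indicator) auto
  also have "(\<lambda>x. eta s x *\<^sub>R (indicator (ball 0 1) x *\<^sub>R G x)) = (\<lambda>x. eta s x *\<^sub>R G x)"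
    by (auto simp: indicator_def fun_eq_iff dest: eta_nonzero)
  finally show "(\<lambda>x. eta s x *\<^sub>R G x) \<in> borel_measurable lborel" by simp
  show "AE x in lborel. norm (eta s x *\<^sub>R G x) \<le> norm (M * eta s x)"
  proof (intro AE_I2)
    fix x :: 'a
    show "norm (eta s x *\<^sub>R G x) \<le> norm (M * eta s x)"
    proof (cases "norm x < 1")
      case True
      then have "norm (G x) \<le> \<bar>M\<bar>" using M[OF True] by linarith
      from mult_left_mono[OF this eta_nonneg[of s x]] show ?thesis
        by (simp add: abs_mult mult.commute)
    qed (simp add: eta_outside)
  qed
qed

lemma integrable_eta:
  assumes "0 \<le> s"
  shows "integrable lborel (eta s :: 'a::euclidean_space \<Rightarrow> real)"
proof (rule Bochner_Integration.integrable_bound[of _ "indicator (cball 0 1)"])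
  show "integrable lborel (indicator (cball (0::'a) 1) :: 'a \<Rightarrow> real)"
    by (auto intro: emeasure_lborel_cball_finite)
  show "AE x in lborel. norm (eta s (x :: 'a)) \<le> norm (indicator (cball 0 1) x :: real)"
    using assms by (auto simp: indicator_def eta_outside eta_le_1)
qed simp

section \<open>Integration by parts on the ball\<close>

text \<open>Translation invariance makes the integral of every difference quotient vanish. The
  quotients are dominated by a bound of the derivative on a ball enlarged by \<open>norm v\<close>,
  since the steps \<open>t n\<close> are at most 1.\<close>

lemma integral_derivative_compact_support:
  fixes F :: "'a::euclidean_space \<Rightarrow> 'b::{banach, second_countable_topology}"
  assumes D: "\<And>x. (F has_derivative F' x) (at x)" and cont: "continuous_on UNIV (\<lambda>x. F' x v)"
    and zero: "\<And>x. norm x > R \<Longrightarrow> F x = 0"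
  shows "(\<integral>x. F' x v \<partial>lborel) = 0"
proof -
  have F_cont: "continuous_on UNIV F"
    using D by (meson continuous_at_imp_continuous_on has_derivative_continuous)
  have F'_zero: "F' x v = 0" if "norm x > R" for x
  proof -
    have op: "open {x::'a. norm x > R}" by (intro open_Collect_less continuous_intros)
    have "((\<lambda>x. 0) has_derivative (\<lambda>h. 0)) (at x)" by simp
    then have "(F has_derivative (\<lambda>h. 0)) (at x)"
      by (rule has_derivative_transform_within_open[OF _ op]) (use that zero in auto)
    then show ?thesis using has_derivative_unique[OF D[of x]] by metis
  qed
  have F_int: "integrable lborel F"
  proof -
    have "integrable lborel (\<lambda>x. indicator (cball 0 R) x *\<^sub>R F x)"
      by (intro borel_integrable_compact continuous_on_subset[OF F_cont]) auto
    also have "(\<lambda>x. indicator (cball 0 R) x *\<^sub>R F x) = F"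
      using zero by (auto simp: indicator_def fun_eq_iff not_le)
    finally show ?thesis .
  qed
  have "compact ((\<lambda>x. F' x v) ` cball 0 R)"
    by (intro compact_continuous_image continuous_on_subset[OF cont]) auto
  then obtain B where B: "\<And>x. x \<in> cball 0 R \<Longrightarrow> norm (F' x v) \<le> B" and B0: "B > 0"
    using compact_imp_bounded bounded_pos by (metis imageI)
  have B: "norm (F' x v) \<le> B" for x
    using B[of x] F'_zero[of x] B0 by (cases "norm x \<le> R") auto
  define t where "t n = 1 / real (Suc n)" for n
  have t: "0 < t n" "t n \<le> 1" for n by (auto simp: t_def)
  have t_lim: "t \<longlonglongrightarrow> 0"
    unfolding t_def by (rule LIMSEQ_Suc[where f = "\<lambda>m. 1 / real m"]) (simp add: lim_const_over_n)
  define g where "g n x = inverse (t n) *\<^sub>R (F (t n *\<^sub>R v + x) - F x)" for n x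
  have path: "((\<lambda>s. F (s *\<^sub>R v + x)) has_derivative (\<lambda>h. h *\<^sub>R F' (s *\<^sub>R v + x) v)) (at s)" for s x
  proof -
    have "((\<lambda>s. F (s *\<^sub>R v + x)) has_derivative (\<lambda>h. F' (s *\<^sub>R v + x) (h *\<^sub>R v))) (at s)"
      by (rule has_derivative_compose[where f = "\<lambda>s. s *\<^sub>R v + x" and g = F, OF _ D])
        (auto intro!: derivative_eq_intros)
    then show ?thesis using linear_cmul[OF has_derivative_linear[OF D]] by simp
  qed
  have int_g: "(\<integral>x. g n x \<partial>lborel) = 0" for n
  proof -
    have Fm: "F \<in> borel_measurable borel" using F_int by simp
    have F_int': "integrable lborel (\<lambda>x. F (t n *\<^sub>R v + x))"
      using F_int integrable_distr_eq[of "(+) (t n *\<^sub>R v)" lborel borel F] Fm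
      by (simp add: lborel_distr_plus)
    have "(\<integral>x. F (t n *\<^sub>R v + x) \<partial>lborel) = (\<integral>x. F x \<partial>distr lborel borel ((+) (t n *\<^sub>R v)))"
      by (rule integral_distr[symmetric]) (use Fm in auto)
    then show ?thesis
      unfolding g_def using F_int F_int' by (simp add: lborel_distr_plus)
  qed
  have "(\<lambda>n. \<integral>x. g n x \<partial>lborel) \<longlonglongrightarrow> (\<integral>x. F' x v \<partial>lborel)"
  proof (rule integral_dominated_convergence[where w = "\<lambda>x. indicator (cball 0 (R + norm v)) x *\<^sub>R B"])
    show "(\<lambda>x. F' x v) \<in> borel_measurable lborel"
      using borel_measurable_continuous_onI[OF cont] by simp
    show "g n \<in> borel_measurable lborel" for n
      using borel_measurable_continuous_onI[OF F_cont] unfolding g_def by measurable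
    show "integrable lborel (\<lambda>x::'a. indicator (cball 0 (R + norm v)) x *\<^sub>R B)"
      by (intro borel_integrable_compact) auto
    show "AE x in lborel. (\<lambda>n. g n x) \<longlonglongrightarrow> F' x v"
    proof (intro AE_I2)
      fix x
      have "((\<lambda>h. (F (h *\<^sub>R v + x) - F x - h *\<^sub>R F' x v) /\<^sub>R norm h) \<longlongrightarrow> 0) (at 0)"
        using path[of x 0] by (simp add: has_derivative_at has_derivative_def)
      then have "((\<lambda>h. norm ((1 / h) *\<^sub>R (F (h *\<^sub>R v + x) - F x) - F' x v)) \<longlongrightarrow> 0) (at 0)"
      proof (rule Lim_transform_eventually[OF tendsto_norm_zero])
        have "norm ((F (h *\<^sub>R v + x) - F x - h *\<^sub>R F' x v) /\<^sub>R norm h)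
            = norm ((1 / h) *\<^sub>R (F (h *\<^sub>R v + x) - F x) - F' x v)" if "h \<noteq> 0" for h
        proof -
          have "(1 / h) *\<^sub>R (F (h *\<^sub>R v + x) - F x) - F' x v
              = (1 / h) *\<^sub>R (F (h *\<^sub>R v + x) - F x - h *\<^sub>R F' x v)"
            using that by (simp add: scaleR_diff_right)
          then show ?thesis by (simp add: divide_inverse)
        qed
        then show "\<forall>\<^sub>F h in at 0. norm ((F (h *\<^sub>R v + x) - F x - h *\<^sub>R F' x v) /\<^sub>R norm h)
            = norm ((1 / h) *\<^sub>R (F (h *\<^sub>R v + x) - F x) - F' x v)"
          by (auto simp: eventually_at_filter)
      qed
      then have "((\<lambda>h. (1 / h) *\<^sub>R (F (h *\<^sub>R v + x) - F x)) \<longlongrightarrow> F' x v) (at 0)"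
        using LIM_zero_cancel tendsto_norm_zero_iff by blast
      then show "(\<lambda>n. g n x) \<longlonglongrightarrow> F' x v"
        unfolding g_def inverse_eq_divide
        by (rule filterlim_compose)
          (use t t_lim in \<open>auto simp: filterlim_at less_imp_neq[symmetric] intro!: always_eventually\<close>)
    qed
    show "AE x in lborel. norm (g n x) \<le> indicator (cball 0 (R + norm v)) x *\<^sub>R B" for n
    proof (intro AE_I2)
      fix x
      have tv: "norm (t n *\<^sub>R v) \<le> norm v" using t[of n] by (simp add: mult_left_le_one_le)
      show "norm (g n x) \<le> indicator (cball 0 (R + norm v)) x *\<^sub>R B"
      proof (cases "norm x \<le> R + norm v")
        case True
        have "norm (F (t n *\<^sub>R v + x) - F (0 *\<^sub>R v + x)) \<le> B * norm (t n - 0)"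
        proof (rule differentiable_bound[of UNIV])
          show "((\<lambda>s. F (s *\<^sub>R v + x)) has_derivative (\<lambda>h. h *\<^sub>R F' (s *\<^sub>R v + x) v)) (at s within UNIV)"
            for s using path by simp
          show "onorm (\<lambda>h. h *\<^sub>R F' (s *\<^sub>R v + x) v) \<le> B" for s
            by (rule onorm_bound) (use B B0 in \<open>auto simp: mult.commute[of B] intro!: mult_left_mono\<close>)
        qed auto
        then show ?thesis
          using True t[of n] by (simp add: g_def divide_simps mult.commute)
      next
        case False
        have "norm (t n *\<^sub>R v + x) \<ge> norm x - norm (t n *\<^sub>R v)"
          by (metis add.commute norm_diff_ineq)
        then have "norm (t n *\<^sub>R v + x) > R" using False tv by linarith
        moreover have "norm x > R" using False norm_ge_zero[of v] by linarith
        ultimately show ?thesis using False by (simp add: g_def zero)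
      qed
    qed
  qed
  then show ?thesis unfolding int_g by (rule LIMSEQ_unique[OF _ tendsto_const])
qed

lemma integrable_compact_support:
  fixes f :: "'a::euclidean_space \<Rightarrow> 'b::{banach, second_countable_topology}"
  assumes "continuous_on UNIV f" "\<And>x. norm x > R \<Longrightarrow> f x = 0"
  shows "integrable lborel f"
proof -
  have "integrable lborel (\<lambda>x. indicator (cball 0 R) x *\<^sub>R f x)"
    by (intro borel_integrable_compact continuous_on_subset[OF assms(1)]) auto
  also have "(\<lambda>x. indicator (cball 0 R) x *\<^sub>R f x) = f"
    using assms(2) by (auto simp: indicator_def fun_eq_iff not_le)
  finally show ?thesis .
qed

lemma continuous_on_cball_bounded:
  fixes G :: "'a::euclidean_space \<Rightarrow> 'b::real_normed_vector"
  assumes "continuous_on (cball 0 r) G"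
  obtains M where "M > 0" "\<And>x. norm x \<le> r \<Longrightarrow> norm (G x) \<le> M"
proof -
  have "compact (G ` cball 0 r)" using assms by (intro compact_continuous_image) auto
  then obtain M where "M > 0" "\<forall>y\<in>G ` cball 0 r. norm y \<le> M"
    using compact_imp_bounded bounded_pos by metis
  then show thesis using that by auto
qed

lemma integrable_eta_continuous:
  fixes G :: "'a::euclidean_space \<Rightarrow> 'b::{banach, second_countable_topology}"
  assumes "0 \<le> s" "continuous_on (cball 0 1) G"
  shows "integrable lborel (\<lambda>x. eta s x *\<^sub>R G x)"
proof -
  obtain M where "\<And>x. norm x \<le> 1 \<Longrightarrow> norm (G x) \<le> M"
    using continuous_on_cball_bounded[OF assms(2)] by blast
  then show ?thesis
    using assms(1) continuous_on_subset[OF assms(2)]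
    by (intro integrable_eta_scaleR[where M = M] integrable_eta) auto
qed

lemma hol_on_cball_continuous:
  "1 < R \<Longrightarrow> hol_on (ball 0 R) A \<Longrightarrow> continuous_on (cball 0 1) A"
  by (rule continuous_on_subset[OF hol_on_continuous_on]) auto

text \<open>Integration by parts with the Wirtinger derivative D_v - i D_(iv): it annihilates the
  conjugate of C, doubles the complex linear derivative of A, and turns the derivative of
  \<open>eta s\<close> into -2 s \<open>eta (s - 1) x\<close> times \<open>cin v x\<close>. For s >
  1 the product is continuously differentiable across the sphere.\<close>

lemma ibp_hol:
  fixes A C :: "complex ^ 'n \<Rightarrow> complex"
  assumes R: "1 < R" and A: "hol_on (ball 0 R) A" and C: "hol_on (ball 0 R) C" and s: "s > 1"
  shows "s *\<^sub>R (\<integral>x. eta (s - 1) x *\<^sub>R (A x * cnj (C x) * cin v x) \<partial>lborel)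
    = (\<integral>x. eta s x *\<^sub>R (dd A v x * cnj (C x)) \<partial>lborel)"
proof -
  define \<Psi> where "\<Psi> x = eta s x *\<^sub>R (A x * cnj (C x))" for x
  define \<Psi>' where "\<Psi>' x h = eta s x *\<^sub>R (A x * cnj (dd C h x) + dd A h x * cnj (C x))
      + (- 2 * s * (x \<bullet> h) * eta (s - 1) x) *\<^sub>R (A x * cnj (C x))" for x h
  have op: "open {x :: complex ^ 'n. norm x > 1}" by (intro open_Collect_less continuous_intros)
  have \<Psi>'_out: "\<Psi>' x h = 0" if "norm x > 1" for x h
    using that by (simp add: \<Psi>'_def eta_outside)
  have D: "(\<Psi> has_derivative \<Psi>' x) (at x)" for x
  proof (cases "norm x < R")
    case True
    have "((\<lambda>x. cnj (C x)) has_derivative (\<lambda>h. cnj (dd C h x))) (at x)"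
      using True by (intro bounded_linear.has_derivative[OF bounded_linear_cnj] hol_on_has_derivative[OF C]) auto
    moreover have "(A has_derivative (\<lambda>h. dd A h x)) (at x)"
      using True by (intro hol_on_has_derivative[OF A]) auto
    ultimately have "((\<lambda>x. eta s x *\<^sub>R (A x * cnj (C x))) has_derivative
       (\<lambda>h. eta s x *\<^sub>R (A x * cnj (dd C h x) + dd A h x * cnj (C x))
          + (- 2 * s * (x \<bullet> h) * eta (s - 1) x) *\<^sub>R (A x * cnj (C x)))) (at x)"
      by (intro has_derivative_scaleR eta_has_derivative[OF s] has_derivative_mult)
    then show ?thesis unfolding \<Psi>_def \<Psi>'_def .
  next
    case False
    then have x: "norm x > 1" using R by auto
    have "((\<lambda>x. 0) has_derivative (\<lambda>h. 0)) (at x)" by simp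
    then have "(\<Psi> has_derivative (\<lambda>h. 0)) (at x)"
      by (rule has_derivative_transform_within_open[OF _ op]) (use x in \<open>auto simp: \<Psi>_def eta_outside\<close>)
    moreover have "\<Psi>' x = (\<lambda>h. 0)" by (simp add: fun_eq_iff \<Psi>'_out[OF x])
    ultimately show ?thesis by simp
  qed
  have cont: "continuous_on UNIV (\<lambda>x. \<Psi>' x h)" for h
  proof -
    have "continuous_on (ball 0 R) (\<lambda>x. \<Psi>' x h)"
      unfolding \<Psi>'_def
      using hol_on_continuous_on[OF A] hol_on_continuous_on[OF C]
        hol_on_continuous_on[OF hol_on_dd[OF _ A]] hol_on_continuous_on[OF hol_on_dd[OF _ C]] s
      by (intro continuous_intros continuous_eta) auto
    moreover have "continuous_on {x. norm x > 1} (\<lambda>x. \<Psi>' x h)"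
      using \<Psi>'_out by (subst continuous_on_cong[OF refl, where g = "\<lambda>_. 0"]) auto
    ultimately have "continuous_on (ball 0 R \<union> {x. norm x > 1}) (\<lambda>x. \<Psi>' x h)"
      using op by (intro continuous_on_open_Un) auto
    also have "ball 0 R \<union> {x :: complex ^ 'n. norm x > 1} = UNIV" using R by auto
    finally show ?thesis .
  qed
  have int0: "(\<integral>x. \<Psi>' x h \<partial>lborel) = 0" for h
    by (rule integral_derivative_compact_support[OF D cont, of 1]) (simp add: \<Psi>_def eta_outside)
  have int: "integrable lborel (\<lambda>x. \<Psi>' x h)" for h
    by (rule integrable_compact_support[OF cont, of 1]) (rule \<Psi>'_out)
  define P where "P x = eta s x *\<^sub>R (dd A v x * cnj (C x))" for x
  define Q where "Q x = eta (s - 1) x *\<^sub>R (A x * cnj (C x) * cin v x)" for x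
  have intP: "integrable lborel P"
    unfolding P_def using s hol_on_cball_continuous[OF R C]
      hol_on_cball_continuous[OF R hol_on_dd[OF _ A]]
    by (intro integrable_eta_continuous continuous_intros) auto
  have intQ: "integrable lborel Q"
    unfolding Q_def using s hol_on_cball_continuous[OF R C] hol_on_cball_continuous[OF R A]
    by (intro integrable_eta_continuous continuous_intros cin.continuous_on) auto
  have cin_eq: "cin v x = of_real (x \<bullet> v) - \<i> * of_real (x \<bullet> (\<i> *s v))" for x
    using Re_cin[of v x] Re_cin[of "\<i> *s v" x]
    by (simp add: complex_eq_iff cin_scale_left inner_commute[of x])
  have comb: "\<Psi>' x v - \<i> * \<Psi>' x (\<i> *s v) = 2 * P x - (2 * s) *\<^sub>R Q x" for x
  proof (cases "norm x < 1")
    case True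
    then have x: "x \<in> ball 0 R" using R by auto
    show ?thesis
      unfolding \<Psi>'_def P_def Q_def cin_eq dd_cmul[OF A x] dd_cmul[OF C x]
      by (simp add: scaleR_conv_of_real scaleC_complex_def algebra_simps)
  qed (simp add: \<Psi>'_def P_def Q_def eta_outside)
  have "(\<integral>x. \<Psi>' x v - \<i> * \<Psi>' x (\<i> *s v) \<partial>lborel) = 0"
    using int int0 by simp
  then have "2 * (\<integral>x. P x \<partial>lborel) = (2 * s) *\<^sub>R (\<integral>x. Q x \<partial>lborel)"
    unfolding comb using intP intQ by simp
  then show ?thesis unfolding P_def Q_def by (simp add: scaleR_conv_of_real)
qed

text \<open>Integration by parts with the constant 1 as holomorphic factor, whose derivative
  vanishes, and G as the antiholomorphic one; conjugation then moves G to the holomorphic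
  side.\<close>

lemma eta_orthogonal:
  fixes G :: "complex ^ 'n \<Rightarrow> complex"
  assumes "1 < R" "hol_on (ball 0 R) G" "s > 0"
  shows "(\<integral>x. eta s x *\<^sub>R (G x * cin x w) \<partial>lborel) = 0"
proof -
  have dd0: "dd (\<lambda>_. 1 :: complex) w x = 0" for x :: "complex ^ 'n" by (rule dd_eq) simp
  have "(s + 1) *\<^sub>R (\<integral>x. eta s x *\<^sub>R (cnj (G x) * cin w x) \<partial>lborel) = 0"
    using ibp_hol[OF assms(1) hol_on_const[of _ 1] assms(2), of "s + 1" w] assms(3) by (simp add: dd0)
  then have "cnj (\<integral>x. eta s x *\<^sub>R (cnj (G x) * cin w x) \<partial>lborel) = 0" using assms(3) by simp
  also have "cnj (\<integral>x. eta s x *\<^sub>R (cnj (G x) * cin w x) \<partial>lborel)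
      = (\<integral>x. cnj (eta s x *\<^sub>R (cnj (G x) * cin w x)) \<partial>lborel)"
    by (rule Bochner_Integration.integral_cnj[symmetric])
  also have "\<dots> = (\<integral>x. eta s x *\<^sub>R (G x * cin x w) \<partial>lborel)"
    by (intro Bochner_Integration.integral_cong) (simp_all add: cnj_cin)
  finally show ?thesis .
qed

text \<open>The means \<open>m t\<close> of the dilates A(t x) do not depend on t: the derivative of
  m is the integral of dA at t x in direction x, and each coordinate of it vanishes by
  orthogonality. Comparing t = 1 with t = 0 gives the mean value.\<close>

lemma eta_mean_value:
  fixes A :: "complex ^ 'n \<Rightarrow> complex"
  assumes R: "1 < R" and A: "hol_on (ball 0 R) A" and s: "s > 0"
  shows "(\<integral>x. eta s x *\<^sub>R A x \<partial>lborel) = (\<integral>x. eta s (x :: complex ^ 'n) \<partial>lborel) *\<^sub>R A 0"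
proof -
  define V where "V = (\<integral>x. eta s (x :: complex ^ 'n) \<partial>lborel)"
  have inte: "integrable lborel (eta s :: complex ^ 'n \<Rightarrow> real)" using s by (intro integrable_eta) auto
  define m where "m t = (\<integral>x. eta s x *\<^sub>R A (t *\<^sub>R x) \<partial>lborel)" for t
  define \<rho> where "\<rho> = (R - 1) / 2"
  have \<rho>: "\<rho> > 0" "1 + \<rho> < R" using R by (auto simp: \<rho>_def field_simps)
  have "continuous_on (cball 0 (1 + \<rho>)) A"
    by (rule continuous_on_subset[OF hol_on_continuous_on[OF A]]) (use \<rho> in auto)
  from continuous_on_cball_bounded[OF this] obtain M
    where M: "M > 0" "\<And>x. norm x \<le> 1 + \<rho> \<Longrightarrow> cmod (A x) \<le> M" by blast
  have tx: "norm (t *\<^sub>R x) \<le> 1" if "t \<in> {0..1}" "norm x \<le> 1" for t :: real and x :: "complex ^ 'n"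
    using that mult_mono[of t 1 "norm x" 1] by auto
  have hol_t: "hol_on (ball 0 R) (\<lambda>x. G (t *\<^sub>R x))" if "t \<in> {0..1}" "hol_on (ball 0 R) G"
    for G :: "complex ^ 'n \<Rightarrow> complex" and t
  proof -
    have "t *\<^sub>R x + 0 \<in> ball 0 R" if "x \<in> ball 0 R" for x :: "complex ^ 'n"
      using that \<open>t \<in> {0..1}\<close> mult_right_mono[of t 1 "norm x"] by simp
    then show ?thesis
      using hol_on_affine(1)[OF that(2), where S = "ball 0 R" and r = t and a = 0] by auto
  qed
  have int_A: "integrable lborel (\<lambda>x. eta s x *\<^sub>R A (t *\<^sub>R x))" if "t \<in> {0..1}" for t
    using s hol_on_cball_continuous[OF R hol_t[OF that A]] by (intro integrable_eta_continuous) auto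
  have hdd: "hol_on (ball 0 R) (\<lambda>x. dd A w (t *\<^sub>R x))" if "t \<in> {0..1}" for t w
    using hol_t[OF that hol_on_dd[OF _ A]] by simp
  have sum_eq: "eta s x *\<^sub>R dd A x (t *\<^sub>R x)
      = (\<Sum>j\<in>UNIV. eta s x *\<^sub>R (dd A (axis j 1) (t *\<^sub>R x) * cin x (axis j 1)))" if "t \<in> {0..1}" for t x
  proof (cases "norm x < 1")
    case True
    then have "t *\<^sub>R x \<in> ball 0 R" using tx[OF that, of x] R by auto
    moreover have "cin x (axis j 1) = x $ j" for j
      by (simp add: cin_def axis_def if_distrib[of cnj] if_distrib[of "(*) _"] cong: if_cong)
    ultimately show ?thesis
      by (simp add: dd_sum_axis[OF A, of _ x, symmetric] scaleR_sum_right scaleC_complex_def mult.commute)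
  qed (simp add: eta_outside)
  have int_j: "integrable lborel (\<lambda>x. eta s x *\<^sub>R (dd A w (t *\<^sub>R x) * cin x w'))" if "t \<in> {0..1}" for t w w'
    using s hol_on_cball_continuous[OF R hdd[OF that]]
    by (intro integrable_eta_continuous continuous_intros cin.continuous_on) auto
  have int_dd: "integrable lborel (\<lambda>x. eta s x *\<^sub>R dd A x (t *\<^sub>R x))"
    and dd_0: "(\<integral>x. eta s x *\<^sub>R dd A x (t *\<^sub>R x) \<partial>lborel) = 0" if t: "t \<in> {0..1}" for t
    unfolding sum_eq[OF t] using int_j[OF t] eta_orthogonal[OF R hdd[OF t] s] by simp_all
  \<comment> \<open>Subtracting the vanishing first-order term leaves a Taylor remainder, so
    increments of m are quadratic and its derivative is 0, without differentiating under the
    integral.\<close>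
  have key: "norm (m t' - m t) \<le> V * (2 * M / \<rho>\<^sup>2) * (t' - t)\<^sup>2"
    if t: "t \<in> {0..1}" and t': "t' \<in> {0..1}" and d: "\<bar>t' - t\<bar> \<le> \<rho> / 2" for t t'
  proof (cases "t' = t")
    case False
    have "m t' - m t = (\<integral>x. eta s x *\<^sub>R A (t' *\<^sub>R x) - eta s x *\<^sub>R A (t *\<^sub>R x)
        - (t' - t) *\<^sub>R (eta s x *\<^sub>R dd A x (t *\<^sub>R x)) \<partial>lborel)"
      unfolding m_def using int_A[OF t] int_A[OF t'] int_dd[OF t] dd_0[OF t]
      by (simp del: scaleR_scaleR)
    also have "norm \<dots> \<le> (\<integral>x. eta s (x :: complex ^ 'n) * (2 * M / \<rho>\<^sup>2 * (t' - t)\<^sup>2) \<partial>lborel)"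
    proof (rule Bochner_Integration.integral_norm_bound_integral)
      fix x :: "complex ^ 'n"
      show "norm (eta s x *\<^sub>R A (t' *\<^sub>R x) - eta s x *\<^sub>R A (t *\<^sub>R x) - (t' - t) *\<^sub>R eta s x *\<^sub>R dd A x (t *\<^sub>R x))
          \<le> eta s x * (2 * M / \<rho>\<^sup>2 * (t' - t)\<^sup>2)"
      proof (cases "norm x < 1")
        case True
        have inR: "norm (t *\<^sub>R x + l *s ((t' - t) *\<^sub>R x)) \<le> 1 + \<rho>" if "cmod l \<le> \<rho> / \<bar>t' - t\<bar>" for l
        proof -
          have "norm (l *s ((t' - t) *\<^sub>R x)) = (cmod l * \<bar>t' - t\<bar>) * norm x"
            by (simp add: norm_vector_scalar_mult)
          also have "\<dots> \<le> \<rho> * 1"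
            using that False True \<rho> by (intro mult_mono) (auto simp: pos_le_divide_eq)
          finally show ?thesis
            using tx[OF t, of x] True norm_triangle_ineq[of "t *\<^sub>R x" "l *s ((t' - t) *\<^sub>R x)"] by linarith
        qed
        have txR: "t *\<^sub>R x \<in> ball 0 R" using inR[of 0] \<rho> False by (simp add: vsm.zero_left)
        have "norm (A (t *\<^sub>R x + (t' - t) *\<^sub>R x) - A (t *\<^sub>R x) - dd A ((t' - t) *\<^sub>R x) (t *\<^sub>R x))
            \<le> 2 * M / (\<rho> / \<bar>t' - t\<bar>)\<^sup>2"
        proof (rule cauchy_estimates(2)[OF A])
          show "0 < \<rho> / \<bar>t' - t\<bar>" using \<rho> False by simp
          show "2 \<le> \<rho> / \<bar>t' - t\<bar>" using False d by (simp add: pos_le_divide_eq)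
          fix l assume l: "cmod l \<le> \<rho> / \<bar>t' - t\<bar>"
          show "t *\<^sub>R x + l *s (t' - t) *\<^sub>R x \<in> ball 0 R" using inR[OF l] \<rho> by simp
          show "norm (A (t *\<^sub>R x + l *s (t' - t) *\<^sub>R x)) \<le> M" using inR[OF l] by (rule M)
        qed
        also have "t *\<^sub>R x + (t' - t) *\<^sub>R x = t' *\<^sub>R x" by (simp add: algebra_simps)
        also have "dd A ((t' - t) *\<^sub>R x) (t *\<^sub>R x) = (t' - t) *\<^sub>R dd A x (t *\<^sub>R x)"
          by (rule linear_cmul[OF dd_linear[OF A txR]])
        also have "2 * M / (\<rho> / \<bar>t' - t\<bar>)\<^sup>2 = 2 * M / \<rho>\<^sup>2 * (t' - t)\<^sup>2"
          by (simp add: power_divide)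
        finally have "eta s x * norm (A (t' *\<^sub>R x) - A (t *\<^sub>R x) - (t' - t) *\<^sub>R dd A x (t *\<^sub>R x))
            \<le> eta s x * (2 * M / \<rho>\<^sup>2 * (t' - t)\<^sup>2)" by (intro mult_left_mono) auto
        moreover have "eta s x *\<^sub>R A (t' *\<^sub>R x) - eta s x *\<^sub>R A (t *\<^sub>R x) - (t' - t) *\<^sub>R eta s x *\<^sub>R dd A x (t *\<^sub>R x)
            = eta s x *\<^sub>R (A (t' *\<^sub>R x) - A (t *\<^sub>R x) - (t' - t) *\<^sub>R dd A x (t *\<^sub>R x))"
          by (simp add: scaleR_diff_right)
        ultimately show ?thesis by simp
      qed (simp add: eta_outside)
    qed (use inte int_A[OF t] int_A[OF t'] int_dd[OF t] in \<open>auto simp del: scaleR_scaleR\<close>)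
    also have "\<dots> = V * (2 * M / \<rho>\<^sup>2) * (t' - t)\<^sup>2" by (simp add: V_def)
    finally show ?thesis .
  qed simp
  have "\<exists>c. \<forall>t\<in>{0..1}. m t = c"
  proof (rule has_derivative_zero_constant)
    fix t :: real assume t: "t \<in> {0..1}"
    show "(m has_derivative (\<lambda>h. 0)) (at t within {0..1})"
    proof (rule has_derivativeI_sandwich[of "\<rho> / 2"])
      fix y assume y: "y \<in> {0..1}" "y \<noteq> t" "dist y t < \<rho> / 2"
      show "norm (m y - m t - 0) / norm (y - t) \<le> V * (2 * M / \<rho>\<^sup>2) * \<bar>y - t\<bar>"
      proof -
        have "norm (m y - m t) \<le> (V * (2 * M / \<rho>\<^sup>2) * \<bar>y - t\<bar>) * \<bar>y - t\<bar>"
          using key[OF t y(1)] y by (simp add: dist_real_def power2_eq_square mult.assoc)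
        then show ?thesis using y by (simp add: pos_divide_le_eq)
      qed
    next
      have "((\<lambda>y. V * (2 * M / \<rho>\<^sup>2) * \<bar>y - t\<bar>) \<longlongrightarrow> V * (2 * M / \<rho>\<^sup>2) * \<bar>t - t\<bar>) (at t within {0..1})"
        by (intro tendsto_intros)
      then show "((\<lambda>y. V * (2 * M / \<rho>\<^sup>2) * \<bar>y - t\<bar>) \<longlongrightarrow> 0) (at t within {0..1})" by simp
    qed (use \<rho> in auto)
  qed auto
  then have "m 1 = m 0" by auto
  then show ?thesis using inte by (simp add: m_def)
qed

section \<open>The reproducing formula\<close>

text \<open>Total mass of the weight, with the dimension passed as a type. It is never evaluated:
  what enters is its positivity and the recursion in s.\<close>

definition eta_int :: "'n::finite itself \<Rightarrow> real \<Rightarrow> real"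
  where "eta_int t s = (\<integral>x. eta s (x :: complex ^ 'n) \<partial>lborel)"

lemma eta_mult: "eta s x * (1 - (norm x)\<^sup>2) = eta (s + 1) x"
proof (cases "norm x < 1")
  case True
  then show ?thesis
    using one_minus_norm_sq_pos[OF True] by (simp add: eta_inside powr_add)
qed (simp add: eta_outside)

text \<open>Integration by parts with A = x_j, C = 1 and v the j-th unit vector evaluates the
  integral of |x_j|^2 against \<open>eta s\<close>; summing over j uses |x|^2 = 1 - (1 -
  |x|^2).\<close>

lemma eta_int_recursion:
  assumes s: "s > 0"
  shows "(s + 1) * eta_int TYPE('n) s = (real CARD('n) + s + 1) * eta_int TYPE('n::finite) (s + 1)"
proof -
  have j: "(s + 1) * (\<integral>x. eta s (x :: complex ^ 'n) * (norm (x $ j))\<^sup>2 \<partial>lborel) = eta_int TYPE('n) (s + 1)" for j :: 'n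
  proof -
    have c: "cin (axis j 1) x = cnj (x $ j)" for x :: "complex ^ 'n"
      by (simp add: cin_def axis_def if_distrib[of "\<lambda>a. a * _"] cong: if_cong)
    have "(s + 1) *\<^sub>R (\<integral>x. eta s x *\<^sub>R (x $ j * cnj 1 * cin (axis j 1) x) \<partial>lborel)
        = (\<integral>x. eta (s + 1) x *\<^sub>R (dd (\<lambda>x. x $ j) (axis j 1) x * cnj 1) \<partial>(lborel :: (complex ^ 'n) measure))"
      using ibp_hol[of 2 "\<lambda>x::complex ^ 'n. x $ j" "\<lambda>_. 1" "s + 1" "axis j 1"] s
      by (simp add: hol_on_nth hol_on_const)
    then have "(s + 1) *\<^sub>R (\<integral>x. complex_of_real (eta s (x :: complex ^ 'n) * (norm (x $ j))\<^sup>2) \<partial>lborel)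
        = (\<integral>x. complex_of_real (eta (s + 1) (x :: complex ^ 'n)) \<partial>lborel)"
      by (simp add: c hol_on_nth scaleR_conv_of_real mult.assoc
          flip: complex_norm_square of_real_mult of_real_power)
    from arg_cong[OF this, of Re] show ?thesis
      by (simp add: integral_complex_of_real eta_int_def del: of_real_mult)
  qed
  have i: "integrable lborel (\<lambda>x :: complex ^ 'n. eta s x * (norm (x $ j))\<^sup>2)" for j
    using integrable_eta_continuous[of s "\<lambda>x :: complex ^ 'n. (norm (x $ j))\<^sup>2"] s
    by (simp add: continuous_intros)
  have "real CARD('n) * eta_int TYPE('n) (s + 1)
      = (\<Sum>j\<in>(UNIV :: 'n set). (s + 1) * (\<integral>x. eta s (x :: complex ^ 'n) * (norm (x $ j))\<^sup>2 \<partial>lborel))"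
    by (simp add: j)
  also have "\<dots> = (s + 1) * (\<integral>x. (\<Sum>j\<in>(UNIV :: 'n set). eta s (x :: complex ^ 'n) * (norm (x $ j))\<^sup>2) \<partial>lborel)"
    using i by (simp add: sum_distrib_left)
  also have "(\<lambda>x :: complex ^ 'n. \<Sum>j\<in>(UNIV :: 'n set). eta s x * (norm (x $ j))\<^sup>2) = (\<lambda>x. eta s x - eta (s + 1) x)"
  proof
    fix x :: "complex ^ 'n"
    have "(norm x)\<^sup>2 = (\<Sum>j\<in>UNIV. (norm (x $ j))\<^sup>2)"
      by (simp add: norm_vec_def L2_set_def sum_nonneg)
    then show "(\<Sum>j\<in>UNIV. eta s x * (norm (x $ j))\<^sup>2) = eta s x - eta (s + 1) x"
      using eta_mult[of s x] by (simp add: sum_distrib_left[symmetric] algebra_simps)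
  qed
  also have "(\<integral>x. eta s x - eta (s + 1) (x :: complex ^ 'n) \<partial>lborel) = eta_int TYPE('n) s - eta_int TYPE('n) (s + 1)"
    unfolding eta_int_def using s by (simp add: integrable_eta)
  finally show ?thesis by (simp add: algebra_simps)
qed

lemma eta_int_pos:
  assumes "integrable lborel (eta s :: complex ^ 'n \<Rightarrow> real)"
  shows "eta_int TYPE('n::finite) s > 0"
proof -
  have "eta_int TYPE('n) s \<ge> 0" unfolding eta_int_def by simp
  moreover have "eta_int TYPE('n) s \<noteq> 0"
  proof
    assume "eta_int TYPE('n) s = 0"
    then have "AE x in lborel. eta s (x :: complex ^ 'n) = 0"
      unfolding eta_int_def using integral_nonneg_eq_0_iff_AE[OF assms] by simp
    then have "AE x in lborel. x \<notin> ball (0 :: complex ^ 'n) 1"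
    proof eventually_elim
      case (elim x)
      then show ?case using one_minus_norm_sq_pos[of x] by (auto simp: eta_inside)
    qed
    then have "ball (0 :: complex ^ 'n) 1 \<in> null_sets lborel"
      using AE_iff_null_sets[of "ball (0 :: complex ^ 'n) 1" lborel] by simp
    then have "negligible (ball (0 :: complex ^ 'n) 1)"
      by (simp add: negligible_iff_null_sets null_sets_completionI)
    then show False using open_not_negligible[of "ball (0 :: complex ^ 'n) 1"] by simp
  qed
  ultimately show ?thesis by simp
qed

text \<open>Iterated recursion, in the form that later cancels the binomial coefficients of the
  kernel.\<close>

lemma eta_int_shift:
  assumes "s > 0"
  shows "eta_int TYPE('n::finite) (s + real j) * pochhammer (real CARD('n) + s + 1) j
    = eta_int TYPE('n) s * pochhammer (s + 1) j"
proof (induction j)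
  case (Suc j)
  have "(s + real j + 1) * eta_int TYPE('n) (s + real j)
      = (real CARD('n) + (s + real j) + 1) * eta_int TYPE('n) (s + real j + 1)"
    using eta_int_recursion[where 'n = 'n, of "s + real j"] assms by simp
  then have e: "eta_int TYPE('n) (s + real (Suc j)) * (real CARD('n) + s + 1 + real j)
      = eta_int TYPE('n) (s + real j) * (s + 1 + real j)"
    by (simp add: algebra_simps)
  have "eta_int TYPE('n) (s + real (Suc j)) * (real CARD('n) + s + 1 + real j) * pochhammer (real CARD('n) + s + 1) j
      = (eta_int TYPE('n) (s + real j) * pochhammer (real CARD('n) + s + 1) j) * (s + 1 + real j)"
    unfolding e by (simp only: mult_ac)
  also have "\<dots> = eta_int TYPE('n) s * pochhammer (s + 1) j * (s + 1 + real j)"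
    unfolding Suc.IH ..
  finally show ?case by (simp only: pochhammer_Suc mult_ac)
qed simp

abbreviation dir_deriv :: "complex ^ 'n \<Rightarrow> nat \<Rightarrow> (complex ^ 'n \<Rightarrow> complex) \<Rightarrow> complex ^ 'n \<Rightarrow> complex"
  where "dir_deriv z j \<equiv> (\<lambda>G. dd G z) ^^ j"

lemma hol_on_dir_deriv: "open S \<Longrightarrow> hol_on S A \<Longrightarrow> hol_on S (dir_deriv z j A)"
  by (induction j) (auto intro: hol_on_dd)

text \<open>Each integration by parts trades one factor \<open>cin z x\<close> for one derivative in
  direction z and raises the weight by 1; after j steps the mean value property applies.\<close>

lemma eta_moment:
  fixes A :: "complex ^ 'n \<Rightarrow> complex"
  assumes R: "1 < R" and "hol_on (ball 0 R) A" and "s > 0"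
  shows "(\<integral>x. eta s x *\<^sub>R (A x * cin z x ^ j) \<partial>lborel)
    = (eta_int TYPE('n) (s + real j) / pochhammer (s + 1) j) *\<^sub>R dir_deriv z j A 0"
  using assms(2,3)
proof (induction j arbitrary: s A)
  case 0
  then show ?case using eta_mean_value[OF R 0(1,2)] by (simp add: eta_int_def)
next
  case (Suc j)
  have pow: "hol_on (ball 0 R) (\<lambda>x. cin x z ^ j)"
    by (rule hol_on_compose(1)[where g = "\<lambda>t. t ^ j", OF hol_on_cin(1)])
      (auto intro!: derivative_eq_intros)
  have "(s + 1) *\<^sub>R (\<integral>x. eta s x *\<^sub>R (A x * cin z x ^ Suc j) \<partial>lborel)
      = (\<integral>x. eta (s + 1) x *\<^sub>R (dd A z x * cin z x ^ j) \<partial>lborel)"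
    using ibp_hol[OF R Suc.prems(1) pow, of "s + 1" z] Suc.prems(2)
    by (simp add: cnj_cin mult_ac)
  also have "\<dots> = (eta_int TYPE('n) (s + 1 + real j) / pochhammer (s + 1 + 1) j) *\<^sub>R dir_deriv z j (dd A z) 0"
    using Suc.prems by (intro Suc.IH hol_on_dd) auto
  also have "dir_deriv z j (dd A z) = dir_deriv z (Suc j) A"
    by (simp only: funpow_Suc_right o_def)
  finally have e: "(s + 1) *\<^sub>R (\<integral>x. eta s x *\<^sub>R (A x * cin z x ^ Suc j) \<partial>lborel)
      = (eta_int TYPE('n) (s + 1 + real j) / pochhammer (s + 1 + 1) j) *\<^sub>R dir_deriv z (Suc j) A 0" .
  have "(\<integral>x. eta s x *\<^sub>R (A x * cin z x ^ Suc j) \<partial>lborel)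
      = (1 / (s + 1)) *\<^sub>R ((s + 1) *\<^sub>R (\<integral>x. eta s x *\<^sub>R (A x * cin z x ^ Suc j) \<partial>lborel))"
    using Suc.prems(2) by simp
  then show ?case unfolding e by (simp add: pochhammer_rec add_ac del: funpow.simps)
qed

text \<open>Taylor series of the slice l \<mapsto> A(l z) at l = 1, which lies inside its disc of
  convergence because |z| \<le> 1 < R.\<close>

lemma dir_deriv_sums:
  fixes A :: "complex ^ 'n \<Rightarrow> complex"
  assumes R: "1 < R" and A: "hol_on (ball 0 R) A" and z: "norm z \<le> 1"
  shows "(\<lambda>j. dir_deriv z j A 0 / fact j) sums A z"
proof -
  define \<phi> where "\<phi> l = A (0 + l *s z)" for l :: complex
  have inR: "0 + l *s z \<in> ball 0 R" if "l \<in> ball 0 R" for l :: complex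
  proof -
    have "cmod l * norm z \<le> cmod l * 1" using z by (intro mult_left_mono) auto
    then show ?thesis using that by (simp add: norm_vector_scalar_mult)
  qed
  have d: "((\<lambda>l. dir_deriv z j A (0 + l *s z)) has_field_derivative dir_deriv z (Suc j) A (0 + l *s z)) (at l)"
    if "l \<in> ball 0 R" for j and l :: complex
    using slice_field_derivative[OF hol_on_dir_deriv[OF open_ball A, where z = z and j = j] inR[OF that]]
    unfolding funpow.simps o_def .
  have hol: "\<phi> holomorphic_on ball 0 R"
    unfolding holomorphic_on_def
  proof
    fix l :: complex assume l: "l \<in> ball 0 R"
    have "(\<phi> has_field_derivative dir_deriv z (Suc 0) A (0 + l *s z)) (at l)"
      using d[OF l, of 0] unfolding \<phi>_def funpow_0 .
    then show "\<phi> field_differentiable at l within ball 0 R"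
      using has_field_derivative_at_within field_differentiable_def by blast
  qed
  have D: "(deriv ^^ j) \<phi> l = dir_deriv z j A (0 + l *s z)" if "l \<in> ball 0 R" for j and l :: complex
    using that
  proof (induction j arbitrary: l)
    case (Suc j)
    have "((deriv ^^ j) \<phi> has_field_derivative dir_deriv z (Suc j) A (0 + l *s z)) (at l)"
      by (rule has_field_derivative_transform_within_open[OF d[OF Suc.prems] open_ball Suc.prems])
        (simp only: Suc.IH)
    then show ?case unfolding funpow.simps o_def by (rule DERIV_imp_deriv)
  qed (simp add: \<phi>_def)
  have centre: "0 \<in> ball (0 :: complex) R" using R by simp
  have "(\<lambda>j. (deriv ^^ j) \<phi> 0 / fact j * (1 - 0) ^ j) sums \<phi> 1"
    by (rule holomorphic_power_series[OF hol]) (use R in auto)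
  then show ?thesis
    unfolding D[OF centre] by (simp add: \<phi>_def vsm.zero_left del: funpow.simps)
qed

text \<open>Principal branch: for Re \<zeta> < 1 the base 1 - \<zeta> lies in the right half plane,
  away from the cut.\<close>

definition bker :: "real \<Rightarrow> complex \<Rightarrow> complex"
  where "bker c \<zeta> = (1 - \<zeta>) powr (- of_real c)"

lemma norm_bker: "cmod (bker c \<zeta>) = cmod (1 - \<zeta>) powr (- c)"
  unfolding bker_def by (subst norm_powr_real_powr') auto

lemma bker_sums:
  assumes "cmod \<zeta> < 1"
  shows "(\<lambda>j. of_real (pochhammer c j / fact j) * \<zeta> ^ j) sums bker c \<zeta>"
proof -
  have "(\<lambda>j. ((- of_real c) gchoose j) * (- \<zeta>) ^ j) sums (1 + - \<zeta>) powr (- of_real c)"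
    by (rule gen_binomial_complex) (use assms in simp)
  moreover have "((- of_real c) gchoose j) * (- \<zeta>) ^ j = of_real (pochhammer c j / fact j) * \<zeta> ^ j" for j
  proof -
    have "((- 1) ^ j * (- 1) ^ j :: complex) = 1" by (simp flip: power_mult_distrib)
    then show ?thesis
      by (simp add: gbinomial_pochhammer power_minus[of \<zeta>] pochhammer_of_real)
  qed
  ultimately show ?thesis by (simp add: bker_def)
qed

lemma summable_bker_coeffs:
  fixes r c :: real
  assumes "0 \<le> r" "r < 1"
  shows "summable (\<lambda>j. (pochhammer c j / fact j) * r ^ j)"
proof -
  have "summable (\<lambda>j. complex_of_real ((pochhammer c j / fact j) * r ^ j))"
    using sums_summable[OF bker_sums[of "of_real r" c]] assms by simp
  then show ?thesis by (simp only: summable_complex_of_real)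
qed

text \<open>Termwise integration of the binomial series. The exponent n + s + 1 is the one for which
  the j-th coefficient times the moment constant reduces to \<open>eta_int\<close> / j!, leaving the
  Taylor series of A at z. Convergence is absolute because |cin z x| \<le> |z| < 1.\<close>

lemma reproducing_closed_ball:
  fixes A :: "complex ^ 'n \<Rightarrow> complex"
  assumes R: "1 < R" and A: "hol_on (ball 0 R) A" and s: "s > 0" and z: "norm z < 1"
  shows "(\<integral>x. eta s x *\<^sub>R (A x * bker (real CARD('n) + s + 1) (cin z x)) \<partial>lborel)
    = eta_int TYPE('n) s *\<^sub>R A z"
proof -
  define c where "c = real CARD('n) + s + 1"
  define b where "b j = pochhammer c j / fact j" for j
  have c: "c > 0" using s by (simp add: c_def add_pos_pos)
  have b: "b j \<ge> 0" for j using c by (simp add: b_def pochhammer_nonneg)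
  obtain M where M: "M > 0" "\<And>x. norm x \<le> 1 \<Longrightarrow> cmod (A x) \<le> M"
    using continuous_on_cball_bounded[OF hol_on_cball_continuous[OF R A]] by blast
  define f where "f j x = eta s x *\<^sub>R (A x * (of_real (b j) * cin z x ^ j))" for j x
  have cin1: "cmod (cin z x) \<le> norm z" if "norm x < 1" for x :: "complex ^ 'n"
    using norm_cin_le[of z x] mult_left_mono[of "norm x" 1 "norm z"] that by simp
  have int: "integrable lborel (f j)" for j
    unfolding f_def using s hol_on_cball_continuous[OF R A]
    by (intro integrable_eta_continuous continuous_intros cin.continuous_on) auto
  have bound: "norm (f j x) \<le> eta s x * (M * (b j * norm z ^ j))" for j x
  proof (cases "norm x < 1")
    case True
    have "cmod (A x) * (b j * cmod (cin z x) ^ j) \<le> M * (b j * norm z ^ j)"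
      using b M(2)[of x] True M(1) cin1[OF True] by (intro mult_mono mult_nonneg_nonneg power_mono) auto
    from mult_left_mono[OF this eta_nonneg[of s x]] show ?thesis
      using b by (simp add: f_def norm_mult norm_power)
  qed (simp add: f_def eta_outside)
  have sb: "summable (\<lambda>j. b j * norm z ^ j)"
    unfolding b_def using z by (intro summable_bker_coeffs) auto
  have pt: "f j x = 0" if "\<not> norm x < 1" for j x using that by (simp add: f_def eta_outside)
  have sums_pt: "(\<lambda>j. f j x) sums (eta s x *\<^sub>R (A x * bker c (cin z x)))" for x
  proof (cases "norm x < 1")
    case True
    then have "cmod (cin z x) < 1" using cin1[OF True] z by linarith
    then show ?thesis
      unfolding f_def b_def using sums_scaleR_right[OF sums_mult[OF bker_sums]] by blast
  qed (simp add: f_def eta_outside)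
  have sum: "(\<lambda>j. eta_int TYPE('n) s *\<^sub>R (dir_deriv z j A 0 / fact j)) sums (eta_int TYPE('n) s *\<^sub>R A z)"
    by (rule sums_scaleR_right[OF dir_deriv_sums[OF R A]]) (use z in simp)
  have "(\<lambda>j. \<integral>x. f j x \<partial>lborel) sums (\<integral>x. (\<Sum>j. f j x) \<partial>lborel)"
  proof (rule sums_integral[OF int])
    show "AE x in lborel. summable (\<lambda>j. norm (f j x))"
    proof (intro AE_I2)
      fix x
      show "summable (\<lambda>j. norm (f j x))"
        by (rule summable_comparison_test'[of "\<lambda>j. eta s x * (M * (b j * norm z ^ j))" 0])
          (simp_all only: real_norm_def abs_norm_cancel bound summable_mult sb)
    qed
    show "summable (\<lambda>j. \<integral>x. norm (f j x) \<partial>lborel)"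
    proof (rule summable_comparison_test'[of "\<lambda>j. eta_int TYPE('n) s * (M * (b j * norm z ^ j))" 0])
      show "summable (\<lambda>j. eta_int TYPE('n) s * (M * (b j * norm z ^ j)))"
        by (rule summable_mult[OF summable_mult[OF sb]])
      fix j
      have "(\<integral>x. norm (f j x) \<partial>lborel) \<le> (\<integral>x. eta s x * (M * (b j * norm z ^ j)) \<partial>(lborel :: (complex ^ 'n) measure))"
        using int bound s by (intro Bochner_Integration.integral_mono) (auto intro: integrable_eta)
      then show "norm (\<integral>x. norm (f j x) \<partial>lborel) \<le> eta_int TYPE('n) s * (M * (b j * norm z ^ j))"
        by (simp add: eta_int_def)
    qed
  qed
  moreover have "(\<Sum>j. f j x) = eta s x *\<^sub>R (A x * bker c (cin z x))" for x
    using sums_pt by (simp add: sums_iff)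
  moreover have "(\<integral>x. f j x \<partial>lborel) = eta_int TYPE('n) s *\<^sub>R (dir_deriv z j A 0 / fact j)" for j
  proof -
    have ne: "pochhammer (s + 1) j \<noteq> 0" "pochhammer c j \<noteq> 0"
      using pochhammer_pos[of "s + 1" j] pochhammer_pos[of c j] s c by auto
    have "(\<integral>x. f j x \<partial>lborel) = (\<integral>x. of_real (b j) * (eta s x *\<^sub>R (A x * cin z x ^ j)) \<partial>lborel)"
      unfolding f_def by (intro Bochner_Integration.integral_cong) (auto simp: scaleR_conv_of_real mult_ac)
    also have "\<dots> = of_real (b j) * (\<integral>x. eta s x *\<^sub>R (A x * cin z x ^ j) \<partial>lborel)"
      by (rule Bochner_Integration.integral_mult_right_zero)
    also have "\<dots> = of_real (b j * eta_int TYPE('n) (s + real j) / pochhammer (s + 1) j) * dir_deriv z j A 0"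
      unfolding eta_moment[OF R A s] by (simp add: scaleR_conv_of_real)
    also have "b j * eta_int TYPE('n) (s + real j) / pochhammer (s + 1) j = eta_int TYPE('n) s / fact j"
      using eta_int_shift[where 'n = 'n, OF s, of j] ne unfolding c_def[symmetric] b_def
      by (simp add: field_simps)
    finally show ?thesis by (simp add: scaleR_conv_of_real)
  qed
  ultimately have "(\<lambda>j. eta_int TYPE('n) s *\<^sub>R (dir_deriv z j A 0 / fact j))
      sums (\<integral>x. eta s x *\<^sub>R (A x * bker c (cin z x)) \<partial>lborel)" by (simp only:)
  from sums_unique2[OF this sum] show ?thesis unfolding c_def .
qed

section \<open>Forelli--Rudin estimates\<close>

abbreviation dist1 :: "complex ^ 'n \<Rightarrow> complex ^ 'n \<Rightarrow> real"
  where "dist1 x w \<equiv> cmod (1 - cin x w)"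

lemma dist1_commute: "dist1 x w = dist1 w x"
  using complex_mod_cnj[of "1 - cin x w"] by (simp add: cnj_cin)

lemma dist1_ge: "norm x \<le> 1 \<Longrightarrow> 1 - norm w \<le> dist1 x w"
  using norm_cin_le[of x w] norm_triangle_ineq2[of 1 "cin x w"] mult_right_mono[of "norm x" 1 "norm w"]
  by simp

lemma half_le_one_minus_norm: "norm w \<le> 1 \<Longrightarrow> (1 - (norm w)\<^sup>2) / 2 \<le> 1 - norm w"
  using zero_le_power2[of "1 - norm w"] by (simp add: power2_eq_square field_simps)

lemma dist1_ge': "norm x \<le> 1 \<Longrightarrow> norm w \<le> 1 \<Longrightarrow> (1 - (norm w)\<^sup>2) / 2 \<le> dist1 x w"
  using dist1_ge[of x w] half_le_one_minus_norm[of w] by simp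

lemma dist1_pos: "norm x \<le> 1 \<Longrightarrow> norm w < 1 \<Longrightarrow> 0 < dist1 x w"
  using dist1_ge[of x w] by linarith

lemma dist1_le: "norm x \<le> 1 \<Longrightarrow> norm w \<le> 1 \<Longrightarrow> dist1 x w \<le> 2"
  using norm_cin_le[of x w] norm_triangle_ineq4[of 1 "cin x w"] mult_mono[of "norm x" 1 "norm w" 1]
  by simp

lemma Re_cin_less: "norm x * norm w < 1 \<Longrightarrow> Re (cin x w) < 1"
  using complex_Re_le_cmod[of "cin x w"] norm_cin_le[of x w] by linarith

lemma cnj_bker: "Re \<zeta> < 1 \<Longrightarrow> cnj (bker c \<zeta>) = bker c (cnj \<zeta>)"
  by (simp add: bker_def cnj_powr)

lemma bker_field_derivative:
  assumes "Re \<zeta> < 1"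
  shows "(bker c has_field_derivative of_real c * bker (c + 1) \<zeta>) (at \<zeta>)"
proof -
  have "1 - \<zeta> \<notin> \<real>\<^sub>\<le>\<^sub>0"
    using assms by (auto simp: complex_nonpos_Reals_iff)
  then have "((\<lambda>z. z powr (- of_real c)) has_field_derivative
      (- of_real c * (1 - \<zeta>) powr (- of_real c - 1))) (at (1 - \<zeta>))"
    by (rule has_field_derivative_powr)
  then have "((\<lambda>\<zeta>. (1 - \<zeta>) powr (- of_real c)) has_field_derivative
      (- of_real c * (1 - \<zeta>) powr (- of_real c - 1)) * (0 - 1)) (at \<zeta>)"
    by (rule DERIV_chain2) (auto intro!: derivative_eq_intros)
  then show ?thesis by (simp add: bker_def[abs_def])
qed

lemma hol_on_bker:
  assumes "\<And>x. x \<in> S \<Longrightarrow> norm x * norm w < 1"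
  shows "hol_on S (\<lambda>x. bker c (cin x w))"
  by (rule hol_on_compose(1)[OF hol_on_cin(1) bker_field_derivative]) (use assms Re_cin_less in auto)

lemma bker_of_real:
  assumes "r \<le> 1"
  shows "bker c (of_real r) = of_real ((1 - r) powr (- c))"
proof -
  have "1 - complex_of_real r = of_real (1 - r)" "- complex_of_real c = of_real (- c)" by simp_all
  then show ?thesis using assms unfolding bker_def by (simp only: powr_of_real)
qed

lemma divide_powr_minus:
  fixes u b k :: real
  assumes "0 < u" "0 < b"
  shows "(u / b) powr (- k) = b powr k * u powr (- k)"
  using assms by (simp add: powr_divide powr_minus field_simps)

text \<open>Room for a kernel to be holomorphic beyond the closed ball: any radius between 1 and
  1/|w| would do, and 2 / (1 + |w|) also covers w = 0.\<close>

lemma larger_ball: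
  fixes w :: "complex ^ 'n"
  assumes "norm w < 1"
  obtains R where "1 < R" "\<And>x :: complex ^ 'n. x \<in> ball 0 R \<Longrightarrow> norm x * norm w < 1"
proof
  let ?R = "2 / (1 + norm w)"
  show "1 < ?R" using assms by (simp add: field_simps add_pos_nonneg)
  fix x :: "complex ^ 'n" assume x: "x \<in> ball 0 ?R"
  show "norm x * norm w < 1"
  proof (cases "norm w = 0")
    case False
    then have "norm x * norm w < ?R * norm w" using x by (intro mult_strict_right_mono) auto
    also have "\<dots> \<le> 1" using assms by (simp add: field_simps add_pos_nonneg)
    finally show ?thesis .
  qed simp
qed

text \<open>Valued in \<open>ennreal\<close>, so that no integrability has to be known before the
  estimates.\<close>

definition fr_int :: "real \<Rightarrow> real \<Rightarrow> complex ^ 'n \<Rightarrow> ennreal"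
  where "fr_int a q w = (\<integral>\<^sup>+x. ennreal (eta a x * dist1 x w powr (- q)) \<partial>lborel)"

lemma measurable_cin [measurable (raw)]:
  assumes "f \<in> borel_measurable M" "g \<in> borel_measurable M"
  shows "(\<lambda>x. cin (f x) (g x :: complex ^ 'n)) \<in> borel_measurable M"
proof -
  have "(\<lambda>p :: (complex ^ 'n) \<times> (complex ^ 'n). cin (fst p) (snd p)) \<in> borel_measurable borel"
    by (intro borel_measurable_continuous_onI cin.continuous_on continuous_intros)
  from measurable_compose[OF borel_measurable_Pair[OF assms] this] show ?thesis by simp
qed

text \<open>At this exponent the integrand is the kernel times its conjugate, so the reproducing
  formula applied to the kernel itself evaluates the integral exactly, as the kernel at (w,
  w).\<close>

lemma fr_int_start:
  fixes w :: "complex ^ 'n"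
  assumes a: "a > 0" and w: "norm w < 1"
  shows "fr_int a (2 * (real CARD('n) + a + 1)) w
    = ennreal (eta_int TYPE('n) a * (1 - (norm w)\<^sup>2) powr (- (real CARD('n) + a + 1)))"
proof -
  define c where "c = real CARD('n) + a + 1"
  obtain R where R: "1 < R" "\<And>x :: complex ^ 'n. x \<in> ball 0 R \<Longrightarrow> norm x * norm w < 1"
    using larger_ball[OF w] by blast
  have A: "hol_on (ball 0 R) (\<lambda>x. bker c (cin x w))" by (rule hol_on_bker[OF R(2)])
  have rep: "(\<integral>x. eta a x *\<^sub>R (bker c (cin x w) * bker c (cin w x)) \<partial>lborel)
      = eta_int TYPE('n) a *\<^sub>R bker c (cin w w)"
    using reproducing_closed_ball[OF R(1) A a w] by (simp add: c_def)
  have pt: "eta a x *\<^sub>R (bker c (cin x w) * bker c (cin w x))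
      = complex_of_real (eta a x * dist1 x w powr (- (2 * c)))" for x
  proof (cases "norm x < 1")
    case True
    have "bker c (cin w x) = cnj (bker c (cin x w))"
      using True w R by (subst cnj_bker) (auto simp: cnj_cin intro!: Re_cin_less)
    then have "bker c (cin x w) * bker c (cin w x) = of_real ((cmod (bker c (cin x w)))\<^sup>2)"
      by (simp only: complex_norm_square)
    also have "(cmod (bker c (cin x w)))\<^sup>2 = dist1 x w powr (- (2 * c))"
      by (simp add: norm_bker power2_eq_square flip: powr_add)
    finally show ?thesis by (simp add: scaleR_conv_of_real)
  qed (simp add: eta_outside)
  have ww: "bker c (cin w w) = of_real ((1 - (norm w)\<^sup>2) powr (- c))"
    unfolding cin_self by (rule bker_of_real) (use one_minus_norm_sq_pos[OF w] in simp)
  have "integrable lborel (\<lambda>x. eta a x *\<^sub>R (bker c (cin x w) * bker c (cin w x)))"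
  proof (rule integrable_eta_continuous)
    have "continuous_on (cball 0 1) (\<lambda>x. bker c (cin w x))"
    proof (rule continuous_on_eq)
      show "continuous_on (cball 0 1) (\<lambda>x. cnj (bker c (cin x w)))"
        by (intro continuous_intros hol_on_cball_continuous[OF R(1) A])
      show "cnj (bker c (cin x w)) = bker c (cin w x)" if "x \<in> cball 0 1" for x
        using that R by (subst cnj_bker) (auto simp: cnj_cin intro!: Re_cin_less)
    qed
    then show "continuous_on (cball 0 1) (\<lambda>x. bker c (cin x w) * bker c (cin w x))"
      by (intro continuous_intros hol_on_cball_continuous[OF R(1) A])
  qed (use a in simp)
  then have i: "integrable lborel (\<lambda>x. eta a x * dist1 x w powr (- (2 * c)))"
    unfolding pt by (simp only: complex_of_real_integrable_eq)
  have "complex_of_real (\<integral>x. eta a x * dist1 x w powr (- (2 * c)) \<partial>lborel)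
      = of_real (eta_int TYPE('n) a * (1 - (norm w)\<^sup>2) powr (- c))"
    using rep unfolding pt ww by (simp only: integral_complex_of_real) (simp add: scaleR_conv_of_real)
  then have "(\<integral>x. eta a x * dist1 x w powr (- (2 * c)) \<partial>lborel) = eta_int TYPE('n) a * (1 - (norm w)\<^sup>2) powr (- c)"
    by (simp only: of_real_eq_iff)
  then show ?thesis
    unfolding fr_int_def c_def[symmetric] using i by (subst nn_integral_eq_integral) auto
qed

text \<open>The power of the distance beyond 2 (n + 1 + a) is estimated pointwise by dist1 \<ge> (1
  - |w|^2)/2, which loses only a constant; the rest is the exact value of
  \<open>fr_int_start\<close>.\<close>

lemma fr_int_large:
  fixes w :: "complex ^ 'n"
  assumes a: "a > 0" and w: "norm w < 1" and t: "t \<ge> real CARD('n) + 1 + a"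
  shows "fr_int a (real CARD('n) + 1 + a + t) w
    \<le> ennreal (eta_int TYPE('n) a * 2 powr (t - (real CARD('n) + 1 + a)) * (1 - (norm w)\<^sup>2) powr (- t))"
proof -
  define c where "c = real CARD('n) + 1 + a"
  define u where "u = 1 - (norm w)\<^sup>2"
  have u: "u > 0" using one_minus_norm_sq_pos[OF w] by (simp add: u_def)
  have "fr_int a (c + t) w \<le> (\<integral>\<^sup>+x. ennreal ((u / 2) powr (- (t - c))) * ennreal (eta a x * dist1 x w powr (- (2 * c))) \<partial>lborel)"
    unfolding fr_int_def
  proof (intro nn_integral_mono)
    fix x
    show "ennreal (eta a x * dist1 x w powr (- (c + t)))
      \<le> ennreal ((u / 2) powr (- (t - c))) * ennreal (eta a x * dist1 x w powr (- (2 * c)))"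
    proof (cases "norm x < 1")
      case True
      have d: "u / 2 \<le> dist1 x w" "0 < dist1 x w"
        using dist1_ge'[of x w] dist1_pos[of x w] True w by (auto simp: u_def)
      have "dist1 x w powr (- (c + t)) = dist1 x w powr (- (t - c)) * dist1 x w powr (- (2 * c))"
        by (simp flip: powr_add)
      also have "\<dots> \<le> (u / 2) powr (- (t - c)) * dist1 x w powr (- (2 * c))"
        using t d u by (intro mult_right_mono powr_mono2') (auto simp: c_def)
      finally have "eta a x * dist1 x w powr (- (c + t))
          \<le> (u / 2) powr (- (t - c)) * (eta a x * dist1 x w powr (- (2 * c)))"
        by (subst mult.left_commute) (rule mult_left_mono, simp_all)
      then show ?thesis by (simp flip: ennreal_mult)
    qed (simp add: eta_outside)
  qed
  also have "\<dots> = ennreal ((u / 2) powr (- (t - c))) * fr_int a (2 * c) w"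
    by (subst nn_integral_cmult) (auto simp: fr_int_def)
  also have "fr_int a (2 * c) w = ennreal (eta_int TYPE('n) a * u powr (- c))"
    using fr_int_start[OF a w] by (simp add: c_def u_def add_ac)
  also have "ennreal ((u / 2) powr (- (t - c))) * \<dots>
      = ennreal ((u / 2) powr (- (t - c)) * (eta_int TYPE('n) a * u powr (- c)))"
    by (rule ennreal_mult'[symmetric]) simp
  also have "(u / 2) powr (- (t - c)) * (eta_int TYPE('n) a * u powr (- c))
      = eta_int TYPE('n) a * 2 powr (t - c) * u powr (- t)"
  proof -
    have "(u / 2) powr (- (t - c)) = u powr (- (t - c)) * 2 powr (t - c)"
      using divide_powr_minus[OF u, of 2 "t - c"] by (simp only: mult.commute)
    moreover have "u powr (- (t - c)) * u powr (- c) = u powr (- t)" by (simp flip: powr_add)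
    moreover have "(u powr (- (t - c)) * 2 powr (t - c)) * (E * u powr (- c))
        = E * 2 powr (t - c) * (u powr (- (t - c)) * u powr (- c))" for E by (simp only: mult_ac)
    ultimately show ?thesis by (simp only:)
  qed
  finally show ?thesis unfolding c_def u_def .
qed

text \<open>The exponent \<open>t\<close> is lowered to \<open>t + m\<close> by comparing the distance with that to the points
  \<open>(1 - 2\<^sup>-\<^sup>j) w\<close>, which is never much larger and for one dyadic scale is also not much smaller than
  \<open>2\<^sup>-\<^sup>j\<close>.\<close>

lemma dyadic_kernel_bound:
  fixes \<zeta> :: complex and q m :: real
  assumes \<zeta>: "cmod \<zeta> \<le> 1" and J: "(1 / 2) ^ J \<le> cmod (1 - \<zeta>)" and q: "0 \<le> q" and m: "0 \<le> m"
  shows "cmod (1 - \<zeta>) powr (- q) \<le> 2 powr (q + 2 * m) *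
    (\<Sum>j\<le>J. ((1 / 2) ^ j) powr m * cmod (1 - of_real (1 - (1 / 2) ^ j) * \<zeta>) powr (- (q + m)))"
proof -
  define \<delta> where "\<delta> = cmod (1 - \<zeta>)"
  have \<delta>: "0 < \<delta>" using J less_le_trans[of 0 "(1 / 2) ^ J" \<delta>] by (simp add: \<delta>_def)
  have \<delta>2: "\<delta> \<le> 2" using \<zeta> norm_triangle_ineq4[of 1 \<zeta>] by (simp add: \<delta>_def)
  have "\<exists>j\<le>J. (1 / 2) ^ j \<le> \<delta> \<and> \<delta> \<le> 2 * (1 / 2) ^ j"
  proof (cases "1 \<le> \<delta>")
    case True
    then show ?thesis using \<delta>2 by (intro exI[of _ 0]) simp
  next
    case False
    \<comment> \<open>First dyadic scale not above \<delta>; minimality makes \<delta> less than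
      twice this scale.\<close>
    define j where "j = (LEAST j. (1 / 2 :: real) ^ j \<le> \<delta>)"
    have 1: "(1 / 2) ^ j \<le> \<delta>" unfolding j_def by (rule LeastI[of _ J]) (use J \<delta>_def in simp)
    have 2: "j \<le> J" unfolding j_def by (rule Least_le) (use J \<delta>_def in simp)
    have "j \<noteq> 0" using 1 False by (intro notI) simp
    then obtain i where i: "j = Suc i" using not0_implies_Suc by blast
    have "\<not> (1 / 2) ^ i \<le> \<delta>"
      using not_less_Least[of i "\<lambda>j. (1 / 2 :: real) ^ j \<le> \<delta>"] i unfolding j_def by simp
    with 1 2 i show ?thesis by (intro exI[of _ j]) simp
  qed
  then obtain j where j: "j \<le> J" "(1 / 2) ^ j \<le> \<delta>" "\<delta> \<le> 2 * (1 / 2) ^ j" by blast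
  define d where "d i = cmod (1 - of_real (1 - (1 / 2) ^ i) * \<zeta>)" for i
  have "1 - of_real (1 - (1 / 2) ^ j) * \<zeta> = (1 - \<zeta>) + of_real ((1 / 2) ^ j) * \<zeta>"
    by (simp add: algebra_simps)
  then have "d j \<le> \<delta> + cmod (of_real ((1 / 2) ^ j) * \<zeta>)"
    unfolding d_def \<delta>_def by (simp only: norm_triangle_ineq)
  also have "cmod (of_real ((1 / 2) ^ j) * \<zeta>) \<le> (1 / 2) ^ j"
    using \<zeta> mult_left_mono[of "cmod \<zeta>" 1 "(1 / 2) ^ j"] by (simp add: norm_mult norm_power norm_divide)
  finally have dj: "d j \<le> 2 * \<delta>" using j by simp
  have d0: "0 < d j"
  proof -
    define X where "X = of_real (1 - (1 / 2) ^ j) * \<zeta>"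
    have "cmod X \<le> 1 - (1 / 2) ^ j"
      using \<zeta> mult_left_mono[of "cmod \<zeta>" 1 "1 - (1 / 2) ^ j"] power_le_one[of "1 / 2 :: real" j]
      by (simp add: X_def norm_mult del: of_real_diff)
    moreover have "(0 :: real) < (1 / 2) ^ j" by simp
    moreover have "1 - cmod X \<le> cmod (1 - X)" using norm_triangle_ineq2[of 1 X] by simp
    ultimately have "0 < cmod (1 - X)" by linarith
    then show ?thesis by (simp only: d_def X_def)
  qed
  \<comment> \<open>Split so that \<delta>/2 \<le> 2^(-j) and \<open>d j \<le> 2 * \<delta>\<close>
    can be inserted; the two factors of 2 cost 2^m and 2^(q+m).\<close>
  have "\<delta> powr (- q) = (2 powr (q + 2 * m)) * ((\<delta> / 2) powr m * (2 * \<delta>) powr (- (q + m)))"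
  proof -
    have "(\<delta> / 2) powr m * (2 * \<delta>) powr (- (q + m))
        = (\<delta> powr m * \<delta> powr (- (q + m))) * (2 powr (- m) * 2 powr (- (q + m)))"
      using \<delta> by (simp add: powr_divide powr_mult powr_minus field_simps)
    also have "\<dots> = \<delta> powr (m + - (q + m)) * 2 powr (- m + - (q + m))" by (simp only: powr_add)
    also have "m + - (q + m) = - q" by simp
    also have "- m + - (q + m) = - (q + 2 * m)" by simp
    finally have e: "(\<delta> / 2) powr m * (2 * \<delta>) powr (- (q + m)) = \<delta> powr (- q) * 2 powr (- (q + 2 * m))" .
    have "2 powr (q + 2 * m) * 2 powr (- (q + 2 * m)) = (1::real)" by (simp only: flip: powr_add) simp
    then show ?thesis unfolding e by (simp only: mult.left_commute[of "2 powr (q + 2 * m)"] mult_1_right)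
  qed
  also have "(\<delta> / 2) powr m * (2 * \<delta>) powr (- (q + m)) \<le> ((1 / 2) ^ j) powr m * d j powr (- (q + m))"
    using j \<delta> dj d0 q m by (intro mult_mono powr_mono2 powr_mono2') auto
  also have "\<dots> \<le> (\<Sum>i\<le>J. ((1 / 2) ^ i) powr m * d i powr (- (q + m)))"
    using j by (intro member_le_sum) auto
  finally show ?thesis unfolding d_def \<delta>_def by simp
qed

text \<open>Each dyadic term has exponent t + m, large enough for \<open>fr_int_large\<close>, and
  contributes about 2^(j t). As t > 0, the geometric sum is governed by its last term j = J, where
  2^(-J) is comparable to 1 - |w|.\<close>

lemma fr_int_pos:
  assumes a: "a > 0" and t: "t > 0"
  obtains C where "C > 0" "\<And>w :: complex ^ 'n. norm w < 1 \<Longrightarrow>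
    fr_int a (real CARD('n) + 1 + a + t) w \<le> ennreal (C * (1 - (norm w)\<^sup>2) powr (- t))"
proof -
  \<comment> \<open>The least shift that makes t + m admissible in \<open>fr_int_large\<close> for
    every t > 0.\<close>
  define m where "m = real CARD('n) + 1 + a"
  define q where "q = real CARD('n) + 1 + a + t"
  define K where "K = eta_int TYPE('n) a * 2 powr t"
  have K: "K > 0" using a eta_int_pos[where 'n = 'n, OF integrable_eta, of a] by (simp add: K_def)
  have m: "m > 0" and q: "q > 0" using a t by (auto simp: m_def q_def add_pos_pos)
  define G where "G = 2 powr t / (2 powr t - 1)"
  have t2: "2 powr t > (1::real)" using t by simp
  have G: "G > 0" using t2 by (simp add: G_def)
  \<comment> \<open>The factor \<open>4 powr t\<close> comes from 2^(-J) \<ge> (1 - |w|)/2 \<ge> (1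
    - |w|^2)/4, the factor G from the geometric sum.\<close>
  define C where "C = 2 powr (q + 2 * m) * K * G * 4 powr t"
  show thesis
  proof (rule that[of C])
    show "C > 0" using K G by (simp add: C_def)
    fix w :: "complex ^ 'n" assume w: "norm w < 1"
    define \<rho> where "\<rho> = 1 - norm w"
    have \<rho>: "0 < \<rho>" "\<rho> \<le> 1" using w by (auto simp: \<rho>_def)
    \<comment> \<open>The distance to w never falls below 1 - |w|, so no scale beyond J
      occurs.\<close>
    define J where "J = (LEAST j. (1 / 2 :: real) ^ j \<le> \<rho>)"
    have ex: "\<exists>j. (1 / 2 :: real) ^ j \<le> \<rho>"
      using real_arch_pow_inv[of \<rho> "1 / 2"] \<rho> by (auto intro: less_imp_le)
    have J1: "(1 / 2) ^ J \<le> \<rho>" unfolding J_def using ex by (rule LeastI_ex)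
    have J2: "\<rho> / 2 \<le> (1 / 2) ^ J"
    proof (cases J)
      case 0
      then show ?thesis using \<rho> by simp
    next
      case (Suc i)
      have "\<not> (1 / 2) ^ i \<le> \<rho>"
        using not_less_Least[of i "\<lambda>j. (1 / 2 :: real) ^ j \<le> \<rho>"] Suc unfolding J_def by simp
      then show ?thesis using Suc by simp
    qed
    define r where "r j = 1 - (1 / 2 :: real) ^ j" for j
    have r: "0 \<le> r j" "r j \<le> 1" for j
      using power_le_one[of "1 / 2 :: real" j] by (auto simp: r_def)
    have rw: "norm (r j *\<^sub>R w) < 1" for j
      using r[of j] w mult_right_mono[of "r j" 1 "norm w"] by simp
    have "fr_int a q w \<le> (\<integral>\<^sup>+x. (\<Sum>j\<le>J. ennreal (2 powr (q + 2 * m) * ((1 / 2) ^ j) powr m) *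
        ennreal (eta a x * dist1 x (r j *\<^sub>R w) powr (- (q + m)))) \<partial>lborel)"
      unfolding fr_int_def
    proof (intro nn_integral_mono)
      fix x :: "complex ^ 'n"
      show "ennreal (eta a x * dist1 x w powr (- q)) \<le> (\<Sum>j\<le>J. ennreal (2 powr (q + 2 * m) * ((1 / 2) ^ j) powr m) *
        ennreal (eta a x * dist1 x (r j *\<^sub>R w) powr (- (q + m))))"
      proof (cases "norm x < 1")
        case True
        have c1: "cmod (cin x w) \<le> 1"
          using norm_cin_le[of x w] mult_mono[of "norm x" 1 "norm w" 1] True w by simp
        have "dist1 x w powr (- q) \<le> 2 powr (q + 2 * m) *
          (\<Sum>j\<le>J. ((1 / 2) ^ j) powr m * dist1 x (r j *\<^sub>R w) powr (- (q + m)))"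
          using dyadic_kernel_bound[OF c1, of J q m] J1 dist1_ge[of x w] True q m
          unfolding r_def[symmetric] by (simp add: \<rho>_def cin_scaleR_right scaleR_conv_of_real[where 'a = complex])
        from mult_left_mono[OF this eta_nonneg[of a x]]
        have "eta a x * dist1 x w powr (- q) \<le> (\<Sum>j\<le>J. (2 powr (q + 2 * m) * ((1 / 2) ^ j) powr m) *
          (eta a x * dist1 x (r j *\<^sub>R w) powr (- (q + m))))"
          by (simp add: sum_distrib_left mult_ac)
        then have "ennreal (eta a x * dist1 x w powr (- q)) \<le> ennreal (\<Sum>j\<le>J. (2 powr (q + 2 * m) * ((1 / 2) ^ j) powr m) *
          (eta a x * dist1 x (r j *\<^sub>R w) powr (- (q + m))))" by (rule ennreal_leI)
        also have "\<dots> = (\<Sum>j\<le>J. ennreal ((2 powr (q + 2 * m) * ((1 / 2) ^ j) powr m) *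
          (eta a x * dist1 x (r j *\<^sub>R w) powr (- (q + m)))))"
          by (rule sum_ennreal[symmetric]) simp
        also have "\<dots> = (\<Sum>j\<le>J. ennreal (2 powr (q + 2 * m) * ((1 / 2) ^ j) powr m) *
          ennreal (eta a x * dist1 x (r j *\<^sub>R w) powr (- (q + m))))"
          by (intro sum.cong refl ennreal_mult) auto
        finally show ?thesis .
      qed (simp add: eta_outside)
    qed
    also have "\<dots> = (\<Sum>j\<le>J. ennreal (2 powr (q + 2 * m) * ((1 / 2) ^ j) powr m) * fr_int a (q + m) (r j *\<^sub>R w))"
      unfolding fr_int_def by (subst nn_integral_sum) (auto simp: nn_integral_cmult)
    also have "\<dots> \<le> (\<Sum>j\<le>J. ennreal (2 powr (q + 2 * m) * K * (2 powr t) ^ j))"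
    proof (intro sum_mono)
      fix j
      have u: "(1 / 2) ^ j \<le> 1 - (norm (r j *\<^sub>R w))\<^sup>2"
      proof -
        have "(norm (r j *\<^sub>R w))\<^sup>2 \<le> norm (r j *\<^sub>R w)"
          using rw[of j] by (simp add: power2_eq_square mult_left_le_one_le)
        also have "norm (r j *\<^sub>R w) \<le> r j" using r[of j] w by (simp add: mult_left_le)
        finally show ?thesis by (simp add: r_def)
      qed
      have e: "q + m = real CARD('n) + 1 + a + (t + m)" by (simp add: q_def)
      have "fr_int a (q + m) (r j *\<^sub>R w) \<le> ennreal (K * (1 - (norm (r j *\<^sub>R w))\<^sup>2) powr (- (t + m)))"
        using fr_int_large[OF a rw[of j], of "t + m"] t unfolding e by (simp add: K_def m_def)
      also have "\<dots> \<le> ennreal (K * ((1 / 2) ^ j) powr (- (t + m)))"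
        using u K t m by (intro ennreal_leI mult_left_mono powr_mono2') auto
      finally have "ennreal (2 powr (q + 2 * m) * ((1 / 2) ^ j) powr m) * fr_int a (q + m) (r j *\<^sub>R w)
          \<le> ennreal (2 powr (q + 2 * m) * ((1 / 2) ^ j) powr m) * ennreal (K * ((1 / 2) ^ j) powr (- (t + m)))"
        by (intro mult_left_mono) auto
      also have "\<dots> = ennreal (2 powr (q + 2 * m) * K * (((1 / 2) ^ j) powr m * ((1 / 2) ^ j) powr (- (t + m))))"
        using K by (subst ennreal_mult'[symmetric]) (auto simp: mult_ac)
      also have "((1 / 2 :: real) ^ j) powr m * ((1 / 2) ^ j) powr (- (t + m)) = (2 powr t) ^ j"
      proof -
        have "((1 / 2 :: real) ^ j) powr m * ((1 / 2) ^ j) powr (- (t + m)) = ((1 / 2) ^ j) powr (- t)"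
          by (simp flip: powr_add)
        also have "\<dots> = (2 powr t) ^ j"
          by (simp add: powr_minus powr_power power_one_over powr_divide flip: powr_realpow)
            (simp add: powr_powr mult.commute)
        finally show ?thesis .
      qed
      finally show "ennreal (2 powr (q + 2 * m) * ((1 / 2) ^ j) powr m) * fr_int a (q + m) (r j *\<^sub>R w)
          \<le> ennreal (2 powr (q + 2 * m) * K * (2 powr t) ^ j)" .
    qed
    also have "\<dots> = ennreal (\<Sum>j\<le>J. 2 powr (q + 2 * m) * K * (2 powr t) ^ j)"
      using K by (intro sum_ennreal) auto
    also have "\<dots> \<le> ennreal (C * (1 - (norm w)\<^sup>2) powr (- t))"
    proof (rule ennreal_leI)
      have "(\<Sum>j\<le>J. (2 powr t) ^ j) = ((2 powr t) ^ Suc J - 1) / (2 powr t - 1)"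
        using t2 by (subst geometric_sum[symmetric]) (auto simp: lessThan_Suc_atMost)
      also have "\<dots> \<le> (2 powr t) ^ Suc J / (2 powr t - 1)" using t2 by (intro divide_right_mono) auto
      also have "\<dots> = G * (2 powr t) ^ J" by (simp add: G_def)
      also have "(2 powr t) ^ J = ((1 / 2) ^ J) powr (- t)"
        by (simp add: powr_minus powr_power power_one_over powr_divide flip: powr_realpow)
          (simp add: powr_powr mult.commute)
      also have "\<dots> \<le> ((1 - (norm w)\<^sup>2) / 4) powr (- t)"
        using J2 half_le_one_minus_norm[of w] w t one_minus_norm_sq_pos[OF w]
        by (intro powr_mono2') (auto simp: \<rho>_def)
      also have "\<dots> = 4 powr t * (1 - (norm w)\<^sup>2) powr (- t)"
        using one_minus_norm_sq_pos[OF w] by (intro divide_powr_minus) auto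
      finally have "(\<Sum>j\<le>J. (2 powr t) ^ j) \<le> G * (4 powr t * (1 - (norm w)\<^sup>2) powr (- t))"
        using G by simp
      then have "2 powr (q + 2 * m) * K * (\<Sum>j\<le>J. (2 powr t) ^ j)
          \<le> 2 powr (q + 2 * m) * K * (G * (4 powr t * (1 - (norm w)\<^sup>2) powr (- t)))"
        using K by (intro mult_left_mono) auto
      then show "(\<Sum>j\<le>J. 2 powr (q + 2 * m) * K * (2 powr t) ^ j) \<le> C * (1 - (norm w)\<^sup>2) powr (- t)"
        unfolding sum_distrib_left[symmetric] by (simp add: C_def mult_ac)
    qed
    finally show "fr_int a (real CARD('n) + 1 + a + t) w \<le> ennreal (C * (1 - (norm w)\<^sup>2) powr (- t))"
      by (simp add: q_def)
  qed
qed

text \<open>The divergence theorem for the vector field \<open>x h(1 - |x|\<^sup>2) \<Phi>(x)\<close>.\<close>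

lemma radial_divergence:
  fixes \<Phi> :: "'a::euclidean_space \<Rightarrow> real"
  assumes R: "1 < R" and \<Phi>: "\<And>x. norm x < R \<Longrightarrow> (\<Phi> has_derivative \<Phi>' x) (at x)"
    and \<Phi>'_cont: "\<And>v. continuous_on (ball 0 R) (\<lambda>x. \<Phi>' x v)"
    and h: "\<And>t. (h has_real_derivative h' t) (at t)" and h'_cont: "continuous_on UNIV h'"
    and h0: "\<And>t. t \<le> 0 \<Longrightarrow> h t = 0" and h'0: "\<And>t. t \<le> 0 \<Longrightarrow> h' t = 0"
  shows "(\<integral>x. 2 * (norm x)\<^sup>2 * h' (1 - (norm x)\<^sup>2) * \<Phi> x \<partial>lborel)
    = (\<integral>x. h (1 - (norm x)\<^sup>2) * (real DIM('a) * \<Phi> x + \<Phi>' x x) \<partial>lborel)"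
    and "integrable lborel (\<lambda>x. 2 * (norm x)\<^sup>2 * h' (1 - (norm x)\<^sup>2) * \<Phi> x)"
    and "integrable lborel (\<lambda>x. h (1 - (norm x)\<^sup>2) * (real DIM('a) * \<Phi> x + \<Phi>' x x))"
proof -
  define F where "F b x = (x \<bullet> b) * (h (1 - (norm x)\<^sup>2) * \<Phi> x)" for b x
  define F' where "F' b x v = (x \<bullet> b) * (h (1 - (norm x)\<^sup>2) * \<Phi>' x v + (- 2 * (x \<bullet> v) * h' (1 - (norm x)\<^sup>2)) * \<Phi> x)
      + (v \<bullet> b) * (h (1 - (norm x)\<^sup>2) * \<Phi> x)" for b x v
  have out: "1 - (norm x)\<^sup>2 \<le> 0" if "1 \<le> norm x" for x :: 'a
    using one_le_power[OF that, of 2] by simp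
  have op: "open {x :: 'a. norm x > 1}" by (intro open_Collect_less continuous_intros)
  have F'_out: "F' b x v = 0" if "1 \<le> norm x" for b x v
    using out[OF that] by (simp add: F'_def h0 h'0)
  have h_cont: "continuous_on UNIV h"
    using h by (intro continuous_at_imp_continuous_on) (auto intro: DERIV_isCont)
  have \<Phi>_cont: "continuous_on (ball 0 R) \<Phi>"
    using \<Phi> by (intro continuous_at_imp_continuous_on) (auto intro!: has_derivative_continuous[OF \<Phi>])
  have extend: "continuous_on UNIV G" if "continuous_on (ball 0 R) G" "\<And>x. 1 \<le> norm x \<Longrightarrow> G x = 0"
    for G :: "'a \<Rightarrow> real"
  proof -
    have "continuous_on {x. norm x > 1} G"
      by (rule continuous_on_eq[of _ "\<lambda>_. 0"]) (use that(2) in auto)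
    then have "continuous_on (ball 0 R \<union> {x. norm x > 1}) G"
      using op that(1) by (intro continuous_on_open_Un) auto
    also have "ball 0 R \<union> {x :: 'a. norm x > 1} = UNIV" using R by auto
    finally show ?thesis .
  qed
  have D: "(F b has_derivative F' b x) (at x)" for b x
  proof (cases "norm x < R")
    case True
    have "((\<lambda>x::'a. 1 - (norm x)\<^sup>2) has_derivative (\<lambda>v. - 2 * (x \<bullet> v))) (at x)"
      unfolding power2_norm_eq_inner by (auto intro!: derivative_eq_intros simp: inner_commute)
    then have "((\<lambda>x. h (1 - (norm x)\<^sup>2)) has_derivative (\<lambda>v. h' (1 - (norm x)\<^sup>2) * (- 2 * (x \<bullet> v)))) (at x)"
      by (rule has_derivative_compose[where g = h]) (use h in \<open>simp add: has_field_derivative_def\<close>)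
    then have hd: "((\<lambda>x. h (1 - (norm x)\<^sup>2)) has_derivative (\<lambda>v. - 2 * (x \<bullet> v) * h' (1 - (norm x)\<^sup>2))) (at x)"
      by (simp add: mult_ac)
    have "((\<lambda>x. (x \<bullet> b) * (h (1 - (norm x)\<^sup>2) * \<Phi> x)) has_derivative
      (\<lambda>v. (x \<bullet> b) * (h (1 - (norm x)\<^sup>2) * \<Phi>' x v + (- 2 * (x \<bullet> v) * h' (1 - (norm x)\<^sup>2)) * \<Phi> x)
      + (v \<bullet> b) * (h (1 - (norm x)\<^sup>2) * \<Phi> x))) (at x)"
      by (intro has_derivative_mult hd \<Phi>[OF True]) (auto intro!: derivative_eq_intros)
    then show ?thesis unfolding F_def F'_def .
  next
    case False
    then have x: "norm x > 1" using R by auto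
    have "((\<lambda>x. 0) has_derivative (\<lambda>h. 0)) (at x)" by simp
    then have "(F b has_derivative (\<lambda>h. 0)) (at x)"
      by (rule has_derivative_transform_within_open[OF _ op]) (use x out in \<open>auto simp: F_def h0\<close>)
    moreover have "F' b x = (\<lambda>h. 0)" using x by (simp add: fun_eq_iff F'_out)
    ultimately show ?thesis by simp
  qed
  note cont = continuous_on_compose2[OF h_cont] continuous_on_compose2[OF h'_cont]
  have F'_cont: "continuous_on UNIV (\<lambda>x. F' b x v)" for b v
  proof (rule extend[OF _ F'_out])
    show "continuous_on (ball 0 R) (\<lambda>x. F' b x v)"
      unfolding F'_def by (intro continuous_intros cont \<Phi>_cont \<Phi>'_cont) auto
  qed
  have zero: "(\<integral>x. F' b x v \<partial>lborel) = 0" for b v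
    by (rule integral_derivative_compact_support[OF D F'_cont, of 1]) (use out in \<open>simp add: F_def h0\<close>)
  have int: "integrable lborel (\<lambda>x. F' b x v)" for b v
    by (rule integrable_compact_support[OF F'_cont, of 1]) (simp add: F'_out)
  define P where "P x = 2 * (norm x)\<^sup>2 * h' (1 - (norm x)\<^sup>2) * \<Phi> x" for x
  define Q where "Q x = h (1 - (norm x)\<^sup>2) * (real DIM('a) * \<Phi> x + \<Phi>' x x)" for x
  have intP: "integrable lborel P"
  proof (rule integrable_compact_support[where R = 1])
    show "continuous_on UNIV P"
    proof (rule extend)
      show "continuous_on (ball 0 R) P"
        unfolding P_def by (intro continuous_intros cont \<Phi>_cont) auto
    qed (use out in \<open>simp add: P_def h'0\<close>)
  qed (use out in \<open>simp add: P_def h'0\<close>)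
  have \<Phi>'_sum: "\<Phi>' x x = (\<Sum>b\<in>Basis. (x \<bullet> b) * \<Phi>' x b)" if "norm x < R" for x
  proof -
    have l: "linear (\<Phi>' x)" using \<Phi>[OF that] by (rule has_derivative_linear)
    have "\<Phi>' x (\<Sum>b\<in>Basis. (x \<bullet> b) *\<^sub>R b) = (\<Sum>b\<in>Basis. \<Phi>' x ((x \<bullet> b) *\<^sub>R b))"
      by (rule linear_sum[OF l])
    then show ?thesis by (simp add: linear_cmul[OF l] euclidean_representation)
  qed
  have sum_eq: "(\<Sum>b\<in>Basis. F' b x b) = Q x - P x" for x
  proof (cases "norm x < 1")
    case True
    have "(\<Sum>b\<in>Basis. F' b x b) = h (1 - (norm x)\<^sup>2) * (\<Sum>b\<in>Basis. (x \<bullet> b) * \<Phi>' x b)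
        - 2 * h' (1 - (norm x)\<^sup>2) * \<Phi> x * (\<Sum>b\<in>Basis. (x \<bullet> b)\<^sup>2)
        + (\<Sum>b\<in>(Basis :: 'a set). h (1 - (norm x)\<^sup>2) * \<Phi> x)"
      by (simp add: F'_def sum.distrib sum_distrib_left sum_subtractf algebra_simps power2_eq_square
          inner_Basis cong: sum.cong)
    also have "(\<Sum>b\<in>Basis. (x \<bullet> b)\<^sup>2) = (norm x)\<^sup>2"
    proof -
      have "(norm x)\<^sup>2 = (\<Sum>b\<in>Basis. (x \<bullet> b) * (x \<bullet> b))"
        unfolding power2_norm_eq_inner by (rule euclidean_inner)
      then show ?thesis by (simp only: power2_eq_square)
    qed
    also have "(\<Sum>b\<in>Basis. (x \<bullet> b) * \<Phi>' x b) = \<Phi>' x x" using True R by (simp add: \<Phi>'_sum)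
    finally show ?thesis by (simp add: P_def Q_def algebra_simps)
  next
    case False
    then show ?thesis using out[of x] by (simp add: F'_out P_def Q_def h0 h'0)
  qed
  have i: "integrable lborel (\<lambda>x. Q x - P x)"
    unfolding sum_eq[symmetric] using int by simp
  then show intQ: "integrable lborel (\<lambda>x. h (1 - (norm x)\<^sup>2) * (real DIM('a) * \<Phi> x + \<Phi>' x x))"
    using Bochner_Integration.integrable_add[OF i intP] by (simp add: Q_def[abs_def])
  have "(\<integral>x. Q x - P x \<partial>lborel) = 0"
    unfolding sum_eq[symmetric] using int zero by simp
  then show "(\<integral>x. 2 * (norm x)\<^sup>2 * h' (1 - (norm x)\<^sup>2) * \<Phi> x \<partial>lborel)
    = (\<integral>x. h (1 - (norm x)\<^sup>2) * (real DIM('a) * \<Phi> x + \<Phi>' x x) \<partial>lborel)"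
    using intP intQ by (simp add: P_def[abs_def] Q_def[abs_def])
  show "integrable lborel (\<lambda>x. 2 * (norm x)\<^sup>2 * h' (1 - (norm x)\<^sup>2) * \<Phi> x)"
    using intP by (simp add: P_def[abs_def])
qed

lemma dist1_powr_has_derivative:
  fixes x w :: "complex ^ 'n"
  assumes "norm x * norm w < 1"
  shows "((\<lambda>x. dist1 x w powr (- q)) has_derivative
    (\<lambda>v. q * dist1 x w powr (- q - 2) * ((1 - cin x w) \<bullet> cin v w))) (at x)"
proof -
  have pos: "0 < (1 - cin x w) \<bullet> (1 - cin x w)"
    using Re_cin_less[OF assms] by auto
  have 1: "((\<lambda>x. (1 - cin x w) \<bullet> (1 - cin x w)) has_derivative (\<lambda>v. - 2 * ((1 - cin x w) \<bullet> cin v w))) (at x)"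
    by (auto intro!: derivative_eq_intros bounded_linear_imp_has_derivative cin.bounded_linear_left
        bounded_linear.has_derivative[OF cin.bounded_linear_left] simp: inner_commute inner_diff_right algebra_simps)
  note 2 = has_real_derivative_powr[OF pos, of "- q / 2", unfolded has_field_derivative_def]
  have e: "((1 - cin y w) \<bullet> (1 - cin y w)) powr r = dist1 y w powr (2 * r)" for y r
    unfolding dot_square_norm powr_powr[symmetric] by simp
  have r: "2 * (- q / 2) = - q" "2 * (- q / 2 - 1) = - q - 2" by simp_all
  show ?thesis
    using has_derivative_compose[OF 1 2] unfolding e r
    by (rule has_derivative_eq_rhs) (simp add: fun_eq_iff)
qed


lemma square_powr_half: "0 \<le> t \<Longrightarrow> (t\<^sup>2) powr (b / 2) = t powr b" for t b :: real
  using powr_powr[of t 2 "b / 2"] by simp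

text \<open>Regularisation of max(0,t)^(a+1), whose derivative is unbounded or jumps at 0 for -1 < a
  \<le> 0. For e > 0 the function \<open>h\<close> is continuously differentiable and stays below
  its limit, while for t > 0 its derivative \<open>h'\<close> tends to (a + 1) t^a as e tends to
  0.\<close>

lemma h_eps_properties:
  fixes a e :: real
  assumes a: "- 1 < a" "a \<le> 0" and e: "0 < e"
  defines "h \<equiv> \<lambda>t. (max 0 t)\<^sup>2 * (t\<^sup>2 + e) powr ((a - 1) / 2)"
    and "h' \<equiv> \<lambda>t. 2 * max 0 t * (t\<^sup>2 + e) powr ((a - 3) / 2) * ((a + 1) / 2 * t\<^sup>2 + e)"
  shows "(h has_real_derivative h' t) (at t)" "continuous_on UNIV h'"
    "t \<le> 0 \<Longrightarrow> h t = 0" "t \<le> 0 \<Longrightarrow> h' t = 0" "0 \<le> h t" "0 \<le> h' t" "h t \<le> max 0 t powr (a + 1)"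
proof -
  have pos: "0 < t\<^sup>2 + e" for t :: real using e by (simp add: add_nonneg_pos)
  have m: "(\<lambda>t. max 0 t powr 2) = (\<lambda>t::real. (max 0 t)\<^sup>2)" by (auto simp: fun_eq_iff)
  have 1: "((\<lambda>t. (max 0 t)\<^sup>2) has_real_derivative 2 * max 0 t) (at t)"
    using max_powr_has_derivative[of 2 t] unfolding m by simp
  have "((\<lambda>t. (t\<^sup>2 + e) powr ((a - 1) / 2)) has_real_derivative
      ((a - 1) / 2) * (t\<^sup>2 + e) powr ((a - 1) / 2 - 1) * (2 * t)) (at t)"
    by (rule DERIV_chain2[where f = "\<lambda>t. t powr ((a - 1) / 2)" and g = "\<lambda>t. t\<^sup>2 + e", OF has_real_derivative_powr[OF pos]])
      (auto intro!: derivative_eq_intros)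
  from DERIV_mult[OF 1 this]
  have "(h has_real_derivative (2 * max 0 t * (t\<^sup>2 + e) powr ((a - 1) / 2)
      + (a - 1) / 2 * (t\<^sup>2 + e) powr ((a - 1) / 2 - 1) * (2 * t) * (max 0 t)\<^sup>2)) (at t)"
    unfolding h_def .
  also have "(a - 1) / 2 - 1 = (a - 3) / 2" by (simp add: field_simps)
  also have "(t\<^sup>2 + e) powr ((a - 1) / 2) = (t\<^sup>2 + e) powr ((a - 3) / 2) * (t\<^sup>2 + e)"
  proof -
    have "(t\<^sup>2 + e) powr ((a - 1) / 2) = (t\<^sup>2 + e) powr ((a - 3) / 2 + 1)" by (simp add: field_simps)
    then show ?thesis using pos[of t] by (simp add: powr_add)
  qed
  also have "2 * max 0 t * ((t\<^sup>2 + e) powr ((a - 3) / 2) * (t\<^sup>2 + e))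
      + (a - 1) / 2 * (t\<^sup>2 + e) powr ((a - 3) / 2) * (2 * t) * (max 0 t)\<^sup>2 = h' t"
    by (cases "t \<le> 0") (simp_all add: h'_def max_def field_simps power2_eq_square)
  finally show "(h has_real_derivative h' t) (at t)" .
  show "continuous_on UNIV h'"
    unfolding h'_def using pos less_imp_neq[OF pos]
    by (intro continuous_intros continuous_on_powr') (auto simp: less_imp_le)
  show "t \<le> 0 \<Longrightarrow> h t = 0" "t \<le> 0 \<Longrightarrow> h' t = 0" by (auto simp: h_def h'_def max_absorb1)
  show "0 \<le> h t" by (simp add: h_def)
  show "0 \<le> h' t" unfolding h'_def using a e by (intro mult_nonneg_nonneg add_nonneg_nonneg) auto
  show "h t \<le> max 0 t powr (a + 1)"
  proof (cases "t \<le> 0")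
    case False
    then have "(t\<^sup>2 + e) powr ((a - 1) / 2) \<le> (t\<^sup>2) powr ((a - 1) / 2)"
      using a e by (intro powr_mono2') auto
    also have "(t\<^sup>2) powr ((a - 1) / 2) = t powr (a - 1)"
      using False by (intro square_powr_half) simp
    finally have "t\<^sup>2 * (t\<^sup>2 + e) powr ((a - 1) / 2) \<le> t powr 2 * t powr (a - 1)"
      using False by (simp add: mult_left_mono)
    also have "\<dots> = t powr (a + 1)" by (simp add: add.commute flip: powr_add)
    finally show ?thesis using False by (simp add: h_def)
  qed (simp add: h_def max_absorb1)
qed

lemma ennreal_linear:
  assumes "0 \<le> A" "0 \<le> P" "0 \<le> B" "0 \<le> Q"
  shows "ennreal (A * P + B * Q) = ennreal A * ennreal P + ennreal B * ennreal Q"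
  using assms by (simp add: ennreal_mult)

text \<open>Divergence theorem with h(t) = t^(a+1): the side with h' carries the weight exponent a,
  the side with h carries a + 1 and costs one power of the distance. It is applied to the
  regularised h, and Fatou's lemma removes the regularisation.\<close>

lemma fr_int_step_down:
  fixes w :: "complex ^ 'n"
  assumes a: "- 1 < a" "a \<le> 0" and q: "0 \<le> q" and w: "norm w < 1"
  shows "fr_int a q w \<le> ennreal (4 * (4 * real CARD('n) + q) / (a + 1) + 4) * fr_int (a + 1) (q + 1) w"
proof -
  let ?e = "\<lambda>k::nat. 1 / real (Suc k)"
  let ?u = "\<lambda>x :: complex ^ 'n. 1 - (norm x)\<^sup>2"
  define h where "h k t = (max 0 t)\<^sup>2 * (t\<^sup>2 + ?e k) powr ((a - 1) / 2)" for k t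
  define h' where "h' k t = 2 * max 0 t * (t\<^sup>2 + ?e k) powr ((a - 3) / 2) * ((a + 1) / 2 * t\<^sup>2 + ?e k)" for k t
  have e_pos: "0 < ?e k" for k by simp
  note hp = h_eps_properties[OF a e_pos, folded h_def h'_def]
  obtain R where R: "1 < R" "\<And>x :: complex ^ 'n. x \<in> ball 0 R \<Longrightarrow> norm x * norm w < 1"
    using larger_ball[OF w] by blast
  define \<Phi> where "\<Phi> x = dist1 x w powr (- q)" for x
  define \<Phi>' where "\<Phi>' x v = q * dist1 x w powr (- q - 2) * ((1 - cin x w) \<bullet> cin v w)" for x v
  have \<Phi>: "(\<Phi> has_derivative \<Phi>' x) (at x)" if "norm x < R" for x
    using dist1_powr_has_derivative[of x w q] R(2)[of x] that unfolding \<Phi>_def \<Phi>'_def by auto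
  have \<Phi>'_cont: "continuous_on (ball 0 R) (\<lambda>x. \<Phi>' x v)" for v
  proof -
    have "1 - cin x w \<noteq> 0" if "x \<in> ball 0 R" for x using Re_cin_less[OF R(2)[OF that]] by auto
    then show ?thesis
      unfolding \<Phi>'_def by (intro continuous_intros cin.continuous_on) auto
  qed
  have div: "(\<integral>x. 2 * (norm x)\<^sup>2 * h' k (?u x) * \<Phi> x \<partial>lborel)
      = (\<integral>x. h k (?u x) * (real DIM(complex ^ 'n) * \<Phi> x + \<Phi>' x x) \<partial>lborel)"
    "integrable lborel (\<lambda>x. 2 * (norm x)\<^sup>2 * h' k (?u x) * \<Phi> x)"
    "integrable lborel (\<lambda>x. h k (?u x) * (real DIM(complex ^ 'n) * \<Phi> x + \<Phi>' x x))" for k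
    subgoal by (rule radial_divergence(1)[where \<Phi>' = \<Phi>' and R = R]) (rule R(1) hp(1) hp(2) \<Phi>'_cont | erule \<Phi> hp(3) hp(4))+
    subgoal by (rule radial_divergence(2)[where \<Phi>' = \<Phi>' and R = R]) (rule R(1) hp(1) hp(2) \<Phi>'_cont | erule \<Phi> hp(3) hp(4))+
    subgoal by (rule radial_divergence(3)[where \<Phi>' = \<Phi>' and R = R]) (rule R(1) hp(1) hp(2) \<Phi>'_cont | erule \<Phi> hp(3) hp(4))+
    done
  \<comment> \<open>4n + q: the real dimension 2n times the factor 2 from dist1 \<le> 2, plus q from
    the radial derivative of the power of the distance.\<close>
  define B where "B = ennreal (4 * real CARD('n) + q) * fr_int (a + 1) (q + 1) w"
  have \<Phi>2: "\<Phi> x \<le> 2 * dist1 x w powr (- (q + 1))" if "norm x < 1" for x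
  proof -
    have "\<Phi> x = dist1 x w * dist1 x w powr (- (q + 1))"
      using dist1_pos[of x w] w that by (simp add: \<Phi>_def powr_diff powr_minus field_simps)
    also have "\<dots> \<le> 2 * dist1 x w powr (- (q + 1))"
      using dist1_le[of x w] that w by (intro mult_right_mono) auto
    finally show ?thesis .
  qed
  have step: "(\<integral>\<^sup>+x. ennreal (2 * (norm x)\<^sup>2 * h' k (?u x) * \<Phi> x) \<partial>lborel) \<le> B" for k
  proof -
    have "(\<integral>\<^sup>+x. ennreal (2 * (norm x)\<^sup>2 * h' k (?u x) * \<Phi> x) \<partial>lborel)
        = ennreal (\<integral>x. h k (?u x) * (real DIM(complex ^ 'n) * \<Phi> x + \<Phi>' x x) \<partial>lborel)"
      unfolding div(1)[symmetric] by (rule nn_integral_eq_integral[OF div(2)]) (auto simp: \<Phi>_def hp(6))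
    also have "\<dots> \<le> (\<integral>\<^sup>+x. ennreal (norm (h k (?u x) * (real DIM(complex ^ 'n) * \<Phi> x + \<Phi>' x x))) \<partial>lborel)"
      using integral_norm_bound_ennreal[OF div(3), of k] by (rule order_trans[rotated]) (simp add: ennreal_leI)
    also have "\<dots> \<le> (\<integral>\<^sup>+x. ennreal (4 * real CARD('n) + q) * ennreal (eta (a + 1) x * dist1 x w powr (- (q + 1))) \<partial>lborel)"
    proof (intro nn_integral_mono)
      fix x :: "complex ^ 'n"
      show "ennreal (norm (h k (?u x) * (real DIM(complex ^ 'n) * \<Phi> x + \<Phi>' x x)))
          \<le> ennreal (4 * real CARD('n) + q) * ennreal (eta (a + 1) x * dist1 x w powr (- (q + 1)))"
      proof (cases "norm x < 1")
        case True
        have d: "dist1 x w > 0" using True w by (intro dist1_pos) auto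
        have "\<bar>(1 - cin x w) \<bullet> cin x w\<bar> \<le> dist1 x w * cmod (cin x w)" by (rule Cauchy_Schwarz_ineq2)
        also have "\<dots> \<le> dist1 x w * 1"
          using norm_cin_le[of x w] mult_mono[of "norm x" 1 "norm w" 1] True w by (intro mult_left_mono) auto
        finally have "\<bar>\<Phi>' x x\<bar> \<le> q * dist1 x w powr (- q - 2) * dist1 x w"
          using q by (simp add: \<Phi>'_def abs_mult mult_left_mono)
        also have "\<dots> = q * dist1 x w powr (- (q + 1))"
          using d by (simp add: powr_diff powr_minus field_simps power2_eq_square)
        finally have 1: "\<bar>\<Phi>' x x\<bar> \<le> q * dist1 x w powr (- (q + 1))" .
        have "\<bar>real DIM(complex ^ 'n) * \<Phi> x + \<Phi>' x x\<bar> \<le> real DIM(complex ^ 'n) * \<Phi> x + \<bar>\<Phi>' x x\<bar>"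
          by (rule order_trans[OF abs_triangle_ineq]) (simp add: \<Phi>_def)
        also have "\<dots> \<le> real DIM(complex ^ 'n) * (2 * dist1 x w powr (- (q + 1))) + q * dist1 x w powr (- (q + 1))"
          using 1 \<Phi>2[OF True] by (intro add_mono mult_left_mono) auto
        also have "\<dots> = (4 * real CARD('n) + q) * dist1 x w powr (- (q + 1))"
          by (simp add: algebra_simps)
        finally have 2: "\<bar>real DIM(complex ^ 'n) * \<Phi> x + \<Phi>' x x\<bar> \<le> (4 * real CARD('n) + q) * dist1 x w powr (- (q + 1))" .
        have "norm (h k (?u x) * (real DIM(complex ^ 'n) * \<Phi> x + \<Phi>' x x))
            = h k (?u x) * \<bar>real DIM(complex ^ 'n) * \<Phi> x + \<Phi>' x x\<bar>"
          using hp(5) by (simp add: abs_mult)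
        also have "\<dots> \<le> eta (a + 1) x * ((4 * real CARD('n) + q) * dist1 x w powr (- (q + 1)))"
          using hp(7)[of k "?u x"] 2 by (intro mult_mono) (auto simp: eta_def)
        finally show ?thesis
          using q by (subst ennreal_mult[symmetric]) (auto simp: mult_ac intro!: ennreal_leI)
      next
        case False
        then have "?u x \<le> 0" using one_le_power[of "norm x" 2] by simp
        then show ?thesis using hp(3)[of "?u x" k] by simp
      qed
    qed
    also have "\<dots> = B" unfolding B_def fr_int_def by (subst nn_integral_cmult) auto
    finally show ?thesis .
  qed
  have lim_value: "2 * max 0 u * (u\<^sup>2 + 0) powr ((a - 3) / 2) * ((a + 1) / 2 * u\<^sup>2 + 0) = (a + 1) * u powr a"
    if u: "u > 0" for u :: real
  proof -
    have "(u\<^sup>2) powr ((a - 3) / 2) = u powr (a - 3)"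
      using u by (intro square_powr_half) simp
    moreover have "u powr a = u powr 1 * u powr (a - 3) * u powr 2" by (simp only: flip: powr_add) simp
    ultimately show ?thesis using u by (simp add: mult_ac)
  qed
  have lim: "(\<lambda>k. ennreal (2 * (norm x)\<^sup>2 * h' k (?u x) * \<Phi> x)) \<longlonglongrightarrow> ennreal (2 * (norm x)\<^sup>2 * ((a + 1) * eta a x) * \<Phi> x)" for x
  proof (intro tendsto_ennrealI tendsto_mult_right tendsto_mult_left)
    show "(\<lambda>k. h' k (?u x)) \<longlonglongrightarrow> (a + 1) * eta a x"
    proof (cases "norm x < 1")
      case True
      have u: "?u x > 0" by (rule one_minus_norm_sq_pos[OF True])
      have e0: "(\<lambda>k. ?e k) \<longlonglongrightarrow> 0" by (rule LIMSEQ_Suc) (rule lim_1_over_n)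
      have "(\<lambda>k. h' k (?u x)) \<longlonglongrightarrow> 2 * max 0 (?u x) * ((?u x)\<^sup>2 + 0) powr ((a - 3) / 2) * ((a + 1) / 2 * (?u x)\<^sup>2 + 0)"
        unfolding h'_def using u by (intro tendsto_intros tendsto_powr e0) auto
      also have "2 * max 0 (?u x) * ((?u x)\<^sup>2 + 0) powr ((a - 3) / 2) * ((a + 1) / 2 * (?u x)\<^sup>2 + 0) = (a + 1) * eta a x"
        using lim_value[OF u] by (simp only: eta_inside[OF True])
      finally show ?thesis .
    next
      case False
      then have "?u x \<le> 0" using one_le_power[of "norm x" 2] by simp
      then show ?thesis using False hp(4)[of "?u x"] by (simp add: eta_outside)
    qed
  qed
  have h'm: "(\<lambda>x. ennreal (2 * (norm x)\<^sup>2 * h' k (?u x) * \<Phi> x)) \<in> borel_measurable lborel" for k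
    using borel_measurable_integrable[OF div(2)[of k]] by simp
  have main: "(\<integral>\<^sup>+x. ennreal (2 * (norm x)\<^sup>2 * ((a + 1) * eta a x) * \<Phi> x) \<partial>lborel) \<le> B"
  proof -
    have "(\<integral>\<^sup>+x. ennreal (2 * (norm x)\<^sup>2 * ((a + 1) * eta a x) * \<Phi> x) \<partial>lborel)
        = (\<integral>\<^sup>+x. liminf (\<lambda>k. ennreal (2 * (norm x)\<^sup>2 * h' k (?u x) * \<Phi> x)) \<partial>lborel)"
      by (intro nn_integral_cong lim_imp_Liminf[symmetric] lim) simp
    also have "\<dots> \<le> liminf (\<lambda>k. \<integral>\<^sup>+x. ennreal (2 * (norm x)\<^sup>2 * h' k (?u x) * \<Phi> x) \<partial>lborel)"
      by (rule nn_integral_liminf[OF h'm])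
    also have "\<dots> \<le> liminf (\<lambda>k::nat. B)"
      by (intro Liminf_mono always_eventually allI step)
    also have "\<dots> = B" by (simp add: Liminf_const)
    finally show ?thesis .
  qed
  \<comment> \<open>The divergence identity carries the factor |x|^2, useless near the origin; for
    |x|^2 < 1/4 the weights of exponents a and a + 1 are comparable instead.\<close>
  have pt: "ennreal (eta a x * \<Phi> x) \<le> ennreal (2 / (a + 1)) * ennreal (2 * (norm x)\<^sup>2 * ((a + 1) * eta a x) * \<Phi> x)
      + ennreal 4 * ennreal (eta (a + 1) x * dist1 x w powr (- (q + 1)))" for x
  proof -
    have "eta a x * \<Phi> x \<le> 2 / (a + 1) * (2 * (norm x)\<^sup>2 * ((a + 1) * eta a x) * \<Phi> x)
      + 4 * (eta (a + 1) x * dist1 x w powr (- (q + 1)))"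
    proof (cases "norm x < 1")
      case True
      show ?thesis
      proof (cases "(norm x)\<^sup>2 \<ge> 1 / 4")
        case True
        then have "1 * (eta a x * \<Phi> x) \<le> (4 * (norm x)\<^sup>2) * (eta a x * \<Phi> x)"
          by (intro mult_right_mono) (auto simp: \<Phi>_def)
        moreover have "2 / (a + 1) * (2 * (norm x)\<^sup>2 * ((a + 1) * eta a x) * \<Phi> x) = (4 * (norm x)\<^sup>2) * (eta a x * \<Phi> x)"
          using a by simp
        moreover have "0 \<le> 4 * (eta (a + 1) x * dist1 x w powr (- (q + 1)))" by simp
        ultimately show ?thesis by linarith
      next
        case False
        then have "eta a x * (1 / 2) \<le> eta a x * (1 - (norm x)\<^sup>2)" by (intro mult_left_mono) auto
        then have "eta a x \<le> 2 * eta (a + 1) x" by (simp add: eta_mult)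
        then have "eta a x * \<Phi> x \<le> (2 * eta (a + 1) x) * (2 * dist1 x w powr (- (q + 1)))"
          using \<Phi>2[OF \<open>norm x < 1\<close>] by (intro mult_mono) (auto simp: \<Phi>_def)
        moreover have "0 \<le> 2 / (a + 1) * (2 * (norm x)\<^sup>2 * ((a + 1) * eta a x) * \<Phi> x)"
          using a by (simp add: \<Phi>_def)
        ultimately show ?thesis by simp
      qed
    qed (simp add: eta_outside)
    then have "ennreal (eta a x * \<Phi> x) \<le> ennreal (2 / (a + 1) * (2 * (norm x)\<^sup>2 * ((a + 1) * eta a x) * \<Phi> x)
      + 4 * (eta (a + 1) x * dist1 x w powr (- (q + 1))))" by (rule ennreal_leI)
    also have "\<dots> = ennreal (2 / (a + 1)) * ennreal (2 * (norm x)\<^sup>2 * ((a + 1) * eta a x) * \<Phi> x)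
      + ennreal 4 * ennreal (eta (a + 1) x * dist1 x w powr (- (q + 1)))"
      using a by (intro ennreal_linear) (auto simp: \<Phi>_def)
    finally show ?thesis .
  qed
  have [measurable]: "\<Phi> \<in> borel_measurable borel" unfolding \<Phi>_def by measurable
  have "fr_int a q w \<le> (\<integral>\<^sup>+x. ennreal (2 / (a + 1)) * ennreal (2 * (norm x)\<^sup>2 * ((a + 1) * eta a x) * \<Phi> x)
      + ennreal 4 * ennreal (eta (a + 1) x * dist1 x w powr (- (q + 1))) \<partial>lborel)"
    unfolding fr_int_def using pt unfolding \<Phi>_def by (intro nn_integral_mono)
  also have "\<dots> = ennreal (2 / (a + 1)) * (\<integral>\<^sup>+x. ennreal (2 * (norm x)\<^sup>2 * ((a + 1) * eta a x) * \<Phi> x) \<partial>lborel)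
      + ennreal 4 * fr_int (a + 1) (q + 1) w"
    unfolding fr_int_def by (subst nn_integral_add) (auto simp: nn_integral_cmult)
  also have "\<dots> \<le> ennreal (2 / (a + 1)) * B + ennreal 4 * fr_int (a + 1) (q + 1) w"
    using main by (intro add_mono mult_left_mono) auto
  also have "\<dots> = (ennreal (2 / (a + 1) * (4 * real CARD('n) + q)) + ennreal 4) * fr_int (a + 1) (q + 1) w"
  proof -
    have "ennreal (2 / (a + 1) * (4 * real CARD('n) + q)) = ennreal (2 / (a + 1)) * ennreal (4 * real CARD('n) + q)"
      using a q by (intro ennreal_mult) auto
    then show ?thesis by (simp only: B_def distrib_right mult.assoc)
  qed
  also have "\<dots> = ennreal (2 / (a + 1) * (4 * real CARD('n) + q) + 4) * fr_int (a + 1) (q + 1) w"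
    using a q by (subst ennreal_plus) auto
  also have "\<dots> \<le> ennreal (4 * (4 * real CARD('n) + q) / (a + 1) + 4) * fr_int (a + 1) (q + 1) w"
    using a q by (intro mult_right_mono ennreal_leI) (auto simp: divide_simps)
  finally show ?thesis .
qed

text \<open>Raising both a and the exponent of the distance by 1 keeps the excess t, so weights with
  -1 < a \<le> 0 reduce to the positive case.\<close>

theorem forelli_rudin:
  assumes a: "a > - 1" and t: "t > 0"
  obtains C where "C > 0" "\<And>w :: complex ^ 'n. norm w < 1 \<Longrightarrow>
    fr_int a (real CARD('n) + 1 + a + t) w \<le> ennreal (C * (1 - (norm w)\<^sup>2) powr (- t))"
proof (cases "a > 0")
  case True
  then show thesis using fr_int_pos[OF True t] that by blast
next
  case False
  then have a1: "a + 1 > 0" "a \<le> 0" using a by auto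
  define q where "q = real CARD('n) + 1 + a + t"
  have q: "q \<ge> 0" using a t by (simp add: q_def)
  obtain C where C: "C > 0" "\<And>w :: complex ^ 'n. norm w < 1 \<Longrightarrow>
    fr_int (a + 1) (real CARD('n) + 1 + (a + 1) + t) w \<le> ennreal (C * (1 - (norm w)\<^sup>2) powr (- t))"
    using fr_int_pos[OF a1(1) t] by blast
  define K where "K = 4 * (4 * real CARD('n) + q) / (a + 1) + 4"
  have K: "K > 0" using q a1 by (simp add: K_def add_nonneg_pos)
  show thesis
  proof (rule that[of "K * C"])
    show "K * C > 0" using K C by simp
    fix w :: "complex ^ 'n" assume w: "norm w < 1"
    have "fr_int a q w \<le> ennreal K * fr_int (a + 1) (q + 1) w"
      unfolding K_def by (rule fr_int_step_down[OF a a1(2) q w])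
    also have "q + 1 = real CARD('n) + 1 + (a + 1) + t" by (simp add: q_def)
    also have "ennreal K * fr_int (a + 1) \<dots> w \<le> ennreal K * ennreal (C * (1 - (norm w)\<^sup>2) powr (- t))"
      by (intro mult_left_mono C(2)[OF w]) simp
    also have "\<dots> = ennreal (K * C * (1 - (norm w)\<^sup>2) powr (- t))"
      using K by (simp add: ennreal_mult'[symmetric] mult.assoc)
    finally show "fr_int a (real CARD('n) + 1 + a + t) w \<le> ennreal (K * C * (1 - (norm w)\<^sup>2) powr (- t))"
      by (simp add: q_def)
  qed
qed

text \<open>Forelli-Rudin at w = 0, where the kernel is 1 and any t > 0 serves.\<close>

lemma integrable_eta_gt: 
  assumes "s > - 1"
  shows "integrable lborel (eta s :: complex ^ 'n \<Rightarrow> real)"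
proof (rule integrableI_nonneg)
  obtain C where C: "\<And>w :: complex ^ 'n. norm w < 1 \<Longrightarrow>
    fr_int s (real CARD('n) + 1 + s + 1) w \<le> ennreal (C * (1 - (norm w)\<^sup>2) powr (- 1))"
    using forelli_rudin[OF assms, of 1] by auto
  have "(\<integral>\<^sup>+x. ennreal (eta s (x :: complex ^ 'n)) \<partial>lborel) = fr_int s (real CARD('n) + 1 + s + 1) (0 :: complex ^ 'n)"
    by (simp add: fr_int_def cin.zero_right)
  also have "\<dots> < \<infinity>" using C[of 0] by (rule order.strict_trans1) auto
  finally show "(\<integral>\<^sup>+x. ennreal (eta s (x :: complex ^ 'n)) \<partial>lborel) < \<infinity>" .
qed auto

section \<open>The reproducing formula for functions of moderate growth\<close>

lemma eta_powr_mult: "norm x < 1 \<Longrightarrow> eta s x * (1 - (norm x)\<^sup>2) powr b = eta (s + b) x"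
  using one_minus_norm_sq_pos[of x] by (simp add: eta_inside powr_add)

lemma one_minus_norm_sq_scale:
  "\<bar>r\<bar> \<le> 1 \<Longrightarrow> 1 - (norm x)\<^sup>2 \<le> 1 - (norm (r *\<^sub>R x))\<^sup>2" for x :: "'a::real_normed_vector"
  using mult_right_mono[of "r\<^sup>2" 1 "(norm x)\<^sup>2"] abs_square_le_1[of r] by (simp add: power_mult_distrib)

lemma measurable_eta_scaleR:
  fixes G :: "'a::euclidean_space \<Rightarrow> 'b::{banach, second_countable_topology}"
  assumes "continuous_on (ball 0 1) G"
  shows "(\<lambda>x. eta s x *\<^sub>R G x) \<in> borel_measurable borel"
proof -
  have "(\<lambda>x. eta s x *\<^sub>R (indicator (ball 0 1) x *\<^sub>R G x)) \<in> borel_measurable borel"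
    using assms by (intro borel_measurable_scaleR borel_measurable_continuous_on_indicator) auto
  also have "(\<lambda>x. eta s x *\<^sub>R (indicator (ball 0 1) x *\<^sub>R G x)) = (\<lambda>x. eta s x *\<^sub>R G x)"
    by (auto simp: indicator_def fun_eq_iff dest: eta_nonzero)
  finally show ?thesis .
qed

lemma hol_on_dilate:
  assumes "hol_on (ball 0 1) F" "0 < r"
  shows "hol_on (ball 0 (1 / r)) (\<lambda>x. F (r *\<^sub>R x))"
proof -
  have "r *\<^sub>R x + 0 \<in> ball 0 1" if "x \<in> ball 0 (1 / r)" for x :: "complex ^ 'n"
    using that assms(2) by (simp add: field_simps)
  then show ?thesis
    using hol_on_affine(1)[OF assms(1), where S = "ball 0 (1 / r)" and r = r and a = 0] by auto
qed

text \<open>Radii increasing to 1 that start at 1/2: the lower bound keeps the Jacobian of the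
  dilation under control.\<close>

definition rad :: "nat \<Rightarrow> real"
  where "rad k = 1 - 1 / real (k + 2)"

lemma rad: "1 / 2 \<le> rad k" "0 < rad k" "rad k < 1" "\<bar>rad k\<bar> \<le> 1" "1 < 1 / rad k"
  by (auto simp: rad_def field_simps)

lemma rad_lim: "rad \<longlonglongrightarrow> 1"
proof -
  have "(\<lambda>k. 1 / real (k + 2)) \<longlonglongrightarrow> 0"
    by (rule LIMSEQ_ignore_initial_segment[OF lim_1_over_n])
  then have "(\<lambda>k. 1 - 1 / real (k + 2)) \<longlonglongrightarrow> 1 - 0" by (intro tendsto_intros)
  then show ?thesis by (simp add: rad_def[abs_def])
qed

lemma norm_rad_scale: "norm x < 1 \<Longrightarrow> norm (rad k *\<^sub>R x) < 1"
  using mult_right_mono[of "rad k" 1 "norm x"] rad[of k] by simp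

lemma rad_scale_lim:
  assumes "hol_on (ball 0 1) F" "norm z < 1"
  shows "(\<lambda>k. F (rad k *\<^sub>R z)) \<longlonglongrightarrow> F z"
proof -
  have "isCont F z"
    using has_derivative_continuous[OF hol_on_has_derivative[OF assms(1), of z]] assms(2) by simp
  moreover have "(\<lambda>k. rad k *\<^sub>R z) \<longlonglongrightarrow> 1 *\<^sub>R z" by (intro tendsto_intros rad_lim)
  then have "(\<lambda>k. rad k *\<^sub>R z) \<longlonglongrightarrow> z" by simp
  ultimately show ?thesis by (rule isCont_tendsto_compose)
qed

lemma bker_cin_continuous:
  fixes z :: "complex ^ 'n"
  assumes "norm z < 1"
  shows "continuous_on (cball 0 1) (\<lambda>x. bker c (cin z x))"
proof -
  have Re: "Re (cin z x) < 1" if "x \<in> cball 0 1" for x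
    using that assms mult_left_mono[of "norm x" 1 "norm z"] by (intro Re_cin_less) auto
  have "continuous_on {\<zeta>. Re \<zeta> < 1} (bker c)"
    using bker_field_derivative by (intro continuous_at_imp_continuous_on) (auto intro: DERIV_isCont)
  then show ?thesis
    by (rule continuous_on_compose2) (use Re in \<open>auto intro!: cin.continuous_on continuous_intros\<close>)
qed

lemma norm_bker_cin_le:
  fixes z :: "complex ^ 'n"
  assumes "norm z < 1" "norm x \<le> 1" "0 \<le> c"
  shows "cmod (bker c (cin z x)) \<le> (1 - norm z) powr (- c)"
  unfolding norm_bker using assms dist1_ge[of x z] dist1_commute[of x z]
  by (intro powr_mono2') auto

text \<open>Dilates satisfy the formula for the closed ball. Since a dilation only increases 1 -
  |x|^2, the growth bound of F dominates all of them by a multiple of \<open>eta (s - b)\<close>,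
  integrable as s - b > -1; the kernel is bounded because z is fixed.\<close>

lemma reproducing_formula:
  fixes F :: "complex ^ 'n \<Rightarrow> complex"
  assumes F: "hol_on (ball 0 1) F" and s: "s > 0" and b: "0 \<le> b" "s - b > - 1"
    and M: "\<And>x. norm x < 1 \<Longrightarrow> cmod (F x) \<le> M * (1 - (norm x)\<^sup>2) powr (- b)" and z: "norm z < 1"
  shows "(\<integral>x. eta s x *\<^sub>R (F x * bker (real CARD('n) + s + 1) (cin z x)) \<partial>lborel)
    = eta_int TYPE('n) s *\<^sub>R F z" (is "?I = _")
    and "integrable lborel (\<lambda>x. eta s x *\<^sub>R (F x * bker (real CARD('n) + s + 1) (cin z x)))"
proof -
  define c where "c = real CARD('n) + s + 1"
  have c: "0 \<le> c" using s by (simp add: c_def)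
  have M0: "0 \<le> M" using order_trans[OF norm_ge_zero M[of 0]] by simp
  define K where "K = (1 - norm z) powr (- c)"
  define w where "w x = M * K * eta (s - b) x" for x :: "complex ^ 'n"
  have w_int: "integrable lborel w"
    unfolding w_def by (intro integrable_mult_right integrable_eta_gt b)
  have bound: "norm (eta s x *\<^sub>R (F (r *\<^sub>R x) * bker c (cin z x))) \<le> w x" if r: "\<bar>r\<bar> \<le> 1" for x and r :: real
  proof (cases "norm x < 1")
    case True
    have rx: "norm (r *\<^sub>R x) < 1" using True r mult_right_mono[of "\<bar>r\<bar>" 1 "norm x"] by simp
    have "cmod (F (r *\<^sub>R x)) \<le> M * (1 - (norm (r *\<^sub>R x))\<^sup>2) powr (- b)" by (rule M[OF rx])
    also have "\<dots> \<le> M * (1 - (norm x)\<^sup>2) powr (- b)"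
      using M0 b one_minus_norm_sq_scale[OF r, of x] one_minus_norm_sq_pos[OF True]
      by (intro mult_left_mono powr_mono2') auto
    finally have "cmod (F (r *\<^sub>R x)) * cmod (bker c (cin z x)) \<le> (M * (1 - (norm x)\<^sup>2) powr (- b)) * K"
      unfolding K_def using M0 True z c by (intro mult_mono norm_bker_cin_le) auto
    from mult_left_mono[OF this eta_nonneg[of s x]]
    have "eta s x * (cmod (F (r *\<^sub>R x)) * cmod (bker c (cin z x))) \<le> M * K * (eta s x * (1 - (norm x)\<^sup>2) powr (- b))"
      by (simp only: mult_ac)
    then show ?thesis
      using eta_powr_mult[OF True, of s "- b"] by (simp add: norm_mult w_def)
  qed (simp add: eta_outside w_def)
  have cont: "continuous_on (ball 0 1) (\<lambda>x. F (r *\<^sub>R x) * bker c (cin z x))" if "\<bar>r\<bar> \<le> 1" for r :: real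
  proof -
    have "r *\<^sub>R x \<in> ball 0 1" if "x \<in> ball 0 1" for x :: "complex ^ 'n"
      using that \<open>\<bar>r\<bar> \<le> 1\<close> mult_right_mono[of "\<bar>r\<bar>" 1 "norm x"] by simp
    then have "continuous_on (ball 0 1) (\<lambda>x. F (r *\<^sub>R x))"
      by (intro continuous_on_compose2[OF hol_on_continuous_on[OF F]] continuous_intros) auto
    then show ?thesis
      by (intro continuous_intros continuous_on_subset[OF bker_cin_continuous[OF z]]) auto
  qed
  have "(\<lambda>k. \<integral>x. eta s x *\<^sub>R (F (rad k *\<^sub>R x) * bker c (cin z x)) \<partial>lborel) \<longlonglongrightarrow>
      (\<integral>x. eta s x *\<^sub>R (F x * bker c (cin z x)) \<partial>lborel)"
  proof (rule integral_dominated_convergence[OF _ _ w_int])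
    show "(\<lambda>x. eta s x *\<^sub>R (F x * bker c (cin z x))) \<in> borel_measurable lborel"
      using measurable_eta_scaleR[OF cont[of 1]] by simp
    show "(\<lambda>x. eta s x *\<^sub>R (F (rad k *\<^sub>R x) * bker c (cin z x))) \<in> borel_measurable lborel" for k
      using measurable_eta_scaleR[OF cont[of "rad k"]] rad(4) by simp
    show "AE x in lborel. (\<lambda>k. eta s x *\<^sub>R (F (rad k *\<^sub>R x) * bker c (cin z x))) \<longlonglongrightarrow> eta s x *\<^sub>R (F x * bker c (cin z x))"
    proof (intro AE_I2)
      fix x :: "complex ^ 'n"
      show "(\<lambda>k. eta s x *\<^sub>R (F (rad k *\<^sub>R x) * bker c (cin z x))) \<longlonglongrightarrow> eta s x *\<^sub>R (F x * bker c (cin z x))"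
      proof (cases "norm x < 1")
        case True
        then show ?thesis by (intro tendsto_intros rad_scale_lim[OF F])
      qed (simp add: eta_outside)
    qed
    show "AE x in lborel. norm (eta s x *\<^sub>R (F (rad k *\<^sub>R x) * bker c (cin z x))) \<le> w x" for k
      using bound[OF rad(4)] by simp
  qed
  moreover have "(\<integral>x. eta s x *\<^sub>R (F (rad k *\<^sub>R x) * bker c (cin z x)) \<partial>lborel)
      = eta_int TYPE('n) s *\<^sub>R F (rad k *\<^sub>R z)" for k
    unfolding c_def by (rule reproducing_closed_ball[OF rad(5) hol_on_dilate[OF F rad(2)] s z])
  moreover have "(\<lambda>k. eta_int TYPE('n) s *\<^sub>R F (rad k *\<^sub>R z)) \<longlonglongrightarrow> eta_int TYPE('n) s *\<^sub>R F z"
    by (intro tendsto_intros rad_scale_lim[OF F z])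
  ultimately show "?I = eta_int TYPE('n) s *\<^sub>R F z"
    unfolding c_def[symmetric] by (simp only: LIMSEQ_unique)
  show "integrable lborel (\<lambda>x. eta s x *\<^sub>R (F x * bker (real CARD('n) + s + 1) (cin z x)))"
    unfolding c_def[symmetric]
    by (rule Bochner_Integration.integrable_bound[OF w_int])
      (use measurable_eta_scaleR[OF cont[of 1]] order_trans[OF bound[of 1] abs_ge_self] in \<open>simp_all\<close>)
qed

section \<open>A sub-mean value majorant\<close>

text \<open>The non-isotropic quasi-metric of the ball. The operator \<open>P\<close> is a square
  root of x \<mapsto> x - cin x u u, so Cauchy-Schwarz for P z and P v estimates cin z v - cin z u
  cin u v, while |P x|^2 \<le> 1 - |cin x u|^2 is controlled by the distance to u.\<close>

lemma dist1_quasi_triangle: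
  fixes u v z :: "complex ^ 'n"
  assumes "norm u \<le> 1" "norm v \<le> 1" "norm z \<le> 1"
  shows "dist1 z v \<le> 2 * (dist1 z u + dist1 u v)"
proof -
  \<comment> \<open>The smaller root of 2\<theta> - \<theta>^2 |u|^2 = 1, written without dividing
    by |u|^2.\<close>
  define \<theta> where "\<theta> = 1 / (1 + sqrt (1 - (norm u)\<^sup>2))"
  define t where "t = sqrt (1 - (norm u)\<^sup>2)"
  have u1: "(norm u)\<^sup>2 \<le> 1" using assms(1) by (simp add: abs_square_le_1)
  have t: "0 \<le> t" "t\<^sup>2 = 1 - (norm u)\<^sup>2" using u1 by (auto simp: t_def)
  have \<theta>: "2 * \<theta> - \<theta>\<^sup>2 * (norm u)\<^sup>2 = 1"
  proof -
    have 1: "\<theta> * (1 + t) = 1" using t by (simp add: \<theta>_def t_def[symmetric])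
    have nu: "(norm u)\<^sup>2 = (1 + t) * (1 - t)"
      using t(2) by (simp add: power2_eq_square algebra_simps)
    have "\<theta>\<^sup>2 * (norm u)\<^sup>2 = (\<theta> * (1 + t)) * (\<theta> * (1 - t))"
      unfolding nu by (simp only: power2_eq_square mult_ac)
    then have "\<theta>\<^sup>2 * (norm u)\<^sup>2 = \<theta> - \<theta> * t" unfolding 1 by (simp add: algebra_simps)
    moreover have "\<theta> + \<theta> * t = 1" using 1 by (simp add: algebra_simps)
    ultimately show ?thesis by linarith
  qed
  define P where "P x = x - (of_real \<theta> * cin x u) *s u" for x
  have PP: "cin (P x) (P y) = cin x y - cin x u * cin u y" for x y
  proof -
    have "cin (P x) (P y) = cin x y - (2 * of_real \<theta> - of_real \<theta> * of_real \<theta> * cin u u) * (cin x u * cin u y)"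
      by (simp add: P_def cin.diff_left cin.diff_right cin_scale_left cin_scale_right cnj_cin algebra_simps)
    also have "2 * of_real \<theta> - of_real \<theta> * of_real \<theta> * cin u u = of_real (2 * \<theta> - \<theta>\<^sup>2 * (norm u)\<^sup>2)"
      by (simp add: cin_self power2_eq_square)
    finally show ?thesis by (simp add: \<theta>)
  qed
  have P_norm: "(norm (P x))\<^sup>2 \<le> 2 * dist1 x u" if "norm x \<le> 1" for x
  proof -
    have "complex_of_real ((norm (P x))\<^sup>2) = of_real ((norm x)\<^sup>2 - (cmod (cin x u))\<^sup>2)"
    proof -
      have "cin x u * cin u x = of_real ((cmod (cin x u))\<^sup>2)" by (simp only: complex_norm_square cnj_cin)
      then show ?thesis using PP[of x x] by (simp only: cin_self of_real_diff)
    qed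
    then have "(norm (P x))\<^sup>2 = (norm x)\<^sup>2 - (cmod (cin x u))\<^sup>2" by (simp only: of_real_eq_iff)
    also have "\<dots> \<le> 1 - (cmod (cin x u))\<^sup>2" using that by (simp add: abs_square_le_1)
    also have "\<dots> = (1 - cmod (cin x u)) * (1 + cmod (cin x u))"
      by (simp add: power2_eq_square algebra_simps)
    also have "\<dots> \<le> dist1 x u * 2"
      using norm_triangle_ineq2[of 1 "cin x u"] norm_cin_le[of x u] mult_mono[of "norm x" 1 "norm u" 1] that assms
      by (intro mult_mono) auto
    finally show ?thesis by simp
  qed
  have "cmod (cin (P z) (P v)) \<le> norm (P z) * norm (P v)" by (rule norm_cin_le)
  also have "\<dots> \<le> ((norm (P z))\<^sup>2 + (norm (P v))\<^sup>2) / 2"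
    using zero_le_power2[of "norm (P z) - norm (P v)"] by (simp add: power2_eq_square algebra_simps)
  also have "\<dots> \<le> dist1 z u + dist1 u v"
    using P_norm[OF assms(3)] P_norm[OF assms(2)] dist1_commute[of v u] by simp
  finally have 1: "cmod (cin z v - cin z u * cin u v) \<le> dist1 z u + dist1 u v" unfolding PP .
  have "cmod (1 - cin z u * cin u v) = cmod ((1 - cin z u) + cin z u * (1 - cin u v))"
    by (simp add: algebra_simps)
  also have "\<dots> \<le> dist1 z u + cmod (cin z u) * dist1 u v"
    by (rule order_trans[OF norm_triangle_ineq]) (simp add: norm_mult)
  also have "\<dots> \<le> dist1 z u + 1 * dist1 u v"
    using norm_cin_le[of z u] mult_mono[of "norm z" 1 "norm u" 1] assms
    by (intro add_mono mult_right_mono) auto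
  finally have 2: "cmod (1 - cin z u * cin u v) \<le> dist1 z u + dist1 u v" by simp
  have "1 - cin z v = (1 - cin z u * cin u v) - (cin z v - cin z u * cin u v)" by simp
  then have "dist1 z v \<le> cmod (1 - cin z u * cin u v) + cmod (cin z v - cin z u * cin u v)"
    by (metis norm_triangle_ineq4)
  then show ?thesis using 1 2 by simp
qed


text \<open>Both summands of the quasi-triangle inequality become products, since
  \<open>dist1 z u\<close> and \<open>dist1 u v\<close> are at least (1 - |u|^2)/2. The quotient is
  the cost of moving the centre of a kernel between u and z.\<close>

lemma dist1_ratio:
  fixes u v z :: "complex ^ 'n"
  assumes "norm u < 1" "norm v \<le> 1" "norm z \<le> 1"
  shows "dist1 z v \<le> 8 * (dist1 z u / (1 - (norm u)\<^sup>2)) * dist1 u v"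
    and "1 \<le> 8 * (dist1 z u / (1 - (norm u)\<^sup>2))"
proof -
  define b where "b = 1 - (norm u)\<^sup>2"
  have b: "0 < b" using one_minus_norm_sq_pos[OF assms(1)] by (simp add: b_def)
  have zu: "b / 2 \<le> dist1 z u" and uv: "b / 2 \<le> dist1 u v"
    using dist1_ge'[of z u] dist1_ge'[of v u] dist1_commute[of v u] assms by (auto simp: b_def)
  have "b * dist1 z v \<le> b * (2 * (dist1 z u + dist1 u v))"
    using b dist1_quasi_triangle[of u v z] assms by (intro mult_left_mono) auto
  also have "\<dots> = 2 * (dist1 z u * b) + 2 * (b * dist1 u v)" by (simp add: algebra_simps)
  also have "\<dots> \<le> 2 * (dist1 z u * (2 * dist1 u v)) + 2 * ((2 * dist1 z u) * dist1 u v)"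
    using zu uv by (intro add_mono mult_left_mono mult_right_mono) auto
  finally have "b * dist1 z v \<le> 8 * (dist1 z u * dist1 u v)" by (simp add: mult_ac)
  then show "dist1 z v \<le> 8 * (dist1 z u / (1 - (norm u)\<^sup>2)) * dist1 u v"
    using b by (simp add: b_def[symmetric] field_simps)
  show "1 \<le> 8 * (dist1 z u / (1 - (norm u)\<^sup>2))"
    using zu b by (simp add: b_def[symmetric] field_simps)
qed

text \<open>The case of a function holomorphic across the boundary: with \<open>S\<close> the least constant in
  \<open>|F|\<^sup>p \<le> S W\<close>, the reproducing formula and \<open>|F| = |F|\<^sup>p |F|\<^sup>1\<^sup>-\<^sup>p \<le> |F|\<^sup>p (S W)\<^sup>(\<^sup>1\<^sup>-\<^sup>p\<^sup>)\<^sup>/\<^sup>p\<close> give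
  \<open>S \<le> C S\<^sup>1\<^sup>-\<^sup>p\<close>. The summand \<open>e\<close> keeps \<open>W\<close> away from zero, so that \<open>S\<close> is finite.\<close>

lemma majorant_closed_ball:
  fixes F :: "complex ^ 'n \<Rightarrow> complex"
  assumes p: "0 < p" "p \<le> 1" and A: "0 < A" and R: "1 < R" and F: "hol_on (ball 0 R) F"
    and z: "norm z < 1"
  defines "q \<equiv> real CARD('n) + 1 + A"
  defines "\<kappa> \<equiv> (1 - p) / p"
  shows "cmod (F z) powr p \<le> (8 powr q) powr \<kappa> / eta_int TYPE('n) (A + q * \<kappa>)
    * (\<integral>u. eta A u * (cmod (F u) powr p * dist1 z u powr (- q)) \<partial>lborel)"
proof -
  \<comment> \<open>Raised so that it absorbs the factor (d/b)^(q \<kappa>) below: the weight drops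
    from s to A, and the distance exponent from n + s + 1 to q.\<close>
  define s where "s = A + q * \<kappa>"
  define K where "K = 8 powr q"
  define V where "V = eta_int TYPE('n) s"
  have q: "q > 0" using A by (simp add: q_def add_pos_pos)
  have \<kappa>: "\<kappa> \<ge> 0" using p by (simp add: \<kappa>_def)
  have s: "s > 0" using A q \<kappa> by (simp add: s_def add_pos_nonneg)
  have V: "V > 0" unfolding V_def using s by (intro eta_int_pos integrable_eta) simp
  have K: "K > 0" by (simp add: K_def)
  have \<kappa>1: "(\<kappa> + 1) * p = 1" "\<kappa> * p = 1 - p" "p * \<kappa> = 1 - p" using p by (auto simp: \<kappa>_def field_simps)
  define T where "T z = (\<integral>u. eta A u * (cmod (F u) powr p * dist1 z u powr (- q)) \<partial>lborel)" for z
  obtain M where M: "M > 0" "\<And>x. norm x \<le> 1 \<Longrightarrow> cmod (F x) \<le> M"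
    using continuous_on_cball_bounded[OF hol_on_cball_continuous[OF R F]] by blast
  have dist_cont: "continuous_on (cball 0 1) (\<lambda>u. dist1 z u powr r)" if "norm z < 1" for z :: "complex ^ 'n" and r
  proof -
    have "cin z u \<noteq> 1" if "u \<in> cball 0 1" for u
      using dist1_pos[of u z] dist1_commute[of u z] that \<open>norm z < 1\<close> by auto
    then show ?thesis by (intro continuous_intros cin.continuous_on) auto
  qed
  have int_T: "integrable lborel (\<lambda>u. eta A u * (cmod (F u) powr p * dist1 z u powr (- q)))" if "norm z < 1" for z
    using integrable_eta_continuous[of A "\<lambda>u. cmod (F u) powr p * dist1 z u powr (- q)"] A p
      dist_cont[OF that] hol_on_cball_continuous[OF R F]
    by (simp add: continuous_intros continuous_on_powr')
  have T0: "0 \<le> T z" for z unfolding T_def by (intro Bochner_Integration.integral_nonneg) simp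
  have main: "cmod (F z) powr p \<le> (K powr \<kappa> / V) * (T z + e)" if e: "e > 0" and z: "norm z < 1" for e z
  proof -
    define W where "W z = T z + e" for z
    have W: "W z > 0" "e \<le> W z" for z using T0[of z] e by (auto simp: W_def)
    \<comment> \<open>Harnack-type comparison: the kernels centred at u and z differ by at most the
      q-th power of the factor in \<open>dist1_ratio\<close>.\<close>
    have W_ratio: "W u \<le> K * (dist1 z u / (1 - (norm u)\<^sup>2)) powr q * W z"
      if u: "norm u < 1" and z: "norm z < 1" for u z :: "complex ^ 'n"
    proof -
      define \<rho> where "\<rho> = 8 * (dist1 z u / (1 - (norm u)\<^sup>2))"
      have \<rho>1: "1 \<le> \<rho>" unfolding \<rho>_def using dist1_ratio(2)[of u z z] u z by simp
      have "eta A v * (cmod (F v) powr p * dist1 u v powr (- q))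
          \<le> \<rho> powr q * (eta A v * (cmod (F v) powr p * dist1 z v powr (- q)))" for v
      proof (cases "norm v < 1")
        case True
        have dz: "0 < dist1 z v" using dist1_pos[of v z] dist1_commute[of v z] True z by simp
        have "dist1 z v \<le> \<rho> * dist1 u v" unfolding \<rho>_def by (rule dist1_ratio(1)) (use u z True in auto)
        then have "dist1 z v / \<rho> \<le> dist1 u v" using \<rho>1 by (simp add: field_simps)
        then have "dist1 u v powr (- q) \<le> (dist1 z v / \<rho>) powr (- q)"
          using dz \<rho>1 q by (intro powr_mono2') auto
        also have "\<dots> = \<rho> powr q * dist1 z v powr (- q)"
          using dz \<rho>1 by (intro divide_powr_minus) auto
        finally have "(eta A v * cmod (F v) powr p) * dist1 u v powr (- q)
            \<le> (eta A v * cmod (F v) powr p) * (\<rho> powr q * dist1 z v powr (- q))"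
          by (intro mult_left_mono) auto
        then show ?thesis by (simp only: mult_ac)
      qed (simp add: eta_outside)
      then have "T u \<le> (\<integral>v. \<rho> powr q * (eta A v * (cmod (F v) powr p * dist1 z v powr (- q))) \<partial>lborel)"
        unfolding T_def by (intro Bochner_Integration.integral_mono int_T u integrable_mult_right z)
      also have "\<dots> = \<rho> powr q * T z" by (simp add: T_def)
      finally have "T u \<le> \<rho> powr q * T z" .
      moreover have "1 * e \<le> \<rho> powr q * e" using e \<rho>1 q by (intro mult_right_mono ge_one_powr_ge_zero) auto
      ultimately have "W u \<le> \<rho> powr q * W z" by (simp add: W_def algebra_simps)
      moreover have "\<rho> powr q = K * (dist1 z u / (1 - (norm u)\<^sup>2)) powr q"
        unfolding \<rho>_def K_def by (intro powr_mult)
      ultimately show ?thesis by simp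
    qed
    define S where "S = (SUP z\<in>ball 0 1. cmod (F z) powr p / W z)"
    have bdd: "bdd_above ((\<lambda>z. cmod (F z) powr p / W z) ` ball 0 1)"
    proof (rule bdd_aboveI2)
      fix x :: "complex ^ 'n" assume "x \<in> ball 0 1"
      then show "cmod (F x) powr p / W x \<le> M powr p / e"
        using M(2)[of x] W[of x] p e by (intro frac_le powr_mono2) auto
    qed
    have S_upper: "cmod (F u) powr p \<le> S * W u" if "norm u < 1" for u
    proof -
      have "cmod (F u) powr p / W u \<le> S" unfolding S_def using that by (intro cSUP_upper bdd) auto
      then show ?thesis using W[of u] by (simp add: field_simps)
    qed
    have S0: "0 \<le> S"
      using order_trans[OF divide_nonneg_pos[OF powr_ge_zero W(1)]
          cSUP_upper[OF _ bdd, of 0]] by (simp add: S_def)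
    \<comment> \<open>Reproducing formula with |F| = |F|^p (|F|^p)^\<kappa>, where the second factor
      is replaced by its bound S W and W is then moved from u to z.\<close>
    have ineq: "cmod (F z) powr p / W z \<le> (K * S) powr (1 - p) / V powr p" if z: "norm z < 1" for z
    proof -
      define B where "B = (S * K * W z) powr \<kappa>"
      have B0: "0 \<le> B" by (simp add: B_def)
      have "cmod (eta_int TYPE('n) s *\<^sub>R F z) \<le> (\<integral>u. B * (eta A u * (cmod (F u) powr p * dist1 z u powr (- q))) \<partial>lborel)"
        unfolding reproducing_closed_ball[OF R F s z, symmetric]
      proof (rule Bochner_Integration.integral_norm_bound_integral)
        show "integrable lborel (\<lambda>x. eta s x *\<^sub>R (F x * bker (real CARD('n) + s + 1) (cin z x)))"
          using s by (intro integrable_eta_continuous continuous_intros bker_cin_continuous z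
              hol_on_cball_continuous[OF R F]) auto
        show "integrable lborel (\<lambda>u. B * (eta A u * (cmod (F u) powr p * dist1 z u powr (- q))))"
          by (intro integrable_mult_right int_T z)
        fix u :: "complex ^ 'n"
        show "norm (eta s u *\<^sub>R (F u * bker (real CARD('n) + s + 1) (cin z u)))
            \<le> B * (eta A u * (cmod (F u) powr p * dist1 z u powr (- q)))"
        proof (cases "norm u < 1")
          case True
          define d where "d = dist1 z u"
          define b where "b = 1 - (norm u)\<^sup>2"
          have d: "d > 0" using dist1_pos[of u z] dist1_commute[of u z] True z by (simp add: d_def)
          have b: "b > 0" using one_minus_norm_sq_pos[OF True] by (simp add: b_def)
          have "cmod (F u) = cmod (F u) powr p * (cmod (F u) powr p) powr \<kappa>"
            using \<kappa>1 p by (simp add: powr_powr algebra_simps flip: powr_add)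
          also have "\<dots> \<le> cmod (F u) powr p * (S * (K * (d / b) powr q * W z)) powr \<kappa>"
            using S_upper[OF True] W_ratio[OF True z] S0 \<kappa>
            by (intro mult_left_mono powr_mono2) (auto simp: d_def b_def intro: order_trans mult_left_mono)
          also have "(S * (K * (d / b) powr q * W z)) powr \<kappa> = (S * K * W z) powr \<kappa> * (d / b) powr (q * \<kappa>)"
          proof -
            have "S * (K * (d / b) powr q * W z) = (S * K * W z) * (d / b) powr q" by (simp only: mult_ac)
            then show ?thesis using S0 K W[of z] d b
              by (simp add: powr_mult powr_powr)
          qed
          finally have Fu: "cmod (F u) \<le> cmod (F u) powr p * (B * (d / b) powr (q * \<kappa>))" by (simp add: B_def)
          have "norm (eta s u *\<^sub>R (F u * bker (real CARD('n) + s + 1) (cin z u)))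
              = eta s u * (cmod (F u) * d powr (- (real CARD('n) + s + 1)))"
            by (simp add: norm_mult norm_bker d_def)
          also have "\<dots> \<le> eta s u * ((cmod (F u) powr p * (B * (d / b) powr (q * \<kappa>))) * d powr (- (real CARD('n) + s + 1)))"
            using Fu by (intro mult_left_mono mult_right_mono) auto
          also have "\<dots> = B * ((eta s u * b powr (- (q * \<kappa>))) * (cmod (F u) powr p * (d powr (q * \<kappa>) * d powr (- (real CARD('n) + s + 1)))))"
            using d b by (simp add: powr_divide powr_minus field_simps)
          also have "d powr (q * \<kappa>) * d powr (- (real CARD('n) + s + 1)) = d powr (- q)"
            by (simp add: s_def q_def algebra_simps flip: powr_add)
          also have "eta s u * b powr (- (q * \<kappa>)) = eta A u"
            using eta_powr_mult[OF True, of s "- (q * \<kappa>)"] by (simp add: b_def s_def)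
          finally show ?thesis by (simp add: d_def)
        qed (simp add: eta_outside)
      qed
      also have "\<dots> = B * T z" by (simp add: T_def)
      also have "\<dots> \<le> B * W z" using B0 e by (intro mult_left_mono) (auto simp: W_def)
      also have "\<dots> = (S * K) powr \<kappa> * W z powr (\<kappa> + 1)"
        using S0 K W[of z] by (simp add: B_def powr_mult powr_add)
      finally have "V * cmod (F z) \<le> (S * K) powr \<kappa> * W z powr (\<kappa> + 1)" using V by (simp add: V_def)
      then have "(V * cmod (F z)) powr p \<le> ((S * K) powr \<kappa> * W z powr (\<kappa> + 1)) powr p"
        using V p by (intro powr_mono2) auto
      also have "\<dots> = (S * K) powr (1 - p) * W z"
        using W[of z] \<kappa>1 by (simp add: powr_mult powr_powr)
      also have "(V * cmod (F z)) powr p = V powr p * cmod (F z) powr p"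
        using V by (simp add: powr_mult)
      finally show ?thesis using V W[of z] by (simp add: field_simps)
    qed
    have S_le: "S \<le> (K * S) powr (1 - p) / V powr p"
      unfolding S_def[of] by (rule cSUP_least) (use ineq in \<open>auto simp: S_def[symmetric]\<close>)
    \<comment> \<open>As S is a finite number, its power 1 - p cancels from S \<le> C
      S^(1-p).\<close>
    have S_fin: "S \<le> K powr \<kappa> / V"
    proof (cases "S = 0")
      case False
      then have Sp: "S > 0" using S0 by simp
      have "S powr p * S powr (1 - p) = S" using Sp by (simp flip: powr_add)
      then have "S powr p * S powr (1 - p) \<le> (K powr (1 - p) / V powr p) * S powr (1 - p)"
        using S_le K Sp by (simp add: powr_mult)
      then have "S powr p \<le> K powr (1 - p) / V powr p"
        by (rule mult_right_le_imp_le) (use Sp in simp)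
      then have "(S powr p) powr (1 / p) \<le> (K powr (1 - p) / V powr p) powr (1 / p)"
        using p by (intro powr_mono2) auto
      moreover have "(S powr p) powr (1 / p) = S" using Sp p by (simp add: powr_powr)
      moreover have "(K powr (1 - p) / V powr p) powr (1 / p) = K powr \<kappa> / V"
        using K V p by (simp add: powr_divide powr_powr \<kappa>_def)
      ultimately show ?thesis by simp
    qed (use K V in simp)
    have "cmod (F z) powr p \<le> S * W z" by (rule S_upper[OF z])
    also have "\<dots> \<le> (K powr \<kappa> / V) * W z" using S_fin W[of z] by (intro mult_right_mono) auto
    finally show ?thesis by (simp add: W_def)
  qed
  have "cmod (F z) powr p \<le> (K powr \<kappa> / V) * T z"
  proof (rule field_le_epsilon)
    fix e :: real assume e: "e > 0"
    define k where "k = K powr \<kappa> / V"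
    have k: "k > 0" using K V by (simp add: k_def)
    have "cmod (F z) powr p \<le> k * (T z + e / k)" using main[of "e / k" z] e k z by (simp add: k_def[symmetric])
    then show "cmod (F z) powr p \<le> K powr \<kappa> / V * T z + e" using k by (simp add: k_def[symmetric] algebra_simps)
  qed
  then show ?thesis by (simp add: K_def V_def s_def T_def)
qed

section \<open>The Bergman space\<close>

text \<open>A substitute for the radial maximal function of \<open>|f|\<^sup>p\<close>: it dominates \<open>|f|\<^sup>p\<close>, is essentially
  unchanged under dilation of \<open>f\<close>, and is integrable by the Forelli--Rudin estimates.\<close>

definition kernel_majorant :: "real \<Rightarrow> real \<Rightarrow> (complex ^ 'n \<Rightarrow> 'x::real_normed_vector) \<Rightarrow> complex ^ 'n \<Rightarrow> ennreal"
  where "kernel_majorant A p f z = (\<integral>\<^sup>+u. ennreal (eta A u * (norm (f u) powr p * dist1 z u powr (- (real CARD('n) + 1 + A)))) \<partial>lborel)"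

text \<open>The p-th power of the norm up to the factor \<open>nu_const\<close>, in
  \<open>ennreal\<close> so that it is meaningful before membership is known.\<close>

definition bergman_integral :: "real \<Rightarrow> real \<Rightarrow> (complex ^ 'n \<Rightarrow> 'x::real_normed_vector) \<Rightarrow> ennreal"
  where "bergman_integral \<alpha> p f = (\<integral>\<^sup>+u. ennreal (eta \<alpha> u * norm (f u) powr p) \<partial>lborel)"

lemma nn_integral_scale:
  fixes g :: "'a::euclidean_space \<Rightarrow> ennreal"
  assumes [measurable]: "g \<in> borel_measurable borel" and r: "0 < r"
  shows "(\<integral>\<^sup>+x. g x \<partial>lborel) = ennreal (r ^ DIM('a)) * (\<integral>\<^sup>+x. g (r *\<^sub>R x) \<partial>lborel)"
proof -
  have "(\<integral>\<^sup>+x. g x \<partial>lborel) = (\<integral>\<^sup>+x. g x \<partial>density (distr lborel borel (\<lambda>x. 0 + r *\<^sub>R x)) (\<lambda>_. ennreal (\<bar>r\<bar> ^ DIM('a))))"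
    using lborel_affine[of r "0 :: 'a"] r by simp
  also have "\<dots> = (\<integral>\<^sup>+x. ennreal (r ^ DIM('a)) * g (r *\<^sub>R x) \<partial>lborel)"
    using r by (subst nn_integral_density) (auto simp: nn_integral_distr)
  also have "\<dots> = ennreal (r ^ DIM('a)) * (\<integral>\<^sup>+x. g (r *\<^sub>R x) \<partial>lborel)"
    by (rule nn_integral_cmult) simp
  finally show ?thesis .
qed

lemma ennreal_integral_le:
  assumes "\<And>x. 0 \<le> f x"
  shows "ennreal (\<integral>x. f x \<partial>M) \<le> (\<integral>\<^sup>+x. ennreal (f x) \<partial>M)"
proof (cases "integrable M f")
  case True
  then show ?thesis using assms by (simp add: nn_integral_eq_integral)
qed (simp add: not_integrable_integral_eq)

lemma measurable_eta_norm_powr: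
  assumes "hol_on (ball 0 1) f"
  shows "(\<lambda>u. eta A u * norm (f u) powr p) \<in> borel_measurable borel"
proof -
  have n: "continuous_on (ball 0 1) (\<lambda>u. norm (f u))"
    by (intro continuous_intros hol_on_continuous_on[OF assms])
  then have "(\<lambda>u. indicator (ball 0 1) u *\<^sub>R norm (f u)) \<in> borel_measurable borel"
    by (intro borel_measurable_continuous_on_indicator) auto
  then have "(\<lambda>u. eta A u * (indicator (ball 0 1) u *\<^sub>R norm (f u)) powr p) \<in> borel_measurable borel"
    by measurable
  also have "(\<lambda>u. eta A u * (indicator (ball 0 1) u *\<^sub>R norm (f u)) powr p) = (\<lambda>u. eta A u * norm (f u) powr p)"
    by (auto simp: indicator_def fun_eq_iff dest: eta_nonzero)
  finally show ?thesis .
qed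

lemma measurable_kernel_majorant_integrand:
  fixes f :: "complex ^ 'n \<Rightarrow> 'x::complex_normed_space"
  assumes "hol_on (ball 0 1) f"
  shows "(\<lambda>(z, u). ennreal (eta A u * (norm (f u) powr p * dist1 z u powr r))) \<in> borel_measurable (borel \<Otimes>\<^sub>M borel)"
proof -
  note [measurable] = measurable_eta_norm_powr[OF assms, of A p]
  have "(\<lambda>(z, u). ennreal ((eta A u * norm (f u) powr p) * dist1 z u powr r)) \<in> borel_measurable (borel \<Otimes>\<^sub>M borel)"
    by measurable
  then show ?thesis by (simp add: mult.assoc)
qed

text \<open>The closed-ball estimate for dilates, with r u substituted for u in the integral. Once 1
  - r \<le> 1 - |z|, distances change by a factor at most 2, giving \<open>2 powr q\<close>; the
  Jacobian is compensated by 2 to the real dimension because r \<ge> 1/2; then r tends to 1.\<close>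

lemma majorant_scalar:
  fixes F :: "complex ^ 'n \<Rightarrow> complex"
  assumes p: "0 < p" "p \<le> 1" and A: "0 < A" and F: "hol_on (ball 0 1) F" and z: "norm z < 1"
  defines "q \<equiv> real CARD('n) + 1 + A"
  shows "ennreal (cmod (F z) powr p)
    \<le> ennreal ((8 powr q) powr ((1 - p) / p) / eta_int TYPE('n) (A + q * ((1 - p) / p)) * 2 powr q * 2 ^ DIM(complex ^ 'n))
      * kernel_majorant A p F z"
proof -
  define C where "C = (8 powr q) powr ((1 - p) / p) / eta_int TYPE('n) (A + q * ((1 - p) / p))"
  have q: "q > 0" using A by (simp add: q_def add_pos_pos)
  have C: "C > 0"
  proof -
    have "0 \<le> A + q * ((1 - p) / p)" using A q p by simp
    then show ?thesis unfolding C_def by (intro divide_pos_pos eta_int_pos integrable_eta) simp_all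
  qed
  define g where "g v = ennreal (eta A v * (cmod (F v) powr p * dist1 z v powr (- q)))" for v
  have g_meas: "g \<in> borel_measurable borel"
    using measurable_Pair2[OF measurable_kernel_majorant_integrand[OF F, of A p "- q"], of z]
    unfolding g_def by simp
  have step: "ennreal (cmod (F (rad k *\<^sub>R z)) powr p) \<le> ennreal (C * 2 powr q * 2 ^ DIM(complex ^ 'n)) * kernel_majorant A p F z"
    if k: "1 - rad k \<le> 1 - norm z" for k
  proof -
    have "cmod (F (rad k *\<^sub>R z)) powr p \<le> C * (\<integral>u. eta A u * (cmod (F (rad k *\<^sub>R u)) powr p * dist1 z u powr (- q)) \<partial>lborel)"
      unfolding C_def q_def
      by (rule majorant_closed_ball[OF p A rad(5) hol_on_dilate[OF F rad(2)] z])
    then have "ennreal (cmod (F (rad k *\<^sub>R z)) powr p)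
        \<le> ennreal (C * (\<integral>u. eta A u * (cmod (F (rad k *\<^sub>R u)) powr p * dist1 z u powr (- q)) \<partial>lborel))"
      by (rule ennreal_leI)
    also have "\<dots> = ennreal C * ennreal (\<integral>u. eta A u * (cmod (F (rad k *\<^sub>R u)) powr p * dist1 z u powr (- q)) \<partial>lborel)"
      using C by (intro ennreal_mult') simp
    also have "\<dots> \<le> ennreal C * (\<integral>\<^sup>+u. ennreal (eta A u * (cmod (F (rad k *\<^sub>R u)) powr p * dist1 z u powr (- q))) \<partial>lborel)"
      by (intro mult_left_mono ennreal_integral_le) auto
    also have "\<dots> \<le> ennreal C * (\<integral>\<^sup>+u. ennreal (2 powr q) * g (rad k *\<^sub>R u) \<partial>lborel)"
    proof (intro mult_left_mono nn_integral_mono)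
      fix u :: "complex ^ 'n"
      show "ennreal (eta A u * (cmod (F (rad k *\<^sub>R u)) powr p * dist1 z u powr (- q))) \<le> ennreal (2 powr q) * g (rad k *\<^sub>R u)"
      proof (cases "norm u < 1")
        case True
        define a where "a = cin z u"
        have a1: "cmod a \<le> 1"
          using norm_cin_le[of z u] mult_mono[of "norm z" 1 "norm u" 1] True z by (simp add: a_def)
        have d: "1 - norm z \<le> cmod (1 - a)" and dpos: "0 < dist1 z (rad k *\<^sub>R u)"
          using dist1_ge[of u z] dist1_commute[of u z] dist1_pos[of "rad k *\<^sub>R u" z] norm_rad_scale[OF True, of k]
            dist1_commute[of "rad k *\<^sub>R u" z] True z by (auto simp: a_def)
        have "dist1 z (rad k *\<^sub>R u) = cmod ((1 - a) + of_real (1 - rad k) * a)"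
          by (simp add: a_def cin_scaleR_right scaleR_conv_of_real[where 'a = complex] algebra_simps)
        also have "\<dots> \<le> cmod (1 - a) + (1 - rad k) * cmod a"
          using rad[of k] by (intro order_trans[OF norm_triangle_ineq]) (simp add: norm_mult del: of_real_diff)
        also have "(1 - rad k) * cmod a \<le> (1 - rad k) * 1" using a1 rad[of k] by (intro mult_left_mono) auto
        finally have le: "dist1 z (rad k *\<^sub>R u) / 2 \<le> dist1 z u" using d k by (simp add: a_def)
        have "dist1 z u powr (- q) \<le> (dist1 z (rad k *\<^sub>R u) / 2) powr (- q)"
          using le dpos q by (intro powr_mono2') auto
        also have "\<dots> = 2 powr q * dist1 z (rad k *\<^sub>R u) powr (- q)"
          using dpos by (intro divide_powr_minus) auto
        finally have D: "dist1 z u powr (- q) \<le> 2 powr q * dist1 z (rad k *\<^sub>R u) powr (- q)" .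
        have E: "eta A u \<le> eta A (rad k *\<^sub>R u)"
          using one_minus_norm_sq_scale[OF rad(4), of u k] one_minus_norm_sq_pos[OF True] A True norm_rad_scale[OF True, of k]
          by (simp add: eta_inside powr_mono2)
        have "eta A u * (cmod (F (rad k *\<^sub>R u)) powr p * dist1 z u powr (- q))
            \<le> eta A (rad k *\<^sub>R u) * (cmod (F (rad k *\<^sub>R u)) powr p * (2 powr q * dist1 z (rad k *\<^sub>R u) powr (- q)))"
          using D E by (intro mult_mono mult_left_mono) auto
        also have "\<dots> = 2 powr q * (eta A (rad k *\<^sub>R u) * (cmod (F (rad k *\<^sub>R u)) powr p * dist1 z (rad k *\<^sub>R u) powr (- q)))"
          by (simp only: mult_ac)
        finally show ?thesis unfolding g_def by (subst ennreal_mult[symmetric]) (auto intro: ennreal_leI)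
      qed (simp add: eta_outside)
    qed auto
    also have "\<dots> = ennreal C * (ennreal (2 powr q) * (\<integral>\<^sup>+u. g (rad k *\<^sub>R u) \<partial>lborel))"
      using measurable_compose[of "\<lambda>u. rad k *\<^sub>R u" lborel borel g] g_meas by (subst nn_integral_cmult) auto
    also have "(\<integral>\<^sup>+u. g (rad k *\<^sub>R u) \<partial>lborel) \<le> ennreal (2 ^ DIM(complex ^ 'n)) * kernel_majorant A p F z"
    proof -
      have "1 \<le> (2 * rad k) ^ DIM(complex ^ 'n)" using rad(1)[of k] by (intro one_le_power) simp
      then have "1 \<le> ennreal (2 ^ DIM(complex ^ 'n) * rad k ^ DIM(complex ^ 'n))"
        unfolding power_mult_distrib by (metis ennreal_leI ennreal_1)
      from mult_right_mono[OF this, of "\<integral>\<^sup>+u. g (rad k *\<^sub>R u) \<partial>lborel"]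
      have "(\<integral>\<^sup>+u. g (rad k *\<^sub>R u) \<partial>lborel) \<le> ennreal (2 ^ DIM(complex ^ 'n) * rad k ^ DIM(complex ^ 'n)) * (\<integral>\<^sup>+u. g (rad k *\<^sub>R u) \<partial>lborel)"
        by simp
      also have "\<dots> = ennreal (2 ^ DIM(complex ^ 'n)) * (ennreal (rad k ^ DIM(complex ^ 'n)) * (\<integral>\<^sup>+u. g (rad k *\<^sub>R u) \<partial>lborel))"
        using rad(2)[of k] by (subst ennreal_mult) (auto simp: mult.assoc)
      also have "ennreal (rad k ^ DIM(complex ^ 'n)) * (\<integral>\<^sup>+u. g (rad k *\<^sub>R u) \<partial>lborel) = (\<integral>\<^sup>+u. g u \<partial>lborel)"
        by (rule nn_integral_scale[OF g_meas rad(2), symmetric])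
      also have "\<dots> = kernel_majorant A p F z" by (simp add: kernel_majorant_def g_def q_def)
      finally show ?thesis .
    qed
    also have "ennreal C * (ennreal (2 powr q) * (ennreal (2 ^ DIM(complex ^ 'n)) * kernel_majorant A p F z))
        = ennreal (C * 2 powr q * 2 ^ DIM(complex ^ 'n)) * kernel_majorant A p F z"
      using C by (simp add: ennreal_mult mult.assoc)
    finally show ?thesis by (meson mult_left_mono order_trans zero_le)
  qed
  have "(\<lambda>k. ennreal (cmod (F (rad k *\<^sub>R z)) powr p)) \<longlonglongrightarrow> ennreal (cmod (F z) powr p)"
    using p by (intro tendsto_ennrealI tendsto_powr' tendsto_intros rad_scale_lim[OF F z]) auto
  moreover have "\<exists>N. \<forall>k\<ge>N. ennreal (cmod (F (rad k *\<^sub>R z)) powr p) \<le> ennreal (C * 2 powr q * 2 ^ DIM(complex ^ 'n)) * kernel_majorant A p F z"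
  proof -
    have "\<forall>\<^sub>F k in sequentially. norm z < rad k" using rad_lim z by (rule order_tendstoD)
    then obtain N where "\<And>k. k \<ge> N \<Longrightarrow> norm z < rad k" by (auto simp: eventually_sequentially)
    then show ?thesis using step by (intro exI[of _ N]) (auto simp: less_imp_le)
  qed
  ultimately show ?thesis unfolding C_def by (rule LIMSEQ_le_const2)
qed

lemma kernel_majorant_mono:
  fixes f :: "complex ^ 'n \<Rightarrow> 'x::real_normed_vector" and g :: "complex ^ 'n \<Rightarrow> 'y::real_normed_vector"
  assumes "\<And>u. norm u < 1 \<Longrightarrow> norm (f u) \<le> norm (g u)" "0 \<le> p"
  shows "kernel_majorant A p f z \<le> kernel_majorant A p g z"
  unfolding kernel_majorant_def
proof (intro nn_integral_mono ennreal_leI)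
  fix u :: "complex ^ 'n"
  show "eta A u * (norm (f u) powr p * dist1 z u powr (- (real CARD('n) + 1 + A)))
      \<le> eta A u * (norm (g u) powr p * dist1 z u powr (- (real CARD('n) + 1 + A)))"
    by (cases "norm u < 1")
      (use assms in \<open>auto simp: eta_outside intro!: mult_left_mono mult_right_mono powr_mono2\<close>)
qed

text \<open>The functional is chosen to norm f at the given z; composing with it does not increase
  the majorant, so the scalar constant survives.\<close>

lemma majorant:
  assumes p: "0 < p" "p \<le> 1" and A: "0 < A"
  obtains C where "C > 0" "\<And>(f :: complex ^ 'n \<Rightarrow> 'x::complex_normed_space) z.
    hol_on (ball 0 1) f \<Longrightarrow> norm z < 1 \<Longrightarrow> ennreal (norm (f z) powr p) \<le> ennreal C * kernel_majorant A p f z"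
proof -
  define q where "q = real CARD('n) + 1 + A"
  define C where "C = (8 powr q) powr ((1 - p) / p) / eta_int TYPE('n) (A + q * ((1 - p) / p)) * 2 powr q * 2 ^ DIM(complex ^ 'n)"
  have q: "q > 0" using A by (simp add: q_def add_pos_pos)
  have "0 \<le> A + q * ((1 - p) / p)" using A q p by simp
  then have C: "C > 0" unfolding C_def by (intro mult_pos_pos divide_pos_pos eta_int_pos integrable_eta) simp_all
  show thesis
  proof (rule that[OF C])
    fix f :: "complex ^ 'n \<Rightarrow> 'x" and z :: "complex ^ 'n"
    assume f: "hol_on (ball 0 1) f" and z: "norm z < 1"
    obtain u :: "'x cdual" where u: "norm u \<le> 1" "cdual_apply u (f z) = of_real (norm (f z))"
      by (rule norming_functional)
    define F where "F x = cdual_apply u (f x)" for x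
    have F: "hol_on (ball 0 1) F" unfolding F_def by (rule hol_on_cdual(1)[OF f])
    have le: "norm (F x) \<le> norm (f x)" for x
      using norm_cdual_apply[of u "f x"] mult_right_mono[OF u(1), of "norm (f x)"] by (simp add: F_def)
    have "ennreal (norm (f z) powr p) = ennreal (cmod (F z) powr p)" by (simp add: F_def u)
    also have "\<dots> \<le> ennreal C * kernel_majorant A p F z"
      unfolding C_def q_def by (rule majorant_scalar[OF p A F z])
    also have "\<dots> \<le> ennreal C * kernel_majorant A p f z" using p by (intro mult_left_mono kernel_majorant_mono le) auto
    finally show "ennreal (norm (f z) powr p) \<le> ennreal C * kernel_majorant A p f z" .
  qed
qed

text \<open>The part A - \<alpha> of the distance exponent is bounded via 1 - |u|^2 and lowers the
  weight from A to \<alpha>; the remaining n + 1 + \<alpha> is bounded via 1 - |z|^2.\<close>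

lemma kernel_majorant_le_bergman_integral:
  fixes f :: "complex ^ 'n \<Rightarrow> 'x::complex_normed_space"
  assumes f: "hol_on (ball 0 1) f" and \<alpha>: "\<alpha> > - 1" "\<alpha> \<le> A" and z: "norm z < 1"
  shows "kernel_majorant A p f z \<le> ennreal (2 powr (real CARD('n) + 1 + A) * (1 - (norm z)\<^sup>2) powr (- (real CARD('n) + 1 + \<alpha>))) * bergman_integral \<alpha> p f"
proof -
  define N where "N = real CARD('n) + 1"
  define b where "b = 1 - (norm z)\<^sup>2"
  have N: "N + \<alpha> > 0" using \<alpha> by (simp add: N_def)
  have b: "b > 0" using one_minus_norm_sq_pos[OF z] by (simp add: b_def)
  have "kernel_majorant A p f z \<le> (\<integral>\<^sup>+u. ennreal (2 powr (N + A) * b powr (- (N + \<alpha>))) * ennreal (eta \<alpha> u * norm (f u) powr p) \<partial>lborel)"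
    unfolding kernel_majorant_def N_def[symmetric]
  proof (intro nn_integral_mono)
    fix u :: "complex ^ 'n"
    show "ennreal (eta A u * (norm (f u) powr p * dist1 z u powr (- (N + A))))
      \<le> ennreal (2 powr (N + A) * b powr (- (N + \<alpha>))) * ennreal (eta \<alpha> u * norm (f u) powr p)"
    proof (cases "norm u < 1")
      case True
      define d where "d = dist1 z u"
      define a where "a = 1 - (norm u)\<^sup>2"
      have a: "a > 0" using one_minus_norm_sq_pos[OF True] by (simp add: a_def)
      have d: "a / 2 \<le> d" "b / 2 \<le> d" "0 < d"
        using dist1_ge'[of z u] dist1_ge'[of u z] dist1_commute[of z u] dist1_pos[of z u] True z
        by (auto simp: a_def b_def d_def)
      have "d powr (- (N + A)) = d powr (- (A - \<alpha>)) * d powr (- (N + \<alpha>))"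
        unfolding powr_add[symmetric] by (simp add: algebra_simps)
      also have "\<dots> \<le> (a / 2) powr (- (A - \<alpha>)) * (b / 2) powr (- (N + \<alpha>))"
        using d a b \<alpha> N by (intro mult_mono powr_mono2') auto
      also have "\<dots> = (2 powr (A - \<alpha>) * a powr (- (A - \<alpha>))) * (2 powr (N + \<alpha>) * b powr (- (N + \<alpha>)))"
        using a b by (simp only: divide_powr_minus[OF a] divide_powr_minus[OF b])
      also have "\<dots> = (2 powr (A - \<alpha>) * 2 powr (N + \<alpha>)) * a powr (- (A - \<alpha>)) * b powr (- (N + \<alpha>))"
        by (simp only: mult_ac)
      also have "2 powr (A - \<alpha>) * 2 powr (N + \<alpha>) = (2 powr (N + A) :: real)" by (simp add: add.commute flip: powr_add)
      finally have "(eta A u * norm (f u) powr p) * d powr (- (N + A))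
          \<le> (eta A u * norm (f u) powr p) * (2 powr (N + A) * a powr (- (A - \<alpha>)) * b powr (- (N + \<alpha>)))"
        by (intro mult_left_mono) auto
      also have "\<dots> = 2 powr (N + A) * b powr (- (N + \<alpha>)) * ((eta A u * a powr (- (A - \<alpha>))) * norm (f u) powr p)"
        by (simp only: mult_ac)
      also have "eta A u * a powr (- (A - \<alpha>)) = eta \<alpha> u"
        using eta_powr_mult[OF True, of A "- (A - \<alpha>)"] by (simp add: a_def)
      finally show ?thesis
        by (subst ennreal_mult[symmetric]) (auto simp: d_def mult.assoc intro!: ennreal_leI)
    qed (simp add: eta_outside)
  qed
  also have "\<dots> = ennreal (2 powr (N + A) * b powr (- (N + \<alpha>))) * bergman_integral \<alpha> p f"
    unfolding bergman_integral_def using measurable_eta_norm_powr[OF f, of \<alpha> p] by (subst nn_integral_cmult) auto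
  finally show ?thesis by (simp add: N_def b_def)
qed

text \<open>For |a| \<le> 1 and 0 \<le> r \<le> 1 one has |1 - a| \<le> 2 |1 - r a|, since |1 - r a|
  \<ge> 1 - r.\<close>

lemma kernel_majorant_dilate_le:
  fixes f :: "complex ^ 'n \<Rightarrow> 'x::complex_normed_space"
  assumes f: "hol_on (ball 0 1) f" and z: "norm z < 1" and r: "0 \<le> r" "r \<le> 1" and A: "0 < A"
  shows "kernel_majorant A p f (r *\<^sub>R z) \<le> ennreal (2 powr (real CARD('n) + 1 + A)) * kernel_majorant A p f z"
proof -
  define q where "q = real CARD('n) + 1 + A"
  have q: "q > 0" using A by (simp add: q_def add_pos_pos)
  have m: "(\<lambda>u. ennreal (eta A u * (norm (f u) powr p * dist1 z u powr (- q)))) \<in> borel_measurable borel"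
    using measurable_Pair2[OF measurable_kernel_majorant_integrand[OF f, of A p "- q"], of z] by simp
  have "kernel_majorant A p f (r *\<^sub>R z) \<le> (\<integral>\<^sup>+u. ennreal (2 powr q) * ennreal (eta A u * (norm (f u) powr p * dist1 z u powr (- q))) \<partial>lborel)"
    unfolding kernel_majorant_def q_def[symmetric]
  proof (intro nn_integral_mono)
    fix u :: "complex ^ 'n"
    show "ennreal (eta A u * (norm (f u) powr p * dist1 (r *\<^sub>R z) u powr (- q)))
      \<le> ennreal (2 powr q) * ennreal (eta A u * (norm (f u) powr p * dist1 z u powr (- q)))"
    proof (cases "norm u < 1")
      case True
      define a where "a = cin z u"
      have a1: "cmod a \<le> 1"
        using norm_cin_le[of z u] mult_mono[of "norm z" 1 "norm u" 1] True z by (simp add: a_def)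
      have dpos: "0 < cmod (1 - a)" using dist1_pos[of z u] True z by (simp add: a_def)
      have ra: "cmod (of_real r * a) \<le> r" using a1 r mult_left_mono[of "cmod a" 1 r] by (simp add: norm_mult)
      have 1: "1 - r \<le> cmod (1 - of_real r * a)"
        using norm_triangle_ineq2[of 1 "of_real r * a"] ra by simp
      have "cmod (1 - a) = cmod ((1 - of_real r * a) - of_real (1 - r) * a)" by (simp add: algebra_simps)
      also have "\<dots> \<le> cmod (1 - of_real r * a) + (1 - r) * cmod a"
        using r by (intro order_trans[OF norm_triangle_ineq4]) (simp add: norm_mult del: of_real_diff)
      also have "(1 - r) * cmod a \<le> (1 - r) * 1" using a1 r by (intro mult_left_mono) auto
      finally have "cmod (1 - a) / 2 \<le> dist1 (r *\<^sub>R z) u"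
        using 1 by (simp add: a_def cin_scaleR_left scaleR_conv_of_real[where 'a = complex])
      then have "dist1 (r *\<^sub>R z) u powr (- q) \<le> (cmod (1 - a) / 2) powr (- q)"
        using dpos q by (intro powr_mono2') auto
      also have "\<dots> = 2 powr q * dist1 z u powr (- q)"
        using dpos by (subst divide_powr_minus) (auto simp: a_def)
      finally have "(eta A u * norm (f u) powr p) * dist1 (r *\<^sub>R z) u powr (- q)
          \<le> (eta A u * norm (f u) powr p) * (2 powr q * dist1 z u powr (- q))"
        by (intro mult_left_mono) auto
      then show ?thesis by (subst ennreal_mult[symmetric]) (auto simp: mult_ac intro!: ennreal_leI)
    qed (simp add: eta_outside)
  qed
  also have "\<dots> = ennreal (2 powr q) * kernel_majorant A p f z"
    unfolding kernel_majorant_def q_def[symmetric] using m by (subst nn_integral_cmult) auto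
  finally show ?thesis by (simp add: q_def)
qed

lemma measurable_kernel_majorant:
  fixes f :: "complex ^ 'n \<Rightarrow> 'x::complex_normed_space"
  assumes f: "hol_on (ball 0 1) f"
  shows "kernel_majorant A p f \<in> borel_measurable borel"
proof -
  have "(\<lambda>z. \<integral>\<^sup>+u. (\<lambda>(z, u). ennreal (eta A u * (norm (f u) powr p * dist1 z u powr (- (real CARD('n) + 1 + A))))) (z, u) \<partial>lborel)
      \<in> borel_measurable borel"
    using measurable_kernel_majorant_integrand[OF f] by (intro lborel.borel_measurable_nn_integral_fst) simp
  then show ?thesis by (simp add: kernel_majorant_def[abs_def])
qed

text \<open>Tonelli: the inner integral over z is a Forelli-Rudin integral with t = A - \<alpha> >
  0, and its bound lowers the weight in u from A to \<alpha>.\<close>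

lemma nn_integral_eta_kernel_majorant:
  assumes \<alpha>: "\<alpha> > - 1" "\<alpha> < A"
  obtains C where "C > 0" "\<And>f :: complex ^ 'n \<Rightarrow> 'x::complex_normed_space. hol_on (ball 0 1) f \<Longrightarrow>
    (\<integral>\<^sup>+z. ennreal (eta \<alpha> z) * kernel_majorant A p f z \<partial>lborel) \<le> ennreal C * bergman_integral \<alpha> p f"
proof -
  define q where "q = real CARD('n) + 1 + A"
  obtain C where C: "C > 0" "\<And>w :: complex ^ 'n. norm w < 1 \<Longrightarrow>
      fr_int \<alpha> (real CARD('n) + 1 + \<alpha> + (A - \<alpha>)) w \<le> ennreal (C * (1 - (norm w)\<^sup>2) powr (- (A - \<alpha>)))"
    using forelli_rudin[OF \<alpha>(1), of "A - \<alpha>"] \<alpha> by auto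
  show thesis
  proof (rule that[OF C(1)])
    fix f :: "complex ^ 'n \<Rightarrow> 'x" assume f: "hol_on (ball 0 1) f"
    note [measurable] = measurable_kernel_majorant_integrand[OF f, of A p "- q"] measurable_eta_norm_powr[OF f]
    have "(\<integral>\<^sup>+z. ennreal (eta \<alpha> z) * kernel_majorant A p f z \<partial>lborel)
        = (\<integral>\<^sup>+z. (\<integral>\<^sup>+u. ennreal (eta \<alpha> z) * ennreal (eta A u * (norm (f u) powr p * dist1 z u powr (- q))) \<partial>lborel) \<partial>lborel)"
      unfolding kernel_majorant_def q_def[symmetric]
      using measurable_Pair2[OF measurable_kernel_majorant_integrand[OF f, of A p "- q"]]
      by (intro nn_integral_cong nn_integral_cmult[symmetric]) simp
    also have "\<dots> = (\<integral>\<^sup>+u. (\<integral>\<^sup>+z. ennreal (eta \<alpha> z) * ennreal (eta A u * (norm (f u) powr p * dist1 z u powr (- q))) \<partial>lborel) \<partial>lborel)"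
    proof (rule lborel_pair.Fubini'[symmetric])
      have "(\<lambda>x. ennreal (eta \<alpha> (fst x)) * (case x of (z, u) \<Rightarrow> ennreal (eta A u * (norm (f u) powr p * dist1 z u powr (- q)))))
         \<in> borel_measurable (borel \<Otimes>\<^sub>M borel)" by measurable
      then show "(\<lambda>(z, u). ennreal (eta \<alpha> z) * ennreal (eta A u * (norm (f u) powr p * dist1 z u powr (- q))))
         \<in> borel_measurable (lborel \<Otimes>\<^sub>M lborel)" by (simp add: case_prod_beta')
    qed
    also have "\<dots> \<le> (\<integral>\<^sup>+u. ennreal C * ennreal (eta \<alpha> u * norm (f u) powr p) \<partial>lborel)"
    proof (intro nn_integral_mono)
      fix u :: "complex ^ 'n"
      show "(\<integral>\<^sup>+z. ennreal (eta \<alpha> z) * ennreal (eta A u * (norm (f u) powr p * dist1 z u powr (- q))) \<partial>lborel)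
          \<le> ennreal C * ennreal (eta \<alpha> u * norm (f u) powr p)"
      proof (cases "norm u < 1")
        case True
        have e: "real CARD('n) + 1 + \<alpha> + (A - \<alpha>) = q" by (simp add: q_def)
        have "(\<integral>\<^sup>+z. ennreal (eta \<alpha> z) * ennreal (eta A u * (norm (f u) powr p * dist1 z u powr (- q))) \<partial>lborel)
            = (\<integral>\<^sup>+z. ennreal (eta A u * norm (f u) powr p) * ennreal (eta \<alpha> z * dist1 z u powr (- q)) \<partial>lborel)"
          by (intro nn_integral_cong) (simp add: mult_ac flip: ennreal_mult)
        also have "\<dots> = ennreal (eta A u * norm (f u) powr p) * fr_int \<alpha> q u"
          unfolding fr_int_def by (subst nn_integral_cmult) auto
        also have "\<dots> \<le> ennreal (eta A u * norm (f u) powr p) * ennreal (C * (1 - (norm u)\<^sup>2) powr (- (A - \<alpha>)))"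
          using C(2)[OF True] unfolding e by (intro mult_left_mono) auto
        also have "\<dots> = ennreal (C * ((eta A u * (1 - (norm u)\<^sup>2) powr (- (A - \<alpha>))) * norm (f u) powr p))"
          using C(1) by (subst ennreal_mult[symmetric]) (auto simp: mult_ac)
        also have "eta A u * (1 - (norm u)\<^sup>2) powr (- (A - \<alpha>)) = eta \<alpha> u"
          using eta_powr_mult[OF True, of A "- (A - \<alpha>)"] by simp
        also have "ennreal (C * (eta \<alpha> u * norm (f u) powr p)) = ennreal C * ennreal (eta \<alpha> u * norm (f u) powr p)"
          using C(1) by (intro ennreal_mult') simp
        finally show ?thesis .
      qed (simp add: eta_outside)
    qed
    also have "\<dots> = ennreal C * bergman_integral \<alpha> p f"
      unfolding bergman_integral_def using measurable_eta_norm_powr[OF f, of \<alpha> p] by (subst nn_integral_cmult) auto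
    finally show "(\<integral>\<^sup>+z. ennreal (eta \<alpha> z) * kernel_majorant A p f z \<partial>lborel) \<le> ennreal C * bergman_integral \<alpha> p f" .
  qed
qed


section \<open>The measure \<open>nu_alpha\<close> as a weighted Lebesgue measure\<close>

definition nu_const :: "'n::finite itself \<Rightarrow> real \<Rightarrow> real"
  where "nu_const t \<alpha> = c_alpha CARD('n) \<alpha> / measure lborel (ball (0 :: complex ^ 'n) 1)"

lemma measure_ball_pos: "0 < measure lborel (ball (0 :: complex ^ 'n) 1)"
  using content_ball_pos[of 1 "0 :: complex ^ 'n"] by simp

lemma nu_const_pos: "\<alpha> > - 1 \<Longrightarrow> nu_const TYPE('n::finite) \<alpha> > 0"
  unfolding nu_const_def c_alpha_def using of_nat_0_le_iff[of "CARD('n)", where 'a = real]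
  by (intro divide_pos_pos mult_pos_pos Gamma_real_pos measure_ball_pos) (simp_all, linarith?)

lemma nu_alpha_eq:
  assumes \<alpha>: "\<alpha> > - 1"
  shows "(nu_alpha \<alpha> :: (complex ^ 'n) measure) = density lborel (\<lambda>z. ennreal (nu_const TYPE('n) \<alpha> * eta \<alpha> z))"
proof -
  define v where "v = measure lborel (ball (0 :: complex ^ 'n) 1)"
  have v: "0 < v" "emeasure lborel (ball (0 :: complex ^ 'n) 1) = ennreal v"
    using measure_ball_pos emeasure_eq_ennreal_measure[of lborel "ball (0 :: complex ^ 'n) 1"]
      emeasure_bounded_finite[of "ball (0 :: complex ^ 'n) 1"] by (auto simp: v_def)
  have c: "c_alpha CARD('n) \<alpha> > 0"
    using nu_const_pos[OF \<alpha>, where 'n = 'n] v(1) by (simp add: nu_const_def v_def zero_less_divide_iff)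
  have [measurable]: "ball (0 :: complex ^ 'n) 1 \<in> sets borel" by simp
  have "(nu_alpha \<alpha> :: (complex ^ 'n) measure) = density lborel (\<lambda>z. indicator (ball 0 1) z / ennreal v *
      ennreal (c_alpha CARD('n) \<alpha> * (1 - (norm z)\<^sup>2) powr \<alpha>))"
    unfolding nu_alpha_def nu_def uniform_measure_def v(2) by (rule density_density_eq; measurable)
  also have "\<dots> = density lborel (\<lambda>z. ennreal (nu_const TYPE('n) \<alpha> * eta \<alpha> z))"
  proof (intro density_cong AE_I2)
    fix z :: "complex ^ 'n"
    show "indicator (ball 0 1) z / ennreal v * ennreal (c_alpha CARD('n) \<alpha> * (1 - (norm z)\<^sup>2) powr \<alpha>)
      = ennreal (nu_const TYPE('n) \<alpha> * eta \<alpha> z)"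
    proof (cases "norm z < 1")
      case True
      have "indicator (ball 0 1) z / ennreal v = ennreal (1 / v)"
        using True v(1) divide_ennreal[of 1 v] by simp
      then show ?thesis
        using True v(1) c by (simp add: eta_inside nu_const_def v_def[symmetric] flip: ennreal_mult)
    qed (simp add: eta_outside)
  qed measurable
  finally show ?thesis .
qed

lemma nu_alpha_integral:
  fixes h :: "complex ^ 'n \<Rightarrow> 'b::{banach, second_countable_topology}"
  assumes \<alpha>: "\<alpha> > - 1" and h: "continuous_on (ball 0 1) h"
  shows "set_integrable (nu_alpha \<alpha>) (ball 0 1) h \<longleftrightarrow> integrable lborel (\<lambda>z. eta \<alpha> z *\<^sub>R h z)"
    and "(LINT z:ball 0 1|nu_alpha \<alpha>. h z) = nu_const TYPE('n) \<alpha> *\<^sub>R (\<integral>z. eta \<alpha> z *\<^sub>R h z \<partial>lborel)"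
proof -
  have m: "(\<lambda>z. indicator (ball 0 1) z *\<^sub>R h z) \<in> borel_measurable lborel"
    using borel_measurable_continuous_on_indicator[OF _ h] by simp
  have k: "nu_const TYPE('n) \<alpha> > 0" by (rule nu_const_pos[OF \<alpha>])
  have e: "(nu_const TYPE('n) \<alpha> * eta \<alpha> z) *\<^sub>R (indicator (ball 0 1) z *\<^sub>R h z) = nu_const TYPE('n) \<alpha> *\<^sub>R (eta \<alpha> z *\<^sub>R h z)"
    for z by (auto simp: indicator_def dest: eta_nonzero)
  have "set_integrable (nu_alpha \<alpha>) (ball 0 1) h \<longleftrightarrow>
      integrable lborel (\<lambda>z. (nu_const TYPE('n) \<alpha> * eta \<alpha> z) *\<^sub>R (indicator (ball 0 1) z *\<^sub>R h z))"
    unfolding set_integrable_def nu_alpha_eq[OF \<alpha>] using k m by (intro integrable_density) auto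
  also have "\<dots> \<longleftrightarrow> integrable lborel (\<lambda>z. eta \<alpha> z *\<^sub>R h z)"
  proof
    assume "integrable lborel (\<lambda>z. (nu_const TYPE('n) \<alpha> * eta \<alpha> z) *\<^sub>R (indicator (ball 0 1) z *\<^sub>R h z))"
    from integrable_scaleR_right[OF this[unfolded e], of "inverse (nu_const TYPE('n) \<alpha>)"]
    show "integrable lborel (\<lambda>z. eta \<alpha> z *\<^sub>R h z)" using k by (simp add: mult.assoc[symmetric])
  next
    assume "integrable lborel (\<lambda>z. eta \<alpha> z *\<^sub>R h z)"
    then show "integrable lborel (\<lambda>z. (nu_const TYPE('n) \<alpha> * eta \<alpha> z) *\<^sub>R (indicator (ball 0 1) z *\<^sub>R h z))"
      unfolding e by (rule integrable_scaleR_right)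
  qed
  finally show "set_integrable (nu_alpha \<alpha>) (ball 0 1) h \<longleftrightarrow> integrable lborel (\<lambda>z. eta \<alpha> z *\<^sub>R h z)" .
  have "(LINT z:ball 0 1|nu_alpha \<alpha>. h z) = (\<integral>z. (nu_const TYPE('n) \<alpha> * eta \<alpha> z) *\<^sub>R (indicator (ball 0 1) z *\<^sub>R h z) \<partial>lborel)"
    unfolding set_lebesgue_integral_def nu_alpha_eq[OF \<alpha>] using k m by (intro integral_density) auto
  then show "(LINT z:ball 0 1|nu_alpha \<alpha>. h z) = nu_const TYPE('n) \<alpha> *\<^sub>R (\<integral>z. eta \<alpha> z *\<^sub>R h z \<partial>lborel)"
    unfolding e by (simp del: scaleR_scaleR)
qed

lemma bergman_iff:
  fixes f :: "complex ^ 'n \<Rightarrow> 'x::complex_normed_space"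
  assumes \<alpha>: "\<alpha> > - 1" and p: "0 < p"
  shows "f \<in> bergman p \<alpha> \<longleftrightarrow> hol_on (ball 0 1) f \<and> bergman_integral \<alpha> p f < \<infinity>"
proof (cases "hol_on (ball 0 1) f")
  case True
  have c: "continuous_on (ball 0 1) (\<lambda>z. norm (f z) powr p)"
    using p by (intro continuous_on_powr' continuous_intros hol_on_continuous_on[OF True]) auto
  have "integrable lborel (\<lambda>z. eta \<alpha> z * norm (f z) powr p) \<longleftrightarrow> bergman_integral \<alpha> p f < \<infinity>"
    unfolding bergman_integral_def integrable_iff_bounded
    using measurable_eta_norm_powr[OF True, of \<alpha> p] by simp
  then show ?thesis using True nu_alpha_integral(1)[OF \<alpha> c] by (simp add: bergman_def hol_ball_iff)
qed (simp add: bergman_def hol_ball_iff)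

lemma bergman_norm_eq:
  fixes f :: "complex ^ 'n \<Rightarrow> 'x::complex_normed_space"
  assumes \<alpha>: "\<alpha> > - 1" and p: "0 < p" and f: "f \<in> bergman p \<alpha>"
  shows "bergman_norm p \<alpha> f = (nu_const TYPE('n) \<alpha> * enn2real (bergman_integral \<alpha> p f)) powr (1 / p)"
    and "bergman_integral \<alpha> p f = ennreal (bergman_norm p \<alpha> f powr p / nu_const TYPE('n) \<alpha>)"
proof -
  have hol: "hol_on (ball 0 1) f" and fin: "bergman_integral \<alpha> p f < \<infinity>" using f bergman_iff[OF \<alpha> p] by auto
  have c: "continuous_on (ball 0 1) (\<lambda>z. norm (f z) powr p)"
    using p by (intro continuous_on_powr' continuous_intros hol_on_continuous_on[OF hol]) auto
  have "(\<integral>z. eta \<alpha> z * norm (f z) powr p \<partial>lborel) = enn2real (bergman_integral \<alpha> p f)"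
    unfolding bergman_integral_def using measurable_eta_norm_powr[OF hol, of \<alpha> p] by (intro integral_eq_nn_integral) auto
  then show 1: "bergman_norm p \<alpha> f = (nu_const TYPE('n) \<alpha> * enn2real (bergman_integral \<alpha> p f)) powr (1 / p)"
    unfolding bergman_norm_def nu_alpha_integral(2)[OF \<alpha> c] by simp
  have k: "nu_const TYPE('n) \<alpha> > 0" by (rule nu_const_pos[OF \<alpha>])
  have "bergman_norm p \<alpha> f powr p = nu_const TYPE('n) \<alpha> * enn2real (bergman_integral \<alpha> p f)"
    unfolding 1 using p k by (simp add: powr_powr)
  then have "bergman_norm p \<alpha> f powr p / nu_const TYPE('n) \<alpha> = enn2real (bergman_integral \<alpha> p f)" using k by simp
  then show "bergman_integral \<alpha> p f = ennreal (bergman_norm p \<alpha> f powr p / nu_const TYPE('n) \<alpha>)"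
    using fin by simp
qed

section \<open>Growth of iterated radial derivatives\<close>

text \<open>The constant M is explicit so that the estimates below can be linear in it; uniformity
  in the function is what the equivalence of norms needs.\<close>

definition grow :: "real \<Rightarrow> real \<Rightarrow> (complex ^ 'n \<Rightarrow> 'x::real_normed_vector) \<Rightarrow> bool"
  where "grow b M u \<longleftrightarrow> (\<forall>z. norm z < 1 \<longrightarrow> norm (u z) \<le> M * (1 - (norm z)\<^sup>2) powr (- b))"

lemma growD: "grow b M u \<Longrightarrow> norm z < 1 \<Longrightarrow> norm (u z) \<le> M * (1 - (norm z)\<^sup>2) powr (- b)"
  by (simp add: grow_def)

lemma grow_nonneg: "grow b M u \<Longrightarrow> 0 \<le> M"
  using growD[of b M u 0] order_trans[OF norm_ge_zero] by force

lemma grow_at_0: "grow b M u \<Longrightarrow> norm (u 0) \<le> M"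
  using growD[of b M u 0] by simp

lemma grow_mono: "grow b M u \<Longrightarrow> M \<le> M' \<Longrightarrow> grow b M' u"
  unfolding grow_def by (meson mult_right_mono order_trans powr_ge_zero)

lemma grow_cong: "(\<And>z. norm z < 1 \<Longrightarrow> u z = v z) \<Longrightarrow> grow b M u \<longleftrightarrow> grow b M v"
  unfolding grow_def by auto

lemma powr_minus_mono:
  fixes x :: real
  assumes "0 < x" "x \<le> 1" "b \<le> b'"
  shows "x powr (- b) \<le> x powr (- b')"
  using assms by (simp add: powr_mono')

lemma norm_sq_le_norm: "norm z \<le> 1 \<Longrightarrow> (norm z)\<^sup>2 \<le> norm z" for z :: "'a::real_normed_vector"
  by (simp add: power2_eq_square mult_left_le_one_le)

text \<open>Cauchy estimate on the disc of radius (1 - |z|)/2 in direction z, along which 1 minus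
  the squared norm stays above (1 - |z|^2)/4. Dividing by the radius, itself at least (1 - |z|^2)/4,
  costs one more exponent.\<close>

lemma grow_radial_deriv:
  fixes u :: "complex ^ 'n \<Rightarrow> 'x::complex_banach"
  assumes u: "hol_on (ball 0 1) u" and g: "grow b M u" and b: "0 \<le> b"
  shows "grow (b + 1) (4 powr (b + 1) * M) (radial_deriv u)"
  unfolding grow_def
proof (intro allI impI)
  fix z :: "complex ^ 'n" assume z: "norm z < 1"
  define y where "y = 1 - (norm z)\<^sup>2"
  have y: "0 < y" "y / 2 \<le> 1 - norm z"
    using one_minus_norm_sq_pos[OF z] half_le_one_minus_norm[of z] z by (auto simp: y_def)
  have M: "0 \<le> M" by (rule grow_nonneg[OF g])
  define r where "r = (1 - norm z) / 2"
  have r: "0 < r" "y / 4 \<le> r" using z y by (auto simp: r_def)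
  have in_ball: "norm (z + l *s z) \<le> 1 - r" if "cmod l \<le> r" for l
  proof -
    have "norm (l *s z) \<le> r * 1"
      using that z r mult_mono[of "cmod l" r "norm z" 1] by (simp add: norm_vector_scalar_mult)
    moreover have "1 - r = norm z + r" by (simp add: r_def field_simps)
    ultimately show ?thesis using norm_triangle_ineq[of z "l *s z"] by linarith
  qed
  have bound: "norm (u (z + l *s z)) \<le> M * (y / 4) powr (- b)" if l: "cmod l \<le> r" for l
  proof -
    have n: "norm (z + l *s z) < 1" using in_ball[OF l] r by linarith
    have "y / 4 \<le> 1 - (norm (z + l *s z))\<^sup>2"
      using norm_sq_le_norm[of "z + l *s z"] in_ball[OF l] n r by linarith
    then have "M * (1 - (norm (z + l *s z))\<^sup>2) powr (- b) \<le> M * (y / 4) powr (- b)"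
      using M b y by (intro mult_left_mono powr_mono2') auto
    then show ?thesis using growD[OF g n] by linarith
  qed
  have "norm (dd u z z) \<le> M * (y / 4) powr (- b) / r"
  proof (rule cauchy_estimates(1)[OF u r(1)])
    fix l assume l: "cmod l \<le> r"
    show "z + l *s z \<in> ball 0 1" using in_ball[OF l] r by simp
    show "norm (u (z + l *s z)) \<le> M * (y / 4) powr (- b)" by (rule bound[OF l])
  qed
  also have "\<dots> \<le> M * (y / 4) powr (- b) / (y / 4)"
    using r y M by (intro divide_left_mono mult_nonneg_nonneg) auto
  also have "\<dots> = M * ((y / 4) powr (- b) * (y / 4) powr (- 1))"
  proof -
    have "(y / 4) powr (- 1) = 1 / (y / 4)" using y by (simp add: powr_minus_divide)
    then show ?thesis by (simp only: times_divide_eq_right mult_1_right mult.assoc)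
  qed
  also have "(y / 4) powr (- b) * (y / 4) powr (- 1) = (y / 4) powr (- (b + 1))"
    unfolding powr_add[symmetric] by simp
  also have "\<dots> = 4 powr (b + 1) * y powr (- (b + 1))" using y by (intro divide_powr_minus) auto
  finally show "norm (radial_deriv u z) \<le> 4 powr (b + 1) * M * (1 - (norm z)\<^sup>2) powr (- (b + 1))"
    using radial_deriv_eq[OF u, of z] z by (simp add: y_def mult_ac)
qed

definition growth_const :: "real \<Rightarrow> real"
  where "growth_const b = 2 powr b * (2 / b + 2)"

lemma growth_const_pos: "0 < b \<Longrightarrow> 0 < growth_const b"
  by (simp add: growth_const_def add_pos_pos)

text \<open>Integrating (1 - t x)^(-(b+1)) in t loses a factor 1/x, harmful for small x. Hence the
  comparison function \<psi>: its first term works for x \<ge> 1/2 through 1 \<le> 2x, its linear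
  term for x < 1/2, where the integrand is at most 2^(b+1). This is the origin of the two terms of
  \<open>growth_const\<close>.\<close>

lemma path_growth:
  fixes \<phi> :: "real \<Rightarrow> 'x::real_normed_vector"
  assumes b: "0 < b" and x: "0 \<le> x" "x < 1" and M: "0 \<le> M" and cont: "continuous_on {0..1} \<phi>"
    and d: "\<And>t. 0 < t \<Longrightarrow> t < 1 \<Longrightarrow> (\<phi> has_vector_derivative \<phi>' t) (at t)"
    and le: "\<And>t. 0 < t \<Longrightarrow> t < 1 \<Longrightarrow> norm (\<phi>' t) \<le> M * (1 - t * x) powr (- (b + 1))"
  shows "norm (\<phi> 1 - \<phi> 0) \<le> growth_const b * M * (1 - x\<^sup>2) powr (- b)"
proof -
  have pos: "0 < 1 - t * x" if "0 \<le> t" "t \<le> 1" for t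
    using mult_right_mono[of t 1 x] that x by auto
  define \<psi> where "\<psi> t = M * (2 / b * (1 - t * x) powr (- b) + 2 powr (b + 1) * t)" for t
  define \<psi>' where "\<psi>' t = M * (2 * x * (1 - t * x) powr (- (b + 1)) + 2 powr (b + 1))" for t
  have "norm (\<phi> 1 - \<phi> 0) \<le> \<psi> 1 - \<psi> 0"
  proof (rule differentiable_bound_general[OF _ cont])
    show "continuous_on {0..1} \<psi>"
      unfolding \<psi>_def using pos by (intro continuous_intros) (auto simp: less_imp_neq[symmetric])
    fix t :: real assume t: "0 < t" "t < 1"
    show "(\<phi> has_vector_derivative \<phi>' t) (at t)" by (rule d[OF t])
    have p: "0 < 1 - t * x" using pos[of t] t by simp
    have "((\<lambda>t. (1 - t * x) powr (- b)) has_real_derivative (- b * (1 - t * x) powr (- b - 1)) * (- x)) (at t)"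
      by (rule DERIV_chain2[where f = "\<lambda>t. t powr (- b)" and g = "\<lambda>t. 1 - t * x", OF has_real_derivative_powr[OF p]])
        (auto intro!: derivative_eq_intros)
    then have "(\<psi> has_real_derivative M * (2 / b * ((- b * (1 - t * x) powr (- b - 1)) * (- x)) + 2 powr (b + 1))) (at t)"
      unfolding \<psi>_def by (intro DERIV_cmult DERIV_add DERIV_cmult_Id)
    also have "M * (2 / b * ((- b * (1 - t * x) powr (- b - 1)) * (- x)) + 2 powr (b + 1)) = \<psi>' t"
      using b by (simp add: \<psi>'_def)
    finally show "(\<psi> has_vector_derivative \<psi>' t) (at t)"
      by (simp add: has_real_derivative_iff_has_vector_derivative)
    have "(1 - t * x) powr (- (b + 1)) \<le> 2 * x * (1 - t * x) powr (- (b + 1)) + 2 powr (b + 1)"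
    proof (cases "1 / 2 \<le> x")
      case True
      then have "1 * (1 - t * x) powr (- (b + 1)) \<le> (2 * x) * (1 - t * x) powr (- (b + 1))"
        by (intro mult_right_mono) auto
      then show ?thesis by (simp add: add_increasing2)
    next
      case False
      have "t * x \<le> 1 * (1 / 2)" using False t x by (intro mult_mono) auto
      then have "(1 - t * x) powr (- (b + 1)) \<le> (1 / 2) powr (- (b + 1))"
        using b by (intro powr_mono2') auto
      also have "\<dots> = 2 powr (b + 1)" using divide_powr_minus[of 1 2 "b + 1"] by simp
      finally show ?thesis using x by (simp add: add_increasing)
    qed
    then show "norm (\<phi>' t) \<le> \<psi>' t"
      using le[OF t] M unfolding \<psi>'_def by (meson mult_left_mono order_trans)
  qed simp
  also have "\<dots> \<le> M * (2 / b * (1 - x) powr (- b) + 2 powr (b + 1))"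
    using M b by (simp add: \<psi>_def algebra_simps)
  also have "\<dots> \<le> M * (2 / b * (2 powr b * (1 - x\<^sup>2) powr (- b)) + 2 powr (b + 1) * (1 - x\<^sup>2) powr (- b))"
  proof -
    have y: "0 < 1 - x\<^sup>2" "(1 - x\<^sup>2) / 2 \<le> 1 - x"
      using one_minus_norm_sq_pos[of x] half_le_one_minus_norm[of x] x by auto
    have "(1 - x) powr (- b) \<le> ((1 - x\<^sup>2) / 2) powr (- b)" using y b by (intro powr_mono2') auto
    also have "\<dots> = 2 powr b * (1 - x\<^sup>2) powr (- b)" using y by (intro divide_powr_minus) auto
    finally have 1: "(1 - x) powr (- b) \<le> 2 powr b * (1 - x\<^sup>2) powr (- b)" .
    have "1 \<le> (1 - x\<^sup>2) powr (- b)" using powr_minus_mono[of "1 - x\<^sup>2" 0 b] y b by simp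
    then have "2 powr (b + 1) * 1 \<le> 2 powr (b + 1) * (1 - x\<^sup>2) powr (- b)" by (intro mult_left_mono) auto
    with 1 show ?thesis using M b by (intro mult_left_mono add_mono) auto
  qed
  also have "\<dots> = growth_const b * M * (1 - x\<^sup>2) powr (- b)" by (simp add: growth_const_def powr_add algebra_simps)
  finally show ?thesis .
qed

lemma radial_path:
  assumes u: "hol_on (ball 0 1) u" and z: "norm z < 1" and t: "0 \<le> t" "t \<le> 1"
  shows "((\<lambda>t. u (t *\<^sub>R z)) has_vector_derivative dd u z (t *\<^sub>R z)) (at t)"
    "radial_deriv u (t *\<^sub>R z) = t *\<^sub>R dd u z (t *\<^sub>R z)" "norm (t *\<^sub>R z) < 1"
proof -
  show n: "norm (t *\<^sub>R z) < 1" using mult_right_mono[of t 1 "norm z"] t z by simp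
  then have tz: "t *\<^sub>R z \<in> ball 0 1" by simp
  have "((\<lambda>t. u (t *\<^sub>R z)) has_derivative (\<lambda>h. dd u (h *\<^sub>R z) (t *\<^sub>R z))) (at t)"
    by (rule has_derivative_compose[where g = u and f = "\<lambda>t. t *\<^sub>R z", OF _ hol_on_has_derivative[OF u tz]])
      (auto intro!: derivative_eq_intros)
  then show "((\<lambda>t. u (t *\<^sub>R z)) has_vector_derivative dd u z (t *\<^sub>R z)) (at t)"
    by (simp add: has_vector_derivative_def linear_cmul[OF dd_linear[OF u tz]])
  show "radial_deriv u (t *\<^sub>R z) = t *\<^sub>R dd u z (t *\<^sub>R z)"
    using radial_deriv_eq[OF u tz] by (simp add: linear_cmul[OF dd_linear[OF u tz]])
qed

lemma growth_along_path:
  assumes g: "grow (b + 1) M v" and b: "0 < b" and z: "norm z < 1" and t: "0 \<le> t" "t \<le> 1"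
  shows "norm (v (t *\<^sub>R z)) \<le> M * (1 - t * norm z) powr (- (b + 1))"
proof -
  have tz: "norm (t *\<^sub>R z) < 1" using mult_right_mono[of t 1 "norm z"] t z by simp
  have "norm (v (t *\<^sub>R z)) \<le> M * (1 - (norm (t *\<^sub>R z))\<^sup>2) powr (- (b + 1))" by (rule growD[OF g tz])
  also have "\<dots> \<le> M * (1 - t * norm z) powr (- (b + 1))"
    using norm_sq_le_norm[of "t *\<^sub>R z"] tz t b grow_nonneg[OF g]
    by (intro mult_left_mono powr_mono2') auto
  finally show ?thesis .
qed

text \<open>Integrating factor: d/dt (t^j u(t z)) = t^(j-1) (j u + N u)(t z). Since j \<ge> 1, the
  boundary term at t = 0 vanishes.\<close>

lemma grow_euler_inverse:
  fixes u :: "complex ^ 'n \<Rightarrow> 'x::complex_banach"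
  assumes u: "hol_on (ball 0 1) u" and b: "0 < b" and j: "1 \<le> j"
    and g: "grow (b + 1) M (\<lambda>z. real j *\<^sub>R u z + radial_deriv u z)"
  shows "grow b (growth_const b * M) u"
  unfolding grow_def
proof (intro allI impI)
  fix z :: "complex ^ 'n" assume z: "norm z < 1"
  let ?v = "\<lambda>z. real j *\<^sub>R u z + radial_deriv u z"
  define \<phi> where "\<phi> t = (t ^ j) *\<^sub>R u (t *\<^sub>R z)" for t
  have d: "(\<phi> has_vector_derivative (t ^ (j - 1)) *\<^sub>R ?v (t *\<^sub>R z)) (at t)" if "0 \<le> t" "t \<le> 1" for t
  proof -
    have "(\<phi> has_vector_derivative (t ^ j) *\<^sub>R dd u z (t *\<^sub>R z) + (real j * t ^ (j - 1)) *\<^sub>R u (t *\<^sub>R z)) (at t)"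
      unfolding \<phi>_def
      by (rule has_vector_derivative_scaleR[OF _ radial_path(1)[OF u z that]])
        (auto intro!: derivative_eq_intros)
    moreover have "t ^ j = t ^ (j - 1) * t" using j by (simp add: power_eq_if)
    ultimately show ?thesis
      by (simp add: radial_path(2)[OF u z that] scaleR_add_right mult.commute add.commute)
  qed
  have "norm (\<phi> 1 - \<phi> 0) \<le> growth_const b * M * (1 - (norm z)\<^sup>2) powr (- b)"
  proof (rule path_growth[OF b norm_ge_zero z grow_nonneg[OF g]])
    show "continuous_on {0..1} \<phi>"
      by (intro continuous_at_imp_continuous_on ballI has_vector_derivative_continuous[OF d]) auto
    fix t :: real assume t: "0 < t" "t < 1"
    show "(\<phi> has_vector_derivative (t ^ (j - 1)) *\<^sub>R ?v (t *\<^sub>R z)) (at t)" using d t by simp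
    have "norm ((t ^ (j - 1)) *\<^sub>R ?v (t *\<^sub>R z)) \<le> norm (?v (t *\<^sub>R z))"
      using t power_le_one[of t "j - 1"] by (simp add: mult_left_le_one_le)
    also have "\<dots> \<le> M * (1 - t * norm z) powr (- (b + 1))" using growth_along_path[OF g b z] t by simp
    finally show "norm ((t ^ (j - 1)) *\<^sub>R ?v (t *\<^sub>R z)) \<le> M * (1 - t * norm z) powr (- (b + 1))" .
  qed
  then show "norm (u z) \<le> growth_const b * M * (1 - (norm z)\<^sup>2) powr (- b)"
    using j by (simp add: \<phi>_def zero_power)
qed

text \<open>Without a term j u, the derivative of u(t z) in t is N u(t z)/t, apparently singular at
  t = 0; it is harmless because N u vanishes at the origin. The boundary term at t = 0 contributes
  \<open>norm (u 0)\<close>.\<close>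

lemma grow_radial_inverse:
  fixes u :: "complex ^ 'n \<Rightarrow> 'x::complex_banach"
  assumes u: "hol_on (ball 0 1) u" and b: "0 < b" and g: "grow (b + 1) M (radial_deriv u)"
  shows "grow b (growth_const b * (4 powr (b + 3) * M) + norm (u 0)) u"
  unfolding grow_def
proof (intro allI impI)
  fix z :: "complex ^ 'n" assume z: "norm z < 1"
  define v where "v = radial_deriv u"
  have v: "hol_on (ball 0 1) v" unfolding v_def by (rule hol_on_radial_deriv[OF open_ball u])
  have M: "0 \<le> M" by (rule grow_nonneg[OF g])
  have v0: "v 0 = 0" using radial_path(2)[OF u, of 0 0] by (simp add: v_def)
  \<comment> \<open>Quantitative vanishing at 0: on |y| \<le> 1/2 the derivative of v along the
    segment is bounded by Cauchy estimates on discs within norm 3/4.\<close>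
  have v_small: "norm (v y) \<le> 4 powr (b + 2) * M * norm y" if y: "norm y \<le> 1 / 2" for y
  proof (cases "y = 0")
    case False
    have y1: "norm y < 1" using y by simp
    have d: "norm (dd v y (s *\<^sub>R y)) \<le> 4 powr (b + 2) * M * norm y" if s: "0 \<le> s" "s \<le> 1" for s
    proof -
      have n34: "norm (s *\<^sub>R y + l *s y) \<le> 3 / 4" if "cmod l \<le> 1 / (4 * norm y)" for l
      proof -
        have "norm (s *\<^sub>R y) \<le> 1 * (1 / 2)" using s y mult_mono[of s 1 "norm y" "1 / 2"] by simp
        moreover have "norm (l *s y) \<le> 1 / 4"
          using that False by (simp add: norm_vector_scalar_mult field_simps)
        ultimately show ?thesis using norm_triangle_ineq[of "s *\<^sub>R y" "l *s y"] by linarith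
      qed
      have "norm (dd v y (s *\<^sub>R y)) \<le> (4 powr (b + 1) * M) / (1 / (4 * norm y))"
      proof (rule cauchy_estimates(1)[OF v])
        fix l assume l: "cmod l \<le> 1 / (4 * norm y)"
        then have w: "norm (s *\<^sub>R y + l *s y) \<le> 3 / 4" by (rule n34)
        then show "s *\<^sub>R y + l *s y \<in> ball 0 1" by simp
        have "norm (v (s *\<^sub>R y + l *s y)) \<le> M * (1 - (norm (s *\<^sub>R y + l *s y))\<^sup>2) powr (- (b + 1))"
          unfolding v_def by (rule growD[OF g]) (use w in simp)
        also have "\<dots> \<le> M * (1 / 4) powr (- (b + 1))"
          using norm_sq_le_norm[of "s *\<^sub>R y + l *s y"] w b M by (intro mult_left_mono powr_mono2') auto
        also have "(1 / 4) powr (- (b + 1)) = (4 :: real) powr (b + 1)" using divide_powr_minus[of 1 4 "b + 1"] by simp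
        finally show "norm (v (s *\<^sub>R y + l *s y)) \<le> 4 powr (b + 1) * M" by (simp add: mult.commute)
      qed (use False in simp)
      also have "\<dots> = (4 powr (b + 1) * 4 powr 1) * M * norm y" by simp
      also have "4 powr (b + 1) * 4 powr 1 = (4 :: real) powr (b + 2)" by (simp only: flip: powr_add) (simp add: add.assoc)
      finally show ?thesis .
    qed
    have "norm (v (1 *\<^sub>R y) - v (0 *\<^sub>R y)) \<le> 4 powr (b + 2) * M * norm y * norm (1 - 0 :: real)"
    proof (rule differentiable_bound[of "{0..1}"])
      fix s :: real assume s: "s \<in> {0..1}"
      show "((\<lambda>s. v (s *\<^sub>R y)) has_derivative (\<lambda>h. h *\<^sub>R dd v y (s *\<^sub>R y))) (at s within {0..1})"
        using radial_path(1)[OF v y1, of s] s has_derivative_at_withinI by (auto simp: has_vector_derivative_def)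
      show "onorm (\<lambda>h. h *\<^sub>R dd v y (s *\<^sub>R y)) \<le> 4 powr (b + 2) * M * norm y"
        by (rule onorm_bound) (use d[of s] s M in \<open>auto simp: mult.commute[of _ "\<bar>_\<bar>"] intro!: mult_left_mono\<close>)
    qed auto
    then show ?thesis by (simp add: v0)
  qed (simp add: v0)
  define x where "x = norm z"
  have x: "0 \<le> x" "x < 1" using z by (auto simp: x_def)
  define \<phi> where "\<phi> t = u (t *\<^sub>R z)" for t
  have "norm (\<phi> 1 - \<phi> 0) \<le> growth_const b * (4 powr (b + 3) * M) * (1 - x\<^sup>2) powr (- b)"
  proof (rule path_growth[OF b x])
    show "0 \<le> 4 powr (b + 3) * M" using M by simp
    show "continuous_on {0..1} \<phi>"
      unfolding \<phi>_def
      by (intro continuous_at_imp_continuous_on ballI has_vector_derivative_continuous[OF radial_path(1)[OF u z]]) auto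
    fix t :: real assume t: "0 < t" "t < 1"
    show "(\<phi> has_vector_derivative dd u z (t *\<^sub>R z)) (at t)"
      unfolding \<phi>_def by (rule radial_path(1)[OF u z]) (use t in auto)
    have dv: "norm (dd u z (t *\<^sub>R z)) = norm (v (t *\<^sub>R z)) / t"
      using radial_path(2)[OF u z, of t] t by (simp add: v_def)
    have tx: "0 < 1 - t * x" "1 - t * x \<le> 1" using mult_strict_mono[of t 1 x 1] t x by (auto simp: mult_less_cancel_left)
    have p1: "1 \<le> (1 - t * x) powr (- (b + 1))" using powr_minus_mono[of "1 - t * x" 0 "b + 1"] tx b by simp
    have p4: "(2 :: real) \<le> 4 powr (b + 3)" "(4 :: real) powr (b + 2) \<le> 4 powr (b + 3)"
    proof -
      have "(4 :: real) powr 1 \<le> 4 powr (b + 3)" using b by (intro powr_mono) auto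
      then show "(2 :: real) \<le> 4 powr (b + 3)" by simp
    qed (simp add: powr_mono)
    \<comment> \<open>Near the origin the factor t of \<open>v_small\<close> cancels the division by
      t; otherwise t \<ge> 1/2 and this division costs at most 2.\<close>
    show "norm (dd u z (t *\<^sub>R z)) \<le> 4 powr (b + 3) * M * (1 - t * x) powr (- (b + 1))"
    proof (cases "t * x \<le> 1 / 2")
      case True
      have "norm (v (t *\<^sub>R z)) \<le> 4 powr (b + 2) * M * norm (t *\<^sub>R z)" by (rule v_small) (use True t in \<open>simp add: x_def\<close>)
      also have "\<dots> = t * (4 powr (b + 2) * M * x)" using t by (simp add: x_def)
      finally have "norm (dd u z (t *\<^sub>R z)) \<le> 4 powr (b + 2) * M * x" using t unfolding dv by (simp add: field_simps)
      also have "\<dots> \<le> 4 powr (b + 3) * M * 1" using x M p4 by (intro mult_mono) auto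
      also have "\<dots> \<le> 4 powr (b + 3) * M * (1 - t * x) powr (- (b + 1))" using M p1 by (intro mult_left_mono) auto
      finally show ?thesis .
    next
      case False
      have "t * x \<le> t * 1" using t x by (intro mult_left_mono) auto
      then have t2: "1 / 2 \<le> t" using False by linarith
      have "norm (v (t *\<^sub>R z)) / t \<le> norm (v (t *\<^sub>R z)) / (1 / 2)" using t t2 by (intro divide_left_mono) auto
      also have "\<dots> \<le> 2 * (M * (1 - t * x) powr (- (b + 1)))"
        using growth_along_path[OF g b z, of t] t by (simp add: v_def x_def)
      also have "\<dots> \<le> 4 powr (b + 3) * (M * (1 - t * x) powr (- (b + 1)))"
        using M p4 by (intro mult_right_mono) auto
      finally show ?thesis unfolding dv by (simp add: mult.assoc)
    qed
  qed
  then have "norm (u z - u 0) \<le> growth_const b * (4 powr (b + 3) * M) * (1 - (norm z)\<^sup>2) powr (- b)"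
    by (simp add: \<phi>_def x_def)
  moreover have "norm (u 0) * 1 \<le> norm (u 0) * (1 - (norm z)\<^sup>2) powr (- b)"
    using powr_minus_mono[of "1 - (norm z)\<^sup>2" 0 b] one_minus_norm_sq_pos[OF z] b by (intro mult_left_mono) auto
  moreover have "norm (u z) \<le> norm (u z - u 0) + norm (u 0)" by (metis diff_add_cancel norm_triangle_ineq)
  ultimately show "norm (u z) \<le> (growth_const b * (4 powr (b + 3) * M) + norm (u 0)) * (1 - (norm z)\<^sup>2) powr (- b)"
    by (simp add: distrib_right)
qed


section \<open>Locality and commutation of the Euler operators\<close>

lemma radial_deriv_cong:
  assumes "open S" "hol_on S u" "\<And>z. z \<in> S \<Longrightarrow> u z = v z" "z \<in> S"
  shows "radial_deriv u z = radial_deriv v z"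
proof -
  have "(v has_derivative (\<lambda>h. dd u h z)) (at z)"
    by (rule has_derivative_transform_within_open[OF hol_on_has_derivative[OF assms(2,4)] assms(1,4)])
      (use assms(3) in auto)
  then show ?thesis
    using radial_deriv_eq[OF assms(2,4)] radial_deriv_eq[OF hol_on_cong[OF assms(1-3)] assms(4)]
    by (simp add: dd_eq)
qed

abbreviation euler_op :: "nat \<Rightarrow> (complex ^ 'n \<Rightarrow> 'x::complex_normed_space) \<Rightarrow> complex ^ 'n \<Rightarrow> 'x"
  where "euler_op j f \<equiv> (\<lambda>z. real j *\<^sub>R f z + radial_deriv f z)"

lemma hol_on_euler_op:
  fixes f :: "complex ^ 'n \<Rightarrow> 'x::complex_banach"
  shows "hol_on (ball 0 1) f \<Longrightarrow> hol_on (ball 0 1) (euler_op j f)"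
  by (intro hol_on_add(1) hol_on_scaleR(1) hol_on_radial_deriv open_ball)

lemma radial_euler_commute:
  fixes f :: "complex ^ 'n \<Rightarrow> 'x::complex_banach"
  assumes f: "hol_on (ball 0 1) f" and z: "z \<in> ball 0 1"
  shows "radial_deriv (euler_op j f) z = euler_op j (radial_deriv f) z"
proof -
  note N = hol_on_radial_deriv[OF open_ball f]
  show ?thesis
    unfolding radial_deriv_eq[OF hol_on_euler_op[OF f] z] hol_on_add(2)[OF hol_on_scaleR(1)[OF f] N z]
      hol_on_scaleR(2)[OF f z] radial_deriv_eq[OF f z] radial_deriv_eq[OF N z] ..
qed

lemma hol_on_D_op:
  fixes f :: "complex ^ 'n \<Rightarrow> 'x::complex_banach"
  shows "hol_on (ball 0 1) f \<Longrightarrow> hol_on (ball 0 1) (D_op k f)"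
proof (induction k arbitrary: f)
  case (Suc k)
  show ?case unfolding D_op.simps(2) by (rule Suc.IH[OF hol_on_euler_op[OF Suc.prems]])
qed simp

lemma hol_on_radial_power:
  fixes f :: "complex ^ 'n \<Rightarrow> 'x::complex_banach"
  shows "hol_on (ball 0 1) f \<Longrightarrow> hol_on (ball 0 1) ((radial_deriv ^^ m) f)"
  by (induction m) (simp_all add: hol_on_radial_deriv)

text \<open>Functions are total with irrelevant values off the ball, so operator identities hold on
  the ball only; this congruence lets them be used under further differentiation.\<close>

lemma D_op_cong:
  fixes f g :: "complex ^ 'n \<Rightarrow> 'x::complex_banach"
  assumes "hol_on (ball 0 1) f" "\<And>z. z \<in> ball 0 1 \<Longrightarrow> f z = g z" "z \<in> ball 0 1"
  shows "D_op k f z = D_op k g z"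
  using assms
proof (induction k arbitrary: f g)
  case (Suc k)
  have "D_op k (euler_op (k + 2) f) z = D_op k (euler_op (k + 2) g) z"
  proof (rule Suc.IH[OF hol_on_euler_op[OF Suc.prems(1)] _ Suc.prems(3)])
    fix w :: "complex ^ 'n" assume w: "w \<in> ball 0 1"
    show "euler_op (k + 2) f w = euler_op (k + 2) g w"
      using Suc.prems(2)[OF w] radial_deriv_cong[OF open_ball Suc.prems(1,2) w] by simp
  qed
  then show ?case unfolding D_op.simps(2) .
qed simp

lemma radial_D_op_commute:
  fixes f :: "complex ^ 'n \<Rightarrow> 'x::complex_banach"
  assumes "hol_on (ball 0 1) f" "z \<in> ball 0 1"
  shows "radial_deriv (D_op k f) z = D_op k (radial_deriv f) z"
  using assms
proof (induction k arbitrary: f)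
  case (Suc k)
  note E = hol_on_euler_op[OF Suc.prems(1), of "k + 2"]
  have "radial_deriv (D_op k (euler_op (k + 2) f)) z = D_op k (radial_deriv (euler_op (k + 2) f)) z"
    by (rule Suc.IH[OF E Suc.prems(2)])
  also have "\<dots> = D_op k (euler_op (k + 2) (radial_deriv f)) z"
    by (rule D_op_cong[OF hol_on_radial_deriv[OF open_ball E] radial_euler_commute[OF Suc.prems(1)] Suc.prems(2)])
  finally show ?case unfolding D_op.simps(2) .
qed simp

lemma radial_power_D_op_commute:
  fixes f :: "complex ^ 'n \<Rightarrow> 'x::complex_banach"
  assumes f: "hol_on (ball 0 1) f" and z: "z \<in> ball 0 1"
  shows "(radial_deriv ^^ m) (D_op k f) z = D_op k ((radial_deriv ^^ m) f) z"
  using z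
proof (induction m arbitrary: z)
  case (Suc m)
  have "radial_deriv ((radial_deriv ^^ m) (D_op k f)) z = radial_deriv (D_op k ((radial_deriv ^^ m) f)) z"
    by (rule radial_deriv_cong[OF open_ball hol_on_radial_power[OF hol_on_D_op[OF f]] Suc.IH Suc.prems])
  also have "\<dots> = D_op k (radial_deriv ((radial_deriv ^^ m) f)) z"
    by (rule radial_D_op_commute[OF hol_on_radial_power[OF f] Suc.prems])
  finally show ?case by simp
qed simp

lemma radial_deriv_at_0: "hol_on (ball 0 1) f \<Longrightarrow> radial_deriv f 0 = 0"
  using radial_path(2)[of f 0 0] by simp

text \<open>N f vanishes at 0, so the factors act there as the scalars 2, 3, ..., k + 1.\<close>

lemma D_op_at_0:
  fixes f :: "complex ^ 'n \<Rightarrow> 'x::complex_banach"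
  assumes "hol_on (ball 0 1) f"
  shows "norm (D_op k f 0) = fact (k + 1) * norm (f 0)"
  using assms
proof (induction k arbitrary: f)
  case (Suc k)
  have "norm (D_op (Suc k) f 0) = fact (k + 1) * norm (euler_op (k + 2) f 0)"
    unfolding D_op.simps(2) by (rule Suc.IH[OF hol_on_euler_op[OF Suc.prems]])
  also have "norm (euler_op (k + 2) f 0) = real (k + 2) * norm (f 0)"
    unfolding radial_deriv_at_0[OF Suc.prems] by (simp del: of_nat_add)
  finally show ?case by (simp add: algebra_simps)
qed simp

lemma grow_D_op_up:
  assumes "0 \<le> b"
  shows "\<exists>C>0. \<forall>(u :: complex ^ 'n \<Rightarrow> 'x::complex_banach) M. hol_on (ball 0 1) u \<longrightarrow>
    grow b M u \<longrightarrow> grow (b + real k) (C * M) (D_op k u)"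
  using assms
proof (induction k arbitrary: b)
  case 0
  show ?case by (intro exI[of _ 1]) simp
next
  case (Suc k)
  have b1: "0 \<le> b + 1" using Suc.prems by simp
  obtain C where C: "C > 0" "\<And>(u :: complex ^ 'n \<Rightarrow> 'x) M. hol_on (ball 0 1) u \<Longrightarrow> grow (b + 1) M u \<Longrightarrow> grow ((b + 1) + real k) (C * M) (D_op k u)"
    using Suc.IH[OF b1] by blast
  define K where "K = real (k + 2) + 4 powr (b + 1)"
  have K: "K > 0" unfolding K_def by (intro add_pos_pos) auto
  show ?case
  proof (intro exI[of _ "C * K"] conjI allI impI)
    show "C * K > 0" using C K by simp
    fix u :: "complex ^ 'n \<Rightarrow> 'x" and M assume u: "hol_on (ball 0 1) u" and g: "grow b M u"
    have M: "0 \<le> M" by (rule grow_nonneg[OF g])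
    have "grow (b + 1) (K * M) (euler_op (k + 2) u)"
      unfolding grow_def
    proof (intro allI impI)
      fix z :: "complex ^ 'n" assume z: "norm z < 1"
      have "norm (u z) \<le> M * (1 - (norm z)\<^sup>2) powr (- b)" by (rule growD[OF g z])
      also have "\<dots> \<le> M * (1 - (norm z)\<^sup>2) powr (- (b + 1))"
        using M one_minus_norm_sq_pos[OF z] by (intro mult_left_mono powr_minus_mono) auto
      finally have 1: "norm (real (k + 2) *\<^sub>R u z) \<le> real (k + 2) * (M * (1 - (norm z)\<^sup>2) powr (- (b + 1)))"
        by (simp add: mult_left_mono del: of_nat_add)
      have 2: "norm (radial_deriv u z) \<le> 4 powr (b + 1) * M * (1 - (norm z)\<^sup>2) powr (- (b + 1))"
        by (rule growD[OF grow_radial_deriv[OF u g Suc.prems(1)] z])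
      show "norm (euler_op (k + 2) u z) \<le> K * M * (1 - (norm z)\<^sup>2) powr (- (b + 1))"
        using norm_triangle_mono[OF 1 2] by (simp add: K_def algebra_simps)
    qed
    have "b + real (Suc k) = (b + 1) + real k" "C * K * M = C * (K * M)" by simp_all
    with C(2)[OF hol_on_euler_op[OF u] \<open>grow (b + 1) (K * M) (euler_op (k + 2) u)\<close>]
    show "grow (b + real (Suc k)) (C * K * M) (D_op (Suc k) u)" unfolding D_op.simps(2) by (simp only:)
  qed
qed

lemma grow_D_op_down:
  assumes "0 < b"
  shows "\<exists>C>0. \<forall>(u :: complex ^ 'n \<Rightarrow> 'x::complex_banach) M. hol_on (ball 0 1) u \<longrightarrow>
    grow (b + real k) M (D_op k u) \<longrightarrow> grow b (C * M) u"
  using assms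
proof (induction k arbitrary: b)
  case 0
  show ?case by (intro exI[of _ 1]) simp
next
  case (Suc k)
  have b1: "0 < b + 1" using Suc.prems by simp
  obtain C where C: "C > 0" "\<And>(u :: complex ^ 'n \<Rightarrow> 'x) M. hol_on (ball 0 1) u \<Longrightarrow> grow ((b + 1) + real k) M (D_op k u) \<Longrightarrow> grow (b + 1) (C * M) u"
    using Suc.IH[OF b1] by blast
  show ?case
  proof (intro exI[of _ "growth_const b * C"] conjI allI impI)
    show "growth_const b * C > 0" using C growth_const_pos[OF Suc.prems(1)] by simp
    fix u :: "complex ^ 'n \<Rightarrow> 'x" and M assume u: "hol_on (ball 0 1) u" and g: "grow (b + real (Suc k)) M (D_op (Suc k) u)"
    have "b + real (Suc k) = (b + 1) + real k" by simp
    with g have "grow ((b + 1) + real k) M (D_op k (euler_op (k + 2) u))" unfolding D_op.simps(2) by (simp only:)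
    from C(2)[OF hol_on_euler_op[OF u] this] have "grow (b + 1) (C * M) (euler_op (k + 2) u)" .
    from grow_euler_inverse[OF u Suc.prems(1) _ this] show "grow b (growth_const b * C * M) u" by (simp add: mult.assoc)
  qed
qed

lemma grow_radial_power_up:
  assumes "0 \<le> b"
  shows "\<exists>C>0. \<forall>(u :: complex ^ 'n \<Rightarrow> 'x::complex_banach) M. hol_on (ball 0 1) u \<longrightarrow>
    grow b M u \<longrightarrow> grow (b + real m) (C * M) ((radial_deriv ^^ m) u)"
proof (induction m)
  case 0
  show ?case by (intro exI[of _ 1]) simp
next
  case (Suc m)
  obtain C where C: "C > 0" "\<And>(u :: complex ^ 'n \<Rightarrow> 'x) M. hol_on (ball 0 1) u \<Longrightarrow> grow b M u \<Longrightarrow> grow (b + real m) (C * M) ((radial_deriv ^^ m) u)"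
    using Suc.IH by blast
  show ?case
  proof (intro exI[of _ "4 powr (b + real m + 1) * C"] conjI allI impI)
    show "4 powr (b + real m + 1) * C > 0" using C by simp
    fix u :: "complex ^ 'n \<Rightarrow> 'x" and M assume u: "hol_on (ball 0 1) u" and g: "grow b M u"
    from grow_radial_deriv[OF hol_on_radial_power[OF u] C(2)[OF u g]] assms
    show "grow (b + real (Suc m)) (4 powr (b + real m + 1) * C * M) ((radial_deriv ^^ Suc m) u)"
      by (simp add: algebra_simps)
  qed
qed

text \<open>Only the last inversion sees a value at the origin, because every radial derivative
  vanishes there.\<close>

lemma grow_radial_power_down:
  assumes "0 < b"
  shows "\<exists>C>0. \<forall>(u :: complex ^ 'n \<Rightarrow> 'x::complex_banach) M. hol_on (ball 0 1) u \<longrightarrow>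
    grow (b + real m) M ((radial_deriv ^^ m) u) \<longrightarrow> grow b (C * (M + norm (u 0))) u"
  using assms
proof (induction m arbitrary: b)
  case 0
  show ?case by (intro exI[of _ 1]) (auto intro: grow_mono)
next
  case (Suc m)
  have b1: "0 < b + 1" using Suc.prems by simp
  obtain C where C: "C > 0" "\<And>(u :: complex ^ 'n \<Rightarrow> 'x) M. hol_on (ball 0 1) u \<Longrightarrow> grow ((b + 1) + real m) M ((radial_deriv ^^ m) u) \<Longrightarrow> grow (b + 1) (C * (M + norm (u 0))) u"
    using Suc.IH[OF b1] by blast
  define K where "K = growth_const b * (4 powr (b + 3) * C)"
  have K: "K > 0" using C growth_const_pos[OF Suc.prems(1)] by (simp add: K_def)
  show ?case
  proof (intro exI[of _ "K + 1"] conjI allI impI)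
    show "K + 1 > 0" using K by simp
    fix u :: "complex ^ 'n \<Rightarrow> 'x" and M assume u: "hol_on (ball 0 1) u" and g: "grow (b + real (Suc m)) M ((radial_deriv ^^ Suc m) u)"
    have "grow ((b + 1) + real m) M ((radial_deriv ^^ m) (radial_deriv u))"
      using g unfolding funpow_Suc_right o_def by (simp add: algebra_simps)
    from C(2)[OF hol_on_radial_deriv[OF open_ball u] this]
    have "grow (b + 1) (C * M) (radial_deriv u)" by (simp add: radial_deriv_at_0[OF u])
    from grow_radial_inverse[OF u Suc.prems(1) this]
    have 1: "grow b (K * M + norm (u 0)) u" by (simp add: K_def mult.assoc)
    show "grow b ((K + 1) * (M + norm (u 0))) u"
      using K grow_nonneg[OF g] by (intro grow_mono[OF 1]) (simp add: algebra_simps)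
  qed
qed

text \<open>Apply N^m, commute it past D_k, then strip D_k: the exponent goes from k - \<gamma> up
  to k - \<gamma> + m and down to m - \<gamma>, positive throughout. The value at 0 is read off D_k
  g(0).\<close>

lemma D_op_growth_imp_radial:
  assumes "real k > \<gamma>" "real m > \<gamma>"
  obtains C where "C > 0" "\<And>(g :: complex ^ 'n \<Rightarrow> 'x::complex_banach) M. hol_on (ball 0 1) g \<Longrightarrow>
    grow (real k - \<gamma>) M (D_op k g) \<Longrightarrow> grow (real m - \<gamma>) (C * M) ((radial_deriv ^^ m) g) \<and> norm (g 0) \<le> C * M"
proof -
  have pos: "0 < real k - \<gamma>" "0 \<le> real k - \<gamma>" "0 < real m - \<gamma>" "0 \<le> real m - \<gamma>" using assms by auto
  obtain C1 where C1: "C1 > 0" "\<And>(u :: complex ^ 'n \<Rightarrow> 'x) M. hol_on (ball 0 1) u \<Longrightarrow>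
      grow (real k - \<gamma>) M u \<Longrightarrow> grow (real k - \<gamma> + real m) (C1 * M) ((radial_deriv ^^ m) u)"
    using grow_radial_power_up[where 'n = 'n and 'x = 'x and b = "real k - \<gamma>" and m = m] pos by blast
  obtain C2 where C2: "C2 > 0" "\<And>(u :: complex ^ 'n \<Rightarrow> 'x) M. hol_on (ball 0 1) u \<Longrightarrow>
      grow (real m - \<gamma> + real k) M (D_op k u) \<Longrightarrow> grow (real m - \<gamma>) (C2 * M) u"
    using grow_D_op_down[where 'n = 'n and 'x = 'x and b = "real m - \<gamma>" and k = k] pos by blast
  show thesis
  proof (rule that[of "C2 * C1 + 1"])
    show "C2 * C1 + 1 > 0" using C1 C2 by (simp add: add_pos_pos)
    fix g :: "complex ^ 'n \<Rightarrow> 'x" and M assume g: "hol_on (ball 0 1) g" and gr: "grow (real k - \<gamma>) M (D_op k g)"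
    have M: "0 \<le> M" by (rule grow_nonneg[OF gr])
    have "grow (real k - \<gamma> + real m) (C1 * M) ((radial_deriv ^^ m) (D_op k g))"
      by (rule C1(2)[OF hol_on_D_op[OF g] gr])
    then have "grow (real k - \<gamma> + real m) (C1 * M) (D_op k ((radial_deriv ^^ m) g))"
      by (subst grow_cong[where v = "(radial_deriv ^^ m) (D_op k g)"]) (simp_all add: radial_power_D_op_commute[OF g])
    then have "grow (real m - \<gamma> + real k) (C1 * M) (D_op k ((radial_deriv ^^ m) g))" by (simp add: algebra_simps)
    from C2(2)[OF hol_on_radial_power[OF g] this] have 1: "grow (real m - \<gamma>) (C2 * (C1 * M)) ((radial_deriv ^^ m) g)" .
    have "norm (g 0) \<le> fact (k + 1) * norm (g 0)" by (simp add: mult_le_cancel_right1 fact_ge_1 del: fact_Suc)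
    also have "\<dots> \<le> M" using grow_at_0[OF gr] by (simp add: D_op_at_0[OF g])
    finally have 2: "norm (g 0) \<le> M" .
    show "grow (real m - \<gamma>) ((C2 * C1 + 1) * M) ((radial_deriv ^^ m) g) \<and> norm (g 0) \<le> (C2 * C1 + 1) * M"
    proof -
      have e: "(C2 * C1 + 1) * M = C2 * (C1 * M) + M" by (simp add: algebra_simps)
      have "0 \<le> C2 * (C1 * M)" using M C1 C2 by simp
      then show ?thesis unfolding e using 2 M by (intro conjI grow_mono[OF 1]) auto
    qed
  qed
qed

text \<open>The same detour with the roles of D_k and N^m exchanged. Since N^m with m > 0 loses the
  constant term, the bound has to carry \<open>norm (g 0)\<close>.\<close>

lemma radial_growth_imp_D_op:
  assumes "real k > \<gamma>" "real m > \<gamma>"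
  obtains C where "C > 0" "\<And>(g :: complex ^ 'n \<Rightarrow> 'x::complex_banach) M. hol_on (ball 0 1) g \<Longrightarrow>
    grow (real m - \<gamma>) M ((radial_deriv ^^ m) g) \<Longrightarrow> grow (real k - \<gamma>) (C * (M + norm (g 0))) (D_op k g)"
proof -
  have pos: "0 < real k - \<gamma>" "0 \<le> real k - \<gamma>" "0 < real m - \<gamma>" "0 \<le> real m - \<gamma>" using assms by auto
  obtain C1 where C1: "C1 > 0" "\<And>(u :: complex ^ 'n \<Rightarrow> 'x) M. hol_on (ball 0 1) u \<Longrightarrow>
      grow (real m - \<gamma>) M u \<Longrightarrow> grow (real m - \<gamma> + real k) (C1 * M) (D_op k u)"
    using grow_D_op_up[where 'n = 'n and 'x = 'x and b = "real m - \<gamma>" and k = k] pos by blast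
  obtain C2 where C2: "C2 > 0" "\<And>(u :: complex ^ 'n \<Rightarrow> 'x) M. hol_on (ball 0 1) u \<Longrightarrow>
      grow (real k - \<gamma> + real m) M ((radial_deriv ^^ m) u) \<Longrightarrow> grow (real k - \<gamma>) (C2 * (M + norm (u 0))) u"
    using grow_radial_power_down[where 'n = 'n and 'x = 'x and b = "real k - \<gamma>" and m = m] pos by blast
  show thesis
  proof (rule that[of "C2 * (C1 + fact (k + 1))"])
    show "C2 * (C1 + fact (k + 1)) > 0" using C1 C2 by (simp add: add_pos_pos)
    fix g :: "complex ^ 'n \<Rightarrow> 'x" and M assume g: "hol_on (ball 0 1) g"
      and gr: "grow (real m - \<gamma>) M ((radial_deriv ^^ m) g)"
    have M: "0 \<le> M" by (rule grow_nonneg[OF gr])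
    have "grow (real m - \<gamma> + real k) (C1 * M) (D_op k ((radial_deriv ^^ m) g))"
      by (rule C1(2)[OF hol_on_radial_power[OF g] gr])
    then have "grow (real m - \<gamma> + real k) (C1 * M) ((radial_deriv ^^ m) (D_op k g))"
      by (subst grow_cong[where v = "D_op k ((radial_deriv ^^ m) g)"]) (simp_all add: radial_power_D_op_commute[OF g])
    then have "grow (real k - \<gamma> + real m) (C1 * M) ((radial_deriv ^^ m) (D_op k g))" by (simp add: algebra_simps)
    from C2(2)[OF hol_on_D_op[OF g] this]
    have 1: "grow (real k - \<gamma>) (C2 * (C1 * M + fact (k + 1) * norm (g 0))) (D_op k g)" by (simp only: D_op_at_0[OF g])
    have "C1 * M + fact (k + 1) * norm (g 0) \<le> (C1 + fact (k + 1)) * (M + norm (g 0))"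
      using M C1 by (simp add: algebra_simps del: fact_Suc)
    then have "C2 * (C1 * M + fact (k + 1) * norm (g 0)) \<le> C2 * (C1 + fact (k + 1)) * (M + norm (g 0))"
      using C2(1) by (simp only: mult.assoc mult_le_cancel_left_pos)
    then show "grow (real k - \<gamma>) (C2 * (C1 + fact (k + 1)) * (M + norm (g 0))) (D_op k g)" by (rule grow_mono[OF 1])
  qed
qed

section \<open>\<open>Gamma_norm\<close> in terms of growth bounds\<close>

lemma Gamma_norm_le:
  fixes g :: "complex ^ 'n \<Rightarrow> 'x::complex_normed_space"
  assumes "norm (g 0) \<le> B" "grow (real m - \<gamma>) M ((radial_deriv ^^ m) g)"
  shows "Gamma_norm \<gamma> m g \<le> ennreal (B + M)"
proof -
  have M: "0 \<le> M" by (rule grow_nonneg[OF assms(2)])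
  have B: "0 \<le> B" using assms(1) norm_ge_zero order_trans by blast
  have "(SUP z\<in>ball 0 1. ennreal ((1 - (norm z)\<^sup>2) powr (real m - \<gamma>) * norm ((radial_deriv ^^ m) g z))) \<le> ennreal M"
  proof (rule SUP_least)
    fix z :: "complex ^ 'n" assume "z \<in> ball 0 1"
    then have z: "norm z < 1" by simp
    define y where "y = 1 - (norm z)\<^sup>2"
    have y: "0 < y" using one_minus_norm_sq_pos[OF z] by (simp add: y_def)
    have "y powr (real m - \<gamma>) * norm ((radial_deriv ^^ m) g z) \<le> y powr (real m - \<gamma>) * (M * y powr (- (real m - \<gamma>)))"
      using growD[OF assms(2) z] by (intro mult_left_mono) (auto simp: y_def)
    also have "\<dots> = M * (y powr (real m - \<gamma>) * y powr (- (real m - \<gamma>)))" by (simp only: mult_ac)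
    also have "\<dots> = M" using y unfolding powr_add[symmetric] by simp
    finally show "ennreal ((1 - (norm z)\<^sup>2) powr (real m - \<gamma>) * norm ((radial_deriv ^^ m) g z)) \<le> ennreal M"
      unfolding y_def by (rule ennreal_leI)
  qed
  then have "Gamma_norm \<gamma> m g \<le> ennreal B + ennreal M"
    unfolding Gamma_norm_def using assms(1) by (intro add_mono ennreal_leI)
  then show ?thesis using B M by simp
qed

lemma Gamma_norm_bound:
  fixes g :: "complex ^ 'n \<Rightarrow> 'x::complex_normed_space"
  assumes "Gamma_norm \<gamma> m g \<le> ennreal B" "0 \<le> B"
  shows "norm (g 0) \<le> B" "grow (real m - \<gamma>) B ((radial_deriv ^^ m) g)"
proof -
  have "ennreal (norm (g 0)) \<le> Gamma_norm \<gamma> m g" unfolding Gamma_norm_def by simp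
  then have "ennreal (norm (g 0)) \<le> ennreal B" using assms(1) by (rule order_trans)
  then show "norm (g 0) \<le> B" using assms(2) by simp
  show "grow (real m - \<gamma>) B ((radial_deriv ^^ m) g)"
    unfolding grow_def
  proof (intro allI impI)
    fix z :: "complex ^ 'n" assume z: "norm z < 1"
    define y where "y = 1 - (norm z)\<^sup>2"
    have y: "0 < y" using one_minus_norm_sq_pos[OF z] by (simp add: y_def)
    have "ennreal (y powr (real m - \<gamma>) * norm ((radial_deriv ^^ m) g z))
        \<le> (SUP z\<in>ball 0 1. ennreal ((1 - (norm z)\<^sup>2) powr (real m - \<gamma>) * norm ((radial_deriv ^^ m) g z)))"
      unfolding y_def using z by (intro SUP_upper2[of z]) auto
    also have "\<dots> \<le> Gamma_norm \<gamma> m g" unfolding Gamma_norm_def by simp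
    also have "\<dots> \<le> ennreal B" by (rule assms(1))
    finally have "y powr (real m - \<gamma>) * norm ((radial_deriv ^^ m) g z) \<le> B" using assms(2) by simp
    then have "norm ((radial_deriv ^^ m) g z) \<le> B / y powr (real m - \<gamma>)" using y by (simp add: field_simps)
    then show "norm ((radial_deriv ^^ m) g z) \<le> B * (1 - (norm z)\<^sup>2) powr (- (real m - \<gamma>))"
      unfolding y_def[symmetric] powr_minus by (simp add: divide_inverse)
  qed
qed

section \<open>Bounded functionals on the Bergman space\<close>

text \<open>By homogeneity one may take x + y = 1, where t \<le> t^p. This replaces the triangle
  inequality for p < 1.\<close>

lemma powr_subadditive:
  fixes x y p :: real
  assumes "0 \<le> x" "0 \<le> y" "0 < p" "p \<le> 1"
  shows "(x + y) powr p \<le> x powr p + y powr p"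
proof (cases "x + y = 0")
  case False
  define s where "s = x + y"
  have s: "s > 0" using False assms by (simp add: s_def)
  have *: "t / s \<le> (t / s) powr p" if "0 \<le> t" "t \<le> s" for t
    using powr_mono'[of p 1 "t / s"] that s assms by simp
  have "1 = x / s + y / s" using s by (simp add: s_def add_divide_distrib[symmetric])
  also have "\<dots> \<le> (x / s) powr p + (y / s) powr p"
    using assms by (intro add_mono *) (auto simp: s_def)
  also have "\<dots> = (x powr p + y powr p) / s powr p"
    using assms s by (simp add: powr_divide add_divide_distrib)
  finally show ?thesis using s by (simp add: field_simps s_def[symmetric])
qed (use assms in simp)

locale bergman_setup =
  fixes \<alpha> p :: real
  assumes \<alpha>: "\<alpha> > - 1" and p: "0 < p" "p \<le> 1"
begin

lemma bergmanD: "f \<in> bergman p \<alpha> \<Longrightarrow> hol_on (ball 0 1) f" "f \<in> bergman p \<alpha> \<Longrightarrow> bergman_integral \<alpha> p f < \<infinity>"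
  using bergman_iff[OF \<alpha> p(1)] by auto

lemma bergman_integral_add_le:
  fixes f g :: "complex ^ 'n \<Rightarrow> 'x::complex_normed_space"
  assumes "hol_on (ball 0 1) f" "hol_on (ball 0 1) g"
  shows "bergman_integral \<alpha> p (\<lambda>z. f z + g z) \<le> bergman_integral \<alpha> p f + bergman_integral \<alpha> p g"
proof -
  have "bergman_integral \<alpha> p (\<lambda>z. f z + g z) \<le> (\<integral>\<^sup>+u. ennreal (eta \<alpha> u * norm (f u) powr p) + ennreal (eta \<alpha> u * norm (g u) powr p) \<partial>lborel)"
    unfolding bergman_integral_def
  proof (intro nn_integral_mono)
    fix u :: "complex ^ 'n"
    have "norm (f u + g u) powr p \<le> (norm (f u) + norm (g u)) powr p"
      using p by (intro powr_mono2 norm_triangle_ineq) auto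
    also have "\<dots> \<le> norm (f u) powr p + norm (g u) powr p" using p by (intro powr_subadditive) auto
    finally have "eta \<alpha> u * norm (f u + g u) powr p \<le> eta \<alpha> u * norm (f u) powr p + eta \<alpha> u * norm (g u) powr p"
      by (simp only: distrib_left[symmetric] mult_left_mono eta_nonneg)
    from ennreal_leI[OF this]
    show "ennreal (eta \<alpha> u * norm (f u + g u) powr p) \<le> ennreal (eta \<alpha> u * norm (f u) powr p) + ennreal (eta \<alpha> u * norm (g u) powr p)"
      by simp
  qed
  also have "\<dots> = bergman_integral \<alpha> p f + bergman_integral \<alpha> p g"
    unfolding bergman_integral_def using measurable_eta_norm_powr[OF assms(1)] measurable_eta_norm_powr[OF assms(2)]
    by (intro nn_integral_add) auto
  finally show ?thesis .
qed

lemma bergman_integral_cmul: "bergman_integral \<alpha> p (\<lambda>z. c *\<^sub>C f z) = ennreal (cmod c powr p) * bergman_integral \<alpha> p f"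
  if "hol_on (ball 0 1) f" for f :: "complex ^ 'n \<Rightarrow> 'x::complex_normed_space"
  unfolding bergman_integral_def using measurable_eta_norm_powr[OF that, of \<alpha> p]
  by (subst nn_integral_cmult[symmetric]) (auto simp: norm_scaleC powr_mult mult_ac simp flip: ennreal_mult)

lemma bergman_add: "f \<in> bergman p \<alpha> \<Longrightarrow> g \<in> bergman p \<alpha> \<Longrightarrow> (\<lambda>z. f z + g z) \<in> bergman p \<alpha>"
  using bergman_integral_add_le[of f g] unfolding bergman_iff[OF \<alpha> p(1)]
  by (auto intro!: hol_on_add(1) intro: order.strict_trans1)

lemma bergman_cmul: "f \<in> bergman p \<alpha> \<Longrightarrow> (\<lambda>z. c *\<^sub>C f z) \<in> bergman p \<alpha>"
  using bergman_integral_cmul[of f c] unfolding bergman_iff[OF \<alpha> p(1)]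
  by (auto intro!: hol_on_cmul(1) simp: ennreal_mult_less_top)

lemma bergman_norm_le:
  fixes f :: "complex ^ 'n \<Rightarrow> 'x::complex_normed_space"
  assumes "hol_on (ball 0 1) f" "bergman_integral \<alpha> p f \<le> ennreal B" "0 \<le> B"
  shows "f \<in> bergman p \<alpha>" "bergman_norm p \<alpha> f \<le> (nu_const TYPE('n) \<alpha> * B) powr (1 / p)"
proof -
  show f: "f \<in> bergman p \<alpha>"
    unfolding bergman_iff[OF \<alpha> p(1)] using assms by (auto intro: order.strict_trans1)
  have "enn2real (bergman_integral \<alpha> p f) \<le> B" using assms by (simp add: enn2real_leI)
  then show "bergman_norm p \<alpha> f \<le> (nu_const TYPE('n) \<alpha> * B) powr (1 / p)"
    unfolding bergman_norm_eq(1)[OF \<alpha> p(1) f] using nu_const_pos[OF \<alpha>, where 'n = 'n] p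
    by (intro powr_mono2 mult_left_mono mult_nonneg_nonneg) auto
qed

lemma bergman_integral_bounded:
  fixes f :: "complex ^ 'n \<Rightarrow> 'x::complex_normed_space"
  assumes "\<And>z. norm z < 1 \<Longrightarrow> norm (f z) \<le> B" "0 \<le> B"
  shows "bergman_integral \<alpha> p f \<le> ennreal (eta_int TYPE('n) \<alpha> * B powr p)"
proof -
  have "bergman_integral \<alpha> p f \<le> (\<integral>\<^sup>+u. ennreal (eta \<alpha> (u :: complex ^ 'n) * B powr p) \<partial>lborel)"
    unfolding bergman_integral_def
  proof (intro nn_integral_mono ennreal_leI)
    fix u :: "complex ^ 'n"
    show "eta \<alpha> u * norm (f u) powr p \<le> eta \<alpha> u * B powr p"
      by (cases "norm u < 1") (use assms p in \<open>auto simp: eta_outside intro!: mult_left_mono powr_mono2\<close>)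
  qed
  also have "\<dots> = ennreal (\<integral>u. eta \<alpha> (u :: complex ^ 'n) * B powr p \<partial>lborel)"
    by (intro nn_integral_eq_integral integrable_mult_left integrable_eta_gt \<alpha>) simp
  finally show ?thesis by (simp add: eta_int_def)
qed

definition bergman_const :: "'n::finite itself \<Rightarrow> real"
  where "bergman_const t = (nu_const TYPE('n) \<alpha> * eta_int TYPE('n) \<alpha>) powr (1 / p)"

lemma bergman_const_nonneg: "0 \<le> bergman_const t"
  by (simp add: bergman_const_def)

lemma bergman_bounded:
  fixes f :: "complex ^ 'n \<Rightarrow> 'x::complex_normed_space"
  assumes hol: "hol_on (ball 0 1) f" and B: "\<And>z. norm z < 1 \<Longrightarrow> norm (f z) \<le> B"
  shows "f \<in> bergman p \<alpha>" "bergman_norm p \<alpha> f \<le> bergman_const TYPE('n) * B"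
proof -
  have B0: "0 \<le> B" using order_trans[OF norm_ge_zero B[of 0]] by simp
  have V: "eta_int TYPE('n) \<alpha> > 0" by (intro eta_int_pos integrable_eta_gt \<alpha>)
  note * = bergman_norm_le[OF hol bergman_integral_bounded[OF B B0]]
  show "f \<in> bergman p \<alpha>" using * V by simp
  have "bergman_norm p \<alpha> f \<le> (nu_const TYPE('n) \<alpha> * (eta_int TYPE('n) \<alpha> * B powr p)) powr (1 / p)"
    using * V by simp
  also have "\<dots> = bergman_const TYPE('n) * B"
    using V nu_const_pos[OF \<alpha>, where 'n = 'n] B0 p
    by (simp add: bergman_const_def powr_mult powr_powr mult.assoc[symmetric])
  finally show "bergman_norm p \<alpha> f \<le> bergman_const TYPE('n) * B" .
qed

lemma bergman_norm_eq_0: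
  fixes f :: "complex ^ 'n \<Rightarrow> 'x::complex_normed_space"
  assumes "f \<in> bergman p \<alpha>" "\<And>z. norm z < 1 \<Longrightarrow> f z = 0"
  shows "bergman_norm p \<alpha> f = 0"
  using bergman_bounded(2)[of f 0] assms bergmanD(1)[OF assms(1)]
  by (simp add: bergman_norm_def order_antisym)

lemma dualD:
  assumes "\<Lambda> \<in> bergman_dual p \<alpha>"
  shows "f \<in> bergman p \<alpha> \<Longrightarrow> g \<in> bergman p \<alpha> \<Longrightarrow> \<Lambda> (\<lambda>z. f z + g z) = \<Lambda> f + \<Lambda> g"
    and "f \<in> bergman p \<alpha> \<Longrightarrow> \<Lambda> (\<lambda>z. c *\<^sub>C f z) = c * \<Lambda> f"
  using assms by (auto simp: bergman_dual_def)

lemma dual_bound: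
  assumes "\<Lambda> \<in> bergman_dual p \<alpha>"
  obtains C where "0 \<le> C" "\<And>f. f \<in> bergman p \<alpha> \<Longrightarrow> cmod (\<Lambda> f) \<le> C * bergman_norm p \<alpha> f"
proof -
  obtain C where C: "\<forall>f\<in>bergman p \<alpha>. cmod (\<Lambda> f) \<le> C * bergman_norm p \<alpha> f"
    using assms by (auto simp: bergman_dual_def)
  have "cmod (\<Lambda> f) \<le> max 0 C * bergman_norm p \<alpha> f" if "f \<in> bergman p \<alpha>" for f
  proof -
    have "C * bergman_norm p \<alpha> f \<le> max 0 C * bergman_norm p \<alpha> f"
      by (intro mult_right_mono) (auto simp: bergman_norm_def)
    then show ?thesis using C that by fastforce
  qed
  then show thesis by (intro that[of "max 0 C"]) auto
qed

lemma dual_diff: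
  assumes \<Lambda>: "\<Lambda> \<in> bergman_dual p \<alpha>" and f: "f \<in> bergman p \<alpha>" and g: "g \<in> bergman p \<alpha>"
  shows "(\<lambda>z. f z - g z) \<in> bergman p \<alpha>" "\<Lambda> (\<lambda>z. f z - g z) = \<Lambda> f - \<Lambda> g"
proof -
  have e: "f z - g z = f z + (- 1) *\<^sub>C g z" for z by (simp add: scaleC.minus_left)
  show "(\<lambda>z. f z - g z) \<in> bergman p \<alpha>" unfolding e by (intro bergman_add bergman_cmul f g)
  show "\<Lambda> (\<lambda>z. f z - g z) = \<Lambda> f - \<Lambda> g"
    unfolding e dualD(1)[OF \<Lambda> f bergman_cmul[OF g]] dualD(2)[OF \<Lambda> g] by simp
qed

text \<open>Functionals act on total functions, whose values off the ball are arbitrary; boundedness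
  forces them to ignore these values because the difference has norm 0.\<close>

lemma dual_cong:
  assumes \<Lambda>: "\<Lambda> \<in> bergman_dual p \<alpha>" and f: "f \<in> bergman p \<alpha>" and g: "g \<in> bergman p \<alpha>"
    and eq: "\<And>z. norm z < 1 \<Longrightarrow> f z = g z"
  shows "\<Lambda> f = \<Lambda> g"
proof -
  obtain C where C: "0 \<le> C" "\<And>f. f \<in> bergman p \<alpha> \<Longrightarrow> cmod (\<Lambda> f) \<le> C * bergman_norm p \<alpha> f"
    using dual_bound[OF \<Lambda>] by blast
  note d = dual_diff[OF \<Lambda> f g]
  have "bergman_norm p \<alpha> (\<lambda>z. f z - g z) = 0" by (rule bergman_norm_eq_0[OF d(1)]) (use eq in simp)
  then have "cmod (\<Lambda> f - \<Lambda> g) \<le> 0" using C(2)[OF d(1)] d(2) by simp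
  then show ?thesis by simp
qed

text \<open>The majorant combined with its crude estimate; the auxiliary exponent A drops out of the
  power of 1 - |z|^2.\<close>

lemma bergman_pointwise:
  obtains C where "C > 0" "\<And>(f :: complex ^ 'n \<Rightarrow> 'x::complex_normed_space) z. f \<in> bergman p \<alpha> \<Longrightarrow> norm z < 1 \<Longrightarrow>
    norm (f z) powr p \<le> C * (1 - (norm z)\<^sup>2) powr (- (real CARD('n) + 1 + \<alpha>)) * enn2real (bergman_integral \<alpha> p f)"
proof -
  \<comment> \<open>Any A > 0 with A \<ge> \<alpha> serves; \<alpha> itself may be negative.\<close>
  define A where "A = \<bar>\<alpha>\<bar> + 1"
  have A: "0 < A" "\<alpha> \<le> A" by (auto simp: A_def)
  obtain C where C: "C > 0" "\<And>(f :: complex ^ 'n \<Rightarrow> 'x) z.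
    hol_on (ball 0 1) f \<Longrightarrow> norm z < 1 \<Longrightarrow> ennreal (norm (f z) powr p) \<le> ennreal C * kernel_majorant A p f z"
    using majorant[OF p A(1)] by blast
  define K where "K = C * 2 powr (real CARD('n) + 1 + A)"
  have K: "K > 0" using C by (simp add: K_def)
  show thesis
  proof (rule that[OF K])
    fix f :: "complex ^ 'n \<Rightarrow> 'x" and z :: "complex ^ 'n" assume f: "f \<in> bergman p \<alpha>" and z: "norm z < 1"
    let ?y = "(1 - (norm z)\<^sup>2) powr (- (real CARD('n) + 1 + \<alpha>))"
    have "ennreal (norm (f z) powr p) \<le> ennreal C * kernel_majorant A p f z" by (rule C(2)[OF bergmanD(1)[OF f] z])
    also have "\<dots> \<le> ennreal C * (ennreal (2 powr (real CARD('n) + 1 + A) * ?y) * bergman_integral \<alpha> p f)"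
      by (intro mult_left_mono kernel_majorant_le_bergman_integral[OF bergmanD(1)[OF f] \<alpha> A(2) z]) auto
    also have "bergman_integral \<alpha> p f = ennreal (enn2real (bergman_integral \<alpha> p f))" using bergmanD(2)[OF f] by simp
    also have "ennreal C * (ennreal (2 powr (real CARD('n) + 1 + A) * ?y) * \<dots>) = ennreal (K * ?y * enn2real (bergman_integral \<alpha> p f))"
      using C(1) by (simp add: K_def mult.assoc flip: ennreal_mult)
    finally show "norm (f z) powr p \<le> K * ?y * enn2real (bergman_integral \<alpha> p f)"
      using K by (simp add: ennreal_le_iff)
  qed
qed

text \<open>Splitting \<open>|f| = |f|\<^sup>p |f|\<^sup>1\<^sup>-\<^sup>p\<close> and estimating the second factor pointwise.\<close>

lemma bergman_split:
  assumes \<gamma>: "\<gamma> = (real CARD('n) + 1 + \<alpha>) * (1 / p - 1)"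
  obtains C where "C > 0" "\<And>(f :: complex ^ 'n \<Rightarrow> 'x::complex_normed_space) z. f \<in> bergman p \<alpha> \<Longrightarrow> norm z < 1 \<Longrightarrow>
    norm (f z) \<le> (C * enn2real (bergman_integral \<alpha> p f)) powr (1 / p - 1) * (1 - (norm z)\<^sup>2) powr (- \<gamma>) * norm (f z) powr p"
proof -
  obtain C where C: "C > 0" "\<And>(f :: complex ^ 'n \<Rightarrow> 'x) z. f \<in> bergman p \<alpha> \<Longrightarrow> norm z < 1 \<Longrightarrow>
    norm (f z) powr p \<le> C * (1 - (norm z)\<^sup>2) powr (- (real CARD('n) + 1 + \<alpha>)) * enn2real (bergman_integral \<alpha> p f)"
    using bergman_pointwise by blast
  define \<kappa> where "\<kappa> = 1 / p - 1"
  have \<kappa>: "0 \<le> \<kappa>" using p by (simp add: \<kappa>_def)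
  show thesis
  proof (rule that[OF C(1)])
    fix f :: "complex ^ 'n \<Rightarrow> 'x" and z :: "complex ^ 'n" assume f: "f \<in> bergman p \<alpha>" and z: "norm z < 1"
    define I where "I = enn2real (bergman_integral \<alpha> p f)"
    have I: "0 \<le> I" by (simp add: I_def)
    define y where "y = 1 - (norm z)\<^sup>2"
    have y: "0 < y" using one_minus_norm_sq_pos[OF z] by (simp add: y_def)
    have "p + p * \<kappa> = 1" using p by (simp add: \<kappa>_def right_diff_distrib)
    then have "norm (f z) = (norm (f z) powr p) powr \<kappa> * norm (f z) powr p"
      by (simp add: powr_powr add.commute flip: powr_add)
    also have "\<dots> \<le> (C * y powr (- (real CARD('n) + 1 + \<alpha>)) * I) powr \<kappa> * norm (f z) powr p"
      using C(2)[OF f z] \<kappa> by (intro mult_right_mono powr_mono2) (auto simp: y_def I_def)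
    also have "(C * y powr (- (real CARD('n) + 1 + \<alpha>)) * I) powr \<kappa> = ((C * I) * y powr (- (real CARD('n) + 1 + \<alpha>))) powr \<kappa>"
      by (simp only: mult_ac)
    also have "\<dots> = (C * I) powr \<kappa> * y powr (- (real CARD('n) + 1 + \<alpha>) * \<kappa>)"
      using C(1) I by (simp add: powr_mult powr_powr)
    \<comment> \<open>This exponent is where \<gamma> comes from.\<close>
    also have "- (real CARD('n) + 1 + \<alpha>) * \<kappa> = - \<gamma>" by (simp only: \<gamma> \<kappa>_def mult_minus_left)
    finally show "norm (f z) \<le> (C * enn2real (bergman_integral \<alpha> p f)) powr (1 / p - 1) * (1 - (norm z)\<^sup>2) powr (- \<gamma>) * norm (f z) powr p"
      by (simp add: y_def I_def \<kappa>_def)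
  qed
qed

lemma measurable_eta_norm:
  assumes "hol_on (ball 0 1) f"
  shows "(\<lambda>z. eta b z * norm (f z)) \<in> borel_measurable borel"
  using measurable_eta_norm_powr[OF assms, of b 1] by simp

text \<open>Integrating the split bound gives I^(1/p - 1) times I, that is I^(1/p), a multiple of
  the norm: the dependence is linear although p may be less than 1.\<close>

lemma bergman_embedding:
  assumes \<gamma>: "\<gamma> = (real CARD('n) + 1 + \<alpha>) * (1 / p - 1)"
  obtains C where "C > 0" "\<And>f :: complex ^ 'n \<Rightarrow> 'x::complex_normed_space. f \<in> bergman p \<alpha> \<Longrightarrow>
    integrable lborel (\<lambda>z. eta (\<alpha> + \<gamma>) z * norm (f z)) \<and> (\<integral>z. eta (\<alpha> + \<gamma>) z * norm (f z) \<partial>lborel) \<le> C * bergman_norm p \<alpha> f"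
proof -
  obtain C where C: "C > 0" "\<And>(f :: complex ^ 'n \<Rightarrow> 'x) z. f \<in> bergman p \<alpha> \<Longrightarrow> norm z < 1 \<Longrightarrow>
    norm (f z) \<le> (C * enn2real (bergman_integral \<alpha> p f)) powr (1 / p - 1) * (1 - (norm z)\<^sup>2) powr (- \<gamma>) * norm (f z) powr p"
    using bergman_split[OF \<gamma>] by blast
  define \<kappa> where "\<kappa> = 1 / p - 1"
  define k where "k = nu_const TYPE('n) \<alpha>"
  have k: "k > 0" unfolding k_def by (rule nu_const_pos[OF \<alpha>])
  show thesis
  proof (rule that[of "C powr \<kappa> * (1 / k) powr (1 / p)"])
    show "C powr \<kappa> * (1 / k) powr (1 / p) > 0" using C k by simp
    fix f :: "complex ^ 'n \<Rightarrow> 'x" assume f: "f \<in> bergman p \<alpha>"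
    note hol = bergmanD(1)[OF f]
    define I where "I = enn2real (bergman_integral \<alpha> p f)"
    have I: "0 \<le> I" by (simp add: I_def)
    have bI: "bergman_integral \<alpha> p f = ennreal I" using bergmanD(2)[OF f] by (simp add: I_def)
    have "(\<integral>\<^sup>+z. ennreal (eta (\<alpha> + \<gamma>) z * norm (f z)) \<partial>lborel)
        \<le> (\<integral>\<^sup>+z. ennreal ((C * I) powr \<kappa>) * ennreal (eta \<alpha> z * norm (f z) powr p) \<partial>lborel)"
    proof (intro nn_integral_mono)
      fix z :: "complex ^ 'n"
      show "ennreal (eta (\<alpha> + \<gamma>) z * norm (f z)) \<le> ennreal ((C * I) powr \<kappa>) * ennreal (eta \<alpha> z * norm (f z) powr p)"
      proof (cases "norm z < 1")
        case True
        have "eta (\<alpha> + \<gamma>) z * norm (f z) \<le> eta (\<alpha> + \<gamma>) z * ((C * I) powr \<kappa> * (1 - (norm z)\<^sup>2) powr (- \<gamma>) * norm (f z) powr p)"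
          using C(2)[OF f True] by (intro mult_left_mono) (auto simp: I_def \<kappa>_def)
        also have "\<dots> = (C * I) powr \<kappa> * ((eta (\<alpha> + \<gamma>) z * (1 - (norm z)\<^sup>2) powr (- \<gamma>)) * norm (f z) powr p)"
          by (simp only: mult_ac)
        also have "eta (\<alpha> + \<gamma>) z * (1 - (norm z)\<^sup>2) powr (- \<gamma>) = eta \<alpha> z"
          using eta_powr_mult[OF True, of "\<alpha> + \<gamma>" "- \<gamma>"] by simp
        finally show ?thesis by (subst ennreal_mult[symmetric]) (auto intro: ennreal_leI)
      qed (simp add: eta_outside)
    qed
    also have "\<dots> = ennreal ((C * I) powr \<kappa>) * bergman_integral \<alpha> p f"
      unfolding bergman_integral_def using measurable_eta_norm_powr[OF hol, of \<alpha> p] by (intro nn_integral_cmult) auto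
    also have "\<dots> = ennreal ((C * I) powr \<kappa> * I)" unfolding bI using I by (simp add: ennreal_mult)
    also have "(C * I) powr \<kappa> * I = C powr \<kappa> * I powr (1 / p)"
    proof -
      have "I powr (1 / p) = I powr (\<kappa> + 1)" by (simp add: \<kappa>_def)
      also have "\<dots> = I powr \<kappa> * I" using I by (simp add: powr_add)
      finally show ?thesis using C(1) I by (simp add: powr_mult)
    qed
    also have "I powr (1 / p) = (1 / k) powr (1 / p) * bergman_norm p \<alpha> f"
      unfolding bergman_norm_eq(1)[OF \<alpha> p(1) f] I_def[symmetric] k_def[symmetric]
      using I k by (simp flip: powr_mult)
    finally have le: "(\<integral>\<^sup>+z. ennreal (eta (\<alpha> + \<gamma>) z * norm (f z)) \<partial>lborel)
        \<le> ennreal (C powr \<kappa> * (1 / k) powr (1 / p) * bergman_norm p \<alpha> f)" by (simp add: mult.assoc)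
    have i: "integrable lborel (\<lambda>z. eta (\<alpha> + \<gamma>) z * norm (f z))"
      using measurable_eta_norm[OF hol] le by (intro integrableI_nonneg) (auto intro: order.strict_trans1)
    have "ennreal (\<integral>z. eta (\<alpha> + \<gamma>) z * norm (f z) \<partial>lborel) \<le> ennreal (C powr \<kappa> * (1 / k) powr (1 / p) * bergman_norm p \<alpha> f)"
      using le i by (subst nn_integral_eq_integral[symmetric]) auto
    then show "integrable lborel (\<lambda>z. eta (\<alpha> + \<gamma>) z * norm (f z)) \<and>
        (\<integral>z. eta (\<alpha> + \<gamma>) z * norm (f z) \<partial>lborel) \<le> C powr \<kappa> * (1 / k) powr (1 / p) * bergman_norm p \<alpha> f"
      using i by (subst (asm) ennreal_le_iff) (auto simp: bergman_norm_def)
  qed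
qed

section \<open>The pairing\<close>

lemma pairing_integrand_eq:
  assumes "norm z < 1"
  shows "eta \<alpha> z *\<^sub>R pairing_integrand k f g z = eta (\<alpha> + real k) z *\<^sub>R cdual_apply (D_op k g z) (f z)"
proof -
  have "(1 - (norm z)\<^sup>2) ^ k = (1 - (norm z)\<^sup>2) powr real k"
    using one_minus_norm_sq_pos[OF assms] by (simp add: powr_realpow)
  then show ?thesis
    using eta_powr_mult[OF assms, of \<alpha> "real k"]
    by (simp add: pairing_integrand_def scaleR_conv_of_real mult_ac flip: of_real_mult)
qed

lemma pairing_eq:
  fixes f :: "complex ^ 'n \<Rightarrow> 'x::complex_normed_space"
  assumes f: "hol_on (ball 0 1) f" and g: "hol_on (ball 0 1) g"
  shows "pairing ck k \<alpha> f g = of_real (ck * nu_const TYPE('n) \<alpha>) * (\<integral>z. eta (\<alpha> + real k) z *\<^sub>R cdual_apply (D_op k g z) (f z) \<partial>lborel)"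
    and "set_integrable (nu_alpha \<alpha>) (ball 0 1) (pairing_integrand k f g) \<longleftrightarrow>
      integrable lborel (\<lambda>z. eta (\<alpha> + real k) z *\<^sub>R cdual_apply (D_op k g z) (f z))"
    and "(\<lambda>z. eta (\<alpha> + real k) z *\<^sub>R cdual_apply (D_op k g z) (f z)) \<in> borel_measurable borel"
proof -
  have c: "continuous_on (ball 0 1) (\<lambda>z. cdual_apply (D_op k g z) (f z))"
    by (intro cdual.continuous_on hol_on_continuous_on f hol_on_D_op g)
  then show "(\<lambda>z. eta (\<alpha> + real k) z *\<^sub>R cdual_apply (D_op k g z) (f z)) \<in> borel_measurable borel"
    by (rule measurable_eta_scaleR)
  have c': "continuous_on (ball 0 1) (pairing_integrand k f g)"
    unfolding pairing_integrand_def using c by (intro continuous_intros)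
  have e: "eta \<alpha> z *\<^sub>R pairing_integrand k f g z = eta (\<alpha> + real k) z *\<^sub>R cdual_apply (D_op k g z) (f z)" for z
    using pairing_integrand_eq[of z k f g] by (cases "norm z < 1") (auto simp: eta_outside)
  show "pairing ck k \<alpha> f g = of_real (ck * nu_const TYPE('n) \<alpha>) * (\<integral>z. eta (\<alpha> + real k) z *\<^sub>R cdual_apply (D_op k g z) (f z) \<partial>lborel)"
    unfolding pairing_def nu_alpha_integral(2)[OF \<alpha> c'] e by (simp add: scaleR_conv_of_real)
  show "set_integrable (nu_alpha \<alpha>) (ball 0 1) (pairing_integrand k f g) \<longleftrightarrow>
      integrable lborel (\<lambda>z. eta (\<alpha> + real k) z *\<^sub>R cdual_apply (D_op k g z) (f z))"
    unfolding nu_alpha_integral(1)[OF \<alpha> c'] e ..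
qed

text \<open>The growth exponent k - \<gamma> of D_k g lowers the weight from \<alpha> + k to
  \<alpha> + \<gamma>, the one of the embedding.\<close>

lemma pairing_bounded:
  assumes \<gamma>: "\<gamma> = (real CARD('n) + 1 + \<alpha>) * (1 / p - 1)" and ck: "ck > 0"
  obtains C where "C > 0" "\<And>(f :: complex ^ 'n \<Rightarrow> 'x::complex_normed_space) g M. f \<in> bergman p \<alpha> \<Longrightarrow> hol_on (ball 0 1) g \<Longrightarrow>
    grow (real k - \<gamma>) M (D_op k g) \<Longrightarrow>
    integrable lborel (\<lambda>z. eta (\<alpha> + real k) z *\<^sub>R cdual_apply (D_op k g z) (f z)) \<and>
    cmod (pairing ck k \<alpha> f g) \<le> C * M * bergman_norm p \<alpha> f"
proof -
  obtain C where C: "C > 0" "\<And>f :: complex ^ 'n \<Rightarrow> 'x. f \<in> bergman p \<alpha> \<Longrightarrow>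
    integrable lborel (\<lambda>z. eta (\<alpha> + \<gamma>) z * norm (f z)) \<and> (\<integral>z. eta (\<alpha> + \<gamma>) z * norm (f z) \<partial>lborel) \<le> C * bergman_norm p \<alpha> f"
    using bergman_embedding[OF \<gamma>] by blast
  have nu_const: "nu_const TYPE('n) \<alpha> > 0" by (rule nu_const_pos[OF \<alpha>])
  show thesis
  proof (rule that[of "ck * nu_const TYPE('n) \<alpha> * C"])
    show "ck * nu_const TYPE('n) \<alpha> * C > 0" using C nu_const ck by simp
    fix f :: "complex ^ 'n \<Rightarrow> 'x" and g :: "complex ^ 'n \<Rightarrow> 'x cdual" and M
    assume f: "f \<in> bergman p \<alpha>" and g: "hol_on (ball 0 1) g"
      and gr: "grow (real k - \<gamma>) M (D_op k g)"
    note hol = bergmanD(1)[OF f]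
    have M: "0 \<le> M" by (rule grow_nonneg[OF gr])
    let ?h = "\<lambda>z. eta (\<alpha> + real k) z *\<^sub>R cdual_apply (D_op k g z) (f z)"
    have le: "norm (?h z) \<le> M * (eta (\<alpha> + \<gamma>) z * norm (f z))" for z
    proof (cases "norm z < 1")
      case True
      have "cmod (cdual_apply (D_op k g z) (f z)) \<le> norm (D_op k g z) * norm (f z)" by (rule norm_cdual_apply)
      also have "\<dots> \<le> (M * (1 - (norm z)\<^sup>2) powr (- (real k - \<gamma>))) * norm (f z)"
        by (intro mult_right_mono growD[OF gr True]) simp
      finally have "eta (\<alpha> + real k) z * cmod (cdual_apply (D_op k g z) (f z))
          \<le> eta (\<alpha> + real k) z * ((M * (1 - (norm z)\<^sup>2) powr (- (real k - \<gamma>))) * norm (f z))"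
        by (intro mult_left_mono) auto
      also have "\<dots> = M * ((eta (\<alpha> + real k) z * (1 - (norm z)\<^sup>2) powr (- (real k - \<gamma>))) * norm (f z))"
        by (simp only: mult_ac)
      also have "eta (\<alpha> + real k) z * (1 - (norm z)\<^sup>2) powr (- (real k - \<gamma>)) = eta (\<alpha> + \<gamma>) z"
        using eta_powr_mult[OF True, of "\<alpha> + real k" "- (real k - \<gamma>)"] by simp
      finally show ?thesis by simp
    qed (simp add: eta_outside)
    have i: "integrable lborel ?h"
    proof (rule Bochner_Integration.integrable_bound)
      show "integrable lborel (\<lambda>z. M * (eta (\<alpha> + \<gamma>) z * norm (f z)))" using C(2)[OF f] by simp
      show "?h \<in> borel_measurable lborel" using pairing_eq(3)[OF hol g] by simp
      show "AE z in lborel. norm (?h z) \<le> norm (M * (eta (\<alpha> + \<gamma>) z * norm (f z)))"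
        using order_trans[OF le abs_ge_self] by simp
    qed
    have "cmod (\<integral>z. ?h z \<partial>lborel) \<le> (\<integral>z. M * (eta (\<alpha> + \<gamma>) z * norm (f z)) \<partial>lborel)"
      using i C(2)[OF f] le by (intro Bochner_Integration.integral_norm_bound_integral) auto
    also have "\<dots> \<le> M * (C * bergman_norm p \<alpha> f)" using C(2)[OF f] M by (simp add: mult_left_mono)
    finally have "ck * nu_const TYPE('n) \<alpha> * cmod (\<integral>z. ?h z \<partial>lborel) \<le> ck * nu_const TYPE('n) \<alpha> * (M * (C * bergman_norm p \<alpha> f))"
      using ck nu_const by (intro mult_left_mono) auto
    then show "integrable lborel ?h \<and> cmod (pairing ck k \<alpha> f g) \<le> ck * nu_const TYPE('n) \<alpha> * C * M * bergman_norm p \<alpha> f"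
      using i ck nu_const unfolding pairing_eq(1)[OF hol g] by (simp add: norm_mult mult_ac)
  qed
qed


lemma pairing_in_dual:
  fixes g :: "complex ^ 'n \<Rightarrow> 'x::complex_normed_space cdual"
  assumes \<gamma>: "\<gamma> = (real CARD('n) + 1 + \<alpha>) * (1 / p - 1)" and ck: "ck > 0"
    and g: "hol_on (ball 0 1) g" and gr: "grow (real k - \<gamma>) M (D_op k g)"
  shows "(\<lambda>f. pairing ck k \<alpha> f g) \<in> bergman_dual p \<alpha>"
proof -
  obtain C where C: "C > 0" "\<And>(f :: complex ^ 'n \<Rightarrow> 'x) g M. f \<in> bergman p \<alpha> \<Longrightarrow> hol_on (ball 0 1) g \<Longrightarrow>
    grow (real k - \<gamma>) M (D_op k g) \<Longrightarrow>
    integrable lborel (\<lambda>z. eta (\<alpha> + real k) z *\<^sub>R cdual_apply (D_op k g z) (f z)) \<and>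
    cmod (pairing ck k \<alpha> f g) \<le> C * M * bergman_norm p \<alpha> f"
    using pairing_bounded[OF \<gamma> ck] by blast
  have i: "integrable lborel (\<lambda>z. eta (\<alpha> + real k) z *\<^sub>R cdual_apply (D_op k g z) (f z))" if "f \<in> bergman p \<alpha>" for f
    using C(2)[OF that g gr] by blast
  have "pairing ck k \<alpha> (\<lambda>z. f1 z + f2 z) g = pairing ck k \<alpha> f1 g + pairing ck k \<alpha> f2 g"
    if "f1 \<in> bergman p \<alpha>" "f2 \<in> bergman p \<alpha>" for f1 f2
    using i[OF that(1)] i[OF that(2)]
    unfolding pairing_eq(1)[OF bergmanD(1)[OF bergman_add[OF that]] g] pairing_eq(1)[OF bergmanD(1)[OF that(1)] g]
      pairing_eq(1)[OF bergmanD(1)[OF that(2)] g]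
    by (simp add: cdual_apply_add_right scaleR_add_right distrib_left)
  moreover have "pairing ck k \<alpha> (\<lambda>z. c *\<^sub>C f z) g = c * pairing ck k \<alpha> f g" if f: "f \<in> bergman p \<alpha>" for f c
  proof -
    have e: "eta (\<alpha> + real k) z *\<^sub>R cdual_apply (D_op k g z) (c *\<^sub>C f z)
        = c * (eta (\<alpha> + real k) z *\<^sub>R cdual_apply (D_op k g z) (f z))" for z
      by (simp add: cdual_apply_scaleC_right)
    show ?thesis
      unfolding pairing_eq(1)[OF bergmanD(1)[OF bergman_cmul[OF f]] g] pairing_eq(1)[OF bergmanD(1)[OF f] g] e
        Bochner_Integration.integral_mult_right_zero by (simp only: mult_ac)
  qed
  moreover have "\<exists>C. \<forall>f\<in>bergman p \<alpha>. cmod (pairing ck k \<alpha> f g) \<le> C * bergman_norm p \<alpha> f"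
    using C(2)[OF _ g gr] by (intro exI[of _ "C * M"]) blast
  ultimately show ?thesis unfolding bergman_dual_def by blast
qed

section \<open>Kernel functions\<close>

definition kernel_fun :: "real \<Rightarrow> complex ^ 'n \<Rightarrow> 'x::complex_normed_space \<Rightarrow> complex ^ 'n \<Rightarrow> 'x"
  where "kernel_fun c w x z = bker c (cin z w) *\<^sub>C x"

lemma hol_on_kernel_fun:
  fixes w :: "complex ^ 'n" and x :: "'x::complex_normed_space"
  assumes "norm w < 1"
  shows "hol_on (ball 0 1) (kernel_fun c w x)"
proof -
  have "norm z * norm w < 1" if "z \<in> ball 0 1" for z :: "complex ^ 'n"
    using mult_left_mono[of "norm w" 1 "norm z"] assms that by simp
  then have "hol_on (ball 0 1) (\<lambda>z. bker c (cin z w))" by (rule hol_on_bker)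
  then show ?thesis unfolding kernel_fun_def by (intro hol_on_scaleC hol_on_const)
qed

text \<open>p times the kernel exponent exceeds n + 1 + \<alpha> by exactly t = p (k - \<gamma>), so
  Forelli-Rudin bounds the p-th power of the norm, and the p-th root restores the exponent k -
  \<gamma>.\<close>

lemma kernel_fun_norm:
  assumes \<gamma>: "\<gamma> = (real CARD('n) + 1 + \<alpha>) * (1 / p - 1)" and k: "real k > \<gamma>"
  obtains C where "C > 0" "\<And>(w :: complex ^ 'n) (x :: 'x::complex_normed_space). norm w < 1 \<Longrightarrow>
    kernel_fun (real CARD('n) + 1 + \<alpha> + real k) w x \<in> bergman p \<alpha> \<and>
    bergman_norm p \<alpha> (kernel_fun (real CARD('n) + 1 + \<alpha> + real k) w x) \<le> C * norm x * (1 - (norm w)\<^sup>2) powr (- (real k - \<gamma>))"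
proof -
  define c where "c = real CARD('n) + 1 + \<alpha> + real k"
  define t where "t = p * (real k - \<gamma>)"
  have t: "t > 0" using k p by (simp add: t_def)
  have e: "p * c = real CARD('n) + 1 + \<alpha> + t"
    using p by (simp add: c_def t_def \<gamma> field_simps)
  obtain C where C: "C > 0" "\<And>w :: complex ^ 'n. norm w < 1 \<Longrightarrow>
    fr_int \<alpha> (real CARD('n) + 1 + \<alpha> + t) w \<le> ennreal (C * (1 - (norm w)\<^sup>2) powr (- t))"
    using forelli_rudin[OF \<alpha> t] by blast
  have nu_const: "nu_const TYPE('n) \<alpha> > 0" by (rule nu_const_pos[OF \<alpha>])
  show thesis
  proof (rule that[of "(nu_const TYPE('n) \<alpha> * C) powr (1 / p)"])
    show "(nu_const TYPE('n) \<alpha> * C) powr (1 / p) > 0" using nu_const C by simp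
    fix w :: "complex ^ 'n" and x :: 'x assume w: "norm w < 1"
    define y where "y = 1 - (norm w)\<^sup>2"
    have y: "y > 0" using one_minus_norm_sq_pos[OF w] by (simp add: y_def)
    note hol = hol_on_kernel_fun[OF w, of c x]
    have "bergman_integral \<alpha> p (kernel_fun c w x) = (\<integral>\<^sup>+z. ennreal (norm x powr p) * ennreal (eta \<alpha> z * dist1 z w powr (- (p * c))) \<partial>lborel)"
      unfolding bergman_integral_def kernel_fun_def norm_scaleC norm_bker
      by (intro nn_integral_cong) (simp add: powr_mult powr_powr mult_ac flip: ennreal_mult)
    also have "\<dots> = ennreal (norm x powr p) * fr_int \<alpha> (p * c) w"
      unfolding fr_int_def by (intro nn_integral_cmult) auto
    also have "\<dots> \<le> ennreal (norm x powr p) * ennreal (C * y powr (- t))"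
      unfolding e y_def by (intro mult_left_mono C(2)[OF w]) simp
    also have "\<dots> = ennreal (norm x powr p * (C * y powr (- t)))" using C(1) by (simp add: ennreal_mult)
    finally have b: "bergman_integral \<alpha> p (kernel_fun c w x) \<le> ennreal (norm x powr p * (C * y powr (- t)))" .
    note n = bergman_norm_le[OF hol b]
    have "(nu_const TYPE('n) \<alpha> * (norm x powr p * (C * y powr (- t)))) powr (1 / p)
        = ((nu_const TYPE('n) \<alpha> * C) * norm x powr p * y powr (- t)) powr (1 / p)"
      by (simp only: mult_ac)
    also have "\<dots> = (nu_const TYPE('n) \<alpha> * C) powr (1 / p) * norm x * y powr (- (real k - \<gamma>))"
      using nu_const C(1) p y by (simp add: powr_mult powr_powr t_def)
    finally show "kernel_fun (real CARD('n) + 1 + \<alpha> + real k) w x \<in> bergman p \<alpha> \<and>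
      bergman_norm p \<alpha> (kernel_fun (real CARD('n) + 1 + \<alpha> + real k) w x)
        \<le> (nu_const TYPE('n) \<alpha> * C) powr (1 / p) * norm x * (1 - (norm w)\<^sup>2) powr (- (real k - \<gamma>))"
      using n C(1) by (simp add: c_def y_def)
  qed
qed

text \<open>Evaluation at x is conjugate linear on the dual because of its conjugated scalar
  multiplication; a second conjugation makes it complex linear.\<close>

lemma hol_on_cnj_apply:
  assumes "hol_on S G"
  shows "hol_on S (\<lambda>z. cnj (cdual_apply (G z) x))"
proof -
  have b: "bounded_linear (\<lambda>u. cnj (cdual_apply u x))"
    using bounded_linear_compose[OF bounded_linear_cnj cdual.bounded_linear_left] .
  have "((\<lambda>z. cnj (cdual_apply (G z) x)) has_derivative (\<lambda>h. cnj (cdual_apply (dd G h z) x))) (at z)"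
    if "z \<in> S" for z
    by (rule bounded_linear.has_derivative[OF b hol_on_has_derivative[OF assms that]])
  then show ?thesis
    by (rule hol_onI) (auto simp: dd_cmul[OF assms] cdual_apply_scaleC scaleC_complex_def)
qed

text \<open>After conjugation the integrand is F(z) times the kernel at \<open>cin w z\<close>, with
  F the scalar holomorphic function of \<open>hol_on_cnj_apply\<close>; the reproducing formula
  evaluates F at w.\<close>

lemma pairing_kernel_fun:
  fixes g :: "complex ^ 'n \<Rightarrow> 'x::complex_normed_space cdual"
  assumes g: "hol_on (ball 0 1) g" and \<gamma>: "0 \<le> \<gamma>" "real k > \<gamma>" and k1: "0 < \<alpha> + real k"
    and gr: "grow (real k - \<gamma>) M (D_op k g)" and w: "norm w < 1"
  shows "pairing ck k \<alpha> (kernel_fun (real CARD('n) + 1 + \<alpha> + real k) w x) g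
    = of_real (ck * nu_const TYPE('n) \<alpha> * eta_int TYPE('n) (\<alpha> + real k)) * cdual_apply (D_op k g w) x"
proof -
  define s where "s = \<alpha> + real k"
  define c where "c = real CARD('n) + s + 1"
  define F where "F z = cnj (cdual_apply (D_op k g z) x)" for z
  have F: "hol_on (ball 0 1) F" unfolding F_def by (rule hol_on_cnj_apply[OF hol_on_D_op[OF g]])
  have bound: "cmod (F z) \<le> (M * norm x) * (1 - (norm z)\<^sup>2) powr (- (real k - \<gamma>))" if z: "norm z < 1" for z
  proof -
    have "cmod (F z) \<le> norm (D_op k g z) * norm x" unfolding F_def by (simp add: norm_cdual_apply)
    also have "\<dots> \<le> (M * (1 - (norm z)\<^sup>2) powr (- (real k - \<gamma>))) * norm x"
      by (intro mult_right_mono growD[OF gr z]) simp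
    finally show ?thesis by (simp only: mult_ac)
  qed
  \<comment> \<open>s - (k - \<gamma>) = \<alpha> + \<gamma> > -1, as the reproducing formula for
    moderate growth requires.\<close>
  have s0: "s > 0" and b0: "0 \<le> real k - \<gamma>" and sb: "s - (real k - \<gamma>) > - 1"
    using k1 \<gamma> \<alpha> by (auto simp: s_def)
  have rep: "(\<integral>z. eta s z *\<^sub>R (F z * bker c (cin w z)) \<partial>lborel) = eta_int TYPE('n) s *\<^sub>R F w"
    unfolding c_def by (rule reproducing_formula(1)[OF F s0 b0 sb bound w])
  have pt: "eta s z *\<^sub>R cdual_apply (D_op k g z) (kernel_fun c w x z) = cnj (eta s z *\<^sub>R (F z * bker c (cin w z)))" for z
  proof (cases "norm z < 1")
    case True
    have "Re (cin w z) < 1"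
      using mult_left_mono[of "norm z" 1 "norm w"] True w by (intro Re_cin_less) simp
    then have "cnj (bker c (cin w z)) = bker c (cin z w)" by (simp add: cnj_bker cnj_cin)
    then show ?thesis by (simp add: F_def kernel_fun_def cdual_apply_scaleC_right mult.commute)
  qed (simp add: eta_outside)
  have ce: "real CARD('n) + 1 + \<alpha> + real k = c" by (simp add: c_def s_def)
  have "(\<integral>z. eta s z *\<^sub>R cdual_apply (D_op k g z) (kernel_fun c w x z) \<partial>lborel)
      = cnj (\<integral>z. eta s z *\<^sub>R (F z * bker c (cin w z)) \<partial>lborel)"
    unfolding pt by (rule Bochner_Integration.integral_cnj)
  also have "\<dots> = of_real (eta_int TYPE('n) s) * cdual_apply (D_op k g w) x"
    unfolding rep by (simp add: F_def scaleR_conv_of_real)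
  finally have I: "(\<integral>z. eta s z *\<^sub>R cdual_apply (D_op k g z) (kernel_fun c w x z) \<partial>lborel)
      = of_real (eta_int TYPE('n) s) * cdual_apply (D_op k g w) x" .
  show ?thesis
    unfolding ce pairing_eq(1)[OF hol_on_kernel_fun[OF w] g] s_def[symmetric] I by simp
qed

end

section \<open>Existence of the representing function\<close>

text \<open>Divide the j-th Taylor coefficient of \<psi> by i + j. As i \<ge> 1, no divisor vanishes
  and the coefficients do not grow, so the series still converges on the disc.\<close>

lemma euler_equation_solvable:
  fixes \<psi> :: "complex \<Rightarrow> complex"
  assumes \<psi>: "\<psi> holomorphic_on ball 0 1" and i: "1 \<le> i"
  obtains \<phi> where "\<phi> holomorphic_on ball 0 1"
    "\<And>\<zeta>. cmod \<zeta> < 1 \<Longrightarrow> of_nat i * \<phi> \<zeta> + \<zeta> * deriv \<phi> \<zeta> = \<psi> \<zeta>"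
proof -
  define a where "a j = (deriv ^^ j) \<psi> 0 / fact j" for j
  define b where "b j = a j / of_nat (i + j)" for j
  have a: "(\<lambda>j. a j * \<zeta> ^ j) sums \<psi> \<zeta>" if "cmod \<zeta> < 1" for \<zeta>
    using holomorphic_power_series[OF \<psi>, of \<zeta>] that by (simp add: a_def)
  have b: "summable (\<lambda>j. b j * \<zeta> ^ j)" if \<zeta>: "cmod \<zeta> < 1" for \<zeta>
  proof -
    define t where "t = (1 + cmod \<zeta>) / 2"
    have "0 \<le> t" "t < 1" "cmod \<zeta> < t" using \<zeta> by (auto simp: t_def)
    then have "cmod (of_real t) < 1" "cmod \<zeta> < cmod (of_real t)" by (simp_all only: norm_of_real abs_of_nonneg)
    then have s: "summable (\<lambda>j. norm (a j * \<zeta> ^ j))"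
      using powser_insidea[of a "of_real t" \<zeta>] a sums_summable by blast
    show ?thesis
    proof (rule summable_comparison_test[OF _ s], intro exI allI impI)
      fix j :: nat
      have "1 \<le> real (i + j)" using i by linarith
      then have "cmod (a j) \<le> cmod (a j) * real (i + j)" by (metis mult_left_mono norm_ge_zero mult.right_neutral)
      then have "cmod (b j) \<le> cmod (a j)"
        using \<open>1 \<le> real (i + j)\<close> unfolding b_def norm_divide norm_of_nat by (subst divide_le_eq) auto
      then show "norm (b j * \<zeta> ^ j) \<le> norm (a j * \<zeta> ^ j)"
        unfolding norm_mult by (rule mult_right_mono) simp
    qed
  qed
  define \<phi> where "\<phi> \<zeta> = (\<Sum>j. b j * \<zeta> ^ j)" for \<zeta>
  have d: "(\<phi> has_field_derivative (\<Sum>j. diffs b j * \<zeta> ^ j)) (at \<zeta>)" if "cmod \<zeta> < 1" for \<zeta>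
    unfolding \<phi>_def by (rule termdiffs_strong'[OF b that])
  show thesis
  proof (rule that[of \<phi>])
    show "\<phi> holomorphic_on ball 0 1"
      by (rule holomorphic_onI) (use d in \<open>auto simp: field_differentiable_def intro: has_field_derivative_at_within\<close>)
    fix \<zeta> :: complex assume \<zeta>: "cmod \<zeta> < 1"
    have "summable (\<lambda>j. diffs b j * \<zeta> ^ j)" by (rule termdiff_converges[OF \<zeta> b])
    from sums_mult[OF diffs_equiv[OF this], of \<zeta>]
    have "(\<lambda>j. \<zeta> * (of_nat j * b j * \<zeta> ^ (j - Suc 0))) sums (\<zeta> * deriv \<phi> \<zeta>)"
      using DERIV_imp_deriv[OF d[OF \<zeta>]] by simp
    moreover have "(\<lambda>j. of_nat i * (b j * \<zeta> ^ j)) sums (of_nat i * \<phi> \<zeta>)"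
      unfolding \<phi>_def by (intro sums_mult summable_sums b \<zeta>)
    ultimately have "(\<lambda>j. of_nat i * (b j * \<zeta> ^ j) + \<zeta> * (of_nat j * b j * \<zeta> ^ (j - Suc 0)))
        sums (of_nat i * \<phi> \<zeta> + \<zeta> * deriv \<phi> \<zeta>)" by (intro sums_add)
    moreover have "of_nat i * (b j * \<zeta> ^ j) + \<zeta> * (of_nat j * b j * \<zeta> ^ (j - Suc 0)) = a j * \<zeta> ^ j" for j
    proof -
      have "\<zeta> * (of_nat j * b j * \<zeta> ^ (j - Suc 0)) = of_nat j * b j * \<zeta> ^ j"
        by (cases j) auto
      moreover have "of_nat (i + j) * b j = a j" using i unfolding b_def by (simp del: of_nat_add)
      ultimately show ?thesis by (simp add: algebra_simps flip: \<open>of_nat (i + j) * b j = a j\<close>)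
    qed
    ultimately show "of_nat i * \<phi> \<zeta> + \<zeta> * deriv \<phi> \<zeta> = \<psi> \<zeta>"
      using a[OF \<zeta>] sums_unique2 by simp
  qed
qed

context bergman_setup
begin

text \<open>For a bounded functional \<Lambda> and bounded holomorphic \<phi> such an element exists
  and is unique; it depends conjugate linearly on \<phi>.\<close>

definition dualize :: "((complex ^ 'n \<Rightarrow> 'x::complex_normed_space) \<Rightarrow> complex) \<Rightarrow> (complex ^ 'n \<Rightarrow> complex) \<Rightarrow> 'x cdual"
  where "dualize \<Lambda> \<phi> = (SOME u. \<forall>x. cdual_apply u x = \<Lambda> (\<lambda>z. \<phi> z *\<^sub>C x))"

definition hol_bounded :: "(complex ^ 'n \<Rightarrow> complex) \<Rightarrow> bool"
  where "hol_bounded \<phi> \<longleftrightarrow> hol_on (ball 0 1) \<phi> \<and> (\<exists>B. \<forall>z. norm z < 1 \<longrightarrow> cmod (\<phi> z) \<le> B)"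

lemma hol_boundedI: "hol_on (ball 0 1) \<phi> \<Longrightarrow> (\<And>z. norm z < 1 \<Longrightarrow> cmod (\<phi> z) \<le> B) \<Longrightarrow> hol_bounded \<phi>"
  by (auto simp: hol_bounded_def)

lemma hol_bounded_bergman:
  assumes "hol_bounded \<phi>"
  shows "(\<lambda>z. \<phi> z *\<^sub>C x) \<in> bergman p \<alpha>"
proof -
  obtain B where hol: "hol_on (ball 0 1) \<phi>" and B: "\<And>z. norm z < 1 \<Longrightarrow> cmod (\<phi> z) \<le> B"
    using assms by (auto simp: hol_bounded_def)
  show ?thesis
    by (rule bergman_bounded(1)[OF hol_on_scaleC(1)[OF hol hol_on_const(1)], where B = "B * norm x"])
       (use B in \<open>simp add: norm_scaleC mult_right_mono\<close>)
qed

lemma dualize: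
  fixes \<Lambda> :: "(complex ^ 'n \<Rightarrow> 'x::complex_normed_space) \<Rightarrow> complex"
  assumes \<Lambda>: "\<Lambda> \<in> bergman_dual p \<alpha>"
  shows "hol_bounded \<phi> \<Longrightarrow> cdual_apply (dualize \<Lambda> \<phi>) x = \<Lambda> (\<lambda>z. \<phi> z *\<^sub>C x)"
    and "\<exists>L\<ge>0. \<forall>\<phi> B. hol_on (ball 0 1) \<phi> \<longrightarrow> (\<forall>z. norm z < 1 \<longrightarrow> cmod (\<phi> z) \<le> B) \<longrightarrow> norm (dualize \<Lambda> \<phi>) \<le> L * B"
proof -
  obtain C where C: "0 \<le> C" "\<And>f. f \<in> bergman p \<alpha> \<Longrightarrow> cmod (\<Lambda> f) \<le> C * bergman_norm p \<alpha> f"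
    using dual_bound[OF \<Lambda>] by blast
  define L where "L = C * bergman_const TYPE('n)"
  have L: "0 \<le> L" unfolding L_def by (intro mult_nonneg_nonneg C(1) bergman_const_nonneg)
  have main: "(\<forall>x. cdual_apply (dualize \<Lambda> \<phi>) x = \<Lambda> (\<lambda>z. \<phi> z *\<^sub>C x)) \<and> norm (dualize \<Lambda> \<phi>) \<le> L * B"
    if hol: "hol_on (ball 0 1) \<phi>" and B: "\<And>z. norm z < 1 \<Longrightarrow> cmod (\<phi> z) \<le> B" for \<phi> B
  proof -
    have B0: "0 \<le> B" using order_trans[OF norm_ge_zero B[of 0]] by simp
    note hb = hol_bounded_bergman[OF hol_boundedI[OF hol B]]
    have bound: "cmod (\<Lambda> (\<lambda>z. \<phi> z *\<^sub>C x)) \<le> (L * B) * norm x" for x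
    proof -
      have "bergman_norm p \<alpha> (\<lambda>z. \<phi> z *\<^sub>C x) \<le> bergman_const TYPE('n) * (B * norm x)"
        by (rule bergman_bounded(2)[OF hol_on_scaleC(1)[OF hol hol_on_const(1)]])
          (use B in \<open>simp add: norm_scaleC mult_right_mono\<close>)
      from mult_left_mono[OF this C(1)] C(2)[OF hb[of x]] show ?thesis
        by (simp add: L_def mult_ac)
    qed
    have "\<Lambda> (\<lambda>z. \<phi> z *\<^sub>C (x + y)) = \<Lambda> (\<lambda>z. \<phi> z *\<^sub>C x) + \<Lambda> (\<lambda>z. \<phi> z *\<^sub>C y)" for x y
      using dualD(1)[OF \<Lambda> hb[of x] hb[of y]] by (simp add: scaleC_add_right)
    moreover have "\<Lambda> (\<lambda>z. \<phi> z *\<^sub>C (c *\<^sub>C x)) = c * \<Lambda> (\<lambda>z. \<phi> z *\<^sub>C x)" for c x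
      using dualD(2)[OF \<Lambda> hb[of x], of c] by (simp add: scaleC_scaleC mult.commute)
    moreover have "0 \<le> L * B" using L B0 by simp
    ultimately obtain u where u: "\<And>x. cdual_apply u x = \<Lambda> (\<lambda>z. \<phi> z *\<^sub>C x)"
      using cdual_make[of "\<lambda>x. \<Lambda> (\<lambda>z. \<phi> z *\<^sub>C x)" "L * B"] bound by metis
    have ap: "cdual_apply (dualize \<Lambda> \<phi>) x = \<Lambda> (\<lambda>z. \<phi> z *\<^sub>C x)" for x
      unfolding dualize_def using someI[of "\<lambda>u. \<forall>x. cdual_apply u x = \<Lambda> (\<lambda>z. \<phi> z *\<^sub>C x)" u] u by blast
    moreover have "norm (dualize \<Lambda> \<phi>) \<le> L * B"
      by (rule norm_cdual_bound) (use L B0 bound ap in auto)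
    ultimately show ?thesis by blast
  qed
  show "hol_bounded \<phi> \<Longrightarrow> cdual_apply (dualize \<Lambda> \<phi>) x = \<Lambda> (\<lambda>z. \<phi> z *\<^sub>C x)"
    unfolding hol_bounded_def using main by blast
  show "\<exists>L\<ge>0. \<forall>\<phi> B. hol_on (ball 0 1) \<phi> \<longrightarrow> (\<forall>z. norm z < 1 \<longrightarrow> cmod (\<phi> z) \<le> B) \<longrightarrow> norm (dualize \<Lambda> \<phi>) \<le> L * B"
    using main L by blast
qed

lemma hol_bounded_add: 
  assumes "hol_bounded \<phi>" "hol_bounded \<psi>"
  shows "hol_bounded (\<lambda>z. \<phi> z + \<psi> z)"
proof -
  obtain A B where A: "\<And>z. norm z < 1 \<Longrightarrow> cmod (\<phi> z) \<le> A" "\<And>z. norm z < 1 \<Longrightarrow> cmod (\<psi> z) \<le> B"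
    using assms by (auto simp: hol_bounded_def)
  have "cmod (\<phi> z + \<psi> z) \<le> A + B" if "norm z < 1" for z
    using A[OF that] norm_triangle_le by (metis add_mono)
  moreover have "hol_on (ball 0 1) (\<lambda>z. \<phi> z + \<psi> z)"
    using assms by (intro hol_on_add(1)) (auto simp: hol_bounded_def)
  ultimately show ?thesis by (auto simp: hol_bounded_def)
qed

lemma hol_bounded_cmul:
  assumes "hol_bounded \<phi>"
  shows "hol_bounded (\<lambda>z. c * \<phi> z)"
proof -
  obtain A where A: "\<And>z. norm z < 1 \<Longrightarrow> cmod (\<phi> z) \<le> A"
    using assms by (auto simp: hol_bounded_def)
  have "cmod (c * \<phi> z) \<le> cmod c * A" if "norm z < 1" for z
    using A[OF that] by (simp add: norm_mult mult_left_mono)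
  moreover have "hol_on (ball 0 1) (\<lambda>z. c *\<^sub>C \<phi> z)"
    using assms by (intro hol_on_cmul(1)) (auto simp: hol_bounded_def)
  ultimately show ?thesis by (auto simp: hol_bounded_def scaleC_complex_def)
qed

lemma dualize_add:
  fixes \<Lambda> :: "(complex ^ 'n \<Rightarrow> 'x::complex_normed_space) \<Rightarrow> complex"
  assumes \<Lambda>: "\<Lambda> \<in> bergman_dual p \<alpha>" and h: "hol_bounded \<phi>" "hol_bounded \<psi>"
  shows "dualize \<Lambda> (\<lambda>z. \<phi> z + \<psi> z) = dualize \<Lambda> \<phi> + dualize \<Lambda> \<psi>"
  by (rule cdual_eqI)
    (simp add: dualize(1)[OF \<Lambda>] h hol_bounded_add cdual.add_left scaleC_add_left dualD(1)[OF \<Lambda>] hol_bounded_bergman)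

lemma dualize_cmul:
  fixes \<Lambda> :: "(complex ^ 'n \<Rightarrow> 'x::complex_normed_space) \<Rightarrow> complex"
  assumes \<Lambda>: "\<Lambda> \<in> bergman_dual p \<alpha>" and h: "hol_bounded \<phi>"
  shows "dualize \<Lambda> (\<lambda>z. c * \<phi> z) = cnj c *\<^sub>C dualize \<Lambda> \<phi>"
  by (rule cdual_eqI)
    (simp add: dualize(1)[OF \<Lambda>] h hol_bounded_cmul cdual_apply_scaleC dualD(2)[OF \<Lambda>] hol_bounded_bergman
      flip: scaleC_scaleC)

lemma dualize_scaleR:
  fixes \<Lambda> :: "(complex ^ 'n \<Rightarrow> 'x::complex_normed_space) \<Rightarrow> complex"
  assumes \<Lambda>: "\<Lambda> \<in> bergman_dual p \<alpha>" and h: "hol_bounded \<phi>"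
  shows "dualize \<Lambda> (\<lambda>z. of_real r * \<phi> z) = r *\<^sub>R dualize \<Lambda> \<phi>"
  using dualize_cmul[OF assms, of "of_real r"] by (simp add: scaleC_of_real)

lemma dualize_cong:
  fixes \<Lambda> :: "(complex ^ 'n \<Rightarrow> 'x::complex_normed_space) \<Rightarrow> complex"
  assumes \<Lambda>: "\<Lambda> \<in> bergman_dual p \<alpha>" and h: "hol_bounded \<phi>" "hol_bounded \<psi>"
    and eq: "\<And>z. norm z < 1 \<Longrightarrow> \<phi> z = \<psi> z"
  shows "dualize \<Lambda> \<phi> = dualize \<Lambda> \<psi>"
  by (rule cdual_eqI)
    (use dual_cong[OF \<Lambda> hol_bounded_bergman[OF h(1)] hol_bounded_bergman[OF h(2)]] eq in \<open>simp add: dualize(1)[OF \<Lambda>] h\<close>)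

lemma compose_cin:
  assumes \<phi>: "\<phi> holomorphic_on ball 0 1" and w: "norm (w :: complex ^ 'n) < 1"
  shows "hol_on (ball 0 1) (\<lambda>z. \<phi> (cin z w))" "hol_bounded (\<lambda>z. \<phi> (cin z w))"
proof -
  have le: "cmod (cin z w) \<le> norm w" if "norm z < 1" for z
    using norm_cin_le[of z w] mult_right_mono[of "norm z" 1 "norm w"] that by simp
  show hol: "hol_on (ball 0 1) (\<lambda>z. \<phi> (cin z w))"
  proof (rule hol_on_compose(1)[OF hol_on_cin(1)])
    fix z :: "complex ^ 'n" assume "z \<in> ball 0 1"
    then have "cin z w \<in> ball 0 1" using le[of z] w by simp
    then show "(\<phi> has_field_derivative deriv \<phi> (cin z w)) (at (cin z w))"
      by (rule holomorphic_derivI[OF \<phi> open_ball])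
  qed
  have "continuous_on (cball 0 (norm w)) \<phi>"
    by (rule continuous_on_subset[OF holomorphic_on_imp_continuous_on[OF \<phi>]]) (use w in auto)
  from compact_imp_bounded[OF compact_continuous_image[OF this compact_cball]]
  obtain B where "\<And>\<zeta>. \<zeta> \<in> cball 0 (norm w) \<Longrightarrow> cmod (\<phi> \<zeta>) \<le> B"
    unfolding bounded_iff by blast
  then show "hol_bounded (\<lambda>z. \<phi> (cin z w))" by (intro hol_boundedI[OF hol]) (use le in auto)
qed

text \<open>Antiholomorphic dependence of \<open>\<phi> \<langle>z, w\<rangle>\<close> on \<open>w\<close> becomes holomorphic under the conjugated scalar
  multiplication of the dual space.\<close>

definition dual_kernel :: "((complex ^ 'n \<Rightarrow> 'x::complex_normed_space) \<Rightarrow> complex) \<Rightarrow> (complex \<Rightarrow> complex) \<Rightarrow> complex ^ 'n \<Rightarrow> 'x cdual"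
  where "dual_kernel \<Lambda> \<phi> w = dualize \<Lambda> (\<lambda>z. \<phi> (cin z w))"

lemma compose_cin_deriv:
  assumes \<phi>: "\<phi> holomorphic_on ball 0 1" and w: "norm (w :: complex ^ 'n) < 1"
  obtains M where "M \<ge> 0" "\<And>v. hol_bounded (\<lambda>z. deriv \<phi> (cin z w) * cin z v)"
    "\<And>v z. norm z < 1 \<Longrightarrow> cmod (deriv \<phi> (cin z w) * cin z v) \<le> M * norm v"
proof -
  have d: "deriv \<phi> holomorphic_on ball 0 1" by (rule holomorphic_deriv[OF \<phi> open_ball])
  obtain M where hol: "hol_on (ball 0 1) (\<lambda>z. deriv \<phi> (cin z w))"
    and M: "\<And>z. norm z < 1 \<Longrightarrow> cmod (deriv \<phi> (cin z w)) \<le> M"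
    using compose_cin[OF d w] unfolding hol_bounded_def by auto
  have M0: "0 \<le> M" using order_trans[OF norm_ge_zero M[of 0]] by simp
  have b: "cmod (deriv \<phi> (cin z w) * cin z v) \<le> M * norm v" if z: "norm z < 1" for z v
  proof -
    have "cmod (cin z v) \<le> norm v"
      using norm_cin_le[of z v] mult_right_mono[of "norm z" 1 "norm v"] z by simp
    then show ?thesis unfolding norm_mult by (intro mult_mono M z M0) auto
  qed
  have "hol_on (ball 0 1) (\<lambda>z. deriv \<phi> (cin z w) * cin z v)" for v
    using hol_on_scaleC(1)[OF hol hol_on_cin(1)[of _ v]] by (simp add: scaleC_complex_def)
  from hol_boundedI[OF this b] show thesis by (intro that[OF M0 _ b])
qed

text \<open>Conjugation makes y \<mapsto> \<phi>(cin z y) holomorphic, so the second-order Cauchy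
  estimate applies in y. The bound does not involve z, as is needed for applying a functional to the
  remainder.\<close>

lemma compose_cin_taylor:
  fixes z w v :: "complex ^ 'n"
  assumes \<phi>: "\<phi> holomorphic_on ball 0 1" and z: "norm z < 1" and \<delta>: "\<delta> > 0" "norm w + \<delta> < 1"
    and M: "\<And>\<zeta>. cmod \<zeta> \<le> norm w + \<delta> \<Longrightarrow> cmod (\<phi> \<zeta>) \<le> M" and v: "v \<noteq> 0" "norm v \<le> \<delta> / 2"
  shows "cmod (\<phi> (cin z (w + v)) - \<phi> (cin z w) - deriv \<phi> (cin z w) * cin z v) \<le> 2 * M * (norm v)\<^sup>2 / \<delta>\<^sup>2"
proof -
  have eq: "cnj (\<phi> (cnj (cin y z))) = cnj (\<phi> (cin z y))" for y by (simp add: cnj_cin)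
  have dc: "((\<lambda>\<zeta>. cnj (\<phi> (cnj \<zeta>))) has_field_derivative cnj (deriv \<phi> (cin z y))) (at (cin y z))"
    if "y \<in> ball 0 1" for y
  proof -
    have "norm z * norm y < 1" using mult_right_mono[of "norm z" 1 "norm y"] that z by simp
    then have "cin z y \<in> ball 0 1" using norm_cin_le[of z y] by simp
    from holomorphic_derivI[OF \<phi> open_ball this]
    have "(\<phi> has_field_derivative deriv \<phi> (cin z y)) (at (cnj (cin y z)))" by (simp add: cnj_cin)
    from has_field_derivative_cnj_cnj[OF this] show ?thesis
      by (simp add: o_def)
  qed
  define F where "F y = cnj (\<phi> (cnj (cin y z)))" for y
  have F: "hol_on (ball 0 1) F"
    unfolding F_def by (rule hol_on_compose(1)[OF hol_on_cin(1) dc])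
  define R where "R = \<delta> / norm v"
  have R: "R > 0" "2 \<le> R" using \<delta> v by (auto simp: R_def field_simps)
  have n: "norm (w + l *s v) \<le> norm w + \<delta>" if "cmod l \<le> R" for l
  proof -
    have "cmod l * norm v \<le> \<delta>" using that v by (simp add: R_def field_simps)
    then show ?thesis using norm_triangle_ineq[of w "l *s v"] by (simp add: norm_vector_scalar_mult)
  qed
  have "norm (F (w + v) - F w - dd F v w) \<le> 2 * M / R\<^sup>2"
  proof (rule cauchy_estimates(2)[OF F R(1) _ _ R(2)])
    fix l assume l: "cmod l \<le> R"
    show "w + l *s v \<in> ball 0 1" using n[OF l] \<delta> by simp
    have "cmod (cin z (w + l *s v)) \<le> 1 * norm (w + l *s v)"
      using norm_cin_le[of z "w + l *s v"] mult_right_mono[of "norm z" 1 "norm (w + l *s v)"] z by simp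
    then show "norm (F (w + l *s v)) \<le> M" unfolding F_def eq complex_mod_cnj using n[OF l] by (intro M) simp
  qed
  moreover have "dd F v w = cnj (deriv \<phi> (cin z w) * cin z v)"
  proof -
    have "w \<in> ball 0 1" using \<delta> by simp
    from hol_on_compose(2)[OF hol_on_cin(1) dc this] show ?thesis unfolding F_def by (simp add: hol_on_cin(2) cnj_cin)
  qed
  moreover have "2 * M / R\<^sup>2 = 2 * M * (norm v)\<^sup>2 / \<delta>\<^sup>2" by (simp add: R_def power_divide)
  ultimately have "cmod (cnj (\<phi> (cin z (w + v)) - \<phi> (cin z w) - deriv \<phi> (cin z w) * cin z v)) \<le> 2 * M * (norm v)\<^sup>2 / \<delta>\<^sup>2"
    by (simp add: F_def eq cnj_cin)
  then show ?thesis unfolding complex_mod_cnj .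
qed

text \<open>\<open>dualize\<close> is additive and bounded for the supremum norm, so the Taylor
  remainder, small uniformly in z, passes through \<Lambda>.\<close>

lemma dual_kernel_has_derivative:
  fixes \<Lambda> :: "(complex ^ 'n \<Rightarrow> 'x::complex_normed_space) \<Rightarrow> complex"
  assumes \<Lambda>: "\<Lambda> \<in> bergman_dual p \<alpha>" and \<phi>: "\<phi> holomorphic_on ball 0 1" and w: "norm w < 1"
  shows "(dual_kernel \<Lambda> \<phi> has_derivative (\<lambda>v. dualize \<Lambda> (\<lambda>z. deriv \<phi> (cin z w) * cin z v))) (at w)"
proof -
  define D where "D v = dualize \<Lambda> (\<lambda>z. deriv \<phi> (cin z w) * cin z v)" for v
  obtain L where L: "L \<ge> 0" "\<And>\<phi> B. hol_on (ball 0 1) \<phi> \<Longrightarrow> (\<And>z. norm z < 1 \<Longrightarrow> cmod (\<phi> z) \<le> B) \<Longrightarrow> norm (dualize \<Lambda> \<phi>) \<le> L * B"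
    using dualize(2)[OF \<Lambda>] by blast
  obtain M' where M': "M' \<ge> 0" "\<And>v. hol_bounded (\<lambda>z. deriv \<phi> (cin z w) * cin z v)"
    "\<And>v z. norm z < 1 \<Longrightarrow> cmod (deriv \<phi> (cin z w) * cin z v) \<le> M' * norm v"
    using compose_cin_deriv[OF \<phi> w] by blast
  define \<delta> where "\<delta> = (1 - norm w) / 2"
  have \<delta>: "\<delta> > 0" "norm w + \<delta> < 1" using w by (auto simp: \<delta>_def field_simps)
  have "continuous_on (cball 0 (norm w + \<delta>)) \<phi>"
    by (rule continuous_on_subset[OF holomorphic_on_imp_continuous_on[OF \<phi>]]) (use \<delta> in auto)
  from compact_imp_bounded[OF compact_continuous_image[OF this compact_cball]]
  obtain M where M: "\<And>\<zeta>. \<zeta> \<in> cball 0 (norm w + \<delta>) \<Longrightarrow> cmod (\<phi> \<zeta>) \<le> M"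
    unfolding bounded_iff by blast
  have bl: "bounded_linear D"
  proof (rule bounded_linear_intro)
    show "D (x + y) = D x + D y" for x y
      unfolding D_def dualize_add[OF \<Lambda> M'(2) M'(2), symmetric] by (simp add: cin_add_right distrib_left)
    show "D (r *\<^sub>R x) = r *\<^sub>R D x" for r x
      unfolding D_def dualize_scaleR[OF \<Lambda> M'(2), symmetric]
      by (simp add: cin_scaleR_right scaleR_conv_of_real[where 'a = complex] mult_ac)
    show "norm (D x) \<le> norm x * (L * M')" for x
      using L(2)[of "\<lambda>z. deriv \<phi> (cin z w) * cin z x" "M' * norm x"] M'(2)[of x] M'(3)
      by (auto simp: D_def hol_bounded_def mult_ac)
  qed
  have "(dual_kernel \<Lambda> \<phi> has_derivative D) (at w)"
  proof (rule has_derivativeI_sandwich[where e = "\<delta> / 2" and H = "\<lambda>y. L * (2 * M / \<delta>\<^sup>2) * norm (y - w)"])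
    show "0 < \<delta> / 2" using \<delta> by simp
    show "bounded_linear D" by fact
    show "((\<lambda>y. L * (2 * M / \<delta>\<^sup>2) * norm (y - w)) \<longlongrightarrow> 0) (at w)"
      using tendsto_mult_left[OF tendsto_norm[OF LIM_zero[OF tendsto_ident_at]], of "L * (2 * M / \<delta>\<^sup>2)" w UNIV] by simp
    fix y assume y: "y \<noteq> w" "dist y w < \<delta> / 2"
    define v where "v = y - w"
    have v: "v \<noteq> 0" "norm v \<le> \<delta> / 2" using y by (auto simp: v_def dist_norm)
    have yw: "y = w + v" by (simp add: v_def)
    have y1: "norm y < 1" using norm_triangle_ineq[of w v] v \<delta> by (simp add: yw)
    note hy = compose_cin[OF \<phi> y1] and hw = compose_cin[OF \<phi> w]
    define \<psi> where "\<psi> z = \<phi> (cin z y) - \<phi> (cin z w) - deriv \<phi> (cin z w) * cin z v" for z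
    have \<psi>: "\<psi> = (\<lambda>z. (\<phi> (cin z y) + (-1) * \<phi> (cin z w)) + (-1) * (deriv \<phi> (cin z w) * cin z v))"
      by (simp add: \<psi>_def fun_eq_iff)
    have hb: "hol_bounded \<psi>"
      unfolding \<psi> by (intro hol_bounded_add hol_bounded_cmul hy(2) hw(2) M'(2))
    have "dualize \<Lambda> \<psi> = dual_kernel \<Lambda> \<phi> y + cnj (-1) *\<^sub>C dual_kernel \<Lambda> \<phi> w + cnj (-1) *\<^sub>C D v"
      unfolding \<psi> dual_kernel_def D_def
      by (simp only: dualize_add[OF \<Lambda>] dualize_cmul[OF \<Lambda>] hol_bounded_add hol_bounded_cmul hy(2) hw(2) M'(2))
    then have e: "dualize \<Lambda> \<psi> = dual_kernel \<Lambda> \<phi> y - dual_kernel \<Lambda> \<phi> w - D v"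
      using scaleC_of_real[of "-1" "dual_kernel \<Lambda> \<phi> w"] scaleC_of_real[of "-1" "D v"] by simp
    have "norm (dualize \<Lambda> \<psi>) \<le> L * (2 * M * (norm v)\<^sup>2 / \<delta>\<^sup>2)"
    proof (rule L(2))
      show "hol_on (ball 0 1) \<psi>" using hb by (simp add: hol_bounded_def)
      fix z :: "complex ^ 'n" assume z: "norm z < 1"
      show "cmod (\<psi> z) \<le> 2 * M * (norm v)\<^sup>2 / \<delta>\<^sup>2"
        unfolding \<psi>_def yw by (rule compose_cin_taylor[OF \<phi> z \<delta> _ v]) (use M in simp)
    qed
    then show "norm (dual_kernel \<Lambda> \<phi> y - dual_kernel \<Lambda> \<phi> w - D (y - w)) / norm (y - w) \<le> L * (2 * M / \<delta>\<^sup>2) * norm (y - w)"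
      using v(1) \<delta>(1) unfolding e v_def[symmetric] by (simp add: field_simps power2_eq_square)
  qed
  then show ?thesis unfolding D_def .
qed

lemma hol_on_dual_kernel:
  fixes \<Lambda> :: "(complex ^ 'n \<Rightarrow> 'x::complex_normed_space) \<Rightarrow> complex"
  assumes \<Lambda>: "\<Lambda> \<in> bergman_dual p \<alpha>" and \<phi>: "\<phi> holomorphic_on ball 0 1"
  shows "hol_on (ball 0 1) (dual_kernel \<Lambda> \<phi>)"
proof (rule hol_onI)
  show "(dual_kernel \<Lambda> \<phi> has_derivative (\<lambda>v. dualize \<Lambda> (\<lambda>z. deriv \<phi> (cin z w) * cin z v))) (at w)"
    if "w \<in> ball 0 1" for w by (rule dual_kernel_has_derivative[OF assms]) (use that in simp)
  fix w v :: "complex ^ 'n" and c assume "w \<in> ball 0 1"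
  then obtain M' where M': "\<And>v. hol_bounded (\<lambda>z. deriv \<phi> (cin z w) * cin z v)"
    using compose_cin_deriv[OF \<phi>, of w] by auto
  have "(\<lambda>z. deriv \<phi> (cin z w) * cin z (c *s v)) = (\<lambda>z. cnj c * (deriv \<phi> (cin z w) * cin z v))"
    by (simp add: cin_scale_right mult_ac)
  then show "dualize \<Lambda> (\<lambda>z. deriv \<phi> (cin z w) * cin z (c *s v)) = c *\<^sub>C dualize \<Lambda> (\<lambda>z. deriv \<phi> (cin z w) * cin z v)"
    using dualize_cmul[OF \<Lambda> M', of "cnj c" v] by simp
qed

text \<open>In direction w the derivative becomes \<zeta> \<phi>'(\<zeta>) at \<zeta> =
  \<open>cin z w\<close>, so the Euler operator in w turns into a one-variable operator on
  \<phi>.\<close>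

lemma euler_op_dual_kernel:
  fixes \<Lambda> :: "(complex ^ 'n \<Rightarrow> 'x::complex_normed_space) \<Rightarrow> complex"
  assumes \<Lambda>: "\<Lambda> \<in> bergman_dual p \<alpha>" and \<phi>: "\<phi> holomorphic_on ball 0 1" and w: "w \<in> ball 0 1"
    and eq: "\<And>\<zeta>. cmod \<zeta> < 1 \<Longrightarrow> of_nat i * \<phi> \<zeta> + \<zeta> * deriv \<phi> \<zeta> = \<psi> \<zeta>"
  shows "euler_op i (dual_kernel \<Lambda> \<phi>) w = dual_kernel \<Lambda> \<psi> w"
proof -
  have w': "norm w < 1" using w by simp
  have h: "hol_bounded (\<lambda>z. deriv \<phi> (cin z w) * cin z w)"
    using compose_cin_deriv[OF \<phi> w'] by metis
  note h2 = compose_cin(2)[OF \<phi> w']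
  have h3: "hol_bounded (\<lambda>z. of_real (real i) * \<phi> (cin z w) + deriv \<phi> (cin z w) * cin z w)"
    by (intro hol_bounded_add hol_bounded_cmul h h2)
  have eqz: "of_real (real i) * \<phi> (cin z w) + deriv \<phi> (cin z w) * cin z w = \<psi> (cin z w)" if "norm z < 1" for z
  proof -
    have "norm z * norm w < 1" using mult_right_mono[of "norm z" 1 "norm w"] that w' by simp
    then have "cmod (cin z w) < 1" using norm_cin_le[of z w] by simp
    from eq[OF this] show ?thesis by (simp add: mult_ac)
  qed
  have "euler_op i (dual_kernel \<Lambda> \<phi>) w = real i *\<^sub>R dualize \<Lambda> (\<lambda>z. \<phi> (cin z w)) + dualize \<Lambda> (\<lambda>z. deriv \<phi> (cin z w) * cin z w)"
    unfolding radial_deriv_eq[OF hol_on_dual_kernel[OF \<Lambda> \<phi>] w] dd_eq[OF dual_kernel_has_derivative[OF \<Lambda> \<phi> w']]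
    by (simp add: dual_kernel_def)
  also have "\<dots> = dualize \<Lambda> (\<lambda>z. of_real (real i) * \<phi> (cin z w) + deriv \<phi> (cin z w) * cin z w)"
    by (simp only: dualize_add[OF \<Lambda> hol_bounded_cmul[OF h2] h] dualize_scaleR[OF \<Lambda> h2])
  also have "\<dots> = dualize \<Lambda> (\<lambda>z. \<psi> (cin z w))"
  proof (rule dualize_cong[OF \<Lambda> h3 _ eqz])
    have "hol_on (ball 0 1) (\<lambda>z. \<psi> (cin z w))"
      by (rule hol_on_cong[OF open_ball h3[unfolded hol_bounded_def, THEN conjunct1]]) (use eqz in auto)
    moreover obtain B where "\<And>z. norm z < 1 \<Longrightarrow> cmod (of_real (real i) * \<phi> (cin z w) + deriv \<phi> (cin z w) * cin z w) \<le> B"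
      using h3 unfolding hol_bounded_def by blast
    ultimately show "hol_bounded (\<lambda>z. \<psi> (cin z w))" by (intro hol_boundedI) (use eqz in force)+
  qed
  finally show ?thesis by (simp add: dual_kernel_def)
qed

text \<open>Inverts one Euler factor at a time by power series; the factor k + 2, innermost in
  \<open>D_op (Suc k)\<close>, comes last.\<close>

lemma D_op_dual_kernel_surj:
  fixes \<Lambda> :: "(complex ^ 'n \<Rightarrow> 'x::complex_normed_space) \<Rightarrow> complex"
  assumes \<Lambda>: "\<Lambda> \<in> bergman_dual p \<alpha>" and \<psi>: "\<psi> holomorphic_on ball 0 1"
  shows "\<exists>\<phi>. \<phi> holomorphic_on ball 0 1 \<and> (\<forall>w\<in>ball 0 1. D_op k (dual_kernel \<Lambda> \<phi>) w = dual_kernel \<Lambda> \<psi> w)"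
proof (induction k)
  case (Suc k)
  then obtain \<phi>1 where \<phi>1: "\<phi>1 holomorphic_on ball 0 1" "\<And>w. w \<in> ball 0 1 \<Longrightarrow> D_op k (dual_kernel \<Lambda> \<phi>1) w = dual_kernel \<Lambda> \<psi> w"
    by blast
  obtain \<phi> where \<phi>: "\<phi> holomorphic_on ball 0 1"
    "\<And>\<zeta>. cmod \<zeta> < 1 \<Longrightarrow> of_nat (k + 2) * \<phi> \<zeta> + \<zeta> * deriv \<phi> \<zeta> = \<phi>1 \<zeta>"
    by (rule euler_equation_solvable[OF \<phi>1(1), of "k + 2"]) auto
  have "D_op (Suc k) (dual_kernel \<Lambda> \<phi>) w = dual_kernel \<Lambda> \<psi> w" if w: "w \<in> ball 0 1" for w
    unfolding D_op.simps(2) \<phi>1(2)[OF w, symmetric]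
    by (rule D_op_cong[OF hol_on_euler_op[OF hol_on_dual_kernel[OF \<Lambda> \<phi>(1)]] _ w])
      (rule euler_op_dual_kernel[OF \<Lambda> \<phi>(1) _ \<phi>(2)])
  with \<phi>(1) show ?case by blast
qed (use \<psi> in auto)

end

section \<open>Integrating the kernel representation under a functional\<close>

text \<open>T is linear and bounded on S only, so it is not a bounded operator on the whole space.
  Riemann sums stay in S and T commutes with them; S is not assumed closed, whence the hypothesis on
  the integral. In the application S consists of the bounded continuous functions that are
  holomorphic on the ball.\<close>

lemma integral_linear_on_subspace:
  fixes B :: "'a::euclidean_space \<Rightarrow> 'b::banach" and T :: "'b \<Rightarrow> 'c::banach"
  assumes cont: "continuous_on (cbox a b) B" and S: "subspace S"
    and BS: "\<And>x. x \<in> cbox a b \<Longrightarrow> B x \<in> S" and IS: "integral (cbox a b) B \<in> S"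
    and add: "\<And>u v. u \<in> S \<Longrightarrow> v \<in> S \<Longrightarrow> T (u + v) = T u + T v"
    and sc: "\<And>r u. u \<in> S \<Longrightarrow> T (r *\<^sub>R u) = r *\<^sub>R T u"
    and bd: "\<And>u. u \<in> S \<Longrightarrow> norm (T u) \<le> L * norm u"
  shows "continuous_on (cbox a b) (\<lambda>x. T (B x))"
    and "T (integral (cbox a b) B) = integral (cbox a b) (\<lambda>x. T (B x))"
proof -
  have diff: "T (u - v) = T u - T v" if "u \<in> S" "v \<in> S" for u v
    using add[OF subspace_diff[OF S that] that(2)] by simp
  show c: "continuous_on (cbox a b) (\<lambda>x. T (B x))"
    unfolding continuous_on_def
  proof
    fix x assume x: "x \<in> cbox a b"
    have "((\<lambda>y. L *\<^sub>R B y) \<longlongrightarrow> L *\<^sub>R B x) (at x within cbox a b)"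
      using cont x by (intro tendsto_intros) (auto simp: continuous_on_def)
    moreover have "\<forall>\<^sub>F y in at x within cbox a b. dist (T (B y)) (T (B x)) \<le> dist (L *\<^sub>R B y) (L *\<^sub>R B x)"
      unfolding eventually_at_filter
    proof (intro always_eventually allI impI)
      fix y assume y: "y \<noteq> x" "y \<in> cbox a b"
      have "dist (T (B y)) (T (B x)) \<le> L * norm (B y - B x)"
        using bd[OF subspace_diff[OF S BS[OF y(2)] BS[OF x]]] BS x y by (simp add: dist_norm diff)
      also have "\<dots> \<le> \<bar>L\<bar> * norm (B y - B x)" by (intro mult_right_mono) auto
      finally show "dist (T (B y)) (T (B x)) \<le> dist (L *\<^sub>R B y) (L *\<^sub>R B x)"
        by (simp add: dist_norm flip: scaleR_diff_right)
    qed
    ultimately show "((\<lambda>x. T (B x)) \<longlongrightarrow> T (B x)) (at x within cbox a b)"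
      by (rule metric_tendsto_imp_tendsto)
  qed
  define I where "I = integral (cbox a b) B"
  define J where "J = integral (cbox a b) (\<lambda>x. T (B x))"
  have hI: "(B has_integral I) (cbox a b)"
    unfolding I_def by (rule integrable_integral[OF integrable_continuous[OF cont]])
  have hJ: "((\<lambda>x. T (B x)) has_integral J) (cbox a b)"
    unfolding J_def by (rule integrable_integral[OF integrable_continuous[OF c]])
  have T0: "T 0 = 0" using sc[OF subspace_0[OF S], of 0] by simp
  have "norm (T I - J) \<le> e" if e: "e > 0" for e
  proof -
    \<comment> \<open>Tolerance for the sums of B, chosen so that T, of bound L, moves them by at
      most e / 2.\<close>
    define d where "d = e / (2 * (\<bar>L\<bar> + 1))"
    have d: "d > 0" using e by (simp add: d_def)
    have "\<exists>\<gamma>. gauge \<gamma> \<and> (\<forall>D. D tagged_division_of cbox a b \<and> \<gamma> fine D \<longrightarrow>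
        norm ((\<Sum>(x, k)\<in>D. measure lborel k *\<^sub>R B x) - I) < d)"
      using hI d unfolding has_integral by (elim allE[of _ d] impE)
    then obtain \<gamma>1 where g1: "gauge \<gamma>1" and \<gamma>1: "\<forall>D. D tagged_division_of cbox a b \<and> \<gamma>1 fine D \<longrightarrow>
        norm ((\<Sum>(x, k)\<in>D. measure lborel k *\<^sub>R B x) - I) < d"
      by (elim exE conjE) (rule that)
    have "\<exists>\<gamma>. gauge \<gamma> \<and> (\<forall>D. D tagged_division_of cbox a b \<and> \<gamma> fine D \<longrightarrow>
        norm ((\<Sum>(x, k)\<in>D. measure lborel k *\<^sub>R T (B x)) - J) < e / 2)"
      using hJ half_gt_zero[OF e] unfolding has_integral by (elim allE[of _ "e / 2"] impE)
    then obtain \<gamma>2 where g2: "gauge \<gamma>2" and \<gamma>2: "\<forall>D. D tagged_division_of cbox a b \<and> \<gamma>2 fine D \<longrightarrow>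
        norm ((\<Sum>(x, k)\<in>D. measure lborel k *\<^sub>R T (B x)) - J) < e / 2"
      by (elim exE conjE) (rule that)
    \<comment> \<open>One tagged division fine for both gauges, so that the sums of B and of T B use
      the same points.\<close>
    obtain D where D: "D tagged_division_of cbox a b" "(\<lambda>x. \<gamma>1 x \<inter> \<gamma>2 x) fine D"
      using fine_division_exists[OF gauge_Int[OF g1 g2]] by blast
    have fine: "\<gamma>1 fine D" "\<gamma>2 fine D" using D(2) by (auto simp: fine_Int)
    define s where "s = (\<Sum>(x, k)\<in>D. measure lborel k *\<^sub>R B x)"
    have fin: "finite D" using D(1) by (rule tagged_division_of_finite)
    have inD: "x \<in> cbox a b" if "(x, k) \<in> D" for x k
      using tagged_division_ofD(2,3)[OF D(1) that] by blast
    have "(\<Sum>(x, k)\<in>E. measure lborel k *\<^sub>R B x) \<in> S \<and>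
        T (\<Sum>(x, k)\<in>E. measure lborel k *\<^sub>R B x) = (\<Sum>(x, k)\<in>E. measure lborel k *\<^sub>R T (B x))" if "E \<subseteq> D" for E
      using finite_subset[OF that fin] that
    proof (induction E rule: finite_induct)
      case empty
      then show ?case by (simp add: T0 subspace_0[OF S])
    next
      case (insert t E)
      obtain x k where t: "t = (x, k)" by (cases t)
      have xS: "measure lborel k *\<^sub>R B x \<in> S"
        using insert.prems inD[of x k] by (intro subspace_scale[OF S] BS) (auto simp: t)
      have "B x \<in> S" using insert.prems inD[of x k] by (intro BS) (auto simp: t)
      then show ?case
        using insert.IH insert.prems insert.hyps subspace_add[OF S xS] add[OF xS] sc by (simp add: t)
    qed
    from this[OF order_refl] have s: "s \<in> S" "T s = (\<Sum>(x, k)\<in>D. measure lborel k *\<^sub>R T (B x))"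
      by (simp_all add: s_def)
    have IS': "I \<in> S" using IS by (simp add: I_def)
    have "norm (T s - T I) \<le> L * norm (s - I)"
      using bd[OF subspace_diff[OF S s(1) IS']] diff[OF s(1) IS'] by simp
    also have "\<dots> \<le> (\<bar>L\<bar> + 1) * d"
      using \<gamma>1[THEN spec, THEN mp, OF conjI[OF D(1) fine(1)]] by (intro mult_mono) (auto simp: s_def)
    also have "\<dots> = e / 2" unfolding d_def by (simp add: field_simps)
    finally have "norm (T s - T I) \<le> e / 2" .
    moreover have "norm (T s - J) < e / 2" using \<gamma>2[THEN spec, THEN mp, OF conjI[OF D(1) fine(2)]] by (simp add: s(2))
    ultimately show ?thesis
      using norm_triangle_ineq4[of "T s - J" "T s - T I"] by simp
  qed
  then have "norm (T I - J) \<le> 0" by (rule field_le_epsilon) simp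
  then show "T (integral (cbox a b) B) = integral (cbox a b) (\<lambda>x. T (B x))"
    by (simp add: I_def J_def)
qed

section \<open>Parametrised bounded continuous functions as integrands\<close>

instance bcontfun :: (metric_space, banach) banach ..

lemma norm_scaleR_less_one:
  assumes "0 < r" "r < 1" "norm w \<le> 1"
  shows "norm (r *\<^sub>R w) < 1"
proof -
  have "r * norm w \<le> r * 1" using assms by (intro mult_left_mono) auto
  then show ?thesis using assms(1,2) unfolding norm_scaleR by linarith
qed

text \<open>The type of bounded continuous functions only has functions on the whole space; those on the
  closed ball are extended by composition with the retraction.\<close>

definition ball_retract :: "'a::real_normed_vector \<Rightarrow> 'a"
  where "ball_retract z = z /\<^sub>R max 1 (norm z)"

lemma ball_retract: "norm (ball_retract z) \<le> 1" "norm z \<le> 1 \<Longrightarrow> ball_retract z = z" "continuous_on S ball_retract"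
proof -
  show "norm (ball_retract z) \<le> 1" unfolding ball_retract_def by (cases "norm z \<le> 1") (auto simp: max_def field_simps)
  show "norm z \<le> 1 \<Longrightarrow> ball_retract z = z" by (simp add: ball_retract_def max_def)
  have "max 1 (norm z) \<noteq> 0" for z :: 'a by (metis max.cobounded1 not_one_le_zero)
  then show "continuous_on S ball_retract" unfolding ball_retract_def by (intro continuous_intros) auto
qed

text \<open>Uniform continuity on the compact product turns joint continuity into continuity in w
  for the supremum norm over z.\<close>

lemma bcontfun_parametric:
  fixes H :: "'z::real_normed_vector \<Rightarrow> 'w::metric_space \<Rightarrow> 'x::real_normed_vector"
  assumes H: "continuous_on (cball 0 1 \<times> K) (\<lambda>(z, w). H z w)" and K: "compact K"
    and c: "compact (cball 0 1 :: 'z set)"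
  obtains B where "\<And>w z. w \<in> K \<Longrightarrow> apply_bcontfun (B w) z = H (ball_retract z) w" "continuous_on K B"
proof -
  define B where "B w = Bcontfun (\<lambda>z. H (ball_retract z) w)" for w
  have cKK: "compact (cball (0 :: 'z) 1 \<times> K)" by (rule compact_Times[OF c K])
  obtain M where M: "\<And>z w. z \<in> cball 0 1 \<Longrightarrow> w \<in> K \<Longrightarrow> norm (H z w) \<le> M"
  proof -
    from compact_imp_bounded[OF compact_continuous_image[OF H cKK]]
    obtain M where "\<forall>x\<in>(\<lambda>(z, w). H z w) ` (cball 0 1 \<times> K). norm x \<le> M" unfolding bounded_iff by blast
    then show thesis by (intro that[of M]) auto
  qed
  have r: "ball_retract z \<in> cball 0 1" for z :: 'z by (simp add: ball_retract(1))
  have mem: "(\<lambda>z. H (ball_retract z) w) \<in> bcontfun" if w: "w \<in> K" for w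
  proof (rule bcontfun_normI)
    show "norm (H (ball_retract z) w) \<le> M" for z by (rule M[OF r w])
    have "continuous_on UNIV (\<lambda>z. (\<lambda>(z, w). H z w) (ball_retract z, w))"
      by (rule continuous_on_compose2[OF H continuous_on_Pair[OF ball_retract(3) continuous_on_const]]) (use r w in auto)
    then show "continuous_on UNIV (\<lambda>z. H (ball_retract z) w)" by simp
  qed
  have ap: "apply_bcontfun (B w) z = H (ball_retract z) w" if "w \<in> K" for w z
    unfolding B_def Bcontfun_inverse[OF mem[OF that]] ..
  have "uniformly_continuous_on (cball 0 1 \<times> K) (\<lambda>(z, w). H z w)"
    by (rule compact_uniformly_continuous[OF H cKK])
  note uc = uniformly_continuous_onE[OF this]
  have "continuous_on K B"
    unfolding continuous_on_iff
  proof (intro ballI allI impI)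
    fix w e assume w: "w \<in> K" and e: "(0::real) < e"
    obtain d where d: "d > 0" "\<And>x x'. x \<in> cball 0 1 \<times> K \<Longrightarrow> x' \<in> cball 0 1 \<times> K \<Longrightarrow> dist x' x < d \<Longrightarrow>
        dist ((\<lambda>(z, w). H z w) x') ((\<lambda>(z, w). H z w) x) < e / 2"
      by (rule uc[OF half_gt_zero[OF e]]) (rule that)
    show "\<exists>d>0. \<forall>w'\<in>K. dist w' w < d \<longrightarrow> dist (B w') (B w) < e"
    proof (intro exI conjI ballI impI)
      show "d > 0" by fact
      fix w' assume w': "w' \<in> K" "dist w' w < d"
      have "dist (B w') (B w) \<le> e / 2"
      proof (rule dist_bound)
        fix z :: 'z
        have "dist (ball_retract z, w') (ball_retract z, w) < d" using w'(2) by (simp add: dist_Pair_Pair)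
        from d(2)[OF _ _ this] show "dist (apply_bcontfun (B w') z) (apply_bcontfun (B w) z) \<le> e / 2"
          using r w w' by (simp add: ap)
      qed
      then show "dist (B w') (B w) < e" using e by simp
    qed
  qed
  with ap show thesis by (rule that)
qed

lemma integral_cbox_eq_lborel:
  fixes f :: "'a::euclidean_space \<Rightarrow> 'b::euclidean_space"
  assumes i: "integrable lborel f" and z: "\<And>x. x \<notin> cbox a b \<Longrightarrow> f x = 0"
  shows "integral (cbox a b) f = (\<integral>x. f x \<partial>lborel)"
proof -
  have "(f has_integral (\<integral>x. f x \<partial>lborel)) UNIV" by (rule has_integral_integral_lborel[OF i])
  moreover have "(\<lambda>x. if x \<in> cbox a b then f x else 0) = f" using z by auto
  ultimately have "(f has_integral (\<integral>x. f x \<partial>lborel)) (cbox a b)"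
    using has_integral_restrict_UNIV[of "cbox a b" f "\<integral>x. f x \<partial>lborel"] by simp
  then show ?thesis by (rule integral_unique)
qed

lemma cdual_separates:
  assumes "\<And>u :: 'a::complex_normed_space cdual. cdual_apply u x = cdual_apply u y"
  shows "x = y"
proof -
  obtain u :: "'a cdual" where "cdual_apply u (x - y) = of_real (norm (x - y))"
    using norming_functional by blast
  then show ?thesis using assms[of u] by (simp add: cdual.diff_right)
qed

context bergman_setup
begin

lemma dual_scaleR:
  assumes "\<Lambda> \<in> bergman_dual p \<alpha>" "f \<in> bergman p \<alpha>"
  shows "\<Lambda> (\<lambda>z. r *\<^sub>R f z) = r *\<^sub>R \<Lambda> f"
  using dualD(2)[OF assms, of "of_real r"] by (simp add: scaleC_of_real scaleR_conv_of_real)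

lemma bcontfun_bergman:
  fixes \<phi> :: "(complex ^ 'n) \<Rightarrow>\<^sub>C 'x::complex_normed_space"
  assumes "hol_on (ball 0 1) (apply_bcontfun \<phi>)"
  shows "apply_bcontfun \<phi> \<in> bergman p \<alpha>" "bergman_norm p \<alpha> (apply_bcontfun \<phi>) \<le> bergman_const TYPE('n) * norm \<phi>"
  by (rule bergman_bounded[OF assms norm_bounded])+

text \<open>The space \<open>X\<close> need not be separable, so the reproducing formula is read as a Henstock--Kurzweil
  integral with values in the bounded continuous functions; \<open>\<Lambda>\<close> is applied to its Riemann sums.\<close>

lemma dual_integral:
  fixes \<Lambda> :: "(complex ^ 'n \<Rightarrow> 'x::complex_banach) \<Rightarrow> complex"
  assumes \<Lambda>: "\<Lambda> \<in> bergman_dual p \<alpha>" and f: "hol_on (ball 0 1) f" and r: "0 < r" "r < 1" and s: "s > 0"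
  defines "c \<equiv> real CARD('n) + s + 1"
  shows "(\<integral>w. eta s w *\<^sub>R \<Lambda> (kernel_fun c (r *\<^sub>R w) (f (r *\<^sub>R w))) \<partial>lborel)
    = eta_int TYPE('n) s *\<^sub>R \<Lambda> (\<lambda>z. f (r *\<^sub>R (r *\<^sub>R z)))"
    and "(\<lambda>z. f (r *\<^sub>R (r *\<^sub>R z))) \<in> bergman p \<alpha>"
proof -
  \<comment> \<open>The retraction only makes the integrand defined and jointly continuous for all w
    of a box; where it moves w, the factor \<open>eta s w\<close> is 0.\<close>
  define H where "H z w = eta s w *\<^sub>R (bker c (cin z (r *\<^sub>R ball_retract w)) *\<^sub>C f (r *\<^sub>R ball_retract w))" for z w :: "complex ^ 'n"
  have r1: "norm (r *\<^sub>R ball_retract w) < 1" for w :: "complex ^ 'n"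
    by (rule norm_scaleR_less_one[OF r ball_retract(1)])
  have f': "hol_on (ball 0 (1 / r)) (\<lambda>x. f (r *\<^sub>R x))" by (rule hol_on_dilate[OF f r(1)])
  have Hc: "continuous_on (cball 0 1 \<times> K) (\<lambda>(z, w). H z w)" for K
  proof -
    have e: "continuous_on (cball 0 1 \<times> K) (\<lambda>x. eta s (snd x))" for K :: "(complex ^ 'n) set"
      by (rule continuous_on_compose2[OF continuous_eta[OF s, of UNIV] continuous_on_snd[OF continuous_on_id]]) auto
    have rt: "continuous_on (cball (0 :: complex ^ 'n) 1 \<times> K) (\<lambda>x. r *\<^sub>R ball_retract (snd x))"
      by (intro continuous_intros continuous_on_compose2[OF ball_retract(3)[of UNIV]]) auto
    have fc: "continuous_on (cball (0 :: complex ^ 'n) 1 \<times> K) (\<lambda>x. f (r *\<^sub>R ball_retract (snd x)))"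
      by (rule continuous_on_compose2[OF hol_on_continuous_on[OF f] rt]) (use r1 in auto)
    have ci: "continuous_on (cball 0 1 \<times> K) (\<lambda>x. cin (fst x) (r *\<^sub>R ball_retract (snd x)))"
      by (intro cin.continuous_on rt continuous_intros)
    have bk: "continuous_on {\<zeta>. Re \<zeta> < 1} (bker c)"
      using bker_field_derivative DERIV_continuous continuous_at_imp_continuous_on by (metis mem_Collect_eq)
    have Re: "Re (cin z (r *\<^sub>R ball_retract w)) < 1" if "norm z \<le> 1" for z w :: "complex ^ 'n"
      using mult_right_mono[OF that norm_ge_zero[of "r *\<^sub>R ball_retract w"]] r1[of w] by (intro Re_cin_less) linarith
    have "continuous_on (cball 0 1 \<times> K) (\<lambda>x. bker c (cin (fst x) (r *\<^sub>R ball_retract (snd x))))"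
      by (rule continuous_on_compose2[OF bk ci]) (use Re in auto)
    from continuous_on_scaleR[OF e scaleC.continuous_on[OF this fc]]
    show ?thesis by (simp add: H_def case_prod_beta)
  qed
  obtain a :: "complex ^ 'n" where a: "cball 0 1 \<subseteq> cbox (- a) a"
    using bounded_subset_cbox_symmetric[OF bounded_cball] by blast
  obtain B where B: "\<And>w z. w \<in> cbox (- a) a \<Longrightarrow> apply_bcontfun (B w) z = H (ball_retract z) w"
    and Bc: "continuous_on (cbox (- a) a) B"
    using bcontfun_parametric[OF Hc compact_cbox compact_cball] by metis
  define V where "V = eta_int TYPE('n) s"
  have V: "V > 0" unfolding V_def using s by (intro eta_int_pos integrable_eta) simp
  have eta0: "eta s w = 0" if "w \<notin> cbox (- a) a" for w
  proof (rule eta_outside)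
    have "w \<notin> cball 0 1" using a that by blast
    then show "1 \<le> norm w" by simp
  qed
  have H0: "H z w = 0" if "w \<notin> cbox (- a) a" for z w
    unfolding H_def eta0[OF that] by simp
  have Hin: "norm w < 1 \<Longrightarrow> H z w = eta s w *\<^sub>R kernel_fun c (r *\<^sub>R w) (f (r *\<^sub>R w)) z" for z w
    by (simp add: H_def kernel_fun_def ball_retract(2))
  have BK: "apply_bcontfun (B w) z = eta s w *\<^sub>R kernel_fun c (r *\<^sub>R w) (f (r *\<^sub>R w)) z"
    if "w \<in> cbox (- a) a" "norm z < 1" for w z
    using that by (cases "norm w < 1") (auto simp: B kernel_fun_def ball_retract(2) H_def eta_outside)
  define I where "I = integral (cbox (- a) a) B"
  have Bi: "B integrable_on cbox (- a) a" by (rule integrable_continuous[OF Bc])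
  \<comment> \<open>Tested with functionals on X, the formula is scalar. One dilation comes from f(r
    w), the other from cin z (r w) = cin (r z) w, hence f(r (r z)).\<close>
  have I: "apply_bcontfun I z = V *\<^sub>R f (r *\<^sub>R (r *\<^sub>R z))" if z: "norm z < 1" for z
  proof (rule cdual_separates)
    fix u :: "'x cdual"
    have bl: "bounded_linear (\<lambda>\<phi>. cdual_apply u (apply_bcontfun \<phi> z))"
    proof (rule bounded_linear_intro)
      fix \<phi> \<psi> :: "(complex ^ 'n) \<Rightarrow>\<^sub>C 'x" and q :: real
      have "cmod (cdual_apply u (apply_bcontfun \<phi> z)) \<le> norm u * norm (apply_bcontfun \<phi> z)"
        by (rule norm_cdual_apply)
      also have "\<dots> \<le> norm u * norm \<phi>" by (intro mult_left_mono norm_bounded) simp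
      finally show "cmod (cdual_apply u (apply_bcontfun \<phi> z)) \<le> norm \<phi> * norm u" by (simp only: mult.commute)
      show "cdual_apply u (apply_bcontfun (\<phi> + \<psi>) z) = cdual_apply u (apply_bcontfun \<phi> z) + cdual_apply u (apply_bcontfun \<psi> z)"
        by (simp add: cdual.add_right plus_bcontfun.rep_eq)
      show "cdual_apply u (apply_bcontfun (q *\<^sub>R \<phi>) z) = q *\<^sub>R cdual_apply u (apply_bcontfun \<phi> z)"
        by (simp add: cdual.scaleR_right scaleR_bcontfun.rep_eq)
    qed
    have rz: "norm (r *\<^sub>R z) < 1" by (rule norm_scaleR_less_one[OF r less_imp_le[OF z]])
    define A where "A w = cdual_apply u (f (r *\<^sub>R w))" for w
    have A: "hol_on (ball 0 (1 / r)) A" unfolding A_def by (rule hol_on_cdual(1)[OF f'])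
    have Ac: "continuous_on (cball 0 1) (\<lambda>w. A w * bker c (cin (r *\<^sub>R z) w))"
      using r by (intro continuous_on_mult hol_on_cball_continuous[OF _ A] bker_cin_continuous[OF rz]) simp
    have eq: "cdual_apply u (H z w) = eta s w *\<^sub>R (A w * bker c (cin (r *\<^sub>R z) w))" for w
      by (cases "norm w < 1")
        (auto simp: H_def ball_retract(2) eta_outside cdual.scaleR_right cdual.zero_right cdual_apply_scaleC_right A_def
          cin_scaleR_left cin_scaleR_right mult.commute)
    have "cdual_apply u (apply_bcontfun I z) = integral (cbox (- a) a) ((\<lambda>\<phi>. cdual_apply u (apply_bcontfun \<phi> z)) \<circ> B)"
      unfolding I_def by (rule integral_linear[OF Bi bl, symmetric])
    also have "\<dots> = integral (cbox (- a) a) (\<lambda>w. cdual_apply u (H z w))"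
      using z by (intro Henstock_Kurzweil_Integration.integral_cong) (simp add: B ball_retract(2))
    also have "\<dots> = (\<integral>w. cdual_apply u (H z w) \<partial>lborel)"
    proof (rule integral_cbox_eq_lborel)
      show "integrable lborel (\<lambda>w. cdual_apply u (H z w))"
        unfolding eq using s by (intro integrable_eta_continuous Ac) simp
    qed (simp add: H0 cdual.zero_right)
    also have "\<dots> = V *\<^sub>R A (r *\<^sub>R z)"
      unfolding eq c_def V_def using r by (intro reproducing_closed_ball[OF _ A s rz]) simp
    also have "\<dots> = cdual_apply u (V *\<^sub>R f (r *\<^sub>R (r *\<^sub>R z)))" by (simp add: A_def cdual.scaleR_right)
    finally show "cdual_apply u (apply_bcontfun I z) = cdual_apply u (V *\<^sub>R f (r *\<^sub>R (r *\<^sub>R z)))" .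
  qed
  have fr: "hol_on (ball 0 1) (\<lambda>z. f (r *\<^sub>R (r *\<^sub>R z)))"
  proof -
    have "hol_on (ball 0 1) (\<lambda>x. f ((r * r) *\<^sub>R x))"
    proof (rule hol_on_subset[OF hol_on_dilate[OF f] subset_ball])
      show "0 < r * r" using r by simp
      then show "1 \<le> 1 / (r * r)" using mult_mono[of r 1 r 1] r by (simp add: le_divide_eq)
    qed
    then show ?thesis by simp
  qed
  have Ihol: "hol_on (ball 0 1) (apply_bcontfun I)"
    by (rule hol_on_cong[OF open_ball hol_on_scaleR(1)[OF fr, of V]]) (simp add: I)
  have kh: "hol_on (ball 0 1) (kernel_fun c (r *\<^sub>R w) (f (r *\<^sub>R w)))" if "norm w \<le> 1" for w
    by (rule hol_on_kernel_fun[OF norm_scaleR_less_one[OF r that]])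
  have Bhol: "hol_on (ball 0 1) (apply_bcontfun (B w))" if w: "w \<in> cbox (- a) a" for w
  proof (cases "norm w < 1")
    case True
    then show ?thesis
      by (intro hol_on_cong[OF open_ball hol_on_scaleR(1)[OF kh[of w], of "eta s w"]]) (simp_all add: BK w)
  next
    case False
    then show ?thesis
      by (intro hol_on_cong[OF open_ball hol_on_const[of _ 0]]) (simp add: BK w eta_outside)
  qed
  \<comment> \<open>A subspace on which \<Lambda> may be evaluated: bounded functions holomorphic on
    the ball belong to the Bergman space.\<close>
  define S where "S = {\<phi> :: (complex ^ 'n) \<Rightarrow>\<^sub>C 'x. hol_on (ball 0 1) (apply_bcontfun \<phi>)}"
  define T where "T \<phi> = \<Lambda> (apply_bcontfun \<phi>)" for \<phi>
  obtain C where C: "0 \<le> C" "\<And>f. f \<in> bergman p \<alpha> \<Longrightarrow> cmod (\<Lambda> f) \<le> C * bergman_norm p \<alpha> f"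
    using dual_bound[OF \<Lambda>] by blast
  have Sb: "apply_bcontfun \<phi> \<in> bergman p \<alpha>" if "\<phi> \<in> S" for \<phi> using that by (simp add: S_def bcontfun_bergman)
  have S: "subspace S"
  proof (rule subspaceI)
    show "0 \<in> S" using hol_on_const[of "ball 0 1" 0] by (simp add: S_def)
    show "x + y \<in> S" if "x \<in> S" "y \<in> S" for x y using that hol_on_add(1) by (auto simp: S_def)
    show "c *\<^sub>R x \<in> S" if "x \<in> S" for c x using that hol_on_scaleR(1) by (auto simp: S_def)
  qed
  have B_S: "B w \<in> S" if "w \<in> cbox (- a) a" for w using Bhol[OF that] by (simp add: S_def)
  have I_S: "integral (cbox (- a) a) B \<in> S" using Ihol by (simp add: S_def I_def)
  have Tadd: "T (x + y) = T x + T y" if "x \<in> S" "y \<in> S" for x y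
    using dualD(1)[OF \<Lambda> Sb[OF that(1)] Sb[OF that(2)]] by (simp add: T_def plus_bcontfun.rep_eq)
  have Tsc: "T (q *\<^sub>R x) = q *\<^sub>R T x" if "x \<in> S" for q x
    using dual_scaleR[OF \<Lambda> Sb[OF that], of q] by (simp add: T_def scaleR_bcontfun.rep_eq)
  have Tbd: "norm (T x) \<le> (C * bergman_const TYPE('n)) * norm x" if "x \<in> S" for x
    using C(2)[OF Sb[OF that]] mult_left_mono[OF bcontfun_bergman(2)[of x] C(1)] that by (simp add: T_def S_def mult_ac)
  note lin = integral_linear_on_subspace[OF Bc S B_S I_S Tadd Tsc Tbd]
  define h where "h w = eta s w *\<^sub>R \<Lambda> (kernel_fun c (r *\<^sub>R w) (f (r *\<^sub>R w)))" for w
  have kb: "kernel_fun c (r *\<^sub>R w) (f (r *\<^sub>R w)) \<in> bergman p \<alpha>" if w: "norm w \<le> 1" for w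
  proof (rule bergman_bounded(1)[OF kh[OF w]])
    fix z :: "complex ^ 'n" assume z: "norm z < 1"
    have rw: "norm (r *\<^sub>R w) < 1" by (rule norm_scaleR_less_one[OF r w])
    have c0: "0 \<le> c" using s by (simp add: c_def)
    have "cmod (bker c (cin z (r *\<^sub>R w))) \<le> (1 - norm (r *\<^sub>R w)) powr (- c)"
      unfolding norm_bker using rw z c0 dist1_ge[of z "r *\<^sub>R w"] by (intro powr_mono2') auto
    then show "norm (kernel_fun c (r *\<^sub>R w) (f (r *\<^sub>R w)) z) \<le> (1 - norm (r *\<^sub>R w)) powr (- c) * norm (f (r *\<^sub>R w))"
      unfolding kernel_fun_def norm_scaleC by (rule mult_right_mono) simp
  qed
  have TB: "T (B w) = h w" if w: "w \<in> cbox (- a) a" for w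
  proof (cases "norm w < 1")
    case True
    note k = kb[of w, OF less_imp_le[OF True]]
    have k': "(\<lambda>z. eta s w *\<^sub>R kernel_fun c (r *\<^sub>R w) (f (r *\<^sub>R w)) z) \<in> bergman p \<alpha>"
      using bergman_cmul[OF k, of "of_real (eta s w)"] by (simp add: scaleC_of_real)
    have "T (B w) = \<Lambda> (\<lambda>z. eta s w *\<^sub>R kernel_fun c (r *\<^sub>R w) (f (r *\<^sub>R w)) z)"
      unfolding T_def by (rule dual_cong[OF \<Lambda> Sb[OF B_S[OF w]] k']) (simp add: BK w)
    then show ?thesis using dual_scaleR[OF \<Lambda> k] by (simp add: h_def)
  next
    case False
    then have "apply_bcontfun (B w) z = 0" if "norm z < 1" for z using BK[OF w that] by (simp add: eta_outside)
    then have "T (B w) = T (0 *\<^sub>R B w)"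
      unfolding T_def using subspace_scale[OF S B_S[OF w], of 0]
      by (intro dual_cong[OF \<Lambda>] Sb B_S w) (simp_all add: scaleR_bcontfun.rep_eq)
    then show ?thesis using Tsc[OF B_S[OF w], of 0] False by (simp add: h_def eta_outside)
  qed
  have h0: "h w = 0" if "w \<notin> cbox (- a) a" for w
    unfolding h_def eta0[OF that] by simp
  have hc: "continuous_on (cbox (- a) a) h" using lin(1) TB by (simp cong: continuous_on_cong)
  have hi: "integrable lborel h"
  proof -
    have "set_integrable lborel (cbox (- a) a) h"
      unfolding set_integrable_def by (rule borel_integrable_compact[OF compact_cbox hc])
    moreover have "(\<lambda>x. indicator (cbox (- a) a) x *\<^sub>R h x) = h" using h0 by (auto simp: indicator_def)
    ultimately show ?thesis by (simp add: set_integrable_def)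
  qed
  show frb: "(\<lambda>z. f (r *\<^sub>R (r *\<^sub>R z))) \<in> bergman p \<alpha>"
  proof (rule bergman_bounded(1)[OF fr])
    fix z :: "complex ^ 'n" assume "norm z < 1"
    then have "V * norm (f (r *\<^sub>R (r *\<^sub>R z))) \<le> norm I" using norm_bounded[of I z] V by (simp add: I)
    then show "norm (f (r *\<^sub>R (r *\<^sub>R z))) \<le> norm I / V" using V by (simp add: field_simps)
  qed
  have "(\<integral>w. h w \<partial>lborel) = integral (cbox (- a) a) h" by (rule integral_cbox_eq_lborel[OF hi h0, symmetric])
  also have "\<dots> = integral (cbox (- a) a) (\<lambda>w. T (B w))"
    by (intro Henstock_Kurzweil_Integration.integral_cong) (simp add: TB)
  also have "\<dots> = T I" unfolding I_def by (rule lin(2)[symmetric])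
  also have "\<dots> = \<Lambda> (\<lambda>z. V *\<^sub>R f (r *\<^sub>R (r *\<^sub>R z)))"
  proof -
    have "(\<lambda>z. V *\<^sub>R f (r *\<^sub>R (r *\<^sub>R z))) \<in> bergman p \<alpha>"
      using bergman_cmul[OF frb, of "of_real V"] by (simp add: scaleC_of_real)
    then show ?thesis unfolding T_def using I_S by (intro dual_cong[OF \<Lambda>] Sb) (simp_all add: I I_def[symmetric])
  qed
  also have "\<dots> = V *\<^sub>R \<Lambda> (\<lambda>z. f (r *\<^sub>R (r *\<^sub>R z)))" by (rule dual_scaleR[OF \<Lambda> frb])
  finally show "(\<integral>w. eta s w *\<^sub>R \<Lambda> (kernel_fun c (r *\<^sub>R w) (f (r *\<^sub>R w))) \<partial>lborel)
    = eta_int TYPE('n) s *\<^sub>R \<Lambda> (\<lambda>z. f (r *\<^sub>R (r *\<^sub>R z)))" by (simp add: h_def V_def)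
qed

end

section \<open>Passing to the boundary\<close>

lemma rad_rad_lim: "(\<lambda>j. rad j *\<^sub>R (rad j *\<^sub>R z)) \<longlonglongrightarrow> (z :: 'a::real_normed_vector)"
  using tendsto_scaleR[OF rad_lim tendsto_scaleR[OF rad_lim tendsto_const]] by simp

lemma rad_rad: "0 \<le> rad j * rad j" "rad j * rad j \<le> 1"
  using rad(2,3)[of j] mult_mono[of "rad j" 1 "rad j" 1] by auto

context bergman_setup
begin

text \<open>The kernel majorant at r z is pulled back to z at the cost of a constant, which frees
  the bound from r; integrability is the Tonelli estimate.\<close>

lemma dilation_majorant:
  fixes f :: "complex ^ 'n \<Rightarrow> 'x::complex_normed_space"
  assumes f: "f \<in> bergman p \<alpha>"
  obtains W where "\<And>z. 0 \<le> W z" "integrable lborel (\<lambda>z. eta \<alpha> z * W z)"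
    "\<And>z r. norm z < 1 \<Longrightarrow> 0 \<le> r \<Longrightarrow> r \<le> 1 \<Longrightarrow> norm (f (r *\<^sub>R z)) powr p \<le> W z"
proof -
  note hol = bergmanD(1)[OF f] and fin = bergmanD(2)[OF f]
  define A where "A = \<bar>\<alpha>\<bar> + 1"
  have A: "0 < A" "\<alpha> < A" "\<alpha> \<le> A" by (auto simp: A_def)
  obtain C where C: "C > 0" "\<And>(f :: complex ^ 'n \<Rightarrow> 'x) z.
    hol_on (ball 0 1) f \<Longrightarrow> norm z < 1 \<Longrightarrow> ennreal (norm (f z) powr p) \<le> ennreal C * kernel_majorant A p f z"
    using majorant[OF p A(1)] by blast
  obtain C' where C': "C' > 0" "\<And>f :: complex ^ 'n \<Rightarrow> 'x. hol_on (ball 0 1) f \<Longrightarrow>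
    (\<integral>\<^sup>+z. ennreal (eta \<alpha> z) * kernel_majorant A p f z \<partial>lborel) \<le> ennreal C' * bergman_integral \<alpha> p f"
    using nn_integral_eta_kernel_majorant[OF \<alpha> A(2)] by blast
  define K where "K = C * 2 powr (real CARD('n) + 1 + A)"
  have K: "0 \<le> K" using C(1) by (simp add: K_def)
  \<comment> \<open>\<open>enn2real\<close> loses nothing on the ball, where the majorant is
    finite.\<close>
  define W where "W z = K * enn2real (kernel_majorant A p f z)" for z
  show thesis
  proof (rule that)
    show "0 \<le> W z" for z unfolding W_def using K by simp
    show "integrable lborel (\<lambda>z. eta \<alpha> z * W z)"
    proof -
      have m: "(\<lambda>z. eta \<alpha> z * enn2real (kernel_majorant A p f z)) \<in> borel_measurable borel"
        using measurable_kernel_majorant[OF hol, of A p] by measurable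
      have "(\<integral>\<^sup>+z. ennreal (eta \<alpha> z * enn2real (kernel_majorant A p f z)) \<partial>lborel) \<le> (\<integral>\<^sup>+z. ennreal (eta \<alpha> z) * kernel_majorant A p f z \<partial>lborel)"
      proof (intro nn_integral_mono)
        fix z :: "complex ^ 'n"
        have "ennreal (enn2real (kernel_majorant A p f z)) \<le> kernel_majorant A p f z"
          by (cases "kernel_majorant A p f z") auto
        then show "ennreal (eta \<alpha> z * enn2real (kernel_majorant A p f z)) \<le> ennreal (eta \<alpha> z) * kernel_majorant A p f z"
          by (simp add: ennreal_mult mult_left_mono)
      qed
      also have "\<dots> \<le> ennreal C' * bergman_integral \<alpha> p f" by (rule C'(2)[OF hol])
      also have "\<dots> < \<infinity>" using fin by (simp add: ennreal_mult_less_top)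
      finally have "integrable lborel (\<lambda>z. eta \<alpha> z * enn2real (kernel_majorant A p f z))"
        using m by (intro integrableI_nonneg) auto
      from integrable_mult_right[OF this, of K] show ?thesis by (simp only: W_def mult.left_commute)
    qed
    fix z :: "complex ^ 'n" and r :: real assume z: "norm z < 1" and r: "0 \<le> r" "r \<le> 1"
    have rz: "norm (r *\<^sub>R z) < 1" using mult_right_mono[OF r(2) norm_ge_zero[of z]] z r by simp
    have mfin: "kernel_majorant A p f z < \<infinity>"
      using kernel_majorant_le_bergman_integral[OF hol \<alpha> A(3) z, of p] fin by (auto simp: ennreal_mult_less_top intro: order.strict_trans1)
    have "ennreal (norm (f (r *\<^sub>R z)) powr p) \<le> ennreal C * kernel_majorant A p f (r *\<^sub>R z)" by (rule C(2)[OF hol rz])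
    also have "\<dots> \<le> ennreal C * (ennreal (2 powr (real CARD('n) + 1 + A)) * kernel_majorant A p f z)"
      by (intro mult_left_mono kernel_majorant_dilate_le[OF hol z r A(1)]) simp
    also have "\<dots> = ennreal K * ennreal (enn2real (kernel_majorant A p f z))"
      using mfin C(1) by (simp add: K_def ennreal_mult mult.assoc)
    also have "\<dots> = ennreal (W z)" unfolding W_def using K by (simp add: ennreal_mult)
    finally show "norm (f (r *\<^sub>R z)) powr p \<le> W z" using K by (simp add: W_def)
  qed
qed

text \<open>By subadditivity of the p-th power, |f(r^2 z) - f(z)|^p is at most 2 W. Dominated
  convergence then gives convergence in the Bergman norm, for which \<Lambda> is continuous.\<close>

lemma dual_dilation_limit:
  fixes \<Lambda> :: "(complex ^ 'n \<Rightarrow> 'x::complex_normed_space) \<Rightarrow> complex"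
  assumes \<Lambda>: "\<Lambda> \<in> bergman_dual p \<alpha>" and f: "f \<in> bergman p \<alpha>"
    and fr: "\<And>j. (\<lambda>z. f (rad j *\<^sub>R (rad j *\<^sub>R z))) \<in> bergman p \<alpha>"
  shows "(\<lambda>j. \<Lambda> (\<lambda>z. f (rad j *\<^sub>R (rad j *\<^sub>R z)))) \<longlonglongrightarrow> \<Lambda> f"
proof -
  note hol = bergmanD(1)[OF f]
  define F where "F j = (\<lambda>z. f (rad j *\<^sub>R (rad j *\<^sub>R z)) - f z)" for j
  have F: "F j \<in> bergman p \<alpha>" "\<Lambda> (F j) = \<Lambda> (\<lambda>z. f (rad j *\<^sub>R (rad j *\<^sub>R z))) - \<Lambda> f" for j
    unfolding F_def by (rule dual_diff[OF \<Lambda> fr f])+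
  obtain W where W0: "\<And>z. 0 \<le> W z" and Wi: "integrable lborel (\<lambda>z. eta \<alpha> z * W z)"
    and W: "\<And>z r. norm z < 1 \<Longrightarrow> 0 \<le> r \<Longrightarrow> r \<le> 1 \<Longrightarrow> norm (f (r *\<^sub>R z)) powr p \<le> W z"
    using dilation_majorant[OF f] by metis
  have "(\<lambda>j. bergman_integral \<alpha> p (F j)) \<longlonglongrightarrow> (\<integral>\<^sup>+z. 0 \<partial>(lborel :: (complex ^ 'n) measure))"
    unfolding bergman_integral_def
  proof (rule nn_integral_dominated_convergence[where w = "\<lambda>z. ennreal (2 * (eta \<alpha> z * W z))"])
    show "(\<lambda>z. ennreal (eta \<alpha> z * norm (F j z) powr p)) \<in> borel_measurable lborel" for j
      using measurable_eta_norm_powr[OF bergmanD(1)[OF F(1)], where p = p] by simp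
    show "(\<lambda>z. ennreal (2 * (eta \<alpha> z * W z))) \<in> borel_measurable lborel"
      using borel_measurable_integrable[OF Wi] by measurable
    have "integrable lborel (\<lambda>z. 2 * (eta \<alpha> z * W z))" using Wi by simp
    from nn_integral_eq_integral[OF this] show "(\<integral>\<^sup>+z. ennreal (2 * (eta \<alpha> z * W z)) \<partial>lborel) < \<infinity>"
      using W0 by simp
    show "AE z in lborel. ennreal (eta \<alpha> z * norm (F j z) powr p) \<le> ennreal (2 * (eta \<alpha> z * W z))" for j
    proof (intro AE_I2 ennreal_leI)
      fix z :: "complex ^ 'n"
      show "eta \<alpha> z * norm (F j z) powr p \<le> 2 * (eta \<alpha> z * W z)"
      proof (cases "norm z < 1")
        case True
        have "norm (F j z) powr p \<le> (norm (f (rad j *\<^sub>R (rad j *\<^sub>R z))) + norm (f z)) powr p"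
          unfolding F_def using p by (intro powr_mono2 norm_triangle_ineq4) auto
        also have "\<dots> \<le> norm (f ((rad j * rad j) *\<^sub>R z)) powr p + norm (f (1 *\<^sub>R z)) powr p"
          using powr_subadditive[OF norm_ge_zero norm_ge_zero p] by simp
        also have "\<dots> \<le> W z + W z" by (intro add_mono W True rad_rad) auto
        finally have "eta \<alpha> z * norm (F j z) powr p \<le> eta \<alpha> z * (W z + W z)"
          by (intro mult_left_mono) auto
        then show ?thesis by (simp add: algebra_simps)
      qed (simp add: eta_outside)
    qed
    show "AE z in lborel. (\<lambda>j. ennreal (eta \<alpha> z * norm (F j z) powr p)) \<longlonglongrightarrow> 0"
    proof (intro AE_I2)
      fix z :: "complex ^ 'n"
      show "(\<lambda>j. ennreal (eta \<alpha> z * norm (F j z) powr p)) \<longlonglongrightarrow> 0"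
      proof (cases "norm z < 1")
        case True
        then have "isCont f z" using hol_on_has_derivative[OF hol, of z] has_derivative_continuous by simp
        from LIM_zero[OF isCont_tendsto_compose[OF this rad_rad_lim]]
        have "(\<lambda>j. F j z) \<longlonglongrightarrow> 0" by (simp add: F_def)
        then have "(\<lambda>j. eta \<alpha> z * norm (F j z) powr p) \<longlonglongrightarrow> eta \<alpha> z * norm (0 :: 'x) powr p"
          using p by (intro tendsto_mult tendsto_const tendsto_powr' tendsto_norm) auto
        from tendsto_ennrealI[OF this] show ?thesis by simp
      qed (simp add: eta_outside)
    qed
  qed simp
  then have "(\<lambda>j. bergman_integral \<alpha> p (F j)) \<longlonglongrightarrow> 0" by simp
  then have "(\<lambda>j. bergman_integral \<alpha> p (F j)) \<longlonglongrightarrow> ennreal 0" by simp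
  from tendsto_enn2real[OF this] have "(\<lambda>j. enn2real (bergman_integral \<alpha> p (F j))) \<longlonglongrightarrow> 0" by simp
  moreover have "0 \<le> nu_const TYPE('n) \<alpha> * enn2real (bergman_integral \<alpha> p (F j))" for j
    by (intro mult_nonneg_nonneg enn2real_nonneg less_imp_le[OF nu_const_pos[OF \<alpha>]])
  ultimately have "(\<lambda>j. (nu_const TYPE('n) \<alpha> * enn2real (bergman_integral \<alpha> p (F j))) powr (1 / p)) \<longlonglongrightarrow> (nu_const TYPE('n) \<alpha> * 0) powr (1 / p)"
    using p by (intro tendsto_powr' tendsto_mult tendsto_const) auto
  then have N: "(\<lambda>j. bergman_norm p \<alpha> (F j)) \<longlonglongrightarrow> 0"
    using bergman_norm_eq(1)[OF \<alpha> p(1) F(1)] by simp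
  obtain C where C: "0 \<le> C" "\<And>f. f \<in> bergman p \<alpha> \<Longrightarrow> cmod (\<Lambda> f) \<le> C * bergman_norm p \<alpha> f"
    using dual_bound[OF \<Lambda>] by blast
  have "(\<lambda>j. \<Lambda> (F j)) \<longlonglongrightarrow> 0"
  proof (rule Lim_null_comparison)
    show "\<forall>\<^sub>F j in sequentially. cmod (\<Lambda> (F j)) \<le> C * bergman_norm p \<alpha> (F j)"
      by (intro always_eventually allI C(2) F(1))
    show "(\<lambda>j. C * bergman_norm p \<alpha> (F j)) \<longlonglongrightarrow> 0" using tendsto_mult_left[OF N, of C] by simp
  qed
  then show ?thesis unfolding F(2) by (rule LIM_zero_cancel)
qed

text \<open>Splitting off |f|^p bounds the pairing of h and f at z by a constant times (1 -
  |z|^2)^(-k) |f(z)|^p. At r z the first power is no larger than at z, and |f(r z)|^p stays below W,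
  which gives domination by a multiple of \<open>eta \<alpha> z * W z\<close>.\<close>

lemma dilated_pairing_limit:
  fixes f :: "complex ^ 'n \<Rightarrow> 'x::complex_normed_space"
  assumes \<gamma>: "\<gamma> = (real CARD('n) + 1 + \<alpha>) * (1 / p - 1)" and k: "\<gamma> < real k"
    and f: "f \<in> bergman p \<alpha>" and h: "hol_on (ball 0 1) h" and gr: "grow (real k - \<gamma>) M h"
  shows "(\<lambda>j. \<integral>z. eta (\<alpha> + real k) z *\<^sub>R cdual_apply (h (rad j *\<^sub>R z)) (f (rad j *\<^sub>R z)) \<partial>lborel)
    \<longlonglongrightarrow> (\<integral>z. eta (\<alpha> + real k) z *\<^sub>R cdual_apply (h z) (f z) \<partial>lborel)"
proof -
  note hol = bergmanD(1)[OF f]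
  obtain C where C: "C > 0" "\<And>(f :: complex ^ 'n \<Rightarrow> 'x) z. f \<in> bergman p \<alpha> \<Longrightarrow> norm z < 1 \<Longrightarrow>
    norm (f z) \<le> (C * enn2real (bergman_integral \<alpha> p f)) powr (1 / p - 1) * (1 - (norm z)\<^sup>2) powr (- \<gamma>) * norm (f z) powr p"
    using bergman_split[OF \<gamma>] by blast
  obtain W where W0: "\<And>z. 0 \<le> W z" and Wi: "integrable lborel (\<lambda>z. eta \<alpha> z * W z)"
    and W: "\<And>z r. norm z < 1 \<Longrightarrow> 0 \<le> r \<Longrightarrow> r \<le> 1 \<Longrightarrow> norm (f (r *\<^sub>R z)) powr p \<le> W z"
    using dilation_majorant[OF f] by metis
  define K where "K = (C * enn2real (bergman_integral \<alpha> p f)) powr (1 / p - 1)"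
  have K: "0 \<le> K" by (simp add: K_def)
  have M: "0 \<le> M" by (rule grow_nonneg[OF gr])
  have pointwise: "cmod (cdual_apply (h z) (f z)) \<le> M * K * (1 - (norm z)\<^sup>2) powr (- real k) * norm (f z) powr p"
    if z: "norm z < 1" for z
  proof -
    define y where "y = 1 - (norm z)\<^sup>2"
    have "cmod (cdual_apply (h z) (f z)) \<le> norm (h z) * norm (f z)" by (rule norm_cdual_apply)
    also have "\<dots> \<le> (M * y powr (- (real k - \<gamma>))) * (K * y powr (- \<gamma>) * norm (f z) powr p)"
      unfolding y_def K_def using M by (intro mult_mono growD[OF gr z] C(2)[OF f z]) auto
    also have "\<dots> = M * K * (y powr (- (real k - \<gamma>)) * y powr (- \<gamma>)) * norm (f z) powr p" by (simp only: mult_ac)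
    also have "y powr (- (real k - \<gamma>)) * y powr (- \<gamma>) = y powr (- real k)" unfolding powr_add[symmetric] by simp
    finally show ?thesis by (simp add: y_def)
  qed
  show ?thesis
  proof (rule integral_dominated_convergence[where w = "\<lambda>z. M * K * (eta \<alpha> z * W z)"])
    have meas: "(\<lambda>z. eta (\<alpha> + real k) z *\<^sub>R cdual_apply (h (r *\<^sub>R z)) (f (r *\<^sub>R z))) \<in> borel_measurable lborel"
      if r: "0 \<le> r" "r \<le> 1" for r
    proof -
      have c: "continuous_on (ball 0 1) (\<lambda>z :: complex ^ 'n. r *\<^sub>R z)" by (intro continuous_intros)
      have sub: "(\<lambda>z :: complex ^ 'n. r *\<^sub>R z) ` ball 0 1 \<subseteq> ball 0 1"
      proof clarsimp
        fix z :: "complex ^ 'n" assume "norm z < 1"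
        then show "\<bar>r\<bar> * norm z < 1" using mult_right_mono[OF r(2) norm_ge_zero[of z]] r by simp
      qed
      have "(\<lambda>z. eta (\<alpha> + real k) z *\<^sub>R cdual_apply (h (r *\<^sub>R z)) (f (r *\<^sub>R z))) \<in> borel_measurable borel"
        by (intro measurable_eta_scaleR cdual.continuous_on continuous_on_compose2[OF hol_on_continuous_on[OF h] c sub]
          continuous_on_compose2[OF hol_on_continuous_on[OF hol] c sub])
      then show ?thesis by simp
    qed
    show "(\<lambda>z. eta (\<alpha> + real k) z *\<^sub>R cdual_apply (h z) (f z)) \<in> borel_measurable lborel" using meas[of 1] by simp
    show "(\<lambda>z. eta (\<alpha> + real k) z *\<^sub>R cdual_apply (h (rad j *\<^sub>R z)) (f (rad j *\<^sub>R z))) \<in> borel_measurable lborel" for j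
      using rad(2,3)[of j] by (intro meas) auto
    show "integrable lborel (\<lambda>z. M * K * (eta \<alpha> z * W z))" using Wi by simp
    show "AE z in lborel. (\<lambda>j. eta (\<alpha> + real k) z *\<^sub>R cdual_apply (h (rad j *\<^sub>R z)) (f (rad j *\<^sub>R z)))
        \<longlonglongrightarrow> eta (\<alpha> + real k) z *\<^sub>R cdual_apply (h z) (f z)"
    proof (intro AE_I2)
      fix z :: "complex ^ 'n"
      show "(\<lambda>j. eta (\<alpha> + real k) z *\<^sub>R cdual_apply (h (rad j *\<^sub>R z)) (f (rad j *\<^sub>R z)))
        \<longlonglongrightarrow> eta (\<alpha> + real k) z *\<^sub>R cdual_apply (h z) (f z)"
      proof (cases "norm z < 1")
        case True
        show ?thesis
          by (intro tendsto_scaleR tendsto_const cdual.tendsto rad_scale_lim[OF h True] rad_scale_lim[OF hol True])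
      qed (simp add: eta_outside)
    qed
    show "AE z in lborel. norm (eta (\<alpha> + real k) z *\<^sub>R cdual_apply (h (rad j *\<^sub>R z)) (f (rad j *\<^sub>R z)))
        \<le> M * K * (eta \<alpha> z * W z)" for j
    proof (intro AE_I2)
      fix z :: "complex ^ 'n"
      show "norm (eta (\<alpha> + real k) z *\<^sub>R cdual_apply (h (rad j *\<^sub>R z)) (f (rad j *\<^sub>R z))) \<le> M * K * (eta \<alpha> z * W z)"
      proof (cases "norm z < 1")
        case True
        define y where "y = 1 - (norm z)\<^sup>2"
        have y: "0 < y" using one_minus_norm_sq_pos[OF True] by (simp add: y_def)
        have "cmod (cdual_apply (h (rad j *\<^sub>R z)) (f (rad j *\<^sub>R z)))
            \<le> M * K * (1 - (norm (rad j *\<^sub>R z))\<^sup>2) powr (- real k) * norm (f (rad j *\<^sub>R z)) powr p"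
          by (rule pointwise[OF norm_rad_scale[OF True]])
        also have "\<dots> \<le> M * K * y powr (- real k) * W z"
          using M K y one_minus_norm_sq_scale[OF rad(4), of z j] W[OF True, of "rad j"] rad(2,3)[of j]
          by (intro mult_mono mult_left_mono powr_mono2') (auto simp: y_def)
        finally have "eta (\<alpha> + real k) z * cmod (cdual_apply (h (rad j *\<^sub>R z)) (f (rad j *\<^sub>R z)))
            \<le> eta (\<alpha> + real k) z * (M * K * y powr (- real k) * W z)" by (intro mult_left_mono) auto
        also have "\<dots> = M * K * ((eta (\<alpha> + real k) z * y powr (- real k)) * W z)" by (simp only: mult_ac)
        also have "eta (\<alpha> + real k) z * y powr (- real k) = eta \<alpha> z"
          unfolding y_def using eta_powr_mult[OF True, of "\<alpha> + real k" "- real k"] by simp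
        finally show ?thesis by simp
      qed (simp add: eta_outside)
    qed
  qed
qed

section \<open>Every bounded functional is a pairing\<close>

lemma representing_function:
  fixes \<Lambda> :: "(complex ^ 'n \<Rightarrow> 'x::complex_banach) \<Rightarrow> complex"
  assumes \<gamma>: "\<gamma> = (real CARD('n) + 1 + \<alpha>) * (1 / p - 1)" and k: "\<gamma> < real k" and k1: "0 < \<alpha> + real k"
    and ck: "ck > 0" and \<Lambda>: "\<Lambda> \<in> bergman_dual p \<alpha>"
  obtains g M where "hol_on (ball 0 1) g" "grow (real k - \<gamma>) M (D_op k g)"
    "\<And>f. f \<in> bergman p \<alpha> \<Longrightarrow> \<Lambda> f = pairing ck k \<alpha> f g"
proof -
  define c where "c = real CARD('n) + 1 + \<alpha> + real k"
  define V where "V = eta_int TYPE('n) (\<alpha> + real k)"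
  have V: "V > 0" unfolding V_def using k1 by (intro eta_int_pos integrable_eta) simp
  have nu_const: "nu_const TYPE('n) \<alpha> > 0" by (rule nu_const_pos[OF \<alpha>])
  \<comment> \<open>Normalised so that pairing a kernel function with g returns its value under
    \<Lambda>: the constants \<open>ck\<close>, \<open>nu_const\<close> and \<open>eta_int\<close>
    cancel.\<close>
  define \<rho> where "\<rho> = 1 / (ck * nu_const TYPE('n) \<alpha> * V)"
  have \<rho>: "\<rho> > 0" using ck nu_const V by (simp add: \<rho>_def)
  define \<psi> where "\<psi> \<zeta> = complex_of_real \<rho> * bker c \<zeta>" for \<zeta>
  have \<psi>: "\<psi> holomorphic_on ball 0 1"
  proof -
    have "bker c holomorphic_on ball 0 1"
    proof (rule holomorphic_onI)
      fix \<zeta> :: complex assume "\<zeta> \<in> ball 0 1"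
      then have "Re \<zeta> < 1" using complex_Re_le_cmod[of \<zeta>] by simp
      from bker_field_derivative[OF this, of c] show "bker c field_differentiable at \<zeta> within ball 0 1"
        unfolding field_differentiable_def using has_field_derivative_at_within by blast
    qed
    then show ?thesis unfolding \<psi>_def by (intro holomorphic_intros)
  qed
  obtain \<phi> where \<phi>: "\<phi> holomorphic_on ball 0 1"
    and D: "\<And>w. w \<in> ball 0 1 \<Longrightarrow> D_op k (dual_kernel \<Lambda> \<phi>) w = dual_kernel \<Lambda> \<psi> w"
    using D_op_dual_kernel_surj[OF \<Lambda> \<psi>, of k] by blast
  define g where "g = dual_kernel \<Lambda> \<phi>"
  have g: "hol_on (ball 0 1) g" unfolding g_def by (rule hol_on_dual_kernel[OF \<Lambda> \<phi>])
  obtain C where C: "C > 0" "\<And>(w :: complex ^ 'n) (x :: 'x). norm w < 1 \<Longrightarrow> kernel_fun c w x \<in> bergman p \<alpha> \<and>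
    bergman_norm p \<alpha> (kernel_fun c w x) \<le> C * norm x * (1 - (norm w)\<^sup>2) powr (- (real k - \<gamma>))"
    using kernel_fun_norm[OF \<gamma> k] unfolding c_def by metis
  have apply_D: "cdual_apply (D_op k g w) x = of_real \<rho> * \<Lambda> (kernel_fun c w x)" if w: "norm w < 1" for w x
  proof -
    have "cdual_apply (D_op k g w) x = \<Lambda> (\<lambda>z. \<psi> (cin z w) *\<^sub>C x)"
      using w by (simp add: g_def D dual_kernel_def dualize(1)[OF \<Lambda> compose_cin(2)[OF \<psi>]])
    also have "(\<lambda>z. \<psi> (cin z w) *\<^sub>C x) = (\<lambda>z. of_real \<rho> *\<^sub>C kernel_fun c w x z)"
      by (simp add: \<psi>_def kernel_fun_def scaleC_scaleC)
    also have "\<Lambda> \<dots> = of_real \<rho> * \<Lambda> (kernel_fun c w x)" using C(2)[OF w] by (intro dualD(2)[OF \<Lambda>]) simp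
    finally show ?thesis .
  qed
  obtain L where L: "0 \<le> L" "\<And>f. f \<in> bergman p \<alpha> \<Longrightarrow> cmod (\<Lambda> f) \<le> L * bergman_norm p \<alpha> f"
    using dual_bound[OF \<Lambda>] by blast
  define M where "M = \<rho> * L * C"
  have gr: "grow (real k - \<gamma>) M (D_op k g)"
    unfolding grow_def
  proof (intro allI impI norm_cdual_bound)
    fix w :: "complex ^ 'n" and x :: 'x assume w: "norm w < 1"
    define y where "y = (1 - (norm w)\<^sup>2) powr (- (real k - \<gamma>))"
    show "0 \<le> M * (1 - (norm w)\<^sup>2) powr (- (real k - \<gamma>))" using \<rho> L C by (simp add: M_def)
    have "cmod (cdual_apply (D_op k g w) x) = \<rho> * cmod (\<Lambda> (kernel_fun c w x))"
      unfolding apply_D[OF w] using \<rho> by (simp add: norm_mult)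
    also have "\<dots> \<le> \<rho> * (L * (C * norm x * y))"
      using C(2)[OF w, of x] \<rho> L(1) unfolding y_def
      by (intro mult_left_mono order_trans[OF L(2)]) auto
    finally show "cmod (cdual_apply (D_op k g w) x) \<le> M * (1 - (norm w)\<^sup>2) powr (- (real k - \<gamma>)) * norm x"
      by (simp add: M_def y_def mult_ac)
  qed
  show thesis
  proof (rule that[OF g gr])
    fix f :: "complex ^ 'n \<Rightarrow> 'x" assume f: "f \<in> bergman p \<alpha>"
    note hol = bergmanD(1)[OF f]
    have ceq: "real CARD('n) + (\<alpha> + real k) + 1 = c" by (simp add: c_def)
    note dual_int = dual_integral[OF \<Lambda> hol rad(2,3) k1, unfolded ceq]
    have "(\<integral>z. eta (\<alpha> + real k) z *\<^sub>R cdual_apply (D_op k g (rad j *\<^sub>R z)) (f (rad j *\<^sub>R z)) \<partial>lborel)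
        = of_real (\<rho> * V) * \<Lambda> (\<lambda>z. f (rad j *\<^sub>R (rad j *\<^sub>R z)))" for j
    proof -
      have "(\<integral>z. eta (\<alpha> + real k) z *\<^sub>R cdual_apply (D_op k g (rad j *\<^sub>R z)) (f (rad j *\<^sub>R z)) \<partial>lborel)
          = (\<integral>z. of_real \<rho> * (eta (\<alpha> + real k) z *\<^sub>R \<Lambda> (kernel_fun c (rad j *\<^sub>R z) (f (rad j *\<^sub>R z)))) \<partial>lborel)"
      proof (rule Bochner_Integration.integral_cong[OF refl])
        fix z :: "complex ^ 'n"
        show "eta (\<alpha> + real k) z *\<^sub>R cdual_apply (D_op k g (rad j *\<^sub>R z)) (f (rad j *\<^sub>R z))
            = of_real \<rho> * (eta (\<alpha> + real k) z *\<^sub>R \<Lambda> (kernel_fun c (rad j *\<^sub>R z) (f (rad j *\<^sub>R z))))"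
          by (cases "norm z < 1") (simp_all add: apply_D[OF norm_rad_scale] eta_outside)
      qed
      also have "\<dots> = of_real \<rho> * (V *\<^sub>R \<Lambda> (\<lambda>z. f (rad j *\<^sub>R (rad j *\<^sub>R z))))"
        unfolding Bochner_Integration.integral_mult_right_zero dual_int(1) V_def ..
      finally show ?thesis by (simp add: scaleR_conv_of_real mult.assoc)
    qed
    with dilated_pairing_limit[OF \<gamma> k f hol_on_D_op[OF g] gr]
    have "(\<lambda>j. of_real (\<rho> * V) * \<Lambda> (\<lambda>z. f (rad j *\<^sub>R (rad j *\<^sub>R z))))
        \<longlonglongrightarrow> (\<integral>z. eta (\<alpha> + real k) z *\<^sub>R cdual_apply (D_op k g z) (f z) \<partial>lborel)" by simp
    moreover have "(\<lambda>j. of_real (\<rho> * V) * \<Lambda> (\<lambda>z. f (rad j *\<^sub>R (rad j *\<^sub>R z)))) \<longlonglongrightarrow> of_real (\<rho> * V) * \<Lambda> f"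
      by (intro tendsto_mult tendsto_const dual_dilation_limit[OF \<Lambda> f dual_int(2)])
    ultimately have "(\<integral>z. eta (\<alpha> + real k) z *\<^sub>R cdual_apply (D_op k g z) (f z) \<partial>lborel) = of_real (\<rho> * V) * \<Lambda> f"
      by (rule LIMSEQ_unique)
    then have "pairing ck k \<alpha> f g = of_real (ck * nu_const TYPE('n) \<alpha>) * (of_real (\<rho> * V) * \<Lambda> f)"
      unfolding pairing_eq(1)[OF hol g] by simp
    also have "\<dots> = of_real (ck * nu_const TYPE('n) \<alpha> * (\<rho> * V)) * \<Lambda> f" by simp
    also have "ck * nu_const TYPE('n) \<alpha> * (\<rho> * V) = 1" unfolding \<rho>_def using ck nu_const V by simp
    finally show "\<Lambda> f = pairing ck k \<alpha> f g" by simp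
  qed
qed

end

section \<open>Uniqueness and equivalence of norms\<close>

lemma D_op_diff:
  fixes f g :: "complex ^ 'n \<Rightarrow> 'x::complex_banach"
  assumes "hol_on (ball 0 1) f" "hol_on (ball 0 1) g" "z \<in> ball 0 1"
  shows "D_op k (\<lambda>z. f z - g z) z = D_op k f z - D_op k g z"
  using assms
proof (induction k arbitrary: f g)
  case (Suc k)
  note fg = hol_on_diff(1)[OF Suc.prems(1,2)]
  note E = hol_on_euler_op[OF Suc.prems(1), of "k + 2"] hol_on_euler_op[OF Suc.prems(2), of "k + 2"]
  have "D_op k (euler_op (k + 2) (\<lambda>z. f z - g z)) z = D_op k (\<lambda>z. euler_op (k + 2) f z - euler_op (k + 2) g z) z"
  proof (rule D_op_cong[OF hol_on_euler_op[OF fg] _ Suc.prems(3)])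
    fix w :: "complex ^ 'n" assume w: "w \<in> ball 0 1"
    show "euler_op (k + 2) (\<lambda>z. f z - g z) w = euler_op (k + 2) f w - euler_op (k + 2) g w"
      unfolding radial_deriv_eq[OF fg w] hol_on_diff(2)[OF Suc.prems(1,2) w] radial_deriv_eq[OF Suc.prems(1) w]
        radial_deriv_eq[OF Suc.prems(2) w] by (simp add: scaleR_diff_right)
  qed
  then show ?case unfolding D_op.simps(2) Suc.IH[OF E Suc.prems(3)] .
qed simp

text \<open>The inversion estimate with M = 0: if D_k of the difference vanishes, so does the
  difference. The exponent 1 is arbitrary.\<close>

lemma D_op_inj:
  fixes f g :: "complex ^ 'n \<Rightarrow> 'x::complex_banach"
  assumes f: "hol_on (ball 0 1) f" and g: "hol_on (ball 0 1) g"
    and eq: "\<And>w. norm w < 1 \<Longrightarrow> D_op k f w = D_op k g w" and z: "norm z < 1"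
  shows "f z = g z"
proof -
  obtain C where C: "C > 0" "\<And>(u :: complex ^ 'n \<Rightarrow> 'x) M. hol_on (ball 0 1) u \<Longrightarrow>
    grow (1 + real k) M (D_op k u) \<Longrightarrow> grow 1 (C * M) u"
    using grow_D_op_down[where 'n = 'n and 'x = 'x and b = 1 and k = k] by auto
  have "grow (1 + real k) 0 (D_op k (\<lambda>z. f z - g z))"
    unfolding grow_def using D_op_diff[OF f g, of _ k] eq by simp
  from growD[OF C(2)[OF hol_on_diff(1)[OF f g] this] z] show ?thesis by simp
qed

text \<open>The integer m witnessing membership may differ from the k of the pairing; the comparison
  of N^m with D_k bridges them.\<close>

lemma Gamma_space_growth:
  fixes g :: "complex ^ 'n \<Rightarrow> 'x::complex_banach"
  assumes "g \<in> Gamma_space \<gamma>" "real k > \<gamma>"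
  obtains M where "hol_on (ball 0 1) g" "grow (real k - \<gamma>) M (D_op k g)"
proof -
  obtain m where hol: "hol_on (ball 0 1) g" and m: "real m > \<gamma>" and fin: "Gamma_norm \<gamma> m g < \<infinity>"
    using assms(1) by (auto simp: Gamma_space_def hol_ball_iff)
  define B where "B = enn2real (Gamma_norm \<gamma> m g)"
  have "Gamma_norm \<gamma> m g \<le> ennreal B" using fin by (simp add: B_def)
  then have "grow (real m - \<gamma>) B ((radial_deriv ^^ m) g)" by (rule Gamma_norm_bound(2)) (simp add: B_def)
  moreover obtain C where "\<And>(g :: complex ^ 'n \<Rightarrow> 'x) M. hol_on (ball 0 1) g \<Longrightarrow>
    grow (real m - \<gamma>) M ((radial_deriv ^^ m) g) \<Longrightarrow> grow (real k - \<gamma>) (C * (M + norm (g 0))) (D_op k g)"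
    using radial_growth_imp_D_op[OF assms(2) m] by metis
  ultimately show thesis using that hol by blast
qed

lemma D_op_growth_imp_Gamma:
  fixes g :: "complex ^ 'n \<Rightarrow> 'x::complex_banach"
  assumes "hol_on (ball 0 1) g" "real k > \<gamma>" "grow (real k - \<gamma>) M (D_op k g)"
  shows "g \<in> Gamma_space \<gamma>"
proof -
  obtain C where "\<And>(g :: complex ^ 'n \<Rightarrow> 'x) M. hol_on (ball 0 1) g \<Longrightarrow>
    grow (real k - \<gamma>) M (D_op k g) \<Longrightarrow> grow (real k - \<gamma>) (C * M) ((radial_deriv ^^ k) g) \<and> norm (g 0) \<le> C * M"
    using D_op_growth_imp_radial[OF assms(2,2)] by metis
  from this[OF assms(1,3)] have "Gamma_norm \<gamma> k g \<le> ennreal (C * M + C * M)" by (intro Gamma_norm_le) auto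
  then have "Gamma_norm \<gamma> k g < \<infinity>" by (rule order.strict_trans1) simp
  then show ?thesis using assms(1,2) by (auto simp: Gamma_space_def hol_ball_iff)
qed

context bergman_setup
begin

lemma bergman_norm_cmul:
  fixes f :: "complex ^ 'n \<Rightarrow> 'x::complex_normed_space"
  assumes f: "f \<in> bergman p \<alpha>"
  shows "bergman_norm p \<alpha> (\<lambda>z. c *\<^sub>C f z) = cmod c * bergman_norm p \<alpha> f"
proof -
  have k: "0 \<le> nu_const TYPE('n) \<alpha>" by (rule less_imp_le[OF nu_const_pos[OF \<alpha>]])
  show ?thesis
    unfolding bergman_norm_eq(1)[OF \<alpha> p(1) bergman_cmul[OF f]] bergman_norm_eq(1)[OF \<alpha> p(1) f] bergman_integral_cmul[OF bergmanD(1)[OF f]]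
    using k p by (simp add: enn2real_mult powr_mult powr_powr mult_ac)
qed

text \<open>Rescaling to norm 1. For norm 0 that is impossible, and boundedness of the functional
  gives the value 0 directly.\<close>

lemma pairing_bound_normalized:
  fixes g :: "complex ^ 'n \<Rightarrow> 'x::complex_normed_space cdual"
  assumes \<gamma>: "\<gamma> = (real CARD('n) + 1 + \<alpha>) * (1 / p - 1)" and ck: "ck > 0"
    and g: "hol_on (ball 0 1) g" and gr: "grow (real k - \<gamma>) M (D_op k g)"
    and s: "\<And>f. f \<in> bergman p \<alpha> \<Longrightarrow> bergman_norm p \<alpha> f = 1 \<Longrightarrow> cmod (pairing ck k \<alpha> f g) \<le> s"
    and f: "f \<in> bergman p \<alpha>"
  shows "cmod (pairing ck k \<alpha> f g) \<le> s * bergman_norm p \<alpha> f"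
proof -
  note \<Lambda> = pairing_in_dual[OF \<gamma> ck g gr]
  define N where "N = bergman_norm p \<alpha> f"
  have N: "0 \<le> N" by (simp add: N_def bergman_norm_def)
  show ?thesis
  proof (cases "N = 0")
    case True
    obtain C where "0 \<le> C" "\<And>f :: complex ^ 'n \<Rightarrow> 'x. f \<in> bergman p \<alpha> \<Longrightarrow> cmod (pairing ck k \<alpha> f g) \<le> C * bergman_norm p \<alpha> f"
      using dual_bound[OF \<Lambda>] by blast
    from this(2)[OF f] show ?thesis using True by (simp add: N_def)
  next
    case False
    let ?h = "\<lambda>z. of_real (1 / N) *\<^sub>C f z"
    have "bergman_norm p \<alpha> ?h = 1"
      unfolding bergman_norm_cmul[OF f] N_def[symmetric] using False N by (simp add: norm_divide)
    from s[OF bergman_cmul[OF f] this] have "cmod (of_real (1 / N) * pairing ck k \<alpha> f g) \<le> s"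
      unfolding dualD(2)[OF \<Lambda> f] .
    then show ?thesis using False N unfolding norm_mult norm_of_real N_def[symmetric] by (simp add: field_simps)
  qed
qed

text \<open>Kernel functions are the test functions: they return D_k g(w), and their norm is at most
  a multiple of (1 - |w|^2)^(-(k-\<gamma>)). The bound M only licenses the reproducing formula; the
  resulting constant is independent of it.\<close>

lemma pairing_bound_imp_growth:
  assumes \<gamma>: "\<gamma> = (real CARD('n) + 1 + \<alpha>) * (1 / p - 1)" "0 \<le> \<gamma>" and k: "\<gamma> < real k" "0 < \<alpha> + real k" and ck: "ck > 0"
  obtains C where "C > 0" "\<And>(g :: complex ^ 'n \<Rightarrow> 'x::complex_normed_space cdual) M s. hol_on (ball 0 1) g \<Longrightarrow>
    grow (real k - \<gamma>) M (D_op k g) \<Longrightarrow> 0 \<le> s \<Longrightarrow>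
    (\<And>f. f \<in> bergman p \<alpha> \<Longrightarrow> cmod (pairing ck k \<alpha> f g) \<le> s * bergman_norm p \<alpha> f) \<Longrightarrow>
    grow (real k - \<gamma>) (C * s) (D_op k g)"
proof -
  define c where "c = real CARD('n) + 1 + \<alpha> + real k"
  obtain C where C: "C > 0" "\<And>(w :: complex ^ 'n) (x :: 'x). norm w < 1 \<Longrightarrow> kernel_fun c w x \<in> bergman p \<alpha> \<and>
    bergman_norm p \<alpha> (kernel_fun c w x) \<le> C * norm x * (1 - (norm w)\<^sup>2) powr (- (real k - \<gamma>))"
    using kernel_fun_norm[OF \<gamma>(1) k(1)] unfolding c_def by metis
  define R where "R = ck * nu_const TYPE('n) \<alpha> * eta_int TYPE('n) (\<alpha> + real k)"
  have "eta_int TYPE('n) (\<alpha> + real k) > 0" using k(2) by (intro eta_int_pos integrable_eta) simp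
  then have R: "R > 0" unfolding R_def by (intro mult_pos_pos ck nu_const_pos[OF \<alpha>])
  show thesis
  proof (rule that[of "C / R"])
    show "C / R > 0" using C R by simp
    fix g :: "complex ^ 'n \<Rightarrow> 'x cdual" and M s
    assume g: "hol_on (ball 0 1) g" "grow (real k - \<gamma>) M (D_op k g)" and s: "0 \<le> s"
      and b: "\<And>f. f \<in> bergman p \<alpha> \<Longrightarrow> cmod (pairing ck k \<alpha> f g) \<le> s * bergman_norm p \<alpha> f"
    show "grow (real k - \<gamma>) (C / R * s) (D_op k g)"
      unfolding grow_def
    proof (intro allI impI norm_cdual_bound)
      fix w :: "complex ^ 'n" and x :: 'x assume w: "norm w < 1"
      show "0 \<le> C / R * s * (1 - (norm w)\<^sup>2) powr (- (real k - \<gamma>))" using C R s by simp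
      have "pairing ck k \<alpha> (kernel_fun c w x) g = of_real R * cdual_apply (D_op k g w) x"
        unfolding c_def R_def by (rule pairing_kernel_fun[OF g(1) \<gamma>(2) k g(2) w])
      then have "R * cmod (cdual_apply (D_op k g w) x) = cmod (pairing ck k \<alpha> (kernel_fun c w x) g)"
        using R by (simp add: norm_mult)
      also have "\<dots> \<le> s * (C * norm x * (1 - (norm w)\<^sup>2) powr (- (real k - \<gamma>)))"
        using C(2)[OF w, of x] b[of "kernel_fun c w x"] s by (meson mult_left_mono order_trans)
      finally show "cmod (cdual_apply (D_op k g w) x) \<le> C / R * s * (1 - (norm w)\<^sup>2) powr (- (real k - \<gamma>)) * norm x"
        using R by (simp add: field_simps)
    qed
  qed
qed

text \<open>Kernel functions recover D_k of either function pointwise, and D_k is injective.\<close>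

lemma pairing_determines:
  fixes g h :: "complex ^ 'n \<Rightarrow> 'x::complex_normed_space cdual"
  assumes \<gamma>: "\<gamma> = (real CARD('n) + 1 + \<alpha>) * (1 / p - 1)" "0 \<le> \<gamma>" and k: "\<gamma> < real k" "0 < \<alpha> + real k" and ck: "ck > 0"
    and g: "hol_on (ball 0 1) g" "grow (real k - \<gamma>) M (D_op k g)"
    and h: "hol_on (ball 0 1) h" "grow (real k - \<gamma>) M' (D_op k h)"
    and eq: "\<And>f. f \<in> bergman p \<alpha> \<Longrightarrow> pairing ck k \<alpha> f h = pairing ck k \<alpha> f g" and z: "norm z < 1"
  shows "h z = g z"
proof (rule D_op_inj[OF h(1) g(1) _ z])
  fix w :: "complex ^ 'n" assume w: "norm w < 1"
  define R where "R = ck * nu_const TYPE('n) \<alpha> * eta_int TYPE('n) (\<alpha> + real k)"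
  have "eta_int TYPE('n) (\<alpha> + real k) > 0" using k(2) by (intro eta_int_pos integrable_eta) simp
  then have R: "R > 0" unfolding R_def by (intro mult_pos_pos ck nu_const_pos[OF \<alpha>])
  show "D_op k h w = D_op k g w"
  proof (rule cdual_eqI)
    fix x :: 'x
    have "kernel_fun (real CARD('n) + 1 + \<alpha> + real k) w x \<in> bergman p \<alpha>" using kernel_fun_norm[OF \<gamma>(1) k(1)] w by metis
    from eq[OF this] show "cdual_apply (D_op k h w) x = cdual_apply (D_op k g w) x"
      unfolding pairing_kernel_fun[OF g(1) \<gamma>(2) k g(2) w] pairing_kernel_fun[OF h(1) \<gamma>(2) k h(2) w] R_def[symmetric]
      using R by simp
  qed
qed

text \<open>Both sides are compared with the growth constant of D_k g, which decouples the index m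
  of the norm from the k of the pairing.\<close>

lemma norm_equivalence:
  assumes \<gamma>: "\<gamma> = (real CARD('n) + 1 + \<alpha>) * (1 / p - 1)" "0 \<le> \<gamma>" and k: "\<gamma> < real k" "0 < \<alpha> + real k" and ck: "ck > 0"
    and m: "\<gamma> < real m"
  shows "\<exists>C1>0. \<exists>C2>0. \<forall>g \<in> (Gamma_space \<gamma> :: (complex ^ 'n \<Rightarrow> 'x::complex_normed_space cdual) set).
    Gamma_norm \<gamma> m g \<le> ennreal C1 *
      (SUP f \<in> {f \<in> bergman p \<alpha>. bergman_norm p \<alpha> f = 1}. ennreal (cmod (pairing ck k \<alpha> f g))) \<and>
    (SUP f \<in> {f \<in> bergman p \<alpha>. bergman_norm p \<alpha> f = 1}. ennreal (cmod (pairing ck k \<alpha> f g)))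
      \<le> ennreal C2 * Gamma_norm \<gamma> m g"
proof -
  obtain C where C: "C > 0" "\<And>(g :: complex ^ 'n \<Rightarrow> 'x cdual) M s. hol_on (ball 0 1) g \<Longrightarrow>
    grow (real k - \<gamma>) M (D_op k g) \<Longrightarrow> 0 \<le> s \<Longrightarrow>
    (\<And>f. f \<in> bergman p \<alpha> \<Longrightarrow> cmod (pairing ck k \<alpha> f g) \<le> s * bergman_norm p \<alpha> f) \<Longrightarrow>
    grow (real k - \<gamma>) (C * s) (D_op k g)"
    using pairing_bound_imp_growth[OF \<gamma> k ck] by blast
  obtain C' where C': "C' > 0" "\<And>(g :: complex ^ 'n \<Rightarrow> 'x cdual) M. hol_on (ball 0 1) g \<Longrightarrow>
    grow (real k - \<gamma>) M (D_op k g) \<Longrightarrow> grow (real m - \<gamma>) (C' * M) ((radial_deriv ^^ m) g) \<and> norm (g 0) \<le> C' * M"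
    using D_op_growth_imp_radial[OF k(1) m] by blast
  obtain Cr where Cr: "Cr > 0" "\<And>(g :: complex ^ 'n \<Rightarrow> 'x cdual) M. hol_on (ball 0 1) g \<Longrightarrow>
    grow (real m - \<gamma>) M ((radial_deriv ^^ m) g) \<Longrightarrow> grow (real k - \<gamma>) (Cr * (M + norm (g 0))) (D_op k g)"
    using radial_growth_imp_D_op[OF k(1) m] by blast
  obtain Cp where Cp: "Cp > 0" "\<And>(f :: complex ^ 'n \<Rightarrow> 'x) g M. f \<in> bergman p \<alpha> \<Longrightarrow> hol_on (ball 0 1) g \<Longrightarrow>
    grow (real k - \<gamma>) M (D_op k g) \<Longrightarrow>
    integrable lborel (\<lambda>z. eta (\<alpha> + real k) z *\<^sub>R cdual_apply (D_op k g z) (f z)) \<and>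
    cmod (pairing ck k \<alpha> f g) \<le> Cp * M * bergman_norm p \<alpha> f"
    using pairing_bounded[OF \<gamma>(1) ck] by blast
  show ?thesis
  proof (intro exI conjI ballI)
    show "2 * C' * C > 0" "Cp * Cr * 2 > 0" using C C' Cr Cp by simp_all
    fix g :: "complex ^ 'n \<Rightarrow> 'x cdual" assume gG: "g \<in> Gamma_space \<gamma>"
    obtain M where g: "hol_on (ball 0 1) g" "grow (real k - \<gamma>) M (D_op k g)"
      using Gamma_space_growth[OF gG k(1)] by blast
    define S where "S = (SUP f \<in> {f \<in> bergman p \<alpha>. bergman_norm p \<alpha> f = 1}. ennreal (cmod (pairing ck k \<alpha> f g)))"
    show "Gamma_norm \<gamma> m g \<le> ennreal (2 * C' * C) * (SUP f \<in> {f \<in> bergman p \<alpha>. bergman_norm p \<alpha> f = 1}. ennreal (cmod (pairing ck k \<alpha> f g)))"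
      unfolding S_def[symmetric]
    proof (cases S)
      case (real s)
      have "cmod (pairing ck k \<alpha> f g) \<le> s" if "f \<in> bergman p \<alpha>" "bergman_norm p \<alpha> f = 1" for f
      proof -
        have "ennreal (cmod (pairing ck k \<alpha> f g)) \<le> S" unfolding S_def using that by (intro SUP_upper) simp
        then show ?thesis unfolding real(2) using real(1) by simp
      qed
      from pairing_bound_normalized[OF \<gamma>(1) ck g this]
      have "grow (real k - \<gamma>) (C * s) (D_op k g)" by (intro C(2)[OF g real(1)])
      from C'(2)[OF g(1) this] have "Gamma_norm \<gamma> m g \<le> ennreal (C' * (C * s) + C' * (C * s))"
        by (intro Gamma_norm_le) auto
      also have "\<dots> = ennreal (2 * C' * C) * S" unfolding real(2) using C C' real(1)
        by (subst ennreal_mult[symmetric]) (simp_all add: algebra_simps)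
      finally show "Gamma_norm \<gamma> m g \<le> ennreal (2 * C' * C) * S" .
    next
      \<comment> \<open>An infinite supremum makes the bound trivial because its constant is
        positive.\<close>
      case top
      then show "Gamma_norm \<gamma> m g \<le> ennreal (2 * C' * C) * S" using C C' by (simp add: ennreal_mult_top)
    qed
    show "(SUP f \<in> {f \<in> bergman p \<alpha>. bergman_norm p \<alpha> f = 1}. ennreal (cmod (pairing ck k \<alpha> f g))) \<le> ennreal (Cp * Cr * 2) * Gamma_norm \<gamma> m g"
    proof (cases "Gamma_norm \<gamma> m g")
      case (real B)
      note b = Gamma_norm_bound[OF eq_refl[OF real(2)] real(1)]
      have "grow (real k - \<gamma>) (Cr * (B + B)) (D_op k g)"
        by (rule grow_mono[OF Cr(2)[OF g(1) b(2)]]) (use b(1) Cr(1) in simp)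
      note pb = Cp(2)[OF _ g(1) this]
      show ?thesis
      proof (rule SUP_least)
        fix f :: "complex ^ 'n \<Rightarrow> 'x" assume "f \<in> {f \<in> bergman p \<alpha>. bergman_norm p \<alpha> f = 1}"
        then have "cmod (pairing ck k \<alpha> f g) \<le> Cp * Cr * 2 * B" using pb[of f] by (simp add: algebra_simps)
        from ennreal_leI[OF this] show "ennreal (cmod (pairing ck k \<alpha> f g)) \<le> ennreal (Cp * Cr * 2) * Gamma_norm \<gamma> m g"
          unfolding real(2) using Cp Cr real(1) by (simp add: ennreal_mult)
      qed
    next
      case top
      then show ?thesis using Cp Cr by (simp add: ennreal_mult_top)
    qed
  qed
qed

end

text \<open>The constant \<open>c k\<close> only rescales the representing function, so every
  positive choice is covered.\<close>

theorem theorem3: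
  fixes \<alpha> p \<gamma> :: real and c :: "nat \<Rightarrow> real" and k :: nat
  assumes "\<alpha> > -1" and "0 < p" and "p \<le> 1"
    and "\<gamma> = (real CARD('n) + 1 + \<alpha>) * (1 / p - 1)"
    and "\<forall>j. c j > 0"
    and "real k > \<gamma>"
  shows
    "(\<forall>g \<in> (Gamma_space \<gamma> :: (complex ^ 'n \<Rightarrow> 'x::complex_banach cdual) set).
        (\<forall>f \<in> bergman p \<alpha>. set_integrable (nu_alpha \<alpha>) (ball 0 1) (pairing_integrand k f g)) \<and>
        (\<lambda>f. pairing (c k) k \<alpha> f g) \<in> bergman_dual p \<alpha>) \<and>
     (\<forall>\<Lambda> \<in> (bergman_dual p \<alpha> :: ((complex ^ 'n \<Rightarrow> 'x) \<Rightarrow> complex) set).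
        \<exists>g \<in> Gamma_space \<gamma>.
          (\<forall>f \<in> bergman p \<alpha>. \<Lambda> f = pairing (c k) k \<alpha> f g) \<and>
          (\<forall>h \<in> Gamma_space \<gamma>. (\<forall>f \<in> bergman p \<alpha>. \<Lambda> f = pairing (c k) k \<alpha> f h) \<longrightarrow>
             (\<forall>z \<in> ball 0 1. h z = g z))) \<and>
     (\<forall>m. real m > \<gamma> \<longrightarrow>
        (\<exists>C1 > 0. \<exists>C2 > 0.
           \<forall>g \<in> (Gamma_space \<gamma> :: (complex ^ 'n \<Rightarrow> 'x cdual) set).
             Gamma_norm \<gamma> m g \<le> ennreal C1 *
               (SUP f \<in> {f \<in> bergman p \<alpha>. bergman_norm p \<alpha> f = 1}. ennreal (cmod (pairing (c k) k \<alpha> f g))) \<and>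
             (SUP f \<in> {f \<in> bergman p \<alpha>. bergman_norm p \<alpha> f = 1}. ennreal (cmod (pairing (c k) k \<alpha> f g)))
               \<le> ennreal C2 * Gamma_norm \<gamma> m g))"
proof -
  interpret bergman_setup \<alpha> p using assms(1-3) by unfold_locales
  note \<gamma> = assms(4) and k = assms(6)
  have ck: "0 < c k" using assms(5) by blast
  have \<gamma>0: "0 \<le> \<gamma>" unfolding \<gamma> using \<alpha> p by (intro mult_nonneg_nonneg) simp_all
  \<comment> \<open>As k > \<gamma> \<ge> 0, the integer k is at least 1 and the weight exponent
    \<alpha> + k is positive, which the reproducing formula requires.\<close>
  have "1 \<le> k" using \<gamma>0 k by (cases k) auto
  then have k1: "0 < \<alpha> + real k" using \<alpha> by linarith
  have bounded: "(\<forall>f \<in> bergman p \<alpha>. set_integrable (nu_alpha \<alpha>) (ball 0 1) (pairing_integrand k f g)) \<and>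
      (\<lambda>f. pairing (c k) k \<alpha> f g) \<in> bergman_dual p \<alpha>" if gG: "g \<in> Gamma_space \<gamma>" for g :: "complex ^ 'n \<Rightarrow> 'x cdual"
  proof -
    obtain M where g: "hol_on (ball 0 1) g" "grow (real k - \<gamma>) M (D_op k g)"
      using Gamma_space_growth[OF gG k] by blast
    have "set_integrable (nu_alpha \<alpha>) (ball 0 1) (pairing_integrand k f g)" if f: "f \<in> bergman p \<alpha>" for f
    proof (rule pairing_bounded[OF \<gamma> ck])
      fix C
      assume "\<And>(f :: complex ^ 'n \<Rightarrow> 'x) g M. f \<in> bergman p \<alpha> \<Longrightarrow> hol_on (ball 0 1) g \<Longrightarrow> grow (real k - \<gamma>) M (D_op k g) \<Longrightarrow>
        integrable lborel (\<lambda>z. eta (\<alpha> + real k) z *\<^sub>R cdual_apply (D_op k g z) (f z)) \<and>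
        cmod (pairing (c k) k \<alpha> f g) \<le> C * M * bergman_norm p \<alpha> f"
      from this[OF f g] show ?thesis using pairing_eq(2)[OF bergmanD(1)[OF f] g(1)] by blast
    qed
    then show ?thesis using pairing_in_dual[OF \<gamma> ck g] by blast
  qed
  have representation: "\<exists>g \<in> Gamma_space \<gamma>. (\<forall>f \<in> bergman p \<alpha>. \<Lambda> f = pairing (c k) k \<alpha> f g) \<and>
      (\<forall>h \<in> Gamma_space \<gamma>. (\<forall>f \<in> bergman p \<alpha>. \<Lambda> f = pairing (c k) k \<alpha> f h) \<longrightarrow> (\<forall>z \<in> ball 0 1. h z = g z))"
    if \<Lambda>: "\<Lambda> \<in> bergman_dual p \<alpha>" for \<Lambda> :: "(complex ^ 'n \<Rightarrow> 'x) \<Rightarrow> complex"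
  proof -
    obtain g M where g: "hol_on (ball 0 1) g" "grow (real k - \<gamma>) M (D_op k g)"
      and rep: "\<And>f. f \<in> bergman p \<alpha> \<Longrightarrow> \<Lambda> f = pairing (c k) k \<alpha> f g"
      using representing_function[OF \<gamma> k k1 ck \<Lambda>] by blast
    have "h z = g z" if h: "h \<in> Gamma_space \<gamma>" "\<forall>f \<in> bergman p \<alpha>. \<Lambda> f = pairing (c k) k \<alpha> f h" and z: "z \<in> ball 0 1" for h z
    proof -
      obtain M' where h': "hol_on (ball 0 1) h" "grow (real k - \<gamma>) M' (D_op k h)"
        using Gamma_space_growth[OF h(1) k] by blast
      show ?thesis
        by (rule pairing_determines[OF \<gamma> \<gamma>0 k k1 ck g h']) (use h(2) rep z in auto)
    qed
    then show ?thesis using D_op_growth_imp_Gamma[OF g(1) k g(2)] rep by blast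
  qed
  show ?thesis
    by (intro conjI ballI allI impI bounded[THEN conjunct1, THEN bspec] bounded[THEN conjunct2] representation
      norm_equivalence[OF \<gamma> \<gamma>0 k k1 ck])
qed

end
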